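(* Let $0<\varrho\leq1$, $0\leq\delta<1$ and $0<\epsilon<1$. If $a\in S^{-n(1-\varrho)}_{\varrho,\delta}$, then there is a constant $C$ such that $$M^{\sharp}_{\epsilon}(T_{a}f)(x)\leq C\, Mf(x)\quad\text{and}\quad M^{\sharp}_{\epsilon}(T^{*}_{a}f)(x)\leq C\, Mf(x)$$ for all $f\in\mathscr{S}(\mathbb{R}^n)$ and all $x\in\mathbb{R}^n$.
   Context: For $m\in\mathbb{R}$ and $0\le\varrho,\delta\le1$, $S^m_{\varrho,\delta}$ is the set of $a(x,\xi)\in C^\infty(\mathbb{R}^n\times\mathbb{R}^n)$ with $|\partial_x^\beta\partial_\xi^\alpha a(x,\xi)|\le C_{\alpha,\beta}\langle\xi\rangle^{m-\varrho|\alpha|+\delta|\beta|}$ for all multi-indices $\alpha,\beta$, where $\langle\xi\rangle=(1+|\xi|^2)^{1/2}$. The operators are $$T_{a}u(x)=\frac{1}{(2\pi)^n}\int e^{ i \langle x,\xi\rangle}a(x,\xi)\hat{u}(\xi)\,d\xi,\qquad T^{*}_{a}u(x)=\frac{1}{(2\pi)^n}\int\int e^{ i \langle x-y,\xi\rangle}a(y,\xi)u(y)\,dy\,d\xi,$$ where $\hat u(\xi)=\int e^{-i\langle y,\xi\rangle}u(y)\,dy$. For $u\in L^1_{loc}(\mathbb{R}^n)$, $$M^{\sharp}u(x)=\sup_{Q\ni x}\inf_{c\in\mathbb{C}}\frac{1}{|Q|}\int_{Q}|u(y)-c|\,dy,\qquad Mu(x)=\sup_{Q\ni x}\frac{1}{|Q|}\int_{Q}|u(y)|\,dy,$$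 the suprema over all cubes $Q$ containing $x$ with sides parallel to the axes, and $M^\sharp_\epsilon u=(M^\sharp(|u|^\epsilon))^{1/\epsilon}$. $\mathscr{S}(\mathbb{R}^n)$ is the Schwartz space. *)

theory Defs
  imports "HOL-Analysis.Analysis"
begin

section \<open>Partial derivatives and smooth functions\<close>

definition dir_deriv ::
  "'a::real_normed_vector \<Rightarrow> ('a \<Rightarrow> 'b::real_normed_vector) \<Rightarrow> 'a \<Rightarrow> 'b" where
  "dir_deriv v f x = vector_derivative (\<lambda>t. f (x + t *\<^sub>R v)) (at 0)"

text \<open>Smoothness on the whole space: all iterated partial derivatives exist and are
  (Frechet) differentiable, hence continuous.\<close>

definition smooth :: "('a::euclidean_space \<Rightarrow> 'b::real_normed_vector) \<Rightarrow> bool" where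
  "smooth f \<longleftrightarrow> (\<forall>vs. set vs \<subseteq> Basis \<longrightarrow> foldr dir_deriv vs f differentiable_on UNIV)"

text \<open>A multi-index is a function \<open>\<alpha> :: 'n \<Rightarrow> nat\<close>. The type \<open>'n\<close> carries no order, so
  the order in which the partial derivatives are taken is that of an arbitrary fixed enumeration
  of \<open>'n\<close>; on smooth functions, the only ones it is applied to, the order is immaterial.
  The vector \<open>e i\<close> is the direction of the \<open>i\<close>-th variable, so that derivatives in one
  of two groups of variables can be taken.\<close>

definition index_enum :: "'n::finite list" where
  "index_enum = (SOME is. distinct is \<and> set is = UNIV)"

definition multi_deriv ::
  "('n::finite \<Rightarrow> 'a::real_normed_vector) \<Rightarrow> ('n \<Rightarrow> nat) \<Rightarrow> ('a \<Rightarrow> 'b::real_normed_vector) \<Rightarrow> 'a \<Rightarrow> 'b"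
  where "multi_deriv e \<alpha> f = foldr (\<lambda>i. dir_deriv (e i) ^^ \<alpha> i) index_enum f"

definition multi_order :: "('n::finite \<Rightarrow> nat) \<Rightarrow> nat" where
  "multi_order \<alpha> = (\<Sum>i\<in>UNIV. \<alpha> i)"

section \<open>Schwartz functions and symbols\<close>

definition schwartz :: "(real ^ 'n \<Rightarrow> complex) set" where
  "schwartz = {f. smooth f \<and>
     (\<forall>\<alpha> \<beta>. \<exists>C. \<forall>x. norm ((\<Prod>i\<in>UNIV. (x $ i) ^ \<alpha> i) *\<^sub>R multi_deriv (\<lambda>i. axis i 1) \<beta> f x) \<le> C)}"

definition japanese_bracket :: "real ^ 'n \<Rightarrow> real" where
  "japanese_bracket \<xi> = sqrt (1 + (norm \<xi>)\<^sup>2)"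

definition symbol_class ::
  "real \<Rightarrow> real \<Rightarrow> real \<Rightarrow> ((real ^ 'n) \<times> (real ^ 'n) \<Rightarrow> complex) set" where
  "symbol_class m \<rho> \<delta> = {a. smooth a \<and>
     (\<forall>\<alpha> \<beta>. \<exists>C. \<forall>x \<xi>.
        norm (multi_deriv (\<lambda>i. (axis i 1, 0)) \<beta> (multi_deriv (\<lambda>i. (0, axis i 1)) \<alpha> a) (x, \<xi>))
        \<le> C * japanese_bracket \<xi> powr (m - \<rho> * multi_order \<alpha> + \<delta> * multi_order \<beta>))}"

section \<open>Pseudodifferential operators\<close>

definition fourier :: "(real ^ 'n \<Rightarrow> complex) \<Rightarrow> real ^ 'n \<Rightarrow> complex" where
  "fourier u \<xi> = (\<integral>y. cis (- (y \<bullet> \<xi>)) * u y \<partial>lborel)"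

definition pdo ::
  "((real ^ 'n) \<times> (real ^ 'n) \<Rightarrow> complex) \<Rightarrow> (real ^ 'n \<Rightarrow> complex) \<Rightarrow> real ^ 'n \<Rightarrow> complex" where
  "pdo a u x = 1 / (2 * pi) ^ CARD('n) * (\<integral>\<xi>. cis (x \<bullet> \<xi>) * a (x, \<xi>) * fourier u \<xi> \<partial>lborel)"

text \<open>The double integral is the iterated one, first in \<open>y\<close>, then in \<open>\<xi>\<close>; it is in general
  not absolutely convergent as an integral over the pairs \<open>(y, \<xi>)\<close>. For \<open>a\<close> in a
  symbol class with \<open>\<delta> < 1\<close> and \<open>u\<close> Schwartz, integration by parts shows that the inner
  integral decreases rapidly in \<open>\<xi>\<close>.\<close>

definition pdo_adj ::
  "((real ^ 'n) \<times> (real ^ 'n) \<Rightarrow> complex) \<Rightarrow> (real ^ 'n \<Rightarrow> complex) \<Rightarrow> real ^ 'n \<Rightarrow> complex" where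
  "pdo_adj a u x = 1 / (2 * pi) ^ CARD('n) *
     (\<integral>\<xi>. (\<integral>y. cis ((x - y) \<bullet> \<xi>) * a (y, \<xi>) * u y \<partial>lborel) \<partial>lborel)"

section \<open>Maximal functions\<close>

definition cubes :: "(real ^ 'n) set set" where
  "cubes = {cbox p (\<chi> i. p $ i + s) | p s. 0 < s}"

definition average :: "(real ^ 'n) set \<Rightarrow> (real ^ 'n \<Rightarrow> ennreal) \<Rightarrow> ennreal" where
  "average Q g = (\<integral>\<^sup>+y\<in>Q. g y \<partial>lborel) / emeasure lborel Q"

definition maximal :: "(real ^ 'n \<Rightarrow> complex) \<Rightarrow> real ^ 'n \<Rightarrow> ennreal" where
  "maximal u x = (SUP Q\<in>{Q\<in>cubes. x \<in> Q}. average Q (\<lambda>y. norm (u y)))"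

definition sharp_maximal :: "(real ^ 'n \<Rightarrow> complex) \<Rightarrow> real ^ 'n \<Rightarrow> ennreal" where
  "sharp_maximal u x = (SUP Q\<in>{Q\<in>cubes. x \<in> Q}. INF c. average Q (\<lambda>y. norm (u y - c)))"

text \<open>Real powers on the extended half-line, for positive exponents.\<close>

definition ennreal_powr :: "ennreal \<Rightarrow> real \<Rightarrow> ennreal" where
  "ennreal_powr t p = (if t = \<infinity> then \<infinity> else ennreal (enn2real t powr p))"

definition sharp_maximal_pow :: "real \<Rightarrow> (real ^ 'n \<Rightarrow> complex) \<Rightarrow> real ^ 'n \<Rightarrow> ennreal" where
  "sharp_maximal_pow \<epsilon> u x =
     ennreal_powr (sharp_maximal (\<lambda>y. complex_of_real (norm (u y) powr \<epsilon>)) x) (1 / \<epsilon>)"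

end

theory Submission
  imports Defs "HOL-Library.Function_Algebras" "HOL-Probability.Characteristic_Functions"
begin

text \<open>The symbol is cut into dyadic pieces \<open>a(x, \<xi>) \<psi>\<^sub>j(\<xi>)\<close>, with \<open>|\<xi>| \<approx> 2\<^sup>j\<close> on the support of
  \<open>\<psi>\<^sub>j\<close>. Since the order is \<open>- n (1 - \<rho>)\<close>, the kernel of the \<open>j\<close>-th piece is bounded by an
  \<open>L\<^sup>1\<close>-normalized peak of width \<open>2\<^sup>-\<^sup>j\<^sup>\<rho>\<close>, and a difference in \<open>x\<close> costs a factor \<open>2\<^sup>j |x - x'|\<close>.
  On a cube of side \<open>r\<close> the low frequencies, \<open>2\<^sup>j r < 1\<close>, therefore oscillate by at most a multiple of the
  maximal function. For \<open>\<rho> < 1\<close> the high frequencies are small in the mean over the cube: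
  one freezes \<open>x\<close> in the symbol on cubes of side much larger than \<open>2\<^sup>-\<^sup>j\<close> but smaller than
  \<open>2\<^sup>-\<^sup>j\<^sup>\<delta>\<close> and uses Bessel's inequality for the frozen kernel. For \<open>\<rho> = 1\<close>
  the pieces are almost orthogonal, the Cotlar--Stein lemma and the Calderon--Zygmund decomposition
  give a weak type bound for the part of the function near the cube, and Kolmogorov's inequality
  turns it into a bound for the mean of the power \<open>\<epsilon> < 1\<close>. All bounds are uniform in the
  number of pieces, and Fatou's lemma passes to the limit. Both operators are covered, because
  the kernels are only used through estimates that hold for \<open>K\<^sub>j(x, x - y)\<close> and \<open>K\<^sub>j(y, x - y)\<close>.\<close>

section \<open>Cubes and peaks\<close>

text \<open>Write \<open>n\<close> for \<open>CARD('n)\<close>. The exponent \<open>n + 2\<close> of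
  the peaks has two sources: \<open>n + 1\<close> makes a peak integrable uniformly in its width,
  and one spare power is exchanged for a factor \<open>s / r\<close> at distance \<open>r\<close>,
  or absorbs a factor \<open>norm z\<close> in a cancellation argument. The two regimes come from
  one obstacle. Averaging a frozen kernel over a cube of side \<open>d\<close> gains a negative
  power of \<open>2 ^ j * d\<close>, and \<open>d\<close> must not exceed the width 2^(-j \<rho>) of
  the kernel. For \<rho> < 1 this lets \<open>2 ^ j * d\<close> be large and yields a bound for the
  mean of the modulus, from which the mean of the power \<epsilon> follows. For \<rho> = 1 nothing
  is gained, and the substitute is a weak type bound, which controls only powers below 1. The
  condition \<delta> < 1 serves twice: it keeps the freezing error
  \<open>d * (2 ^ j) powr \<delta>\<close> small for some \<open>d\<close> much larger than 2^-j,
  and for \<rho> = 1 it makes the integral of a kernel along a moving first argument decay like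
  2^(-(1 - \<delta>) j), which is the cancellation behind almost orthogonality. The constant
  subtracted on a cube is the value of the low frequency part at its corner
  \<open>p\<close>.\<close>

lemma nn_integral_lborel_affine:
  fixes f :: "'a::euclidean_space \<Rightarrow> ennreal"
  assumes [measurable]: "f \<in> borel_measurable borel" and "c \<noteq> 0"
  shows "(\<integral>\<^sup>+x. f x \<partial>lborel) = ennreal (\<bar>c\<bar> ^ DIM('a)) * (\<integral>\<^sup>+x. f (t + c *\<^sub>R x) \<partial>lborel)"
  by (subst lborel_affine[OF \<open>c \<noteq> 0\<close>, of t])
     (simp add: nn_integral_density nn_integral_distr nn_integral_cmult)

lemma nn_integral_lborel_shift:
  fixes f :: "'a::euclidean_space \<Rightarrow> ennreal"
  assumes "f \<in> borel_measurable borel"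
  shows "(\<integral>\<^sup>+x. f (x + t) \<partial>lborel) = (\<integral>\<^sup>+x. f x \<partial>lborel)"
    and "(\<integral>\<^sup>+x. f (x - t) \<partial>lborel) = (\<integral>\<^sup>+x. f x \<partial>lborel)"
    and "(\<integral>\<^sup>+x. f (t - x) \<partial>lborel) = (\<integral>\<^sup>+x. f x \<partial>lborel)"
  using nn_integral_lborel_affine[OF assms, of 1 t] nn_integral_lborel_affine[OF assms, of 1 "-t"]
    nn_integral_lborel_affine[OF assms, of "-1" t]
  by (simp_all add: add.commute)

lemma norm_integral_le_nn_integral:
  fixes h :: "'a \<Rightarrow> 'b::{banach,second_countable_topology}"
  shows "ennreal (norm (\<integral>x. h x \<partial>M)) \<le> (\<integral>\<^sup>+x. ennreal (norm (h x)) \<partial>M)"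
  by (cases "integrable M h") (auto simp: integral_norm_bound_ennreal not_integrable_integral_eq)

abbreviation cube :: "real ^ 'n \<Rightarrow> real \<Rightarrow> (real ^ 'n) set" where
  "cube p s \<equiv> cbox p (\<chi> i. p $ i + s)"

lemma mem_cube: "x \<in> cube p s \<longleftrightarrow> (\<forall>i. p $ i \<le> x $ i \<and> x $ i \<le> p $ i + s)"
  by (simp add: mem_box_cart)

lemma emeasure_cube:
  fixes p :: "real ^ 'n"
  assumes "0 \<le> s"
  shows "emeasure lborel (cube p s) = ennreal (s ^ CARD('n))"
proof -
  have *: "((\<chi> i. p $ i + s) - p) \<bullet> b = s" if "b \<in> Basis" for b
    using that by (auto simp: Basis_vec_def inner_diff_left inner_axis)
  have "p \<bullet> b \<le> (\<chi> i. p $ i + s) \<bullet> b" if "b \<in> Basis" for b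
    using *[OF that] assms by (simp add: inner_diff_left)
  then show ?thesis by (simp add: *)
qed

text \<open>The form in which the maximal function at \<open>x\<close> enters all estimates.
  Integrals replace averages, which avoids division in \<open>ennreal\<close>, and a real number
  \<open>\<mu>\<close> replaces the maximal function, whose value may be 0 or infinite.\<close>

definition cubes_bound :: "real ^ 'n \<Rightarrow> real \<Rightarrow> (real ^ 'n \<Rightarrow> ennreal) \<Rightarrow> bool" where
  "cubes_bound x \<mu> F \<longleftrightarrow>
     (\<forall>p s. 0 < s \<longrightarrow> x \<in> cube p s \<longrightarrow> (\<integral>\<^sup>+y\<in>cube p s. F y \<partial>lborel) \<le> ennreal (\<mu> * s ^ CARD('n)))"

lemma cubes_boundD:
  fixes x :: "real ^ 'n"
  assumes "cubes_bound x \<mu> F" "0 < s" "x \<in> cube p s"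
  shows "(\<integral>\<^sup>+y\<in>cube p s. F y \<partial>lborel) \<le> ennreal (\<mu> * s ^ CARD('n))"
  using assms unfolding cubes_bound_def by blast

lemma ball_subset_cube:
  fixes x :: "real ^ 'n"
  shows "{y. norm (x - y) \<le> R} \<subseteq> cube (\<chi> i. x $ i - R) (2 * R)"
proof
  fix y assume y: "y \<in> {y. norm (x - y) \<le> R}"
  have "\<bar>x $ i - y $ i\<bar> \<le> R" for i
    using component_le_norm_cart[of "x - y" i] y by simp
  then show "y \<in> cube (\<chi> i. x $ i - R) (2 * R)"
    unfolding mem_cube by (auto simp: abs_le_iff) (smt (verit, best))+
qed

lemma emeasure_ball_le:
  fixes x :: "real ^ 'n"
  assumes "0 \<le> R"
  shows "emeasure lborel {y. norm (x - y) \<le> R} \<le> ennreal ((2 * R) ^ CARD('n))"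
  using emeasure_mono[OF ball_subset_cube[of x R], of lborel] emeasure_cube[of "2 * R" "\<chi> i. x $ i - R"] assms
  by simp

text \<open>Two regimes. If \<open>R \<le> r\<close>, Fubini gives each \<open>y\<close> the volume
  of a ball, at most \<open>(2 * R) ^ n\<close>, and all relevant \<open>y\<close> lie in a cube of
  side \<open>3 * r\<close>. If \<open>R > r\<close>, each ball already lies in a cube of side
  \<open>3 * R\<close> through \<open>x0\<close>. The constant 6 is 2 times 3.\<close>

lemma cubes_bound_ball:
  fixes p x0 :: "real ^ 'n"
  assumes [measurable]: "F \<in> borel_measurable borel" and cb: "cubes_bound x0 \<mu> F"
    and "0 \<le> \<mu>" "0 < r" "0 < R" "x0 \<in> cube p r"
  shows "(\<integral>\<^sup>+x\<in>cube p r. (\<integral>\<^sup>+y. indicator {z. norm z \<le> R} (x - y) * F y \<partial>lborel) \<partial>lborel)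
         \<le> ennreal (\<mu> * 6 ^ CARD('n) * R ^ CARD('n) * r ^ CARD('n))"
proof -
  have x0: "p $ i \<le> x0 $ i" "x0 $ i \<le> p $ i + r" for i
    using assms(6) by (auto simp: mem_cube)
  define q where "q = (\<chi> i. p $ i - R)"
  have near: "p $ i - R \<le> y $ i \<and> y $ i \<le> p $ i + r + R" if "x \<in> cube p r" "norm (x - y) \<le> R" for x y i
  proof -
    have "\<bar>x $ i - y $ i\<bar> \<le> R"
      using component_le_norm_cart[of "x - y" i] that by simp
    moreover have "p $ i \<le> x $ i" "x $ i \<le> p $ i + r" using that(1) by (auto simp: mem_cube)
    ultimately show ?thesis by linarith
  qed
  show ?thesis
  proof (cases "R \<le> r")
    case True
    have cq: "(\<integral>\<^sup>+y\<in>cube q (3 * r). F y \<partial>lborel) \<le> ennreal (\<mu> * (3 * r) ^ CARD('n))"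
    proof -
      have "x0 \<in> cube q (3 * r)"
        unfolding mem_cube q_def using x0 True \<open>0 < R\<close> \<open>0 < r\<close> by (auto intro: order_trans) (smt (verit) x0)+
      then show ?thesis using cubes_boundD[OF cb, of "3 * r" q] \<open>0 < r\<close> by simp
    qed
    have "(\<integral>\<^sup>+x\<in>cube p r. (\<integral>\<^sup>+y. indicator {z. norm z \<le> R} (x - y) * F y \<partial>lborel) \<partial>lborel)
        = (\<integral>\<^sup>+x. (\<integral>\<^sup>+y. indicator (cube p r) x * (indicator {z. norm z \<le> R} (x - y) * F y) \<partial>lborel) \<partial>lborel)"
      by (intro nn_integral_cong) (simp add: nn_integral_cmult mult.commute)
    also have "\<dots> = (\<integral>\<^sup>+y. (\<integral>\<^sup>+x. indicator (cube p r) x * (indicator {z. norm z \<le> R} (x - y) * F y) \<partial>lborel) \<partial>lborel)"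
      by (rule lborel_pair.Fubini') measurable
    also have "\<dots> \<le> (\<integral>\<^sup>+y. (\<integral>\<^sup>+x. indicator {x. norm (y - x) \<le> R} x * (F y * indicator (cube q (3 * r)) y) \<partial>lborel) \<partial>lborel)"
    proof (intro nn_integral_mono)
      fix x y :: "real ^ 'n"
      have "norm (x - y) = norm (y - x)" by (rule norm_minus_commute)
      moreover have "y \<in> cube q (3 * r)" if "x \<in> cube p r" "norm (x - y) \<le> R"
        unfolding mem_cube q_def using near[OF that] True \<open>0 < r\<close> by (auto) (smt (verit))+
      ultimately show "indicator (cube p r) x * (indicator {z. norm z \<le> R} (x - y) * F y)
        \<le> indicator {x. norm (y - x) \<le> R} x * (F y * indicator (cube q (3 * r)) y)"
        by (auto simp: indicator_def)
    qed
    also have "\<dots> = (\<integral>\<^sup>+y. emeasure lborel {x. norm (y - x) \<le> R} * (F y * indicator (cube q (3 * r)) y) \<partial>lborel)"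
      by (subst nn_integral_multc) auto
    also have "\<dots> \<le> (\<integral>\<^sup>+y. ennreal ((2 * R) ^ CARD('n)) * (F y * indicator (cube q (3 * r)) y) \<partial>lborel)"
      using emeasure_ball_le[of R] \<open>0 < R\<close> by (intro nn_integral_mono mult_right_mono) auto
    also have "\<dots> \<le> ennreal ((2 * R) ^ CARD('n)) * ennreal (\<mu> * (3 * r) ^ CARD('n))"
      using cq by (subst nn_integral_cmult) (auto intro: mult_left_mono)
    also have "\<dots> = ennreal (\<mu> * 6 ^ CARD('n) * R ^ CARD('n) * r ^ CARD('n))"
    proof -
      have "(6::real) ^ CARD('n) = 2 ^ CARD('n) * 3 ^ CARD('n)" by (simp flip: power_mult_distrib)
      then show ?thesis
        using \<open>0 < R\<close> \<open>0 < r\<close> \<open>0 \<le> \<mu>\<close> by (subst ennreal_mult[symmetric]) (auto simp: power_mult_distrib mult_ac)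
    qed
    finally show ?thesis .
  next
    case False
    have "x0 \<in> cube q (3 * R)"
      unfolding mem_cube q_def using x0 False \<open>0 < R\<close> \<open>0 < r\<close> by (auto) (smt (verit) x0)+
    then have cq: "(\<integral>\<^sup>+y\<in>cube q (3 * R). F y \<partial>lborel) \<le> ennreal (\<mu> * (3 * R) ^ CARD('n))"
      using cubes_boundD[OF cb, of "3 * R" q] \<open>0 < R\<close> by simp
    have "(\<integral>\<^sup>+x\<in>cube p r. (\<integral>\<^sup>+y. indicator {z. norm z \<le> R} (x - y) * F y \<partial>lborel) \<partial>lborel)
        \<le> (\<integral>\<^sup>+x\<in>cube p r. ennreal (\<mu> * (3 * R) ^ CARD('n)) \<partial>lborel)"
    proof (intro nn_integral_mono)
      fix x
      have "(\<integral>\<^sup>+y. indicator {z. norm z \<le> R} (x - y) * F y \<partial>lborel) \<le> ennreal (\<mu> * (3 * R) ^ CARD('n))" if x: "x \<in> cube p r"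
      proof -
        have "(\<integral>\<^sup>+y. indicator {z. norm z \<le> R} (x - y) * F y \<partial>lborel) \<le> (\<integral>\<^sup>+y\<in>cube q (3 * R). F y \<partial>lborel)"
        proof (intro nn_integral_mono)
          fix y
          have "y \<in> cube q (3 * R)" if "norm (x - y) \<le> R"
            unfolding mem_cube q_def using near[OF x that] False by (auto) (smt (verit))+
          then show "indicator {z. norm z \<le> R} (x - y) * F y \<le> F y * indicator (cube q (3 * R)) y"
            by (auto simp: indicator_def)
        qed
        then show ?thesis using cq by simp
      qed
      then show "(\<integral>\<^sup>+y. indicator {z. norm z \<le> R} (x - y) * F y \<partial>lborel) * indicator (cube p r) x
          \<le> ennreal (\<mu> * (3 * R) ^ CARD('n)) * indicator (cube p r) x"
        by (auto simp: indicator_def)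
    qed
    also have "\<dots> = ennreal (\<mu> * (3 * R) ^ CARD('n)) * ennreal (r ^ CARD('n))"
      using \<open>0 < r\<close> by (simp add: nn_integral_cmult emeasure_cube del: emeasure_lborel_cbox)
    also have "\<dots> = ennreal (\<mu> * 3 ^ CARD('n) * R ^ CARD('n) * r ^ CARD('n))"
      using \<open>0 < R\<close> \<open>0 < r\<close> \<open>0 \<le> \<mu>\<close> by (subst ennreal_mult[symmetric]) (auto simp: power_mult_distrib mult_ac)
    also have "\<dots> \<le> ennreal (\<mu> * 6 ^ CARD('n) * R ^ CARD('n) * r ^ CARD('n))"
      using \<open>0 < R\<close> \<open>0 < r\<close> \<open>0 \<le> \<mu>\<close> by (intro ennreal_leI mult_right_mono mult_left_mono power_mono) auto
    finally show ?thesis .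
  qed
qed

text \<open>A bump of width \<open>s\<close> whose mass does not depend on \<open>s\<close>. The
  exponent is a parameter because powers of decay are spent in the course of the estimates.\<close>

definition peak :: "nat \<Rightarrow> real \<Rightarrow> real ^ 'n \<Rightarrow> real" where
  "peak N s z = 1 / (s ^ CARD('n) * (1 + norm z / s) ^ N)"

lemma peak_measurable [measurable]: "peak N s \<in> borel_measurable borel"
  unfolding peak_def by measurable

lemma peak_nonneg [simp]: "0 < s \<Longrightarrow> 0 \<le> peak N s z"
  by (simp add: peak_def)

lemma peak_minus_commute: "peak N s (x - y) = peak N s (y - x)"
  by (simp add: peak_def norm_minus_commute)

lemma peak_antimono:
  assumes "0 < s" "M \<le> N" shows "peak N s z \<le> peak M s z"
proof -
  have "1 + norm z / s > 0" using assms by (simp add: add_pos_nonneg)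
  then show ?thesis
    unfolding peak_def using assms by (intro divide_left_mono mult_left_mono power_increasing mult_pos_pos) auto
qed

text \<open>One power of decay pays for a factor \<open>norm z\<close>, which turns into the width
  \<open>s\<close>.\<close>

lemma norm_times_peak_le:
  assumes "0 < s" shows "norm z * peak (Suc N) s z \<le> s * peak N s z"
proof -
  have "norm z \<le> s * (1 + norm z / s)" using assms by (simp add: field_simps)
  moreover have "1 + norm z / s > 0" using assms by (simp add: add_pos_nonneg)
  ultimately have "norm z / (1 + norm z / s) \<le> s" by (simp add: pos_divide_le_eq)
  then have "norm z / (1 + norm z / s) * peak N s z \<le> s * peak N s z"
    using assms by (intro mult_right_mono) auto
  then show ?thesis by (simp add: peak_def mult_ac)
qed

lemma peak_far_le:
  assumes "0 < s" "0 < r" "r \<le> norm z" shows "peak (Suc N) s z \<le> s / r * peak N s z"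
proof -
  have "r * peak (Suc N) s z \<le> norm z * peak (Suc N) s z"
    using assms by (intro mult_right_mono) auto
  also have "\<dots> \<le> s * peak N s z" by (rule norm_times_peak_le) fact
  finally show ?thesis using assms by (simp add: field_simps)
qed

text \<open>A peak is a superposition of normalized indicators of balls, so its effect on a function is
  controlled by averages over balls.\<close>

lemma ennreal_term_le_suminf: "f k \<le> (\<Sum>k. f k)" for f :: "nat \<Rightarrow> ennreal"
  using sum_le_suminf[OF summableI, of "{k}" f] by simp

lemma peak_le_suminf:
  fixes z :: "real ^ 'n"
  assumes "0 < s"
  shows "ennreal (peak (CARD('n) + 1) s z) \<le>
    (\<Sum>k. ennreal (2 ^ (CARD('n) + 1) / ((2 ^ k) ^ (CARD('n) + 1) * s ^ CARD('n))) * indicator {z. norm z \<le> 2 ^ k * s} z)"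
    (is "_ \<le> (\<Sum>k. ?g k)")
proof -
  obtain k0 where "norm z / s < 2 ^ k0" using real_arch_pow[of 2 "norm z / s"] by auto
  then have ex: "\<exists>k. norm z \<le> 2 ^ k * s" using assms by (intro exI[of _ k0]) (simp add: field_simps)
  \<comment> \<open>The smallest dyadic ball containing \<open>z\<close>. By minimality
    \<open>2 ^ k\<close> is at most \<open>2 * (1 + norm z / s)\<close>, so the peak is bounded by
    the single term with this index.\<close>
  define k where "k = (LEAST k. norm z \<le> 2 ^ k * s)"
  have k: "norm z \<le> 2 ^ k * s" unfolding k_def using ex by (rule LeastI_ex)
  have low: "2 ^ k / 2 \<le> 1 + norm z / s"
  proof (cases k)
    case (Suc m)
    then have "\<not> norm z \<le> 2 ^ m * s" using not_less_Least[of m "\<lambda>k. norm z \<le> 2 ^ k * s"] by (simp add: k_def)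
    then have "2 ^ m \<le> norm z / s" using assms by (simp add: field_simps)
    then show ?thesis by (simp add: Suc)
  qed (use assms in auto)
  have "peak (CARD('n) + 1) s z \<le> 1 / (s ^ CARD('n) * (2 ^ k / 2) ^ (CARD('n) + 1))"
    unfolding peak_def using assms low
    by (intro divide_left_mono mult_left_mono power_mono mult_pos_pos zero_less_power) (auto intro: add_pos_nonneg)
  also have "\<dots> = 2 ^ (CARD('n) + 1) / ((2 ^ k) ^ (CARD('n) + 1) * s ^ CARD('n))"
    by (simp add: power_divide mult_ac)
  finally have "ennreal (peak (CARD('n) + 1) s z) \<le> ?g k"
    using k by (auto intro!: ennreal_leI)
  also have "\<dots> \<le> (\<Sum>k. ?g k)"
    by (rule ennreal_term_le_suminf)
  finally show ?thesis .
qed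

lemma suminf_ennreal_geometric: "(\<Sum>k. ennreal (c / 2 ^ k)) = ennreal (2 * c)" if "0 \<le> c"
proof -
  have "(\<lambda>k. c * (1 / 2) ^ k) sums (c * (1 / (1 - 1 / 2)))" by (intro sums_mult geometric_sums) simp
  then have "(\<lambda>k. c / 2 ^ k) sums (2 * c)" by (simp add: power_divide mult.commute)
  then show ?thesis
    using that by (simp add: suminf_ennreal2 sums_iff)
qed

text \<open>The ball volumes cancel all but one of the powers of \<open>2 ^ k\<close> in the
  weights; this surplus power leaves a geometric series with first term
  \<open>2 ^ n * 2 ^ (n + 1)\<close>.\<close>

lemma nn_integral_peak:
  assumes "0 < s" "CARD('n) + 1 \<le> N"
  shows "(\<integral>\<^sup>+z. ennreal (peak N s (z::real ^ 'n)) \<partial>lborel) \<le> ennreal (4 ^ (CARD('n) + 1))"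
proof -
  let ?c = "\<lambda>k::nat. 2 ^ (CARD('n) + 1) / ((2 ^ k) ^ (CARD('n) + 1) * s ^ CARD('n))"
  have "(\<integral>\<^sup>+(z::real ^ 'n). ennreal (peak N s z) \<partial>lborel) \<le> (\<integral>\<^sup>+(z::real ^ 'n). (\<Sum>k. ennreal (?c k) * indicator {z. norm z \<le> 2 ^ k * s} z) \<partial>lborel)"
    by (intro nn_integral_mono order_trans[OF ennreal_leI peak_le_suminf[OF assms(1)]] peak_antimono assms)
  also have "\<dots> = (\<Sum>k. ennreal (?c k) * emeasure lborel {z::real ^ 'n. norm z \<le> 2 ^ k * s})"
    by (subst nn_integral_suminf) (auto simp: nn_integral_cmult)
  also have "\<dots> \<le> (\<Sum>k. ennreal (2 ^ CARD('n) * 2 ^ (CARD('n) + 1) / 2 ^ k))"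
  proof (intro suminf_le summableI)
    fix k
    have "emeasure lborel {z::real ^ 'n. norm z \<le> 2 ^ k * s} \<le> ennreal ((2 * (2 ^ k * s)) ^ CARD('n))"
      using emeasure_ball_le[of "2 ^ k * s" 0] assms by simp
    then have "ennreal (?c k) * emeasure lborel {z::real ^ 'n. norm z \<le> 2 ^ k * s} \<le> ennreal (?c k) * ennreal ((2 * (2 ^ k * s)) ^ CARD('n))"
      by (rule mult_left_mono) simp
    also have "\<dots> = ennreal (2 ^ CARD('n) * 2 ^ (CARD('n) + 1) / 2 ^ k)"
      using assms by (subst ennreal_mult[symmetric]) (auto simp: power_mult_distrib field_simps)
    finally show "ennreal (?c k) * emeasure lborel {z::real ^ 'n. norm z \<le> 2 ^ k * s} \<le> \<dots>" .
  qed
  also have "\<dots> = ennreal (4 ^ (CARD('n) + 1))"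
  proof -
    have "(4::real) ^ CARD('n) = 2 ^ CARD('n) * 2 ^ CARD('n)" by (simp flip: power_mult_distrib)
    then show ?thesis by (subst suminf_ennreal_geometric) (auto simp: mult_ac)
  qed
  finally show ?thesis .
qed

lemma nn_integral_peak_diff:
  assumes "0 < s" "CARD('n) + 1 \<le> N"
  shows "(\<integral>\<^sup>+y. ennreal (peak N s (x - y :: real ^ 'n)) \<partial>lborel) \<le> ennreal (4 ^ (CARD('n) + 1))"
    and "(\<integral>\<^sup>+y. ennreal (peak N s (y - x :: real ^ 'n)) \<partial>lborel) \<le> ennreal (4 ^ (CARD('n) + 1))"
  using nn_integral_peak[OF assms] nn_integral_lborel_shift(2,3)[of "\<lambda>z. ennreal (peak N s z)" x] by simp_all

text \<open>The bound for balls is summed over the dyadic balls that make up the peak; the exponent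
  \<open>n + 1\<close> leaves a factor \<open>1 / 2 ^ k\<close>. The result does not depend on the
  width \<open>s\<close>, so all frequencies are treated alike. The 12 is 2 times the 6 of
  \<open>cubes_bound_ball\<close>.\<close>

lemma cubes_bound_peak:
  fixes p x0 :: "real ^ 'n"
  assumes [measurable]: "F \<in> borel_measurable borel" and cb: "cubes_bound x0 \<mu> F"
    and "0 \<le> \<mu>" "0 < r" "0 < s" "x0 \<in> cube p r" and N: "CARD('n) + 1 \<le> N"
  shows "(\<integral>\<^sup>+x\<in>cube p r. (\<integral>\<^sup>+y. ennreal (peak N s (x - y)) * F y \<partial>lborel) \<partial>lborel)
         \<le> ennreal (4 * 12 ^ CARD('n) * \<mu> * r ^ CARD('n))"
proof -
  let ?c = "\<lambda>k::nat. 2 ^ (CARD('n) + 1) / ((2 ^ k) ^ (CARD('n) + 1) * s ^ CARD('n))"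
  let ?I = "\<lambda>k. indicator {z. norm z \<le> 2 ^ k * s} :: real ^ 'n \<Rightarrow> ennreal"
  have "(\<integral>\<^sup>+x\<in>cube p r. (\<integral>\<^sup>+y. ennreal (peak N s (x - y)) * F y \<partial>lborel) \<partial>lborel)
     \<le> (\<integral>\<^sup>+x\<in>cube p r. (\<integral>\<^sup>+y. (\<Sum>k. ennreal (?c k) * ?I k (x - y)) * F y \<partial>lborel) \<partial>lborel)"
    by (intro nn_integral_mono mult_right_mono order_trans[OF ennreal_leI peak_le_suminf[OF \<open>0 < s\<close>]]
      peak_antimono N \<open>0 < s\<close>) auto
  also have "\<dots> = (\<integral>\<^sup>+x. (\<Sum>k. ennreal (?c k) * ((\<integral>\<^sup>+y. ?I k (x - y) * F y \<partial>lborel) * indicator (cube p r) x)) \<partial>lborel)"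
  proof (intro nn_integral_cong)
    fix x
    have "(\<integral>\<^sup>+y. (\<Sum>k. ennreal (?c k) * ?I k (x - y)) * F y \<partial>lborel)
        = (\<integral>\<^sup>+y. (\<Sum>k. ennreal (?c k) * (?I k (x - y) * F y)) \<partial>lborel)"
      by (simp add: mult.assoc flip: ennreal_suminf_multc)
    also have "\<dots> = (\<Sum>k. ennreal (?c k) * (\<integral>\<^sup>+y. ?I k (x - y) * F y \<partial>lborel))"
      by (subst nn_integral_suminf) (auto simp: nn_integral_cmult)
    finally show "(\<integral>\<^sup>+y. (\<Sum>k. ennreal (?c k) * ?I k (x - y)) * F y \<partial>lborel) * indicator (cube p r) x
       = (\<Sum>k. ennreal (?c k) * ((\<integral>\<^sup>+y. ?I k (x - y) * F y \<partial>lborel) * indicator (cube p r) x))"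
      by (simp add: mult.assoc flip: ennreal_suminf_multc)
  qed
  also have "\<dots> = (\<Sum>k. ennreal (?c k) * (\<integral>\<^sup>+x\<in>cube p r. (\<integral>\<^sup>+y. ?I k (x - y) * F y \<partial>lborel) \<partial>lborel))"
    by (subst nn_integral_suminf) (auto simp: nn_integral_cmult)
  also have "\<dots> \<le> (\<Sum>k. ennreal (2 * 12 ^ CARD('n) * \<mu> * r ^ CARD('n) / 2 ^ k))"
  proof (intro suminf_le summableI)
    fix k
    have "ennreal (?c k) * (\<integral>\<^sup>+x\<in>cube p r. (\<integral>\<^sup>+y. ?I k (x - y) * F y \<partial>lborel) \<partial>lborel)
       \<le> ennreal (?c k) * ennreal (\<mu> * 6 ^ CARD('n) * (2 ^ k * s) ^ CARD('n) * r ^ CARD('n))"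
      using assms by (intro mult_left_mono cubes_bound_ball) auto
    also have "\<dots> = ennreal (2 * 12 ^ CARD('n) * \<mu> * r ^ CARD('n) / 2 ^ k)"
    proof -
      have "(12::real) ^ CARD('n) = 2 ^ CARD('n) * 6 ^ CARD('n)" by (simp flip: power_mult_distrib)
      then show ?thesis
        using assms by (subst ennreal_mult[symmetric]) (auto simp: power_mult_distrib field_simps)
    qed
    finally show "ennreal (?c k) * (\<integral>\<^sup>+x\<in>cube p r. (\<integral>\<^sup>+y. ?I k (x - y) * F y \<partial>lborel) \<partial>lborel) \<le> \<dots>" .
  qed
  also have "\<dots> = ennreal (4 * 12 ^ CARD('n) * \<mu> * r ^ CARD('n))"
    using assms by (subst suminf_ennreal_geometric) (auto simp: mult_ac)
  finally show ?thesis .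
qed

section \<open>Oscillatory integrals\<close>

text \<open>The inverse Fourier transform without its factor \<open>1 / (2 * pi) ^ n\<close>, which
  is put back in the kernels \<open>K\<close>.\<close>

definition ift :: "(real ^ 'n \<Rightarrow> complex) \<Rightarrow> real ^ 'n \<Rightarrow> complex" where
  "ift g z = (\<integral>\<xi>. cis (z \<bullet> \<xi>) * g \<xi> \<partial>lborel)"

lemma continuous_on_UNIV_borel_measurable:
  "continuous_on UNIV f \<Longrightarrow> f \<in> borel_measurable borel"
  by (rule borel_measurable_continuous_onI)

lemma integrable_dominated_continuous:
  fixes g :: "'a::euclidean_space \<Rightarrow> complex"
  assumes "continuous_on UNIV g" "\<And>\<xi>. norm (g \<xi>) \<le> B \<xi>" "integrable lborel B"
  shows "integrable lborel g"
proof (rule Bochner_Integration.integrable_bound[OF assms(3)])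
  show "g \<in> borel_measurable lborel" using continuous_on_UNIV_borel_measurable[OF assms(1)] by simp
qed (auto intro!: AE_I2 order_trans[OF assms(2)])

lemma cis_measurable [measurable]: "cis \<in> borel_measurable borel"
  by (intro continuous_on_UNIV_borel_measurable continuous_intros)

lemma integrable_cis_mult:
  assumes "integrable lborel g" shows "integrable lborel (\<lambda>\<xi>. cis (z \<bullet> \<xi>) * g \<xi>)"
proof (rule Bochner_Integration.integrable_bound[OF assms])
  have [measurable]: "g \<in> borel_measurable borel" using borel_measurable_integrable[OF assms] by simp
  show "(\<lambda>\<xi>. cis (z \<bullet> \<xi>) * g \<xi>) \<in> borel_measurable lborel" by measurable
qed (auto simp: norm_mult)

text \<open>The pure derivatives of \<open>g\<close> in the \<open>i\<close>-th variable, of order \<open>k \<le> N\<close>, are bounded by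
  \<open>l\<^sup>k B\<close>. No mixed derivatives are needed, because some component of \<open>z\<close> is comparable to \<open>norm z\<close>.\<close>

primrec dbd :: "'n \<Rightarrow> real \<Rightarrow> nat \<Rightarrow> (real ^ 'n \<Rightarrow> real) \<Rightarrow> (real ^ 'n \<Rightarrow> complex) \<Rightarrow> bool" where
  "dbd i l 0 B g \<longleftrightarrow> continuous_on UNIV g \<and> (\<forall>\<xi>. norm (g \<xi>) \<le> B \<xi>)"
| "dbd i l (Suc N) B g \<longleftrightarrow> continuous_on UNIV g \<and> (\<forall>\<xi>. norm (g \<xi>) \<le> B \<xi>) \<and>
    (\<exists>g'. (\<forall>\<xi>. ((\<lambda>t. g (\<xi> + t *\<^sub>R axis i 1)) has_vector_derivative g' \<xi>) (at 0)) \<and>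
      dbd i l N (\<lambda>\<xi>. l * B \<xi>) g')"

lemma dbd_continuous: "dbd i l N B g \<Longrightarrow> continuous_on UNIV g"
  by (cases N) auto

lemma dbd_norm_le: "dbd i l N B g \<Longrightarrow> norm (g \<xi>) \<le> B \<xi>"
  by (cases N) auto

lemma dbd_nonneg: "dbd i l N B g \<Longrightarrow> 0 \<le> B \<xi>"
  using dbd_norm_le[of i l N B g \<xi>] norm_ge_zero order_trans by blast

lemma dbd_Suc: "dbd i l (Suc N) B g \<Longrightarrow> dbd i l N B g"
proof (induction N arbitrary: B g)
  case (Suc N)
  from Suc.prems obtain g' where g': "\<And>\<xi>. ((\<lambda>t. g (\<xi> + t *\<^sub>R axis i 1)) has_vector_derivative g' \<xi>) (at 0)"
    and d: "dbd i l (Suc N) (\<lambda>\<xi>. l * B \<xi>) g'" unfolding dbd.simps(2)[of i l "Suc N"] by blast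
  from Suc.IH[OF d] g' show ?case
    using dbd_continuous[OF Suc.prems] dbd_norm_le[OF Suc.prems] by auto
qed auto

lemma dbd_mono:
  "dbd i l N B g \<Longrightarrow> (\<And>\<xi>. B \<xi> \<le> B' \<xi>) \<Longrightarrow> 0 \<le> l \<Longrightarrow> l \<le> l' \<Longrightarrow> dbd i l' N B' g"
proof (induction N arbitrary: B B' g)
  case 0
  then show ?case by (auto intro: order_trans)
next
  case (Suc N)
  from Suc.prems(1) obtain g' where g': "\<And>\<xi>. ((\<lambda>t. g (\<xi> + t *\<^sub>R axis i 1)) has_vector_derivative g' \<xi>) (at 0)"
    "dbd i l N (\<lambda>\<xi>. l * B \<xi>) g'" by auto
  have "dbd i l' N (\<lambda>\<xi>. l' * B' \<xi>) g'"
    using Suc.prems dbd_nonneg[OF Suc.prems(1)]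
    by (intro Suc.IH[OF g'(2)] mult_mono) (auto intro: order_trans)
  with Suc.prems g'(1) show ?case by (auto intro: order_trans)
qed

lemma dbd_add:
  "dbd i l N B g \<Longrightarrow> dbd i l N B' h \<Longrightarrow> dbd i l N (\<lambda>\<xi>. B \<xi> + B' \<xi>) (\<lambda>\<xi>. g \<xi> + h \<xi>)"
proof (induction N arbitrary: B B' g h)
  case 0
  then show ?case by (auto intro!: continuous_on_add norm_triangle_le add_mono)
next
  case (Suc N)
  from Suc.prems obtain g' h' where
    "\<And>\<xi>. ((\<lambda>t. g (\<xi> + t *\<^sub>R axis i 1)) has_vector_derivative g' \<xi>) (at 0)"
    "\<And>\<xi>. ((\<lambda>t. h (\<xi> + t *\<^sub>R axis i 1)) has_vector_derivative h' \<xi>) (at 0)"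
    "dbd i l N (\<lambda>\<xi>. l * B \<xi>) g'" "dbd i l N (\<lambda>\<xi>. l * B' \<xi>) h'" by auto
  note * = this
  from Suc.IH[OF *(3,4)] have "dbd i l N (\<lambda>\<xi>. l * (B \<xi> + B' \<xi>)) (\<lambda>\<xi>. g' \<xi> + h' \<xi>)"
    by (simp add: distrib_left)
  moreover have "((\<lambda>t. g (\<xi> + t *\<^sub>R axis i 1) + h (\<xi> + t *\<^sub>R axis i 1)) has_vector_derivative g' \<xi> + h' \<xi>) (at 0)" for \<xi>
    by (intro has_vector_derivative_add *)
  ultimately show ?case
    using Suc.prems by (auto intro!: continuous_on_add norm_triangle_le add_mono exI[of _ "\<lambda>\<xi>. g' \<xi> + h' \<xi>"])
qed

text \<open>Leibniz rule by induction: every derivative doubles the number of terms, whence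
  \<open>2 ^ N\<close>. Both factors must be measured with the same scale \<open>l\<close>.\<close>

lemma dbd_mult:
  assumes "0 \<le> l"
  shows "dbd i l N B g \<Longrightarrow> dbd i l N B' h \<Longrightarrow> dbd i l N (\<lambda>\<xi>. 2 ^ N * B \<xi> * B' \<xi>) (\<lambda>\<xi>. g \<xi> * h \<xi>)"
proof (induction N arbitrary: B B' g h)
  case 0
  then show ?case
    using dbd_nonneg[OF 0(1)] by (auto intro!: continuous_on_mult mult_mono simp: norm_mult)
next
  case (Suc N)
  from Suc.prems obtain g' h' where
    "\<And>\<xi>. ((\<lambda>t. g (\<xi> + t *\<^sub>R axis i 1)) has_vector_derivative g' \<xi>) (at 0)"
    "\<And>\<xi>. ((\<lambda>t. h (\<xi> + t *\<^sub>R axis i 1)) has_vector_derivative h' \<xi>) (at 0)"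
    "dbd i l N (\<lambda>\<xi>. l * B \<xi>) g'" "dbd i l N (\<lambda>\<xi>. l * B' \<xi>) h'" by auto
  note * = this
  have "dbd i l N (\<lambda>\<xi>. 2 ^ N * B \<xi> * (l * B' \<xi>) + 2 ^ N * (l * B \<xi>) * B' \<xi>) (\<lambda>\<xi>. g \<xi> * h' \<xi> + g' \<xi> * h \<xi>)"
    by (intro dbd_add Suc.IH[OF dbd_Suc[OF Suc.prems(1)] *(4)] Suc.IH[OF *(3) dbd_Suc[OF Suc.prems(2)]])
  then have "dbd i l N (\<lambda>\<xi>. l * (2 ^ Suc N * B \<xi> * B' \<xi>)) (\<lambda>\<xi>. g \<xi> * h' \<xi> + g' \<xi> * h \<xi>)"
    by (simp add: algebra_simps)
  moreover have "((\<lambda>t. g (\<xi> + t *\<^sub>R axis i 1) * h (\<xi> + t *\<^sub>R axis i 1)) has_vector_derivative g \<xi> * h' \<xi> + g' \<xi> * h \<xi>) (at 0)" for \<xi>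
    using has_vector_derivative_mult[OF *(1,2)[of \<xi>]] by simp
  moreover have "norm (g \<xi> * h \<xi>) \<le> 2 ^ Suc N * B \<xi> * B' \<xi>" for \<xi>
  proof -
    have "norm (g \<xi> * h \<xi>) \<le> B \<xi> * B' \<xi>"
      unfolding norm_mult
      by (intro mult_mono dbd_norm_le[OF Suc.prems(1)] dbd_norm_le[OF Suc.prems(2)] dbd_nonneg[OF Suc.prems(1)]) auto
    also have "\<dots> \<le> 2 ^ Suc N * (B \<xi> * B' \<xi>)"
    proof -
      have "0 \<le> B \<xi> * B' \<xi>" using dbd_nonneg[OF Suc.prems(1)] dbd_nonneg[OF Suc.prems(2)] by simp
      then show ?thesis using mult_right_mono[of 1 "2 ^ Suc N" "B \<xi> * B' \<xi>"] by (simp del: power_Suc)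
    qed
    finally show ?thesis by (simp add: mult.assoc)
  qed
  ultimately show ?case
    using Suc.prems by (auto intro!: continuous_on_mult exI[of _ "\<lambda>\<xi>. g \<xi> * h' \<xi> + g' \<xi> * h \<xi>"])
qed

lemma has_vector_derivative_along_line:
  fixes g :: "'a::real_normed_vector \<Rightarrow> 'b::real_normed_vector"
  assumes "\<And>\<xi>. ((\<lambda>t. g (\<xi> + t *\<^sub>R e)) has_vector_derivative g' \<xi>) (at 0)"
  shows "((\<lambda>t. g (\<xi> + t *\<^sub>R e)) has_vector_derivative g' (\<xi> + t *\<^sub>R e)) (at t)"
proof -
  have 1: "((\<lambda>s. s - t) has_vector_derivative 1) (at t)"
    by (auto intro!: derivative_eq_intros simp: has_vector_derivative_def)
  have 2: "((\<lambda>s. g ((\<xi> + t *\<^sub>R e) + s *\<^sub>R e)) has_vector_derivative g' (\<xi> + t *\<^sub>R e)) (at (t - t))"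
    using assms[of "\<xi> + t *\<^sub>R e"] by simp
  have "((\<lambda>s. g ((\<xi> + t *\<^sub>R e) + s *\<^sub>R e)) \<circ> (\<lambda>s. s - t) has_vector_derivative 1 *\<^sub>R g' (\<xi> + t *\<^sub>R e)) (at t)"
    by (rule vector_diff_chain_at[OF 1 2])
  then show ?thesis by (simp add: o_def algebra_simps)
qed

lemma integral_lborel_shift:
  fixes f :: "'a::euclidean_space \<Rightarrow> 'b::{banach,second_countable_topology}"
  assumes "f \<in> borel_measurable borel"
  shows "(\<integral>x. f (x + t) \<partial>lborel) = (\<integral>x. f x \<partial>lborel)"
proof -
  have "(\<integral>x. f x \<partial>lborel) = (\<integral>x. f x \<partial>distr lborel borel ((+) t))"
    using lborel_distr_plus[of t] by simp
  also have "\<dots> = (\<integral>x. f (x + t) \<partial>lborel)"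
    using assms by (subst integral_distr) (auto simp: add.commute)
  finally show ?thesis ..
qed

lemma integrable_lborel_shift:
  fixes f :: "'a::euclidean_space \<Rightarrow> 'b::{banach,second_countable_topology}"
  assumes "integrable lborel f"
  shows "integrable lborel (\<lambda>x. f (x + t))"
proof -
  have "integrable (distr lborel borel ((+) t)) f"
    using lborel_distr_plus[of t] assms by simp
  then show ?thesis
    by (subst (asm) integrable_distr_eq) (use borel_measurable_integrable[OF assms] in \<open>auto simp: add.commute\<close>)
qed

text \<open>Integrating the increment over unit steps in the direction of the derivative gives
  the integral of the derivative, by translation invariance.\<close>

lemma integral_directional_derivative_eq_0:
  fixes g g' :: "real ^ 'n \<Rightarrow> complex"
  assumes d: "\<And>\<xi>. ((\<lambda>t. g (\<xi> + t *\<^sub>R e)) has_vector_derivative g' \<xi>) (at 0)"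
    and c: "continuous_on UNIV g'" and i: "integrable lborel g" and i': "integrable lborel g'"
  shows "(\<integral>\<xi>. g' \<xi> \<partial>lborel) = 0"
proof -
  have [measurable]: "g' \<in> borel_measurable borel" by (rule continuous_on_UNIV_borel_measurable[OF c])
  have [measurable]: "g \<in> borel_measurable borel" using borel_measurable_integrable[OF i] by simp
  have ftc: "(\<integral>s. indicator {0..1::real} s *\<^sub>R g' (\<xi> + s *\<^sub>R e) \<partial>lborel) = g (\<xi> + e) - g \<xi>" for \<xi>
  proof -
    have "has_bochner_integral lborel (\<lambda>s. indicator {0..1::real} s *\<^sub>R g' (\<xi> + s *\<^sub>R e)) (g (\<xi> + 1 *\<^sub>R e) - g (\<xi> + 0 *\<^sub>R e))"
    proof (rule has_bochner_integral_FTC_Icc)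
      show "continuous_on {0..1} (\<lambda>s. g' (\<xi> + s *\<^sub>R e))"
        by (intro continuous_on_compose2[OF c] continuous_intros) auto
    qed (auto intro!: has_vector_derivative_at_within has_vector_derivative_along_line d)
    then show ?thesis using has_bochner_integral_integral_eq by fastforce
  qed
  have int: "integrable (lborel \<Otimes>\<^sub>M lborel) (\<lambda>(s, \<xi>). indicator {0..1::real} s *\<^sub>R g' (\<xi> + s *\<^sub>R e))"
  proof (rule lborel_pair.Fubini_integrable)
    show "integrable lborel (\<lambda>s. \<integral>\<xi>. norm (case (s, \<xi>) of (s, \<xi>) \<Rightarrow> indicator {0..1::real} s *\<^sub>R g' (\<xi> + s *\<^sub>R e)) \<partial>lborel)"
    proof -
      have "(\<integral>\<xi>. norm (indicator {0..1::real} s *\<^sub>R g' (\<xi> + s *\<^sub>R e)) \<partial>lborel) = indicator {0..1::real} s *\<^sub>R (\<integral>\<xi>. norm (g' \<xi>) \<partial>lborel)" for s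
        using integral_lborel_shift[of "\<lambda>\<xi>. norm (g' \<xi>)" "s *\<^sub>R e"] by (simp add: indicator_def)
      then have "(\<lambda>s. \<integral>\<xi>. norm (case (s, \<xi>) of (s, \<xi>) \<Rightarrow> indicator {0..1::real} s *\<^sub>R g' (\<xi> + s *\<^sub>R e)) \<partial>lborel) =
          (\<lambda>s. indicator {0..1::real} s *\<^sub>R (\<integral>\<xi>. norm (g' \<xi>) \<partial>lborel))"
        unfolding prod.case by (rule ext)
      then show ?thesis by simp
    qed
    show "AE s in lborel. integrable lborel (\<lambda>\<xi>. case (s, \<xi>) of (s, \<xi>) \<Rightarrow> indicator {0..1::real} s *\<^sub>R g' (\<xi> + s *\<^sub>R e))"
      by (auto intro!: AE_I2 integrable_scaleR_right integrable_lborel_shift i')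
  qed measurable
  have "(\<integral>\<xi>. (\<integral>s. indicator {0..1::real} s *\<^sub>R g' (\<xi> + s *\<^sub>R e) \<partial>lborel) \<partial>lborel)
     = (\<integral>s. (\<integral>\<xi>. indicator {0..1::real} s *\<^sub>R g' (\<xi> + s *\<^sub>R e) \<partial>lborel) \<partial>lborel)"
    using lborel_pair.Fubini_integral[OF int] by simp
  also have "\<dots> = (\<integral>s. indicator {0..1::real} s *\<^sub>R (\<integral>\<xi>. g' \<xi> \<partial>lborel) \<partial>lborel)"
    by (simp add: integral_lborel_shift)
  also have "\<dots> = (\<integral>\<xi>. g' \<xi> \<partial>lborel)"
    by simp
  finally have "(\<integral>\<xi>. g' \<xi> \<partial>lborel) = (\<integral>\<xi>. g (\<xi> + e) - g \<xi> \<partial>lborel)"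
    by (simp add: ftc)
  also have "\<dots> = 0"
    using i by (simp add: integral_lborel_shift integrable_lborel_shift)
  finally show ?thesis .
qed

text \<open>Integration by parts: the directional derivative of
  \<open>cis (z \<bullet> \<xi>) * g \<xi>\<close> has integral 0. Taking norms discards the powers
  of \<open>\<i>\<close>.\<close>

lemma norm_ift_derivative:
  fixes g g' :: "real ^ 'n \<Rightarrow> complex"
  assumes d: "\<And>\<xi>. ((\<lambda>t. g (\<xi> + t *\<^sub>R axis i 1)) has_vector_derivative g' \<xi>) (at 0)"
    and c: "continuous_on UNIV g" and c': "continuous_on UNIV g'" and i: "integrable lborel g" and i': "integrable lborel g'"
  shows "norm (ift g' z) = \<bar>z $ i\<bar> * norm (ift g z)"
proof -
  let ?G' = "\<lambda>\<xi>. cis (z \<bullet> \<xi>) * g' \<xi> + (\<i> * (z $ i) * cis (z \<bullet> \<xi>)) * g \<xi>"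
  have cis: "((\<lambda>t. cis (z \<bullet> (\<xi> + t *\<^sub>R axis i 1))) has_vector_derivative (\<i> * (z $ i) * cis (z \<bullet> \<xi>))) (at 0)" for \<xi>
  proof -
    have "((\<lambda>t. cis (z \<bullet> \<xi> + t * z $ i)) has_vector_derivative (\<i> * (z $ i) * cis (z \<bullet> \<xi>))) (at 0)"
    proof -
      have "((\<lambda>w::complex. exp (\<i> * (of_real (z \<bullet> \<xi>) + w * of_real (z $ i)))) has_field_derivative
          (\<i> * (z $ i) * cis (z \<bullet> \<xi>))) (at (of_real 0))"
        by (auto intro!: derivative_eq_intros simp: cis_conv_exp)
      from has_vector_derivative_real_field[OF this] show ?thesis
        by (simp add: cis_conv_exp)
    qed
    then show ?thesis by (simp add: inner_add_right inner_axis)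
  qed
  have [measurable]: "g \<in> borel_measurable borel" "g' \<in> borel_measurable borel"
    using c c' continuous_on_UNIV_borel_measurable by blast+
  have ii: "integrable lborel (\<lambda>\<xi>. cis (z \<bullet> \<xi>) * g' \<xi>)" "integrable lborel (\<lambda>\<xi>. cis (z \<bullet> \<xi>) * g \<xi>)"
    using i i' by (auto intro: integrable_cis_mult)
  then have ii3: "integrable lborel (\<lambda>\<xi>. (\<i> * (z $ i) * cis (z \<bullet> \<xi>)) * g \<xi>)"
    by (simp add: mult.assoc)
  have "(\<integral>\<xi>. ?G' \<xi> \<partial>lborel) = 0"
  proof (rule integral_directional_derivative_eq_0)
    show "((\<lambda>t. (\<lambda>\<xi>. cis (z \<bullet> \<xi>) * g \<xi>) (\<xi> + t *\<^sub>R axis i 1)) has_vector_derivative ?G' \<xi>) (at 0)" for \<xi>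
      using has_vector_derivative_mult[OF cis[of \<xi>] d[of \<xi>]] by simp
    show "continuous_on UNIV ?G'"
      by (intro continuous_intros c c')
  qed (use ii ii3 in auto)
  then have "ift g' z = - (\<i> * (z $ i) * ift g z)"
    using ii ii3 by (simp add: ift_def mult.assoc eq_neg_iff_add_eq_0)
  then show ?thesis by (simp add: norm_mult)
qed

text \<open>The witness \<open>h\<close> is the \<open>N\<close>-th derivative in direction
  \<open>i\<close>. It is kept as a function, since it is estimated in two ways: in the supremum
  norm for pointwise decay and by Bessel's inequality for local averages.\<close>

lemma dbd_ift:
  assumes "dbd i l N B g" "integrable lborel B"
  shows "\<exists>h. continuous_on UNIV h \<and> (\<forall>\<xi>. norm (h \<xi>) \<le> l ^ N * B \<xi>) \<and> (\<forall>z. \<bar>z $ i\<bar> ^ N * norm (ift g z) = norm (ift h z))"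
  using assms
proof (induction N arbitrary: B g)
  case 0
  then show ?case by (auto intro!: exI[of _ g])
next
  case (Suc N)
  from Suc.prems obtain g' where d: "\<And>\<xi>. ((\<lambda>t. g (\<xi> + t *\<^sub>R axis i 1)) has_vector_derivative g' \<xi>) (at 0)"
    and d': "dbd i l N (\<lambda>\<xi>. l * B \<xi>) g'" by auto
  have iB: "integrable lborel (\<lambda>\<xi>. l * B \<xi>)" using Suc.prems by auto
  obtain h where h: "continuous_on UNIV h" "\<And>\<xi>. norm (h \<xi>) \<le> l ^ N * (l * B \<xi>)" "\<And>z. \<bar>z $ i\<bar> ^ N * norm (ift g' z) = norm (ift h z)"
    using Suc.IH[OF d' iB] by auto
  have "norm (ift g' z) = \<bar>z $ i\<bar> * norm (ift g z)" for z
    using d dbd_continuous[OF Suc.prems(1)] dbd_continuous[OF d']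
      integrable_dominated_continuous[OF dbd_continuous dbd_norm_le, OF Suc.prems(1) Suc.prems(1) Suc.prems(2)]
      integrable_dominated_continuous[OF dbd_continuous dbd_norm_le, OF d' d' iB]
    by (rule norm_ift_derivative)
  with h show ?case by (auto intro!: exI[of _ h] simp: mult_ac)
qed


lemma norm_ift_le:
  assumes "continuous_on UNIV g" "\<And>\<xi>. norm (g \<xi>) \<le> B \<xi>" "integrable lborel B"
  shows "norm (ift g z) \<le> (\<integral>\<xi>. B \<xi> \<partial>lborel)"
proof -
  have c: "continuous_on UNIV (\<lambda>\<xi>. cis (z \<bullet> \<xi>) * g \<xi>)"
    by (intro continuous_intros assms)
  have b: "norm (cis (z \<bullet> \<xi>) * g \<xi>) \<le> B \<xi>" for \<xi> using assms(2) by (simp add: norm_mult)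
  have i: "integrable lborel (\<lambda>\<xi>. cis (z \<bullet> \<xi>) * g \<xi>)"
    by (rule integrable_dominated_continuous[OF c b assms(3)])
  have "norm (ift g z) \<le> (\<integral>\<xi>. norm (cis (z \<bullet> \<xi>) * g \<xi>) \<partial>lborel)"
    unfolding ift_def by (rule integral_norm_bound)
  also have "\<dots> \<le> (\<integral>\<xi>. B \<xi> \<partial>lborel)"
    using i b assms(3) by (intro integral_mono) auto
  finally show ?thesis .
qed

lemma exists_large_component:
  fixes z :: "real ^ 'n"
  shows "\<exists>i. norm z \<le> CARD('n) * \<bar>z $ i\<bar>"
proof (rule ccontr)
  assume "\<not> ?thesis"
  then have *: "CARD('n) * \<bar>z $ i\<bar> < norm z" for i by (auto simp: not_le)
  have "CARD('n) * norm z \<le> CARD('n) * (\<Sum>i\<in>UNIV. \<bar>z $ i\<bar>)"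
    by (intro mult_left_mono norm_le_l1_cart) auto
  also have "\<dots> = (\<Sum>i\<in>UNIV. CARD('n) * \<bar>z $ i\<bar>)" by (simp add: sum_distrib_left)
  also have "\<dots> < (\<Sum>i\<in>(UNIV::'n set). norm z)" by (intro sum_strict_mono *) auto
  finally show False by simp
qed

lemma one_plus_power_le:
  assumes "(0::real) \<le> t" shows "(1 + t) ^ N \<le> 2 ^ N * (1 + t ^ N)"
proof (cases "t \<le> 1")
  case True
  then have "(1 + t) ^ N \<le> 2 ^ N" using assms by (intro power_mono) auto
  also have "\<dots> \<le> 2 ^ N * (1 + t ^ N)" using assms by simp
  finally show ?thesis .
next
  case False
  then have "(1 + t) ^ N \<le> (2 * t) ^ N" using assms by (intro power_mono) auto
  also have "\<dots> \<le> 2 ^ N * (1 + t ^ N)" by (simp add: power_mult_distrib)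
  finally show ?thesis .
qed

text \<open>The factor \<open>2 ^ N\<close> splits \<open>(1 + t) ^ N\<close> into
  \<open>1 + t ^ N\<close>; the power of the dimension comes from replacing \<open>norm z\<close> by
  its largest component.\<close>

definition ift_const :: "'n::finite itself \<Rightarrow> nat \<Rightarrow> real" where
  "ift_const T N = 2 ^ N * (1 + CARD('n) ^ N)"

text \<open>All \<open>N\<close> integrations by parts are made in the direction of a component
  comparable to \<open>norm z\<close>; this bounds the part with \<open>norm z ^ N\<close>, and the
  trivial bound covers the rest.\<close>

lemma norm_ift_decay:
  fixes g :: "real ^ 'n \<Rightarrow> complex"
  assumes d: "\<And>i. dbd i l N B g" and B: "integrable lborel B" and "0 < l"
  shows "(1 + norm z / l) ^ N * norm (ift g z) \<le> ift_const TYPE('n) N * (\<integral>\<xi>. B \<xi> \<partial>lborel)"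
proof -
  let ?I = "\<integral>\<xi>. B \<xi> \<partial>lborel"
  obtain i where i: "norm z \<le> CARD('n) * \<bar>z $ i\<bar>" using exists_large_component by blast
  obtain h where h: "continuous_on UNIV h" "\<And>\<xi>. norm (h \<xi>) \<le> l ^ N * B \<xi>" "\<And>z. \<bar>z $ i\<bar> ^ N * norm (ift g z) = norm (ift h z)"
    using dbd_ift[OF d B, of i] by blast
  have "\<bar>z $ i\<bar> ^ N * norm (ift g z) \<le> l ^ N * ?I"
    using norm_ift_le[OF h(1,2), of z] h(3) B by simp
  moreover have "(norm z) ^ N \<le> CARD('n) ^ N * \<bar>z $ i\<bar> ^ N"
    using power_mono[OF i, of N] by (simp add: power_mult_distrib)
  ultimately have "(norm z) ^ N * norm (ift g z) \<le> CARD('n) ^ N * (l ^ N * ?I)"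
    by (smt (verit, best) mult.assoc mult_left_mono mult_right_mono norm_ge_zero of_nat_0_le_iff zero_le_power)
  then have 1: "(norm z / l) ^ N * norm (ift g z) \<le> CARD('n) ^ N * ?I"
    using \<open>0 < l\<close> by (simp add: power_divide field_simps)
  have 2: "norm (ift g z) \<le> ?I"
    by (rule norm_ift_le[OF dbd_continuous[OF d] dbd_norm_le[OF d] B])
  have "(1 + norm z / l) ^ N * norm (ift g z) \<le> 2 ^ N * (1 + (norm z / l) ^ N) * norm (ift g z)"
    using \<open>0 < l\<close> by (intro mult_right_mono one_plus_power_le) auto
  also have "\<dots> = 2 ^ N * (norm (ift g z) + (norm z / l) ^ N * norm (ift g z))"
    by (simp add: algebra_simps)
  also have "\<dots> \<le> 2 ^ N * (?I + CARD('n) ^ N * ?I)"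
    using 1 2 by (intro mult_left_mono add_mono) auto
  finally show ?thesis by (simp add: ift_const_def algebra_simps)
qed

section \<open>Gaussian integrals and Bessel's inequality\<close>

lemma integral_lborel_prod:
  fixes f :: "'a::euclidean_space \<Rightarrow> real \<Rightarrow> complex"
  assumes "\<And>b. b \<in> Basis \<Longrightarrow> integrable lborel (f b)"
  shows "(\<integral>x. (\<Prod>b\<in>Basis. f b (x \<bullet> b)) \<partial>lborel) = (\<Prod>b\<in>Basis. (\<integral>x. f b x \<partial>lborel))"
proof -
  have [measurable]: "b \<in> Basis \<Longrightarrow> f b \<in> borel_measurable borel" for b
    using borel_measurable_integrable[OF assms] by simp
  interpret product_sigma_finite "\<lambda>_::'a. lborel :: real measure"
    by standard
  have "(\<integral>x. (\<Prod>b\<in>Basis. f b (x \<bullet> b)) \<partial>lborel) = (\<integral>x. (\<Prod>b\<in>Basis. f b (x b)) \<partial>(\<Pi>\<^sub>M b\<in>(Basis::'a set). lborel))"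
    by (subst lborel_def, subst integral_distr) (auto intro!: Bochner_Integration.integral_cong prod.cong simp: lborel_eq_real)
  also have "\<dots> = (\<Prod>b\<in>Basis. (\<integral>x. f b x \<partial>lborel))"
    using assms by (intro product_integral_prod) auto
  finally show ?thesis .
qed

text \<open>In this normalization the Gaussian is its own Fourier transform up to the factor
  \<open>sqrt (2 * pi) ^ DIM('a)\<close>.\<close>

definition gauss :: "'a::euclidean_space \<Rightarrow> real" where
  "gauss z = exp (- (norm z)\<^sup>2 / 2)"

lemma gauss_measurable [measurable]: "gauss \<in> borel_measurable borel"
  unfolding gauss_def by measurable

lemma gauss_nonneg [simp]: "0 \<le> gauss z" and gauss_le_1: "gauss z \<le> 1" and gauss_0 [simp]: "gauss 0 = 1"
  and gauss_minus [simp]: "gauss (- z) = gauss z"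
  by (simp_all add: gauss_def)

lemma gauss_eq_prod: "gauss z = (\<Prod>b\<in>Basis. exp (- (z \<bullet> b)\<^sup>2 / 2))"
proof -
  have "(norm z)\<^sup>2 = (\<Sum>b\<in>Basis. (z \<bullet> b)\<^sup>2)"
    unfolding power2_norm_eq_inner euclidean_inner[of z z] by (simp add: power2_eq_square)
  then show ?thesis
    by (simp add: gauss_def sum_divide_distrib sum_negf flip: exp_sum)
qed

lemma integrable_gauss_real: "integrable lborel (\<lambda>x::real. exp (- x\<^sup>2 / 2))"
proof -
  have "integrable lborel (\<lambda>x. sqrt (2 * pi) * std_normal_density x)" by simp
  then show ?thesis by (simp add: std_normal_density_def)
qed

lemma integral_gauss_real: "(\<integral>(x::real). exp (- x\<^sup>2 / 2) \<partial>lborel) = sqrt (2 * pi)"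
proof -
  have "(\<integral>x. sqrt (2 * pi) * std_normal_density x \<partial>lborel) = sqrt (2 * pi)" by simp
  then show ?thesis by (simp add: std_normal_density_def)
qed

text \<open>This is the characteristic function of the standard normal law, with the density freed
  from its normalizing factor.\<close>

lemma integral_gauss_cis_real:
  "(\<integral>(x::real). complex_of_real (exp (- x\<^sup>2 / 2)) * cis (x * t) \<partial>lborel) = sqrt (2 * pi) * exp (- t\<^sup>2 / 2)"
proof -
  have "exp (- t\<^sup>2 / 2) = (\<integral>x. iexp (t * x) \<partial>std_normal_distribution)"
    using fun_cong[OF char_std_normal_distribution, of t] by (simp add: char_def)
  also have "\<dots> = (\<integral>x. std_normal_density x *\<^sub>R iexp (t * x) \<partial>lborel)"
    by (subst integral_density) auto
  finally have E: "complex_of_real (exp (- t\<^sup>2 / 2)) = (\<integral>x. std_normal_density x *\<^sub>R iexp (t * x) \<partial>lborel)" .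
  have "sqrt (2 * pi) * exp (- t\<^sup>2 / 2) = complex_of_real (sqrt (2 * pi)) * (\<integral>x. std_normal_density x *\<^sub>R iexp (t * x) \<partial>lborel)"
    by (simp only: of_real_mult E)
  also have "\<dots> = (\<integral>x. sqrt (2 * pi) * (std_normal_density x *\<^sub>R iexp (t * x)) \<partial>lborel)"
    by (rule integral_mult_right_zero[symmetric])
  also have "\<dots> = (\<integral>(x::real). complex_of_real (exp (- x\<^sup>2 / 2)) * cis (x * t) \<partial>lborel)"
    by (intro Bochner_Integration.integral_cong)
       (auto simp: std_normal_density_def scaleR_conv_of_real cis_conv_exp mult_ac)
  finally show ?thesis ..
qed

lemma nn_integral_gauss:
  "(\<integral>\<^sup>+z. ennreal (gauss z) \<partial>(lborel :: 'a::euclidean_space measure)) = ennreal (sqrt (2 * pi) ^ DIM('a))"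
proof -
  have "(\<integral>\<^sup>+z. ennreal (gauss z) \<partial>(lborel :: 'a measure)) = (\<integral>\<^sup>+z. (\<Prod>b\<in>(Basis::'a set). ennreal (exp (- (z \<bullet> b)\<^sup>2 / 2))) \<partial>lborel)"
    by (simp add: gauss_eq_prod prod_ennreal)
  also have "\<dots> = (\<Prod>b\<in>(Basis::'a set). \<integral>\<^sup>+(x::real). ennreal (exp (- x\<^sup>2 / 2)) \<partial>lborel)"
    by (rule nn_integral_lborel_prod) auto
  also have "(\<integral>\<^sup>+(x::real). ennreal (exp (- x\<^sup>2 / 2)) \<partial>lborel) = ennreal (sqrt (2 * pi))"
    using nn_integral_eq_integral[OF integrable_gauss_real] integral_gauss_real by simp
  finally show ?thesis by (simp add: ennreal_power)
qed

lemma integrable_gauss: "integrable lborel (gauss :: 'a::euclidean_space \<Rightarrow> real)"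
  by (intro integrableI_nonneg) (auto simp: nn_integral_gauss)

lemma integral_gauss_cis:
  fixes \<xi> :: "'a::euclidean_space"
  shows "(\<integral>z. complex_of_real (gauss z) * cis (z \<bullet> \<xi>) \<partial>lborel) = sqrt (2 * pi) ^ DIM('a) * gauss \<xi>"
proof -
  have "complex_of_real (gauss z) * cis (z \<bullet> \<xi>) = (\<Prod>b\<in>Basis. complex_of_real (exp (- (z \<bullet> b)\<^sup>2 / 2)) * cis ((z \<bullet> b) * (\<xi> \<bullet> b)))" for z
    by (simp add: gauss_eq_prod prod.distrib euclidean_inner[of z \<xi>] cis_conv_exp sum_distrib_left exp_sum)
  then have "(\<integral>z. complex_of_real (gauss z) * cis (z \<bullet> \<xi>) \<partial>lborel)
    = (\<integral>z. (\<Prod>b\<in>Basis. complex_of_real (exp (- (z \<bullet> b)\<^sup>2 / 2)) * cis ((z \<bullet> b) * (\<xi> \<bullet> b))) \<partial>lborel)" by simp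
  also have "\<dots> = (\<Prod>b\<in>Basis. (\<integral>(x::real). complex_of_real (exp (- x\<^sup>2 / 2)) * cis (x * (\<xi> \<bullet> b)) \<partial>lborel))"
  proof (rule integral_lborel_prod)
    fix b
    show "integrable lborel (\<lambda>x::real. complex_of_real (exp (- x\<^sup>2 / 2)) * cis (x * (\<xi> \<bullet> b)))"
      by (rule Bochner_Integration.integrable_bound[OF integrable_gauss_real]) (auto simp: norm_mult)
  qed
  also have "\<dots> = sqrt (2 * pi) ^ DIM('a) * gauss \<xi>"
    by (simp only: integral_gauss_cis_real) (simp add: gauss_eq_prod prod.distrib)
  finally show ?thesis .
qed

lemma integral_lborel_scale:
  fixes f :: "'a::euclidean_space \<Rightarrow> 'b::{banach,second_countable_topology}"
  assumes [measurable]: "f \<in> borel_measurable borel" and "0 < t"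
  shows "(\<integral>x. f (t *\<^sub>R x) \<partial>lborel) = (1 / t ^ DIM('a)) *\<^sub>R (\<integral>x. f x \<partial>lborel)"
proof -
  have "(\<integral>x. f x \<partial>lborel) = (t ^ DIM('a)) *\<^sub>R (\<integral>x. f (t *\<^sub>R x) \<partial>lborel)"
    using \<open>0 < t\<close> by (subst lborel_affine[of t 0]) (auto simp: integral_density integral_distr)
  then show ?thesis using \<open>0 < t\<close> by simp
qed

lemma integral_gauss_scaled_cis:
  fixes \<xi> :: "'a::euclidean_space"
  assumes "0 < t"
  shows "(\<integral>z. complex_of_real (gauss (t *\<^sub>R z)) * cis (z \<bullet> \<xi>) \<partial>lborel)
    = sqrt (2 * pi) ^ DIM('a) / t ^ DIM('a) * gauss ((1 / t) *\<^sub>R \<xi>)"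
proof -
  have "(\<integral>z. complex_of_real (gauss (t *\<^sub>R z)) * cis (z \<bullet> \<xi>) \<partial>lborel)
    = (\<integral>z. complex_of_real (gauss (t *\<^sub>R z)) * cis ((t *\<^sub>R z) \<bullet> ((1 / t) *\<^sub>R \<xi>)) \<partial>lborel)"
    using assms by simp
  also have "\<dots> = (1 / t ^ DIM('a)) *\<^sub>R (\<integral>z. complex_of_real (gauss z) * cis (z \<bullet> ((1 / t) *\<^sub>R \<xi>)) \<partial>lborel)"
    using integral_lborel_scale[of "\<lambda>z. complex_of_real (gauss z) * cis (z \<bullet> ((1 / t) *\<^sub>R \<xi>))" t] assms by simp
  also have "\<dots> = sqrt (2 * pi) ^ DIM('a) / t ^ DIM('a) * gauss ((1 / t) *\<^sub>R \<xi>)"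
    by (subst integral_gauss_cis) (simp add: scaleR_conv_of_real)
  finally show ?thesis .
qed

lemma nn_integral_gauss_scaled:
  fixes \<xi> :: "'a::euclidean_space"
  assumes "0 < t"
  shows "(\<integral>\<^sup>+z. ennreal (1 / t ^ DIM('a) * gauss ((1 / t) *\<^sub>R z)) \<partial>(lborel :: 'a measure)) = ennreal (sqrt (2 * pi) ^ DIM('a))"
proof -
  have "ennreal (sqrt (2 * pi) ^ DIM('a)) = (\<integral>\<^sup>+z. ennreal (gauss z) \<partial>(lborel :: 'a measure))"
    by (rule nn_integral_gauss[symmetric])
  also have "\<dots> = ennreal ((1 / t) ^ DIM('a)) * (\<integral>\<^sup>+z. ennreal (gauss ((1 / t) *\<^sub>R z)) \<partial>(lborel :: 'a measure))"
    using nn_integral_lborel_affine[of "\<lambda>z::'a. ennreal (gauss z)" "1 / t" 0] assms by simp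
  also have "\<dots> = (\<integral>\<^sup>+z. ennreal (1 / t ^ DIM('a) * gauss ((1 / t) *\<^sub>R z)) \<partial>(lborel :: 'a measure))"
    using assms by (subst nn_integral_cmult[symmetric]) (auto simp: ennreal_mult[symmetric] power_divide)
  finally show ?thesis ..
qed

lemma integrable_gauss_scaled:
  assumes "0 < t" shows "integrable lborel (\<lambda>z::'a::euclidean_space. gauss (t *\<^sub>R z))"
proof -
  have "(\<integral>\<^sup>+z. ennreal (gauss z) \<partial>(lborel :: 'a measure)) = ennreal (t ^ DIM('a)) * (\<integral>\<^sup>+z. ennreal (gauss (t *\<^sub>R z)) \<partial>(lborel :: 'a measure))"
    using nn_integral_lborel_affine[of "\<lambda>z::'a. ennreal (gauss z)" t 0] assms by simp
  then have eq: "ennreal (t ^ DIM('a)) * (\<integral>\<^sup>+z. ennreal (gauss (t *\<^sub>R z)) \<partial>(lborel :: 'a measure)) = ennreal (sqrt (2 * pi) ^ DIM('a))"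
    by (simp add: nn_integral_gauss)
  have "(\<integral>\<^sup>+z. ennreal (gauss (t *\<^sub>R z)) \<partial>(lborel :: 'a measure)) \<noteq> top"
  proof
    assume "(\<integral>\<^sup>+z. ennreal (gauss (t *\<^sub>R z)) \<partial>(lborel :: 'a measure)) = top"
    with eq have "ennreal (t ^ DIM('a)) * top = ennreal (sqrt (2 * pi) ^ DIM('a))" by simp
    then show False using assms by (simp add: ennreal_mult_top)
  qed
  then have "(\<integral>\<^sup>+z. ennreal (gauss (t *\<^sub>R z)) \<partial>(lborel :: 'a measure)) < \<infinity>"
    by (simp add: less_top)
  then show ?thesis by (intro integrableI_nonneg) auto
qed

text \<open>The criterion behind the later exchanges of Bochner integrals: domination by a product
  of two integrable functions of one variable each.\<close>

lemma pair_integrable_bound: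
  fixes f :: "'a::euclidean_space \<times> 'b::euclidean_space \<Rightarrow> complex"
  assumes "integrable lborel u" "integrable lborel v"
    and [measurable]: "f \<in> borel_measurable (lborel \<Otimes>\<^sub>M lborel)"
    and b: "\<And>x y. norm (f (x, y)) \<le> u x * v y"
  shows "integrable (lborel \<Otimes>\<^sub>M lborel) f"
proof (rule lborel_pair.Fubini_integrable)
  have i: "integrable lborel (\<lambda>y. f (x, y))" for x
    by (rule Bochner_Integration.integrable_bound[of _ "\<lambda>y. u x * v y"]) (auto intro!: assms AE_I2 order_trans[OF b])
  then show "AE x in lborel. integrable lborel (\<lambda>y. f (x, y))" by simp
  show "integrable lborel (\<lambda>x. \<integral>y. norm (f (x, y)) \<partial>lborel)"
  proof (rule Bochner_Integration.integrable_bound[of _ "\<lambda>x. u x * (\<integral>y. v y \<partial>lborel)"])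
    have "norm (\<integral>y. norm (f (x, y)) \<partial>lborel) \<le> u x * (\<integral>y. v y \<partial>lborel)" for x
    proof -
      have "norm (\<integral>y. norm (f (x, y)) \<partial>lborel) = (\<integral>y. norm (f (x, y)) \<partial>lborel)" by simp
      also have "\<dots> \<le> (\<integral>y. u x * v y \<partial>lborel)"
        using i assms by (intro integral_mono) auto
      finally show ?thesis by simp
    qed
    then show "AE x in lborel. norm (\<integral>y. norm (f (x, y)) \<partial>lborel) \<le> norm (u x * (\<integral>y. v y \<partial>lborel))"
      by (intro AE_I2) (smt (verit) real_norm_def)
  qed (use assms in auto)
qed fact

lemma cnj_measurable [measurable]: "cnj \<in> borel_measurable borel"
  by (intro borel_measurable_continuous_onI continuous_intros)

lemma ift_measurable [measurable]:
  assumes [measurable]: "g \<in> borel_measurable borel"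
  shows "ift g \<in> borel_measurable borel"
  unfolding ift_def[abs_def] by measurable

text \<open>Weighting with a Gaussian turns the square of the transform into a quadratic form with
  a positive integrable kernel, to which the Schur test applies.\<close>

lemma bessel_gauss:
  fixes g :: "real ^ 'n \<Rightarrow> complex"
  assumes cg: "continuous_on UNIV g" and ig: "integrable lborel g" and "0 < t"
  shows "(\<integral>\<^sup>+z. ennreal (gauss (t *\<^sub>R z) * (norm (ift g z))\<^sup>2) \<partial>lborel)
    \<le> ennreal ((2 * pi) ^ CARD('n)) * (\<integral>\<^sup>+\<xi>. ennreal ((norm (g \<xi>))\<^sup>2) \<partial>lborel)"
proof -
  have [measurable]: "g \<in> borel_measurable borel" by (rule continuous_on_UNIV_borel_measurable[OF cg])
  let ?K = "sqrt (2 * pi) ^ CARD('n)"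
  \<comment> \<open>The Fourier transform of the weight \<open>gauss (t *\<^sub>R z)\<close>: an
    approximate identity whose mass \<open>(2 * pi) ^ n\<close> does not depend on
    \<open>t\<close>.\<close>
  define P where "P \<xi> = ?K / t ^ CARD('n) * gauss ((1 / t) *\<^sub>R \<xi>)" for \<xi> :: "real ^ 'n"
  have [measurable]: "P \<in> borel_measurable borel" unfolding P_def by measurable
  have P0: "0 \<le> P \<xi>" for \<xi> using \<open>0 < t\<close> by (simp add: P_def)
  have Pint: "(\<integral>\<^sup>+\<xi>. ennreal (P \<xi>) \<partial>lborel) = ennreal ((2 * pi) ^ CARD('n))"
  proof -
    have "(\<integral>\<^sup>+\<xi>. ennreal (P \<xi>) \<partial>lborel) = ennreal ?K * (\<integral>\<^sup>+z. ennreal (1 / t ^ CARD('n) * gauss ((1 / t) *\<^sub>R z)) \<partial>(lborel :: (real ^ 'n) measure))"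
      using \<open>0 < t\<close> by (subst nn_integral_cmult[symmetric]) (auto simp: P_def ennreal_mult[symmetric])
    also have "\<dots> = ennreal ?K * ennreal ?K"
      using nn_integral_gauss_scaled[OF \<open>0 < t\<close>, where 'a="real ^ 'n"] by simp
    also have "\<dots> = ennreal ((2 * pi) ^ CARD('n))"
    proof -
      have "?K * ?K = (sqrt (2 * pi) * sqrt (2 * pi)) ^ CARD('n)" by (rule power_mult_distrib[symmetric])
      also have "sqrt (2 * pi) * sqrt (2 * pi) = 2 * pi" using pi_ge_zero by (intro real_sqrt_mult_self[THEN trans] abs_of_nonneg) simp
      finally show ?thesis by (subst ennreal_mult[symmetric]) auto
    qed
    finally show ?thesis .
  qed
  define I where "I = (\<integral>\<xi>. norm (g \<xi>) \<partial>lborel)"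
  have h: "norm (ift g z) \<le> I" for z
    unfolding I_def by (rule norm_ift_le[OF cg]) (use ig in auto)

  \<comment> \<open>The weight in \<open>x * y \<le> c * x\<^sup>2 + c * y\<^sup>2\<close>. As
    \<open>P (\<xi> - \<eta>)\<close> has the same mass in either variable, the two halves add up to
    exactly one full bound.\<close>
  define c :: real where "c = 1/2"
  have "0 \<le> c" by (simp add: c_def)
  have I0: "0 \<le> I" using h[of 0] norm_ge_zero order_trans by blast
  have ng: "integrable lborel (\<lambda>\<xi>. norm (g \<xi>))" using ig by simp
  have gs: "integrable lborel (\<lambda>z::real ^ 'n. gauss (t *\<^sub>R z))" by (rule integrable_gauss_scaled) fact
  \<comment> \<open>Expanding the conjugate of \<open>ift g z\<close> and integrating in
    \<open>z\<close> first turns the product of the two characters into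
    \<open>P (\<xi> - \<eta>)\<close>.\<close>
  have inner: "(\<integral>z. (gauss (t *\<^sub>R z) * cis (z \<bullet> \<xi>)) * cnj (ift g z) \<partial>lborel) = (\<integral>\<eta>. cnj (g \<eta>) * P (\<xi> - \<eta>) \<partial>lborel)" for \<xi>
  proof -
    have int: "integrable (lborel \<Otimes>\<^sub>M lborel) (\<lambda>(z, \<eta>). complex_of_real (gauss (t *\<^sub>R z)) * cis (z \<bullet> (\<xi> - \<eta>)) * cnj (g \<eta>))"
    proof (rule pair_integrable_bound[OF gs ng])
      show "(\<lambda>(z, \<eta>). complex_of_real (gauss (t *\<^sub>R z)) * cis (z \<bullet> (\<xi> - \<eta>)) * cnj (g \<eta>)) \<in> borel_measurable (lborel \<Otimes>\<^sub>M lborel)"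
        by measurable
    qed (auto simp: norm_mult)
    have "(\<integral>z. (gauss (t *\<^sub>R z) * cis (z \<bullet> \<xi>)) * cnj (ift g z) \<partial>lborel) =
       (\<integral>z. (\<integral>\<eta>. complex_of_real (gauss (t *\<^sub>R z)) * cis (z \<bullet> (\<xi> - \<eta>)) * cnj (g \<eta>) \<partial>lborel) \<partial>lborel)"
    proof (intro Bochner_Integration.integral_cong refl)
      fix z
      have "cnj (ift g z) = (\<integral>\<eta>. cnj (cis (z \<bullet> \<eta>) * g \<eta>) \<partial>lborel)"
        unfolding ift_def by (rule Bochner_Integration.integral_cnj[symmetric])
      also have "complex_of_real (gauss (t *\<^sub>R z)) * cis (z \<bullet> \<xi>) * \<dots> = (\<integral>\<eta>. complex_of_real (gauss (t *\<^sub>R z)) * cis (z \<bullet> \<xi>) * cnj (cis (z \<bullet> \<eta>) * g \<eta>) \<partial>lborel)"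
        by (rule integral_mult_right_zero[symmetric])
      also have "\<dots> = (\<integral>\<eta>. complex_of_real (gauss (t *\<^sub>R z)) * cis (z \<bullet> (\<xi> - \<eta>)) * cnj (g \<eta>) \<partial>lborel)"
      proof (intro Bochner_Integration.integral_cong refl)
        fix \<eta>
        have "cis (z \<bullet> (\<xi> - \<eta>)) = cis (z \<bullet> \<xi>) * cnj (cis (z \<bullet> \<eta>))"
          by (simp add: cis_cnj cis_mult inner_diff_right)
        then show "complex_of_real (gauss (t *\<^sub>R z)) * cis (z \<bullet> \<xi>) * cnj (cis (z \<bullet> \<eta>) * g \<eta>)
            = complex_of_real (gauss (t *\<^sub>R z)) * cis (z \<bullet> (\<xi> - \<eta>)) * cnj (g \<eta>)"
          by (simp only: complex_cnj_mult mult.assoc)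
      qed
      finally show "complex_of_real (gauss (t *\<^sub>R z)) * cis (z \<bullet> \<xi>) * cnj (ift g z) = \<dots>" .
    qed
    also have "\<dots> = (\<integral>\<eta>. (\<integral>z. complex_of_real (gauss (t *\<^sub>R z)) * cis (z \<bullet> (\<xi> - \<eta>)) * cnj (g \<eta>) \<partial>lborel) \<partial>lborel)"
      using lborel_pair.Fubini_integral[OF int] by simp
    also have "\<dots> = (\<integral>\<eta>. cnj (g \<eta>) * P (\<xi> - \<eta>) \<partial>lborel)"
      by (intro Bochner_Integration.integral_cong refl)
         (simp add: integral_gauss_scaled_cis[OF \<open>0 < t\<close>] P_def)
    finally show ?thesis .
  qed
  have "(\<integral>z. complex_of_real (gauss (t *\<^sub>R z) * (norm (ift g z))\<^sup>2) \<partial>lborel)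
     = (\<integral>z. (\<integral>\<xi>. complex_of_real (gauss (t *\<^sub>R z)) * cis (z \<bullet> \<xi>) * cnj (ift g z) * g \<xi> \<partial>lborel) \<partial>lborel)"
  proof (intro Bochner_Integration.integral_cong refl)
    fix z
    have "complex_of_real (gauss (t *\<^sub>R z) * (norm (ift g z))\<^sup>2) = (gauss (t *\<^sub>R z) * cnj (ift g z)) * ift g z"
      by (simp add: complex_norm_square del: of_real_power)
    also have "\<dots> = (\<integral>\<xi>. (gauss (t *\<^sub>R z) * cnj (ift g z)) * (cis (z \<bullet> \<xi>) * g \<xi>) \<partial>lborel)"
      by (subst (2) ift_def) simp
    also have "\<dots> = (\<integral>\<xi>. complex_of_real (gauss (t *\<^sub>R z)) * cis (z \<bullet> \<xi>) * cnj (ift g z) * g \<xi> \<partial>lborel)"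
      by (simp add: mult_ac)
    finally show "complex_of_real (gauss (t *\<^sub>R z) * (norm (ift g z))\<^sup>2) = \<dots>" .
  qed
  also have "\<dots> = (\<integral>\<xi>. (\<integral>z. complex_of_real (gauss (t *\<^sub>R z)) * cis (z \<bullet> \<xi>) * cnj (ift g z) * g \<xi> \<partial>lborel) \<partial>lborel)"
  proof -
    have gI: "integrable lborel (\<lambda>z::real ^ 'n. gauss (t *\<^sub>R z) * I)" using gs by simp
    have int: "integrable (lborel \<Otimes>\<^sub>M lborel) (\<lambda>(z, \<xi>). complex_of_real (gauss (t *\<^sub>R z)) * cis (z \<bullet> \<xi>) * cnj (ift g z) * g \<xi>)"
      by (rule pair_integrable_bound[OF gI ng]) (auto simp: norm_mult intro!: mult_mono h I0 mult_nonneg_nonneg[OF gauss_nonneg I0])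
    show ?thesis using lborel_pair.Fubini_integral[OF int] by simp
  qed
  also have "\<dots> = (\<integral>\<xi>. (\<integral>\<eta>. cnj (g \<eta>) * P (\<xi> - \<eta>) \<partial>lborel) * g \<xi> \<partial>lborel)"
    by (simp add: inner)
  finally have eq: "(\<integral>z. complex_of_real (gauss (t *\<^sub>R z) * (norm (ift g z))\<^sup>2) \<partial>lborel)
     = (\<integral>\<xi>. (\<integral>\<eta>. cnj (g \<eta>) * P (\<xi> - \<eta>) \<partial>lborel) * g \<xi> \<partial>lborel)" .
  have iJ: "integrable lborel (\<lambda>z. gauss (t *\<^sub>R z) * (norm (ift g z))\<^sup>2)"
  proof (rule Bochner_Integration.integrable_bound)
    show "integrable lborel (\<lambda>z::real ^ 'n. gauss (t *\<^sub>R z) * I\<^sup>2)" using gs by simp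
  qed (auto intro!: AE_I2 mult_left_mono power_mono h)
  have "(\<integral>\<^sup>+z. ennreal (gauss (t *\<^sub>R z) * (norm (ift g z))\<^sup>2) \<partial>lborel) = ennreal (\<integral>z. gauss (t *\<^sub>R z) * (norm (ift g z))\<^sup>2 \<partial>lborel)"
    by (rule nn_integral_eq_integral[OF iJ]) simp
  also have "(\<integral>z. gauss (t *\<^sub>R z) * (norm (ift g z))\<^sup>2 \<partial>lborel) = norm (\<integral>z. complex_of_real (gauss (t *\<^sub>R z) * (norm (ift g z))\<^sup>2) \<partial>lborel)"
    by (subst integral_complex_of_real) (simp only: norm_of_real abs_of_nonneg Bochner_Integration.integral_nonneg mult_nonneg_nonneg gauss_nonneg zero_le_power2)
  also have "ennreal \<dots> \<le> (\<integral>\<^sup>+\<xi>. ennreal (norm ((\<integral>\<eta>. cnj (g \<eta>) * P (\<xi> - \<eta>) \<partial>lborel) * g \<xi>)) \<partial>lborel)"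
    unfolding eq by (rule norm_integral_le_nn_integral)
  also have "\<dots> \<le> (\<integral>\<^sup>+\<xi>. (\<integral>\<^sup>+\<eta>. ennreal (norm (g \<eta>) * P (\<xi> - \<eta>)) \<partial>lborel) * ennreal (norm (g \<xi>)) \<partial>lborel)"
  proof (intro nn_integral_mono)
    fix \<xi>
    have "ennreal (norm (\<integral>\<eta>. cnj (g \<eta>) * P (\<xi> - \<eta>) \<partial>lborel)) \<le> (\<integral>\<^sup>+\<eta>. ennreal (norm (cnj (g \<eta>) * P (\<xi> - \<eta>))) \<partial>lborel)"
      by (rule norm_integral_le_nn_integral)
    then show "ennreal (norm ((\<integral>\<eta>. cnj (g \<eta>) * P (\<xi> - \<eta>) \<partial>lborel) * g \<xi>))
      \<le> (\<integral>\<^sup>+\<eta>. ennreal (norm (g \<eta>) * P (\<xi> - \<eta>)) \<partial>lborel) * ennreal (norm (g \<xi>))"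
      by (simp add: norm_mult ennreal_mult P0 mult_right_mono)
  qed
  also have "\<dots> = (\<integral>\<^sup>+\<xi>. (\<integral>\<^sup>+\<eta>. ennreal (norm (g \<xi>) * norm (g \<eta>) * P (\<xi> - \<eta>)) \<partial>lborel) \<partial>lborel)"
    by (intro nn_integral_cong, subst nn_integral_multc[symmetric])
       (auto simp: ennreal_mult P0 mult_ac)
  also have "\<dots> \<le> (\<integral>\<^sup>+\<xi>. (\<integral>\<^sup>+\<eta>. ennreal c * (ennreal ((norm (g \<xi>))\<^sup>2) * ennreal (P (\<xi> - \<eta>)))
       + ennreal c * (ennreal ((norm (g \<eta>))\<^sup>2) * ennreal (P (\<xi> - \<eta>))) \<partial>lborel) \<partial>lborel)"
  proof (intro nn_integral_mono)
    fix \<xi> \<eta>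
    have "norm (g \<xi>) * norm (g \<eta>) \<le> c * (norm (g \<xi>))\<^sup>2 + c * (norm (g \<eta>))\<^sup>2"
      using sum_squares_bound[of "norm (g \<xi>)" "norm (g \<eta>)"] by (simp add: c_def)
    then have "norm (g \<xi>) * norm (g \<eta>) * P (\<xi> - \<eta>) \<le> (c * (norm (g \<xi>))\<^sup>2 + c * (norm (g \<eta>))\<^sup>2) * P (\<xi> - \<eta>)"
      by (rule mult_right_mono) (rule P0)
    also have "\<dots> = c * ((norm (g \<xi>))\<^sup>2 * P (\<xi> - \<eta>)) + c * ((norm (g \<eta>))\<^sup>2 * P (\<xi> - \<eta>))" by (simp add: algebra_simps)
    finally have "ennreal (norm (g \<xi>) * norm (g \<eta>) * P (\<xi> - \<eta>)) \<le> ennreal \<dots>" by (rule ennreal_leI)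
    also have "\<dots> = ennreal c * (ennreal ((norm (g \<xi>))\<^sup>2) * ennreal (P (\<xi> - \<eta>)))
       + ennreal c * (ennreal ((norm (g \<eta>))\<^sup>2) * ennreal (P (\<xi> - \<eta>)))"
      using \<open>0 \<le> c\<close> by (subst ennreal_plus) (auto simp: P0 ennreal_mult)
    finally show "ennreal (norm (g \<xi>) * norm (g \<eta>) * P (\<xi> - \<eta>)) \<le> \<dots>" .
  qed
  also have "\<dots> = (\<integral>\<^sup>+\<xi>. (\<integral>\<^sup>+\<eta>. ennreal c * (ennreal ((norm (g \<xi>))\<^sup>2) * ennreal (P (\<xi> - \<eta>))) \<partial>lborel) \<partial>lborel)
       + (\<integral>\<^sup>+\<xi>. (\<integral>\<^sup>+\<eta>. ennreal c * (ennreal ((norm (g \<eta>))\<^sup>2) * ennreal (P (\<xi> - \<eta>))) \<partial>lborel) \<partial>lborel)"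
    by (simp add: nn_integral_add)
  also have "(\<integral>\<^sup>+\<xi>. (\<integral>\<^sup>+\<eta>. ennreal c * (ennreal ((norm (g \<eta>))\<^sup>2) * ennreal (P (\<xi> - \<eta>))) \<partial>lborel) \<partial>lborel)
      = (\<integral>\<^sup>+\<eta>. (\<integral>\<^sup>+\<xi>. ennreal c * (ennreal ((norm (g \<eta>))\<^sup>2) * ennreal (P (\<xi> - \<eta>))) \<partial>lborel) \<partial>lborel)"
    by (rule lborel_pair.Fubini') measurable
  also have "\<dots> = ennreal c * (ennreal ((2 * pi) ^ CARD('n)) * (\<integral>\<^sup>+\<eta>. ennreal ((norm (g \<eta>))\<^sup>2) \<partial>lborel))"
    using nn_integral_lborel_shift(2)[of "\<lambda>\<xi>. ennreal (P \<xi>)"]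
    by (simp add: nn_integral_cmult nn_integral_multc Pint mult.commute)
  also have "(\<integral>\<^sup>+\<xi>. (\<integral>\<^sup>+\<eta>. ennreal c * (ennreal ((norm (g \<xi>))\<^sup>2) * ennreal (P (\<xi> - \<eta>))) \<partial>lborel) \<partial>lborel)
     = ennreal c * (ennreal ((2 * pi) ^ CARD('n)) * (\<integral>\<^sup>+\<eta>. ennreal ((norm (g \<eta>))\<^sup>2) \<partial>lborel))"
    using nn_integral_lborel_shift(3)[of "\<lambda>\<xi>. ennreal (P \<xi>)"]
    by (simp add: nn_integral_cmult nn_integral_multc Pint mult.commute)
  also have "ennreal c * X + ennreal c * X = X" for X
  proof -
    have "ennreal c + ennreal c = 1" by (subst ennreal_plus[symmetric]) (auto simp: c_def)
    then show ?thesis by (simp flip: distrib_right)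
  qed
  finally show ?thesis .
qed

lemma gauss_scaled_tendsto: "(\<lambda>m. gauss ((1 / real (Suc m)) *\<^sub>R z)) \<longlonglongrightarrow> 1"
proof -
  have "(\<lambda>m. (1 / real (Suc m)) *\<^sub>R z) \<longlonglongrightarrow> 0 *\<^sub>R z"
    using LIMSEQ_inverse_real_of_nat by (intro tendsto_intros) (simp add: inverse_eq_divide)
  then have lim: "(\<lambda>m. (1 / real (Suc m)) *\<^sub>R z) \<longlonglongrightarrow> 0" by simp
  have "isCont gauss (0::'a)" unfolding gauss_def by (intro continuous_intros) auto
  from isCont_tendsto_compose[OF this lim] show ?thesis by simp
qed

text \<open>The bound with Gaussian weight is uniform in \<open>t\<close>, so Fatou's lemma along
  \<open>t = 1 / Suc m\<close> removes the weight. Only the inequality is obtained, not Plancherel's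
  identity, and it is all that the local averages require.\<close>

lemma bessel:
  fixes g :: "real ^ 'n \<Rightarrow> complex"
  assumes c: "continuous_on UNIV g" and ig: "integrable lborel g"
  shows "(\<integral>\<^sup>+z. ennreal ((norm (ift g z))\<^sup>2) \<partial>lborel)
    \<le> ennreal ((2 * pi) ^ CARD('n)) * (\<integral>\<^sup>+\<xi>. ennreal ((norm (g \<xi>))\<^sup>2) \<partial>lborel)"
proof -
  have [measurable]: "g \<in> borel_measurable borel" by (rule continuous_on_UNIV_borel_measurable[OF c])
  let ?f = "\<lambda>m z. ennreal (gauss ((1 / real (Suc m)) *\<^sub>R z) * (norm (ift g z))\<^sup>2)"
  have "liminf (\<lambda>m. ?f m z) = ennreal ((norm (ift g z))\<^sup>2)" for z
  proof (rule lim_imp_Liminf)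
    have "(\<lambda>m. gauss ((1 / real (Suc m)) *\<^sub>R z) * (norm (ift g z))\<^sup>2) \<longlonglongrightarrow> 1 * (norm (ift g z))\<^sup>2"
      by (intro tendsto_mult gauss_scaled_tendsto tendsto_const)
    then show "(\<lambda>m. ?f m z) \<longlonglongrightarrow> ennreal ((norm (ift g z))\<^sup>2)" by (simp add: tendsto_ennrealI)
  qed simp
  then have "(\<integral>\<^sup>+z. ennreal ((norm (ift g z))\<^sup>2) \<partial>lborel) = (\<integral>\<^sup>+z. liminf (\<lambda>m. ?f m z) \<partial>lborel)" by simp
  also have "\<dots> \<le> liminf (\<lambda>m. \<integral>\<^sup>+z. ?f m z \<partial>lborel)"
    by (rule nn_integral_liminf) measurable
  also have "\<dots> \<le> liminf (\<lambda>m::nat. ennreal ((2 * pi) ^ CARD('n)) * (\<integral>\<^sup>+\<xi>. ennreal ((norm (g \<xi>))\<^sup>2) \<partial>lborel))"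
    by (intro Liminf_mono always_eventually allI bessel_gauss c ig) simp
  also have "\<dots> = ennreal ((2 * pi) ^ CARD('n)) * (\<integral>\<^sup>+\<xi>. ennreal ((norm (g \<xi>))\<^sup>2) \<partial>lborel)"
    by (simp add: Liminf_const)
  finally show ?thesis .
qed

text \<open>Fourier inversion at the origin. With a Gaussian weight the integral is a constant times
  a Gaussian mean of \<open>g (t *\<^sub>R \<eta>)\<close>, which tends to a multiple of
  \<open>g 0\<close>. This gives the kernels of positive index their mean value zero.\<close>

lemma integral_ift_eq_0:
  fixes g :: "real ^ 'n \<Rightarrow> complex"
  assumes c: "continuous_on UNIV g" and ig: "integrable lborel g" and M: "\<And>\<xi>. norm (g \<xi>) \<le> M"
    and g0: "g 0 = 0" and ih: "integrable lborel (ift g)"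
  shows "(\<integral>z. ift g z \<partial>lborel) = 0"
proof -
  have [measurable]: "g \<in> borel_measurable borel" by (rule continuous_on_UNIV_borel_measurable[OF c])
  let ?K = "sqrt (2 * pi) ^ CARD('n)"
  let ?t = "\<lambda>m. 1 / real (Suc m)"
  \<comment> \<open>Fubini moves the transform to the Gaussian; the substitution of
    \<open>t *\<^sub>R \<eta>\<close> for \<open>\<xi>\<close> makes the Gaussian independent of
    \<open>t\<close>.\<close>
  have eq: "(\<integral>z. complex_of_real (gauss (t *\<^sub>R z)) * ift g z \<partial>lborel) = ?K * (\<integral>\<eta>. gauss \<eta> * g (t *\<^sub>R \<eta>) \<partial>lborel)" if "0 < t" for t
  proof -
    have int: "integrable (lborel \<Otimes>\<^sub>M lborel) (\<lambda>(z, \<xi>). complex_of_real (gauss (t *\<^sub>R z)) * (cis (z \<bullet> \<xi>) * g \<xi>))"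
      by (rule pair_integrable_bound[OF integrable_gauss_scaled[OF that] integrable_norm[OF ig]]) (auto simp: norm_mult)
    have "(\<integral>z. complex_of_real (gauss (t *\<^sub>R z)) * ift g z \<partial>lborel) = (\<integral>z. (\<integral>\<xi>. complex_of_real (gauss (t *\<^sub>R z)) * (cis (z \<bullet> \<xi>) * g \<xi>) \<partial>lborel) \<partial>lborel)"
      by (simp add: ift_def)
    also have "\<dots> = (\<integral>\<xi>. (\<integral>z. complex_of_real (gauss (t *\<^sub>R z)) * (cis (z \<bullet> \<xi>) * g \<xi>) \<partial>lborel) \<partial>lborel)"
      using lborel_pair.Fubini_integral[OF int] by simp
    also have "\<dots> = (\<integral>\<xi>. ?K / t ^ CARD('n) * gauss ((1 / t) *\<^sub>R \<xi>) * g \<xi> \<partial>lborel)"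
      by (simp add: integral_gauss_scaled_cis[OF that] flip: mult.assoc)
    also have "\<dots> = ?K * ((1 / t ^ CARD('n)) *\<^sub>R (\<integral>\<xi>. gauss ((1 / t) *\<^sub>R \<xi>) * g \<xi> \<partial>lborel))"
      by (simp add: scaleR_conv_of_real mult.assoc)
    also have "(1 / t ^ CARD('n)) *\<^sub>R (\<integral>\<xi>. gauss ((1 / t) *\<^sub>R \<xi>) * g \<xi> \<partial>lborel) = (\<integral>\<eta>. gauss \<eta> * g (t *\<^sub>R \<eta>) \<partial>lborel)"
      using integral_lborel_scale[of "\<lambda>\<xi>. complex_of_real (gauss ((1 / t) *\<^sub>R \<xi>)) * g \<xi>" t] that by simp
    finally show ?thesis .
  qed
  have 1: "(\<lambda>m. \<integral>z. complex_of_real (gauss (?t m *\<^sub>R z)) * ift g z \<partial>lborel) \<longlonglongrightarrow> (\<integral>z. ift g z \<partial>lborel)"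
  proof (rule integral_dominated_convergence[where w="\<lambda>z. norm (ift g z)"])
    have "(\<lambda>m. complex_of_real (gauss (?t m *\<^sub>R z)) * ift g z) \<longlonglongrightarrow> complex_of_real 1 * ift g z" for z
      by (intro tendsto_mult tendsto_of_real gauss_scaled_tendsto tendsto_const)
    then show "AE z in lborel. (\<lambda>m. complex_of_real (gauss (?t m *\<^sub>R z)) * ift g z) \<longlonglongrightarrow> ift g z" by simp
  qed (use ih in \<open>auto simp: norm_mult gauss_le_1 intro!: mult_left_le_one_le\<close>)
  have 2: "(\<lambda>m. ?K * (\<integral>\<eta>. gauss \<eta> * g (?t m *\<^sub>R \<eta>) \<partial>lborel)) \<longlonglongrightarrow> complex_of_real ?K * (\<integral>(\<eta>::real ^ 'n). 0 \<partial>lborel)"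
  proof (intro tendsto_mult tendsto_const integral_dominated_convergence[where w="\<lambda>\<eta>. M * gauss \<eta>"])
    have "(\<lambda>m. g (?t m *\<^sub>R \<eta>)) \<longlonglongrightarrow> g 0" for \<eta>
    proof (rule isCont_tendsto_compose[of _ g])
      show "isCont g 0" using c by (simp add: continuous_on_eq_continuous_at)
      have "(\<lambda>m. ?t m *\<^sub>R \<eta>) \<longlonglongrightarrow> 0 *\<^sub>R \<eta>"
        using LIMSEQ_inverse_real_of_nat by (intro tendsto_intros) (simp add: inverse_eq_divide)
      then show "(\<lambda>m. ?t m *\<^sub>R \<eta>) \<longlonglongrightarrow> 0" by simp
    qed
    then have "(\<lambda>m. gauss \<eta> * g (?t m *\<^sub>R \<eta>)) \<longlonglongrightarrow> gauss \<eta> * g 0" for \<eta>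
      by (intro tendsto_mult tendsto_const)
    then show "AE \<eta> in lborel. (\<lambda>m. complex_of_real (gauss \<eta>) * g (?t m *\<^sub>R \<eta>)) \<longlonglongrightarrow> 0" by (simp add: g0)
  qed (use integrable_gauss in \<open>auto simp: norm_mult mult.commute[of M] intro!: mult_left_mono M AE_I2\<close>)
  have 3: "(\<lambda>m. \<integral>z. complex_of_real (gauss (?t m *\<^sub>R z)) * ift g z \<partial>lborel) = (\<lambda>m. ?K * (\<integral>\<eta>. gauss \<eta> * g (?t m *\<^sub>R \<eta>) \<partial>lborel))"
    by (intro ext eq) simp
  from LIMSEQ_unique[OF 1[unfolded 3] 2] show ?thesis by simp
qed

lemma ennreal_le_sqrt:
  fixes X :: ennreal assumes "X\<^sup>2 \<le> ennreal c" "0 \<le> c" shows "X \<le> ennreal (sqrt c)"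
proof (cases X)
  case (real x)
  then have "x\<^sup>2 \<le> c" using assms by (simp add: ennreal_power)
  then show ?thesis using real by (simp add: real_le_rsqrt ennreal_leI)
qed (use assms in \<open>auto simp: power2_eq_square top_unique\<close>)

text \<open>Cauchy-Schwarz on the cube followed by Bessel. The bound is \<open>d\<close> to the
  power \<open>n / 2\<close> times an L2 norm; for \<open>d\<close> much larger than 2^-j this beats
  the volume of the cube times the supremum bound.\<close>

lemma ift_local_L1:
  fixes h :: "real ^ 'n \<Rightarrow> complex"
  assumes c: "continuous_on UNIV h" and b: "\<And>\<xi>. norm (h \<xi>) \<le> b * B \<xi>" and "0 \<le> b"
    and B: "integrable lborel B" and B2: "integrable lborel (\<lambda>\<xi>. (B \<xi>)\<^sup>2)" and "0 < d"
  shows "(\<integral>\<^sup>+u\<in>cube 0 d. ennreal (norm (ift h (z + u))) \<partial>lborel)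
    \<le> ennreal (b * sqrt ((2 * pi) ^ CARD('n) * d ^ CARD('n) * (\<integral>\<xi>. (B \<xi>)\<^sup>2 \<partial>lborel)))"
proof -
  have [measurable]: "h \<in> borel_measurable borel" by (rule continuous_on_UNIV_borel_measurable[OF c])
  have ih: "integrable lborel h" using integrable_dominated_continuous[OF c b] B by simp
  let ?J = "\<integral>\<xi>. (B \<xi>)\<^sup>2 \<partial>lborel"
  have J0: "0 \<le> ?J" by simp
  have "(\<integral>\<^sup>+u. ennreal (norm (ift h (z + u))) * indicator (cube 0 d) u \<partial>lborel)\<^sup>2
     \<le> (\<integral>\<^sup>+u. (ennreal (norm (ift h (z + u))))\<^sup>2 \<partial>lborel) * (\<integral>\<^sup>+u. (indicator (cube (0::real ^ 'n) d) u)\<^sup>2 \<partial>lborel)"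
    by (rule Cauchy_Schwarz_nn_integral) measurable
  also have "(\<integral>\<^sup>+u. (indicator (cube (0::real ^ 'n) d) u)\<^sup>2 \<partial>lborel) = (\<integral>\<^sup>+u. indicator (cube (0::real ^ 'n) d) u \<partial>lborel)"
    by (intro nn_integral_cong) (auto simp: indicator_def)
  also have "\<dots> = ennreal (d ^ CARD('n))" using \<open>0 < d\<close> emeasure_cube[of d "0::real ^ 'n"] by simp
  also have "(\<integral>\<^sup>+u. (ennreal (norm (ift h (z + u))))\<^sup>2 \<partial>lborel) = (\<integral>\<^sup>+u. ennreal ((norm (ift h u))\<^sup>2) \<partial>lborel)"
    using nn_integral_lborel_shift(1)[of "\<lambda>u. ennreal ((norm (ift h u))\<^sup>2)" z]
    by (simp add: ennreal_power add.commute)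
  also have "\<dots> \<le> ennreal ((2 * pi) ^ CARD('n)) * (\<integral>\<^sup>+\<xi>. ennreal ((norm (h \<xi>))\<^sup>2) \<partial>lborel)"
    by (rule bessel[OF c ih])
  also have "(\<integral>\<^sup>+\<xi>. ennreal ((norm (h \<xi>))\<^sup>2) \<partial>lborel) \<le> (\<integral>\<^sup>+\<xi>. ennreal ((b * B \<xi>)\<^sup>2) \<partial>lborel)"
    by (intro nn_integral_mono ennreal_leI power_mono b) auto
  also have "\<dots> = ennreal (b\<^sup>2 * ?J)"
    using B2 by (subst nn_integral_eq_integral) (auto simp: power_mult_distrib)
  finally have "(\<integral>\<^sup>+u. ennreal (norm (ift h (z + u))) * indicator (cube 0 d) u \<partial>lborel)\<^sup>2
     \<le> ennreal ((2 * pi) ^ CARD('n)) * ennreal (b\<^sup>2 * ?J) * ennreal (d ^ CARD('n))"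
    by (simp add: mult_left_mono mult_right_mono)
  also have "\<dots> = ennreal (b\<^sup>2 * ((2 * pi) ^ CARD('n) * d ^ CARD('n) * ?J))"
    using \<open>0 < d\<close> J0 by (simp add: mult_ac flip: ennreal_mult)
  finally have "(\<integral>\<^sup>+u. ennreal (norm (ift h (z + u))) * indicator (cube 0 d) u \<partial>lborel)
     \<le> ennreal (sqrt (b\<^sup>2 * ((2 * pi) ^ CARD('n) * d ^ CARD('n) * ?J)))"
    by (rule ennreal_le_sqrt) (use \<open>0 < d\<close> J0 in auto)
  also have "sqrt (b\<^sup>2 * ((2 * pi) ^ CARD('n) * d ^ CARD('n) * ?J)) = b * sqrt ((2 * pi) ^ CARD('n) * d ^ CARD('n) * ?J)"
    using \<open>0 \<le> b\<close> by (simp add: real_sqrt_mult)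
  finally show ?thesis .
qed

lemma norm_le_of_mem_cube0:
  fixes u :: "real ^ 'n" and d :: real assumes "u \<in> cube 0 d" shows "norm u \<le> CARD('n) * d"
proof -
  have "norm u \<le> (\<Sum>i\<in>UNIV. \<bar>u $ i\<bar>)" by (rule norm_le_l1_cart)
  also have "\<dots> \<le> (\<Sum>i\<in>(UNIV::'n set). d)"
    using assms[unfolded mem_cube] by (intro sum_mono) auto
  finally show ?thesis by simp
qed

text \<open>The first factor moves the weight from \<open>z\<close> to \<open>z + u\<close> and
  splits it; the second counts \<open>g\<close> itself and its \<open>N\<close>-th derivatives in
  all \<open>n\<close> directions; the root comes from Bessel's inequality.\<close>

definition local_const :: "'n::finite itself \<Rightarrow> nat \<Rightarrow> real" where
  "local_const T N = (2 * (1 + CARD('n))) ^ N * (1 + CARD('n) * CARD('n) ^ N) * sqrt ((2 * pi) ^ CARD('n))"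

text \<open>For \<open>d \<le> l\<close> the weight is nearly constant on the cube
  \<open>z + cube 0 d\<close>. Its \<open>N\<close>-th power is converted into \<open>N\<close>-th
  derivatives of \<open>g\<close>, and each of them is averaged by
  \<open>ift_local_L1\<close>.\<close>

lemma ift_local_average:
  fixes g :: "real ^ 'n \<Rightarrow> complex"
  assumes dg: "\<And>i. dbd i l N B g" and B: "integrable lborel B" and B2: "integrable lborel (\<lambda>\<xi>. (B \<xi>)\<^sup>2)"
    and "0 < d" "d \<le> l"
  shows "ennreal ((1 + norm z / l) ^ N) * (\<integral>\<^sup>+u\<in>cube 0 d. ennreal (norm (ift g (z + u))) \<partial>lborel)
    \<le> ennreal (local_const TYPE('n) N * sqrt (d ^ CARD('n) * (\<integral>\<xi>. (B \<xi>)\<^sup>2 \<partial>lborel)))"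
proof -
  have "0 < l" using assms by simp
  let ?n = "real CARD('n)" and ?J = "\<integral>\<xi>. (B \<xi>)\<^sup>2 \<partial>lborel"
  define S where "S = sqrt ((2 * pi) ^ CARD('n) * d ^ CARD('n) * ?J)"
  have J0: "0 \<le> ?J" by simp
  have S0: "0 \<le> S" using J0 \<open>0 < d\<close> by (simp add: S_def)
  have cg: "continuous_on UNIV g" by (rule dbd_continuous[OF dg])
  have [measurable]: "g \<in> borel_measurable borel" by (rule continuous_on_UNIV_borel_measurable[OF cg])
  have "\<forall>i. \<exists>h. continuous_on UNIV h \<and> (\<forall>\<xi>. norm (h \<xi>) \<le> l ^ N * B \<xi>) \<and> (\<forall>z. \<bar>z $ i\<bar> ^ N * norm (ift g z) = norm (ift h z))"
    using dbd_ift[OF dg B] by blast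
  then obtain h where h: "\<And>i. continuous_on UNIV (h i)" "\<And>i \<xi>. norm (h i \<xi>) \<le> l ^ N * B \<xi>"
    "\<And>i z. \<bar>z $ i\<bar> ^ N * norm (ift g z) = norm (ift (h i) z)" by metis
  have [measurable]: "h i \<in> borel_measurable borel" for i by (rule continuous_on_UNIV_borel_measurable[OF h(1)])
  define c where "c = (2 * (1 + ?n)) ^ N"
  have c0: "0 \<le> c" by (simp add: c_def)
  define e where "e = ?n ^ N / l ^ N"
  have e0: "0 \<le> e" using \<open>0 < l\<close> by (simp add: e_def)
  have pt: "(1 + norm z / l) ^ N * norm (ift g (z + u)) \<le> c * norm (ift g (z + u)) + (\<Sum>i\<in>UNIV. c * e * norm (ift (h i) (z + u)))"
    if u: "u \<in> cube 0 d" for u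
  proof -
    have "norm u \<le> ?n * l" using norm_le_of_mem_cube0[OF u] \<open>d \<le> l\<close> by (smt (verit) mult_left_mono of_nat_0_le_iff)
    then have nl: "norm u / l \<le> ?n" using \<open>0 < l\<close> by (simp add: field_simps)
    have "norm z \<le> norm (z + u) + norm u" using norm_triangle_ineq4[of "z + u" u] by simp
    then have "norm z / l \<le> norm (z + u) / l + norm u / l" using \<open>0 < l\<close> by (simp add: field_simps)
    then have "1 + norm z / l \<le> (1 + ?n) + norm (z + u) / l" using nl by simp
    also have "\<dots> \<le> (1 + ?n) * (1 + norm (z + u) / l)"
    proof -
      have "0 \<le> ?n * (norm (z + u) / l)" using \<open>0 < l\<close> by simp
      then show ?thesis by (simp only: distrib_left distrib_right mult_1 mult_1_right)
    qed
    finally have "(1 + norm z / l) ^ N \<le> ((1 + ?n) * (1 + norm (z + u) / l)) ^ N"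
      using \<open>0 < l\<close> by (intro power_mono) auto
    also have "\<dots> \<le> (1 + ?n) ^ N * (2 ^ N * (1 + (norm (z + u) / l) ^ N))"
      unfolding power_mult_distrib using \<open>0 < l\<close> by (intro mult_left_mono one_plus_power_le) auto
    also have "\<dots> = c * (1 + (norm (z + u) / l) ^ N)" by (simp only: c_def power_mult_distrib mult_ac)
    finally have 1: "(1 + norm z / l) ^ N * norm (ift g (z + u)) \<le> c * (1 + (norm (z + u) / l) ^ N) * norm (ift g (z + u))"
      by (rule mult_right_mono) simp
    obtain i where i: "norm (z + u) \<le> ?n * \<bar>(z + u) $ i\<bar>" using exists_large_component by blast
    have "(norm (z + u) / l) ^ N \<le> e * \<bar>(z + u) $ i\<bar> ^ N"
      using power_mono[OF i, of N] \<open>0 < l\<close> by (simp add: e_def power_divide power_mult_distrib divide_right_mono)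
    then have "(norm (z + u) / l) ^ N * norm (ift g (z + u)) \<le> e * \<bar>(z + u) $ i\<bar> ^ N * norm (ift g (z + u))"
      by (rule mult_right_mono) simp
    also have "\<dots> = e * norm (ift (h i) (z + u))" by (simp only: mult.assoc h(3))
    \<comment> \<open>The large component of \<open>z + u\<close> varies with \<open>u\<close>, so
      all directions are summed before integrating in \<open>u\<close>.\<close>
    also have "\<dots> \<le> (\<Sum>i\<in>UNIV. e * norm (ift (h i) (z + u)))"
      using e0 by (intro member_le_sum) auto
    finally have "c * ((norm (z + u) / l) ^ N * norm (ift g (z + u))) \<le> c * (\<Sum>i\<in>UNIV. e * norm (ift (h i) (z + u)))"
      using c0 by (rule mult_left_mono)
    then show ?thesis using 1 by (simp add: algebra_simps sum_distrib_left)
  qed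
  have "ennreal ((1 + norm z / l) ^ N) * (\<integral>\<^sup>+u\<in>cube 0 d. ennreal (norm (ift g (z + u))) \<partial>lborel)
      = (\<integral>\<^sup>+u\<in>cube 0 d. ennreal ((1 + norm z / l) ^ N * norm (ift g (z + u))) \<partial>lborel)"
    using \<open>0 < l\<close> by (subst nn_integral_cmult[symmetric]) (auto simp: ennreal_mult' mult.assoc)
  also have "\<dots> \<le> (\<integral>\<^sup>+u\<in>cube 0 d. (ennreal c * ennreal (norm (ift g (z + u))) + (\<Sum>i\<in>UNIV. ennreal (c * e) * ennreal (norm (ift (h i) (z + u))))) \<partial>lborel)"
  proof (intro nn_integral_mono)
    fix u
    show "ennreal ((1 + norm z / l) ^ N * norm (ift g (z + u))) * indicator (cube 0 d) u \<le>
      (ennreal c * ennreal (norm (ift g (z + u))) + (\<Sum>i\<in>UNIV. ennreal (c * e) * ennreal (norm (ift (h i) (z + u))))) * indicator (cube 0 d) u"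
    proof (cases "u \<in> cube 0 d")
      case True
      from ennreal_leI[OF pt[OF True]] have "ennreal ((1 + norm z / l) ^ N * norm (ift g (z + u)))
        \<le> ennreal c * ennreal (norm (ift g (z + u))) + (\<Sum>i\<in>UNIV. ennreal (c * e) * ennreal (norm (ift (h i) (z + u))))"
        using c0 e0 by (simp add: ennreal_plus sum_nonneg ennreal_mult flip: sum_ennreal)
      then show ?thesis using True by simp
    qed simp
  qed
  also have "\<dots> = ennreal c * (\<integral>\<^sup>+u\<in>cube 0 d. ennreal (norm (ift g (z + u))) \<partial>lborel)
     + (\<Sum>i\<in>UNIV. ennreal (c * e) * (\<integral>\<^sup>+u\<in>cube 0 d. ennreal (norm (ift (h i) (z + u))) \<partial>lborel))"
    by (simp add: distrib_right sum_distrib_right nn_integral_add nn_integral_sum nn_integral_cmult mult.assoc)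
  also have "\<dots> \<le> ennreal c * ennreal (1 * S) + (\<Sum>i\<in>(UNIV :: 'n set). ennreal (c * e) * ennreal (l ^ N * S))"
    unfolding S_def using \<open>0 < l\<close> \<open>0 < d\<close>
    by (intro add_mono mult_left_mono sum_mono ift_local_L1 h cg B B2) (auto intro: dbd_norm_le[OF dg])
  also have "\<dots> = ennreal (c * S + ?n * (c * e * (l ^ N * S)))"
    using c0 e0 S0 \<open>0 < l\<close> by (simp add: ennreal_plus ennreal_mult ennreal_of_nat_eq_real_of_nat)
  also have "c * S + ?n * (c * e * (l ^ N * S)) = local_const TYPE('n) N * sqrt (d ^ CARD('n) * ?J)"
    using \<open>0 < l\<close> by (simp add: local_const_def c_def e_def S_def real_sqrt_mult algebra_simps)
  finally show ?thesis .
qed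

lemma dbd_seq:
  assumes "\<And>k. k \<le> N \<Longrightarrow> continuous_on UNIV (G k)"
    and "\<And>k \<xi>. k < N \<Longrightarrow> ((\<lambda>t. G k (\<xi> + t *\<^sub>R axis i 1)) has_vector_derivative G (Suc k) \<xi>) (at 0)"
    and "\<And>k \<xi>. k \<le> N \<Longrightarrow> norm (G k \<xi>) \<le> l ^ k * B \<xi>"
  shows "dbd i l N B (G 0)"
  using assms
proof (induction N arbitrary: G B)
  case 0
  then show ?case by force
next
  case (Suc N)
  have "norm (G (Suc k) \<xi>) \<le> l ^ k * (l * B \<xi>)" if "k \<le> N" for k \<xi>
    using Suc.prems(3)[of "Suc k" \<xi>] that by (simp add: mult_ac)
  then have "dbd i l N (\<lambda>\<xi>. l * B \<xi>) (G (Suc 0))"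
    using Suc.prems(1,2) by (intro Suc.IH[of "\<lambda>k. G (Suc k)"]) auto
  moreover have "norm (G 0 \<xi>) \<le> B \<xi>" for \<xi> using Suc.prems(3)[of 0] by simp
  ultimately show ?case using Suc.prems(1)[of 0] Suc.prems(2)[of 0] by auto
qed

section \<open>Cutoff functions with finitely many derivatives\<close>

lemma exists_antiderivative:
  fixes f :: "real \<Rightarrow> real"
  assumes "continuous_on UNIV f"
  shows "\<exists>G. \<forall>t. (G has_real_derivative f t) (at t)"
proof (intro exI allI)
  fix t :: real
  define M where "M = \<bar>t\<bar> + 1"
  have "((\<lambda>u. LBINT y=ereal 0..ereal u. f y) has_vector_derivative f t) (at t within {-M..M})"
    by (rule interval_integral_FTC2) (auto simp: M_def intro: continuous_on_subset[OF assms])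
  then show "((\<lambda>u. LBINT y=ereal 0..ereal u. f y) has_real_derivative f t) (at t)"
    using at_within_Icc_at[of "-M" t M] by (simp add: has_real_derivative_iff_has_vector_derivative M_def abs_less_iff)
qed

text \<open>The derivatives are carried along as a sequence and only up to order \<open>N\<close>: a
  fixed number of integrations by parts is made, and finite smoothness can be reached by repeated
  averaging from a piecewise linear function.\<close>

definition cutoff_seq :: "nat \<Rightarrow> real \<Rightarrow> real \<Rightarrow> (nat \<Rightarrow> real \<Rightarrow> real) \<Rightarrow> bool" where
  "cutoff_seq N a b F \<longleftrightarrow> (\<forall>k<N. \<forall>t. (F k has_real_derivative F (Suc k) t) (at t)) \<and>
    (\<forall>k\<le>N. continuous_on UNIV (F k)) \<and> (\<forall>t. \<bar>t\<bar> \<le> a \<longrightarrow> F 0 t = 1) \<and> (\<forall>t. b \<le> \<bar>t\<bar> \<longrightarrow> F 0 t = 0) \<and>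
    (\<forall>t. 0 \<le> F 0 t \<and> F 0 t \<le> 1)"

text \<open>Averaging over a window of length \<open>2 h\<close> gains one derivative and, by the mean value
  theorem, keeps the values of the function up to a shift by at most \<open>h\<close>.\<close>

lemma exists_cutoff_seq:
  fixes a b :: real
  assumes "0 < a" "a < b"
  shows "\<exists>F. cutoff_seq N a b F"
  using assms
proof (induction N arbitrary: a b)
  case 0
  show ?case
    unfolding cutoff_seq_def
  proof (intro exI[of _ "\<lambda>_ t. max 0 (min 1 ((b - \<bar>t\<bar>) / (b - a)))"] conjI)
    show "\<forall>k\<le>0. continuous_on UNIV (\<lambda>t. max 0 (min 1 ((b - \<bar>t\<bar>) / (b - a))))"
      using 0 by (auto intro!: continuous_intros)
  qed (use 0 in \<open>auto simp: field_simps max_def min_def\<close>)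
next
  case (Suc N)
  \<comment> \<open>A third of the transition zone: the inner plateau is entered and left with a
    margin \<open>h\<close> on each side, which is what the averaging consumes, and a transition
    zone of length \<open>h\<close> remains.\<close>
  define h where "h = (b - a) / 3"
  have h: "0 < h" "0 < a + h" "a + h < b - h" using Suc.prems by (auto simp: h_def field_simps)
  obtain F where "cutoff_seq N (a + h) (b - h) F"
    using Suc.IH[OF h(2,3)] by blast
  then have F: "\<And>k t. k < N \<Longrightarrow> (F k has_real_derivative F (Suc k) t) (at t)"
    "\<And>k. k \<le> N \<Longrightarrow> continuous_on UNIV (F k)" "\<And>t. \<bar>t\<bar> \<le> a + h \<Longrightarrow> F 0 t = 1"
    "\<And>t. b - h \<le> \<bar>t\<bar> \<Longrightarrow> F 0 t = 0" "\<And>t. 0 \<le> F 0 t" "\<And>t. F 0 t \<le> 1"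
    unfolding cutoff_seq_def by blast+
  obtain G where G: "\<And>t. (G has_real_derivative F 0 t) (at t)"
    using exists_antiderivative[OF F(2)[of 0]] by auto
  \<comment> \<open>Prepending an antiderivative shifts the indices by one, so that the difference
    quotient \<open>H 0\<close> is the window average of \<open>F 0\<close> and has one more
    derivative.\<close>
  define E where "E k = (if k = 0 then G else F (k - 1))" for k
  have E: "(E k has_real_derivative E (Suc k) t) (at t)" if "k < Suc N" for k t
    using that F(1)[of "k - 1" t] G by (auto simp: E_def)
  define H where "H k t = (E k (t + h) - E k (t - h)) / (2 * h)" for k t
  have mv: "\<exists>z. \<bar>z - t\<bar> \<le> h \<and> H 0 t = F 0 z" for t
  proof -
    obtain z where "t - h < z" "z < t + h" "G (t + h) - G (t - h) = ((t + h) - (t - h)) * F 0 z"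
      using MVT2[of "t - h" "t + h" G "F 0"] h(1) G by auto
    then show ?thesis using h(1) by (intro exI[of _ z]) (auto simp: H_def E_def field_simps)
  qed
  have shift: "(f has_real_derivative f') (at (t + c)) \<Longrightarrow> ((\<lambda>t. f (t + c)) has_real_derivative f') (at t)" for f f' t c
    using DERIV_shift[of f f' t c] by simp
  have dH: "(H k has_real_derivative H (Suc k) t) (at t)" if "k < Suc N" for k t
  proof -
    have "((\<lambda>t. E k (t + h)) has_real_derivative E (Suc k) (t + h)) (at t)"
      "((\<lambda>t. E k (t + - h)) has_real_derivative E (Suc k) (t + - h)) (at t)"
      by (rule shift, rule E, rule that)+
    from DERIV_cdivide[OF DERIV_diff[OF this], of "2 * h"] show ?thesis by (simp add: H_def[abs_def])
  qed
  have cE: "continuous_on UNIV (E k)" if "k \<le> Suc N" for k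
  proof (cases k)
    case 0
    then show ?thesis using G by (auto simp: E_def continuous_on_eq_continuous_at intro!: DERIV_isCont)
  next
    case (Suc m)
    then show ?thesis using F(2)[of m] that by (simp add: E_def)
  qed
  have cH: "continuous_on UNIV (H k)" if "k \<le> Suc N" for k
    unfolding H_def[abs_def] using h(1)
    by (intro continuous_intros continuous_on_compose2[OF cE[OF that]]) auto
  have v1: "H 0 t = 1" if "\<bar>t\<bar> \<le> a" for t
    using mv[of t] F(3) that by (smt (verit))
  have v0: "H 0 t = 0" if "b \<le> \<bar>t\<bar>" for t
    using mv[of t] F(4) that by (smt (verit))
  have vb: "0 \<le> H 0 t \<and> H 0 t \<le> 1" for t
    using mv[of t] F(5,6) by auto
  show ?case unfolding cutoff_seq_def by (intro exI[of _ H]) (use dH cH v1 v0 vb in auto)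
qed

lemma deriv_zero_on_open:
  fixes f :: "real \<Rightarrow> real"
  assumes "open S" "t \<in> S" "\<And>s. s \<in> S \<Longrightarrow> f s = c" "(f has_real_derivative d) (at t)"
  shows "d = 0"
proof -
  have "((\<lambda>_. c) has_real_derivative d) (at t)"
    by (rule has_field_derivative_transform_within_open[OF assms(4,1,2,3)])
  then show ?thesis using DERIV_unique DERIV_const by blast
qed

text \<open>Beyond \<open>cutoff_seq\<close> this records that the derivatives vanish on the closed
  plateau and on the closed outer set, together with one bound for all orders.\<close>

definition cutoff :: "nat \<Rightarrow> real \<Rightarrow> (nat \<Rightarrow> real \<Rightarrow> real) \<Rightarrow> bool" where
  "cutoff N M F \<longleftrightarrow> 1 \<le> M \<and> (\<forall>k<N. \<forall>t. (F k has_real_derivative F (Suc k) t) (at t)) \<and>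
    (\<forall>k\<le>N. continuous_on UNIV (F k)) \<and> (\<forall>t. \<bar>t\<bar> \<le> 1 \<longrightarrow> F 0 t = 1) \<and>
    (\<forall>k\<le>N. \<forall>t. 2 \<le> \<bar>t\<bar> \<longrightarrow> F k t = 0) \<and> (\<forall>k\<le>N. \<forall>t. 0 < k \<longrightarrow> \<bar>t\<bar> \<le> 1 \<longrightarrow> F k t = 0) \<and>
    (\<forall>t. 0 \<le> F 0 t \<and> F 0 t \<le> 1) \<and> (\<forall>k\<le>N. \<forall>t. \<bar>F k t\<bar> \<le> M)"

lemma exists_cutoff: "\<exists>F M. cutoff N M F"
proof -
  \<comment> \<open>The margins 5/4 and 7/4 make the function constant on open sets containing
    \<open>\<bar>t\<bar> \<le> 1\<close> and \<open>2 \<le> \<bar>t\<bar>\<close>, so that all its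
    derivatives vanish there, endpoints included.\<close>
  have "0 < (5/4::real)" "(5/4::real) < 7/4" by auto
  then obtain F where "cutoff_seq N (5/4) (7/4) F"
    using exists_cutoff_seq by blast
  then have F: "\<And>k t. k < N \<Longrightarrow> (F k has_real_derivative F (Suc k) t) (at t)"
    "\<And>k. k \<le> N \<Longrightarrow> continuous_on UNIV (F k)" "\<And>t. \<bar>t\<bar> \<le> 5/4 \<Longrightarrow> F 0 t = 1"
    "\<And>t. 7/4 \<le> \<bar>t\<bar> \<Longrightarrow> F 0 t = 0" "\<And>t. 0 \<le> F 0 t" "\<And>t. F 0 t \<le> 1"
    unfolding cutoff_seq_def by blast+
  define S1 S2 where "S1 = {t::real. \<bar>t\<bar> < 5/4}" and "S2 = {t::real. 7/4 < \<bar>t\<bar>}"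
  have op: "open S1" "open S2" unfolding S1_def S2_def by (intro open_Collect_less continuous_intros)+
  have z1: "F k t = 0" if "0 < k" "k \<le> N" "t \<in> S1" for k t
    using that
  proof (induction k arbitrary: t)
    case (Suc k)
    show ?case
    proof (rule deriv_zero_on_open[OF op(1) Suc.prems(3)])
      show "(F k has_real_derivative F (Suc k) t) (at t)" using Suc.prems by (intro F) auto
      show "F k s = (if k = 0 then 1 else 0)" if "s \<in> S1" for s
        using Suc.IH[of s] Suc.prems that F(3)[of s] by (auto simp: S1_def)
    qed
  qed simp
  have z2: "F k t = 0" if "k \<le> N" "t \<in> S2" for k t
    using that
  proof (induction k arbitrary: t)
    case (Suc k)
    show ?case
    proof (rule deriv_zero_on_open[OF op(2) Suc.prems(2)])
      show "(F k has_real_derivative F (Suc k) t) (at t)" using Suc.prems by (intro F) auto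
      show "F k s = 0" if "s \<in> S2" for s
        using Suc.IH[of s] Suc.prems that by auto
    qed
  qed (use F(4) in \<open>auto simp: S2_def\<close>)
  have "\<forall>k. \<exists>M. k \<le> N \<longrightarrow> (\<forall>t. \<bar>F k t\<bar> \<le> M)"
  proof
    fix k
    show "\<exists>M. k \<le> N \<longrightarrow> (\<forall>t. \<bar>F k t\<bar> \<le> M)"
    proof (cases "k \<le> N")
      case True
      have "compact (F k ` {-2..2})"
        using F(2)[OF True] by (intro compact_continuous_image) (auto intro: continuous_on_subset)
      then have "bounded (F k ` {-2..2})" by (rule compact_imp_bounded)
      then obtain M where "\<forall>y\<in>F k ` {-2..2}. norm y \<le> M" unfolding bounded_iff by blast
      then have M: "\<And>t. t \<in> {-2..2} \<Longrightarrow> \<bar>F k t\<bar> \<le> M" by auto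
      have "\<bar>F k t\<bar> \<le> max M 0" for t
        using M[of t] z2[OF True, of t] by (cases "t \<in> {-2..2}") (auto simp: S2_def abs_if split: if_splits)
      then show ?thesis by blast
    qed auto
  qed
  then obtain M where M: "\<And>k t. k \<le> N \<Longrightarrow> \<bar>F k t\<bar> \<le> M k" by metis
  define M' where "M' = 1 + (\<Sum>k\<le>N. \<bar>M k\<bar>)"
  have M': "\<bar>F k t\<bar> \<le> M'" if "k \<le> N" for k t
  proof -
    have "\<bar>F k t\<bar> \<le> \<bar>M k\<bar>" using M[OF that, of t] by linarith
    also have "\<dots> \<le> (\<Sum>k\<le>N. \<bar>M k\<bar>)" using that by (intro member_le_sum) auto
    finally show ?thesis by (simp add: M'_def)
  qed
  have "1 \<le> M'" by (simp add: M'_def sum_nonneg)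
  then have "cutoff N M' F"
    unfolding cutoff_def using F M' z1 z2 by (simp add: S1_def S2_def)
  then show ?thesis by blast
qed

section \<open>Dyadic pieces of a symbol\<close>

text \<open>The \<open>k\<close>-th derivative of \<open>chi F j\<close> in the \<open>i\<close>-th
  variable. With a tensor product of one-dimensional cutoffs, a pure derivative touches a single
  factor.\<close>

definition chi_deriv :: "(nat \<Rightarrow> real \<Rightarrow> real) \<Rightarrow> 'n \<Rightarrow> nat \<Rightarrow> nat \<Rightarrow> real ^ 'n \<Rightarrow> real" where
  "chi_deriv F i j k \<xi> = (\<Prod>l\<in>UNIV - {i}. F 0 (\<xi> $ l / 2 ^ j)) * ((1 / 2 ^ j) ^ k * F k (\<xi> $ i / 2 ^ j))"

definition chi :: "(nat \<Rightarrow> real \<Rightarrow> real) \<Rightarrow> nat \<Rightarrow> real ^ 'n \<Rightarrow> real" where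
  "chi F j \<xi> = (\<Prod>l\<in>UNIV. F 0 (\<xi> $ l / 2 ^ j))"

definition psi :: "(nat \<Rightarrow> real \<Rightarrow> real) \<Rightarrow> nat \<Rightarrow> real ^ 'n \<Rightarrow> real" where
  "psi F j \<xi> = (if j = 0 then chi F 0 \<xi> else chi F j \<xi> - chi F (j - 1) \<xi>)"

text \<open>A set outside of which \<open>psi F j\<close> and its pure derivatives vanish. The
  strict inequalities make it open, hence measurable; equality may be excluded because the cutoff is
  already constant at the endpoints.\<close>

definition shell :: "nat \<Rightarrow> (real ^ 'n) set" where
  "shell j = {\<xi>. (\<forall>l. \<bar>\<xi> $ l\<bar> < 2 * 2 ^ j) \<and> (j = 0 \<or> (\<exists>l. 2 ^ j / 2 < \<bar>\<xi> $ l\<bar>))}"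

lemma sum_psi: "(\<Sum>j<Suc J. psi F j \<xi>) = chi F J \<xi>"
  by (induction J) (auto simp: psi_def)

lemma chi_eq_chi_deriv: "chi F j \<xi> = chi_deriv F i j 0 \<xi>"
  unfolding chi_def chi_deriv_def by (subst prod.remove[of UNIV i]) auto

lemma chi_deriv_has_derivative:
  assumes "cutoff N M F" "k < N"
  shows "((\<lambda>t. chi_deriv F i j k (\<xi> + t *\<^sub>R axis i 1)) has_real_derivative chi_deriv F i j (Suc k) \<xi>) (at 0)"
proof -
  have *: "chi_deriv F i j k (\<xi> + t *\<^sub>R axis i 1) =
      (\<Prod>l\<in>UNIV - {i}. F 0 (\<xi> $ l / 2 ^ j)) * ((1 / 2 ^ j) ^ k * F k ((\<xi> $ i + t) / 2 ^ j))" for t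
    unfolding chi_deriv_def by (intro arg_cong2[where f="(*)"] prod.cong refl) (auto simp: axis_def)
  have dF: "(F k has_real_derivative F (Suc k) ((\<xi> $ i + 0) / 2 ^ j)) (at ((\<xi> $ i + 0) / 2 ^ j))"
    using assms by (auto simp: cutoff_def)
  have "((\<lambda>t. (\<xi> $ i + t) / 2 ^ j) has_real_derivative 1 / 2 ^ j) (at 0)"
    by (auto intro!: derivative_eq_intros)
  from DERIV_chain2[OF dF this]
  have "((\<lambda>t. F k ((\<xi> $ i + t) / 2 ^ j)) has_real_derivative F (Suc k) ((\<xi> $ i + 0) / 2 ^ j) * (1 / 2 ^ j)) (at 0)" .
  from DERIV_cmult[OF DERIV_cmult[OF this, of "(1 / 2 ^ j) ^ k"], of "\<Prod>l\<in>UNIV - {i}. F 0 (\<xi> $ l / 2 ^ j)"]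
  show ?thesis
    unfolding * by (simp add: chi_deriv_def mult_ac)
qed

lemma continuous_on_chi_deriv:
  assumes "cutoff N M F" "k \<le> N" shows "continuous_on UNIV (chi_deriv F i j k)"
proof -
  have "continuous_on UNIV (F k)" "continuous_on UNIV (F 0)" using assms by (auto simp: cutoff_def)
  note * = this[THEN continuous_on_compose2]
  show ?thesis unfolding chi_deriv_def[abs_def]
    by (intro continuous_intros *) auto
qed

lemma abs_chi_deriv_le:
  assumes "cutoff N M F" "k \<le> N" shows "\<bar>chi_deriv F i j k \<xi>\<bar> \<le> (1 / 2 ^ j) ^ k * M"
proof -
  let ?P = "\<Prod>l\<in>UNIV - {i}. F 0 (\<xi> $ l / 2 ^ j)"
  have "0 \<le> ?P" "?P \<le> 1" using assms by (auto intro!: prod_nonneg prod_le_1 simp: cutoff_def)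
  moreover have "\<bar>F k (\<xi> $ i / 2 ^ j)\<bar> \<le> M" using assms by (auto simp: cutoff_def)
  ultimately have "?P * ((1 / 2 ^ j) ^ k * \<bar>F k (\<xi> $ i / 2 ^ j)\<bar>) \<le> 1 * ((1 / 2 ^ j) ^ k * M)"
    by (intro mult_mono) auto
  then show ?thesis using \<open>0 \<le> ?P\<close> by (simp add: chi_deriv_def abs_mult)
qed

lemma chi_deriv_eq_0:
  assumes "cutoff N M F" "k \<le> N" "2 * 2 ^ j \<le> \<bar>\<xi> $ l\<bar>" shows "chi_deriv F i j k \<xi> = 0"
proof -
  have "2 \<le> \<bar>\<xi> $ l / 2 ^ j\<bar>" using assms(3) by (simp add: field_simps)
  then have z: "F k' (\<xi> $ l / 2 ^ j) = 0" if "k' \<le> N" for k' using assms(1) that by (auto simp: cutoff_def)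
  show ?thesis
  proof (cases "l = i")
    case True
    then show ?thesis using z[OF assms(2)] by (simp add: chi_deriv_def)
  next
    case False
    then have "(\<Prod>l\<in>UNIV - {i}. F 0 (\<xi> $ l / 2 ^ j)) = 0" using z[of 0] by (intro prod_zero) auto
    then show ?thesis by (simp add: chi_deriv_def)
  qed
qed

lemma chi_deriv_inside:
  assumes "cutoff N M F" "k \<le> N" "\<And>l. \<bar>\<xi> $ l\<bar> \<le> 2 ^ j" shows "chi_deriv F i j k \<xi> = (if k = 0 then 1 else 0)"
proof -
  have "\<bar>\<xi> $ l / 2 ^ j\<bar> \<le> 1" for l using assms(3)[of l] by (simp add: field_simps)
  then have "F 0 (\<xi> $ l / 2 ^ j) = 1" "0 < k \<Longrightarrow> F k (\<xi> $ l / 2 ^ j) = 0" for l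
    using assms(1,2) by (auto simp: cutoff_def)
  then show ?thesis by (simp add: chi_deriv_def)
qed

text \<open>Going from scale \<open>j\<close> to scale \<open>j - 1\<close> multiplies a
  \<open>k\<close>-th derivative by \<open>2 ^ k\<close>, and
  \<open>1 + 2 ^ k \<le> 2 ^ Suc N\<close>. Off the shell the two cutoffs are both constant with the
  same value, so the difference vanishes with its derivatives.\<close>

lemma dbd_psi:
  fixes i :: "'n::finite"
  assumes F: "cutoff N M F"
  shows "dbd i (1 / 2 ^ j) N (\<lambda>\<xi>. 2 ^ Suc N * M * indicator (shell j) \<xi>) (\<lambda>\<xi>. complex_of_real (psi F j \<xi>))"
proof -
  define D where "D k \<xi> = (if j = 0 then chi_deriv F i 0 k \<xi> else chi_deriv F i j k \<xi> - chi_deriv F i (j - 1) k \<xi>)" for k and \<xi> :: "real ^ 'n"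
  have M: "0 \<le> M" using F by (auto simp: cutoff_def)
  have "dbd i (1 / 2 ^ j) N (\<lambda>\<xi>. 2 ^ Suc N * M * indicator (shell j) \<xi>) (\<lambda>\<xi>. complex_of_real (D 0 \<xi>))"
  proof (rule dbd_seq[where G="\<lambda>k \<xi>. complex_of_real (D k \<xi>)"])
    fix k assume "k \<le> N"
    then show "continuous_on UNIV (\<lambda>\<xi>. complex_of_real (D k \<xi>))"
      unfolding D_def by (cases "j = 0") (auto intro!: continuous_intros continuous_on_compose2[OF continuous_on_chi_deriv[OF F]])
  next
    fix k and \<xi> :: "real ^ 'n" assume k: "k < N"
    have "((\<lambda>t. D k (\<xi> + t *\<^sub>R axis i 1)) has_real_derivative D (Suc k) \<xi>) (at 0)"
      unfolding D_def using chi_deriv_has_derivative[OF F k]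
      by (cases "j = 0") (auto intro!: DERIV_diff)
    then show "((\<lambda>t. complex_of_real (D k (\<xi> + t *\<^sub>R axis i 1))) has_vector_derivative complex_of_real (D (Suc k) \<xi>)) (at 0)"
      by (intro has_vector_derivative_of_real) (simp add: has_real_derivative_iff_has_vector_derivative)
  next
    fix k and \<xi> :: "real ^ 'n" assume k: "k \<le> N"
    show "norm (complex_of_real (D k \<xi>)) \<le> (1 / 2 ^ j) ^ k * (2 ^ Suc N * M * indicator (shell j) \<xi>)"
    proof (cases "\<xi> \<in> shell j")
      case True
      have "\<bar>D k \<xi>\<bar> \<le> (1 / 2 ^ j) ^ k * M + 2 ^ k * ((1 / 2 ^ j) ^ k * M)"
      proof (cases "j = 0")
        case True
        have "\<bar>D k \<xi>\<bar> \<le> M" using abs_chi_deriv_le[OF F k, of i 0 \<xi>] True by (simp add: D_def)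
        moreover have "M \<le> M + 2 ^ k * M" using M by simp
        ultimately have "\<bar>D k \<xi>\<bar> \<le> M + 2 ^ k * M" by linarith
        then show ?thesis by (simp add: True)
      next
        case False
        then have "(1 / 2 ^ (j - 1)) = 2 * (1 / 2 ^ j :: real)" by (cases j) auto
        then have "\<bar>chi_deriv F i (j - 1) k \<xi>\<bar> \<le> 2 ^ k * ((1 / 2 ^ j) ^ k * M)"
          using abs_chi_deriv_le[OF F k, of i "j - 1" \<xi>] by (simp only: power_mult_distrib mult.assoc)
        then show ?thesis using abs_chi_deriv_le[OF F k, of i j \<xi>] False by (simp add: D_def)
      qed
      also have "\<dots> = (1 / 2 ^ j) ^ k * (1 + 2 ^ k) * M" by (simp add: algebra_simps)
      also have "\<dots> \<le> (1 / 2 ^ j) ^ k * 2 ^ Suc N * M"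
      proof (intro mult_right_mono mult_left_mono)
        have "(1::real) \<le> 2 ^ k" by simp
        moreover have "(2::real) ^ k \<le> 2 ^ N" using k by (intro power_increasing) auto
        ultimately show "1 + 2 ^ k \<le> (2 ^ Suc N :: real)" unfolding power_Suc by linarith
      qed (use M in auto)
      finally show ?thesis using True by (simp add: mult_ac)
    next
      case False
      have "D k \<xi> = 0"
      proof (cases "\<exists>l. 2 * 2 ^ j \<le> \<bar>\<xi> $ l\<bar>")
        case True
        then obtain l where l: "2 * 2 ^ j \<le> \<bar>\<xi> $ l\<bar>" by blast
        have "2 * 2 ^ (j - 1) \<le> (2 * 2 ^ j :: real)" by (intro mult_left_mono power_increasing) auto
        then have "2 * 2 ^ (j - 1) \<le> \<bar>\<xi> $ l\<bar>" using l by linarith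
        then show ?thesis using chi_deriv_eq_0[OF F k l] chi_deriv_eq_0[OF F k, of "j - 1" \<xi> l] by (auto simp: D_def)
      next
        case nl: False
        then have j: "j \<noteq> 0" and small: "\<bar>\<xi> $ l\<bar> \<le> 2 ^ j / 2" for l
          using False by (auto simp: shell_def not_le not_less)
        have "2 ^ (j - 1) = (2 ^ j / 2 :: real)" using j by (cases j) auto
        then have "\<bar>\<xi> $ l\<bar> \<le> 2 ^ (j - 1)" for l using small[of l] by linarith
        then have 1: "chi_deriv F i (j - 1) k \<xi> = (if k = 0 then 1 else 0)"
          by (rule chi_deriv_inside[OF F k])
        have "\<bar>\<xi> $ l\<bar> \<le> 2 ^ j" for l
        proof -
          have "(0::real) < 2 ^ j" by simp
          then show ?thesis using small[of l] by linarith
        qed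
        then have "chi_deriv F i j k \<xi> = (if k = 0 then 1 else 0)"
          by (rule chi_deriv_inside[OF F k])
        with 1 show ?thesis using j by (simp add: D_def)
      qed
      then show ?thesis using M by simp
    qed
  qed
  moreover have "D 0 \<xi> = psi F j \<xi>" for \<xi> by (simp add: D_def psi_def flip: chi_eq_chi_deriv)
  ultimately show ?thesis by simp
qed

lemma norm_one_minus_cis_le: "norm (1 - cis t) \<le> \<bar>t\<bar>"
  using iexp_approx1[of t 0] by (simp add: cis_conv_exp norm_minus_commute)

text \<open>Every derivative of positive order \<open>k\<close> is at most
  \<open>norm h ^ k\<close>; one factor is kept as the gain \<open>norm h * 2 ^ j\<close>, the
  others are at most \<open>CARD('n) / 2 ^ j\<close> by assumption. For \<open>k = 0\<close> the
  gain needs the factor \<open>norm \<xi> / 2 ^ j\<close>, bounded on the shell.\<close>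

lemma dbd_one_minus_cis:
  fixes h :: "real ^ 'n"
  assumes h: "norm h \<le> CARD('n) / 2 ^ j"
  shows "dbd i (1 / 2 ^ j) N (\<lambda>\<xi>. norm h * 2 ^ j * (real CARD('n) ^ N + norm \<xi> / 2 ^ j)) (\<lambda>\<xi>. 1 - cis (h \<bullet> \<xi>))"
proof -
  define G where "G k \<xi> = (if k = 0 then 1 - cis (h \<bullet> \<xi>) else - ((\<i> * (h $ i)) ^ k * cis (h \<bullet> \<xi>)))" for k \<xi>
  have cis: "((\<lambda>t. cis (h \<bullet> (\<xi> + t *\<^sub>R axis i 1))) has_vector_derivative (\<i> * (h $ i) * cis (h \<bullet> \<xi>))) (at 0)" for \<xi>
  proof -
    have "((\<lambda>w::complex. exp (\<i> * (of_real (h \<bullet> \<xi>) + w * of_real (h $ i)))) has_field_derivative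
        (\<i> * (h $ i) * cis (h \<bullet> \<xi>))) (at (of_real 0))"
      by (auto intro!: derivative_eq_intros simp: cis_conv_exp)
    from has_vector_derivative_real_field[OF this]
    have "((\<lambda>t. cis (h \<bullet> \<xi> + t * h $ i)) has_vector_derivative (\<i> * (h $ i) * cis (h \<bullet> \<xi>))) (at 0)"
      by (simp add: cis_conv_exp)
    then show ?thesis by (simp add: inner_add_right inner_axis)
  qed
  have "dbd i (1 / 2 ^ j) N (\<lambda>\<xi>. norm h * 2 ^ j * (real CARD('n) ^ N + norm \<xi> / 2 ^ j)) (G 0)"
  proof (rule dbd_seq[where G=G])
    fix k show "continuous_on UNIV (G k)"
      unfolding G_def by (cases "k = 0") (auto intro!: continuous_intros)
  next
    fix k and \<xi> :: "real ^ 'n"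
    show "((\<lambda>t. G k (\<xi> + t *\<^sub>R axis i 1)) has_vector_derivative G (Suc k) \<xi>) (at 0)"
    proof (cases "k = 0")
      case True
      have "((\<lambda>t. 1 - cis (h \<bullet> (\<xi> + t *\<^sub>R axis i 1))) has_vector_derivative 0 - (\<i> * (h $ i) * cis (h \<bullet> \<xi>))) (at 0)"
        by (intro has_vector_derivative_diff has_vector_derivative_const cis)
      then show ?thesis using True by (simp add: G_def)
    next
      case False
      have "((\<lambda>t. - ((\<i> * (h $ i)) ^ k) * cis (h \<bullet> (\<xi> + t *\<^sub>R axis i 1))) has_vector_derivative - ((\<i> * (h $ i)) ^ k) * (\<i> * (h $ i) * cis (h \<bullet> \<xi>))) (at 0)"
        by (intro has_vector_derivative_mult_right cis)
      then show ?thesis using False by (simp add: G_def mult_ac)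
    qed
  next
    fix k and \<xi> :: "real ^ 'n" assume k: "k \<le> N"
    show "norm (G k \<xi>) \<le> (1 / 2 ^ j) ^ k * (norm h * 2 ^ j * (real CARD('n) ^ N + norm \<xi> / 2 ^ j))"
    proof (cases k)
      case 0
      have "norm (G k \<xi>) \<le> \<bar>h \<bullet> \<xi>\<bar>" using norm_one_minus_cis_le by (simp add: G_def 0)
      also have "\<dots> \<le> norm h * norm \<xi>" by (rule Cauchy_Schwarz_ineq2)
      also have "\<dots> \<le> norm h * 2 ^ j * (real CARD('n) ^ N + norm \<xi> / 2 ^ j)"
        by (simp add: field_simps)
      finally show ?thesis using 0 by simp
    next
      case (Suc k')
      have "\<bar>h $ i\<bar> \<le> norm h" by (rule component_le_norm_cart)
      have "norm (G k \<xi>) = \<bar>h $ i\<bar> ^ k" using Suc by (simp add: G_def norm_mult norm_power)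
      also have "\<dots> \<le> norm h ^ k" using \<open>\<bar>h $ i\<bar> \<le> norm h\<close> by (intro power_mono) auto
      also have "\<dots> = norm h * norm h ^ k'" by (simp add: Suc)
      also have "\<dots> \<le> norm h * (CARD('n) / 2 ^ j) ^ k'" using h by (intro mult_left_mono power_mono) auto
      also have "\<dots> = (1 / 2 ^ j) ^ k * (norm h * 2 ^ j * real CARD('n) ^ k')" by (simp add: Suc power_divide)
      also have "\<dots> \<le> (1 / 2 ^ j) ^ k * (norm h * 2 ^ j * (real CARD('n) ^ N + norm \<xi> / 2 ^ j))"
      proof -
        have "real CARD('n) ^ k' \<le> real CARD('n) ^ N" using k Suc by (intro power_increasing) auto
        then have "real CARD('n) ^ k' \<le> real CARD('n) ^ N + norm \<xi> / 2 ^ j" by (simp add: add_increasing2)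
        then show ?thesis by (intro mult_left_mono) auto
      qed
      finally show ?thesis .
    qed
  qed
  moreover have "G 0 = (\<lambda>\<xi>. 1 - cis (h \<bullet> \<xi>))" by (auto simp: G_def)
  ultimately show ?thesis by simp
qed

section \<open>From the symbol class to estimates of the dyadic pieces\<close>

lemma index_enum: "distinct (index_enum :: 'n::finite list)" "set (index_enum :: 'n list) = UNIV"
proof -
  have "\<exists>is :: 'n list. distinct is \<and> set is = UNIV"
    using finite_distinct_list[of "UNIV :: 'n set"] by auto
  from someI_ex[OF this] show "distinct (index_enum :: 'n::finite list)" "set (index_enum :: 'n list) = UNIV"
    by (auto simp: index_enum_def)
qed

lemma foldr_funpow_single:
  assumes "distinct is"
  shows "foldr (\<lambda>j. D j ^^ (if j = i then k else 0)) is f = (if i \<in> set is then (D i ^^ k) f else f)"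
  using assms by (induction "is") auto

lemma multi_deriv_single: "multi_deriv e (\<lambda>j. if j = i then k else 0) f = (dir_deriv (e i) ^^ k) f"
  unfolding multi_deriv_def foldr_funpow_single[OF index_enum(1), where D="\<lambda>i. dir_deriv (e i)"] by (simp add: index_enum(2))

lemma multi_order_single: "multi_order (\<lambda>j. if j = i then k else 0) = k"
  by (simp add: multi_order_def)

lemma multi_deriv_0: "multi_deriv e (\<lambda>j. 0) f = f"
  using multi_deriv_single[of e undefined 0 f] by simp

lemma dir_deriv_eq_derivative:
  assumes "(f has_derivative f') (at p)"
  shows "((\<lambda>t. f (p + t *\<^sub>R v)) has_vector_derivative f' v) (at 0)" "dir_deriv v f p = f' v"
proof -
  have 1: "((\<lambda>t. p + t *\<^sub>R v) has_derivative (\<lambda>t. t *\<^sub>R v)) (at 0)"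
    by (auto intro!: derivative_eq_intros)
  have "(f has_derivative f') (at (p + 0 *\<^sub>R v))" using assms by simp
  from diff_chain_at[OF 1 this] have "((\<lambda>t. f (p + t *\<^sub>R v)) has_derivative (\<lambda>t. f' (t *\<^sub>R v))) (at 0)"
    by (simp add: o_def)
  moreover have "f' (t *\<^sub>R v) = t *\<^sub>R f' v" for t
    using assms by (simp add: has_derivative_def linear_simps)
  ultimately show "((\<lambda>t. f (p + t *\<^sub>R v)) has_vector_derivative f' v) (at 0)"
    by (simp add: has_vector_derivative_def)
  then show "dir_deriv v f p = f' v"
    unfolding dir_deriv_def by (rule vector_derivative_at)
qed

lemma foldr_replicate_funpow: "foldr D (replicate k v) f = (D v ^^ k) f"
  by (induction k) auto

lemma smooth_dir_deriv_funpow: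
  assumes "smooth f" "v \<in> Basis"
  shows "\<exists>f'. ((dir_deriv v ^^ k) f has_derivative f') (at p)"
proof -
  have "set (replicate k v) \<subseteq> Basis" using assms(2) by (auto simp: set_replicate_conv_if)
  then have "foldr dir_deriv (replicate k v) f differentiable_on UNIV"
    using assms(1) unfolding smooth_def by blast
  then show ?thesis
    by (auto simp: foldr_replicate_funpow differentiable_on_def differentiable_def)
qed

lemma smooth_funpow_has_vector_derivative:
  assumes "smooth f" "v \<in> Basis"
  shows "((\<lambda>t. (dir_deriv v ^^ k) f (p + t *\<^sub>R v)) has_vector_derivative (dir_deriv v ^^ Suc k) f p) (at 0)"
proof -
  obtain f' where "((dir_deriv v ^^ k) f has_derivative f') (at p)"
    using smooth_dir_deriv_funpow[OF assms] by blast
  from dir_deriv_eq_derivative[OF this, of v] show ?thesis by simp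
qed

lemma smooth_funpow_continuous:
  assumes "smooth f" "v \<in> Basis" shows "continuous_on UNIV ((dir_deriv v ^^ k) f)"
  using smooth_dir_deriv_funpow[OF assms] has_derivative_continuous
  by (intro continuous_at_imp_continuous_on ballI) blast

text \<open>At frequency 2^j it is both what a \<xi>-derivative of the symbol gains and the width of
  the kernel. It is also used with the exponent \<open>(1 + \<delta>) / 2\<close>, as the side of a
  cube.\<close>

definition dscale :: "real \<Rightarrow> nat \<Rightarrow> real" where
  "dscale \<rho> j = (2 ^ j) powr (- \<rho>)"

lemma dscale_pos [simp]: "0 < dscale \<rho> j"
  by (simp add: dscale_def)

lemma dscale_nonneg [simp]: "0 \<le> dscale \<rho> j"
  by (simp add: dscale_def)

lemma dscale_le_1: "0 \<le> \<rho> \<Longrightarrow> dscale \<rho> j \<le> 1"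
  by (simp add: dscale_def powr_minus inverse_le_1_iff ge_one_powr_ge_zero)

lemma dscale_ge: "\<rho> \<le> 1 \<Longrightarrow> 1 / 2 ^ j \<le> dscale \<rho> j"
proof -
  assume "\<rho> \<le> 1"
  then have "(2 ^ j :: real) powr (- 1) \<le> dscale \<rho> j"
    unfolding dscale_def by (intro powr_mono) auto
  then show ?thesis by (simp add: powr_minus_divide)
qed

lemma dscale_1: "dscale 1 j = 1 / 2 ^ j"
  by (simp add: dscale_def powr_minus_divide)

lemma dscale_power: "(2 ^ j) powr (m - \<rho> * real k) = (2 ^ j) powr m * dscale \<rho> j ^ k"
  unfolding dscale_def by (subst powr_power) (auto simp: mult.commute simp flip: powr_add)

lemma powr_comparable:
  fixes K L y :: real
  assumes "1 \<le> K" "0 < L" "L / K \<le> y" "y \<le> K * L" "\<bar>e\<bar> \<le> E"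
  shows "y powr e \<le> K powr E * L powr e"
proof -
  have "0 < y" using assms by (smt (verit) divide_pos_pos)
  have "y powr e \<le> K powr \<bar>e\<bar> * L powr e"
  proof (cases "0 \<le> e")
    case True
    then have "y powr e \<le> (K * L) powr e" using assms \<open>0 < y\<close> by (intro powr_mono2) auto
    then show ?thesis using True assms by (simp add: powr_mult)
  next
    case False
    then have "y powr e \<le> (L / K) powr e" using assms by (intro powr_mono2') auto
    then show ?thesis using False assms by (simp add: powr_divide powr_minus_divide field_simps)
  qed
  also have "\<dots> \<le> K powr E * L powr e" using assms by (intro mult_right_mono powr_mono) auto
  finally show ?thesis .
qed

lemma finite_uniform_bound:
  fixes f g :: "'s \<Rightarrow> 'x \<Rightarrow> real"
  assumes "finite S" "\<And>s. s \<in> S \<Longrightarrow> \<exists>C. \<forall>x. f s x \<le> C * g s x" "\<And>s x. 0 \<le> g s x"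
  shows "\<exists>C\<ge>0. \<forall>s\<in>S. \<forall>x. f s x \<le> C * g s x"
proof -
  obtain C where C: "\<And>s x. s \<in> S \<Longrightarrow> f s x \<le> C s * g s x" using assms(2) by metis
  have "f s x \<le> (\<Sum>s\<in>S. \<bar>C s\<bar>) * g s x" if "s \<in> S" for s x
  proof -
    have "C s \<le> (\<Sum>s\<in>S. \<bar>C s\<bar>)"
      using member_le_sum[of s S "\<lambda>s. \<bar>C s\<bar>"] that assms(1) by (auto intro: order_trans[OF abs_ge_self])
    then show ?thesis using C[OF that, of x] assms(3) by (meson mult_right_mono order_trans)
  qed
  then show ?thesis by (intro exI[of _ "\<Sum>s\<in>S. \<bar>C s\<bar>"]) (auto intro: sum_nonneg)
qed

abbreviation xi_deriv :: "'n::finite \<Rightarrow> nat \<Rightarrow> ((real ^ 'n) \<times> (real ^ 'n) \<Rightarrow> complex) \<Rightarrow> (real ^ 'n) \<times> (real ^ 'n) \<Rightarrow> complex" where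
  "xi_deriv i k a \<equiv> (dir_deriv (0, axis i 1) ^^ k) a"

lemma axis_Basis: "(axis i 1, 0) \<in> (Basis :: ((real ^ 'n) \<times> (real ^ 'n)) set)" "(0, axis i 1) \<in> (Basis :: ((real ^ 'n) \<times> (real ^ 'n)) set)"
  by (auto simp: Basis_prod_def Basis_vec_def)

text \<open>Two kinds of derivatives are extracted from the symbol class: pure \<xi>-derivatives,
  and these followed by a single \<xi>-independent direction in the first variable. There are
  finitely many up to order \<open>N\<close>, so one constant serves for all.\<close>

lemma symbol_bounds:
  fixes a :: "(real ^ 'n) \<times> (real ^ 'n) \<Rightarrow> complex"
  assumes a: "a \<in> symbol_class m \<rho> \<delta>"
  shows "\<exists>C\<ge>0. \<forall>i k x \<xi>. k \<le> N \<longrightarrow> norm (xi_deriv i k a (x, \<xi>)) \<le> C * japanese_bracket \<xi> powr (m - \<rho> * real k)"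
    and "\<exists>C\<ge>0. \<forall>i k l x \<xi>. k \<le> N \<longrightarrow> norm (dir_deriv (axis l 1, 0) (xi_deriv i k a) (x, \<xi>)) \<le> C * japanese_bracket \<xi> powr (m - \<rho> * real k + \<delta>)"
proof -
  have b: "\<exists>C. \<forall>x \<xi>. norm (multi_deriv (\<lambda>i. (axis i 1, 0)) \<beta> (multi_deriv (\<lambda>i. (0, axis i 1)) \<alpha> a) (x, \<xi>))
      \<le> C * japanese_bracket \<xi> powr (m - \<rho> * multi_order \<alpha> + \<delta> * multi_order \<beta>)" for \<alpha> \<beta>
    using a by (auto simp: symbol_class_def)
  have "\<exists>C\<ge>0. \<forall>s\<in>(UNIV :: 'n set) \<times> {..N}. \<forall>p. norm (xi_deriv (fst s) (snd s) a p) \<le> C * japanese_bracket (snd p) powr (m - \<rho> * real (snd s))"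
  proof (rule finite_uniform_bound)
    fix s :: "'n \<times> nat"
    show "\<exists>C. \<forall>p. norm (xi_deriv (fst s) (snd s) a p) \<le> C * japanese_bracket (snd p) powr (m - \<rho> * real (snd s))"
      using b[of "\<lambda>_. 0" "\<lambda>j. if j = fst s then snd s else 0"]
      by (simp add: multi_deriv_single multi_deriv_0 multi_order_single) (simp add: multi_order_def)
  qed auto
  then show "\<exists>C\<ge>0. \<forall>i k x \<xi>. k \<le> N \<longrightarrow> norm (xi_deriv i k a (x, \<xi>)) \<le> C * japanese_bracket \<xi> powr (m - \<rho> * real k)"
    by fastforce
  have "\<exists>C\<ge>0. \<forall>s\<in>(UNIV :: 'n set) \<times> (UNIV :: 'n set) \<times> {..N}. \<forall>p. norm (dir_deriv (axis (fst s) 1, 0) (xi_deriv (fst (snd s)) (snd (snd s)) a) p)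
      \<le> C * japanese_bracket (snd p) powr (m - \<rho> * real (snd (snd s)) + \<delta>)"
  proof (rule finite_uniform_bound)
    fix s :: "'n \<times> 'n \<times> nat"
    show "\<exists>C. \<forall>p. norm (dir_deriv (axis (fst s) 1, 0) (xi_deriv (fst (snd s)) (snd (snd s)) a) p)
      \<le> C * japanese_bracket (snd p) powr (m - \<rho> * real (snd (snd s)) + \<delta>)"
      using b[of "\<lambda>j. if j = fst s then 1 else 0" "\<lambda>j. if j = fst (snd s) then snd (snd s) else 0"]
      unfolding multi_deriv_single multi_order_single by simp
  qed auto
  then show "\<exists>C\<ge>0. \<forall>i k l x \<xi>. k \<le> N \<longrightarrow> norm (dir_deriv (axis l 1, 0) (xi_deriv i k a) (x, \<xi>)) \<le> C * japanese_bracket \<xi> powr (m - \<rho> * real k + \<delta>)"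
    by fastforce
qed

text \<open>Mean value inequality in the first variable; the operator norm of the derivative is at
  most the sum of the \<open>n\<close> partial derivatives.\<close>

lemma xi_deriv_diff_le:
  fixes a :: "(real ^ 'n) \<times> (real ^ 'n) \<Rightarrow> complex" and B :: real
  assumes "smooth a" and b: "\<And>l x. norm (dir_deriv (axis l 1, 0) (xi_deriv i k a) (x, \<xi>)) \<le> B"
  shows "norm (xi_deriv i k a (x, \<xi>) - xi_deriv i k a (x', \<xi>)) \<le> CARD('n) * B * norm (x - x')"
proof -
  let ?f = "xi_deriv i k a"
  have "\<forall>p. \<exists>f'. (?f has_derivative f') (at p)"
    using smooth_dir_deriv_funpow[OF assms(1) axis_Basis(2)] by blast
  then obtain f' where f': "\<And>p. (?f has_derivative f' p) (at p)" by metis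
  have B: "0 \<le> B" using b norm_ge_zero order_trans by blast
  have d: "((\<lambda>x. ?f (x, \<xi>)) has_derivative (\<lambda>h. f' (x, \<xi>) (h, 0))) (at x)" for x
  proof -
    have "((\<lambda>x. (x, \<xi>)) has_derivative (\<lambda>h. (h, 0))) (at x)"
      by (auto intro!: derivative_eq_intros)
    from diff_chain_at[OF this f'] show ?thesis by (simp add: o_def)
  qed
  have o: "onorm (\<lambda>h. f' (x, \<xi>) (h, 0)) \<le> CARD('n) * B" for x
  proof (rule onorm_bound)
    fix h :: "real ^ 'n"
    have lin: "linear (\<lambda>h. f' (x, \<xi>) (h, 0))" using has_derivative_linear[OF d] .
    have "h = (\<Sum>l\<in>UNIV. (h $ l) *\<^sub>R axis l 1)" using basis_expansion[of h] by (simp add: scalar_mult_eq_scaleR)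
    then have "f' (x, \<xi>) (h, 0) = f' (x, \<xi>) ((\<Sum>l\<in>UNIV. (h $ l) *\<^sub>R axis l 1), 0)" by simp
    also have "\<dots> = (\<Sum>l\<in>UNIV. (h $ l) *\<^sub>R f' (x, \<xi>) (axis l 1, 0))"
      by (simp add: linear_sum[OF lin] linear_cmul[OF lin])
    also have "norm \<dots> \<le> (\<Sum>l\<in>(UNIV :: 'n set). norm h * B)"
    proof (rule order_trans[OF norm_sum], intro sum_mono)
      fix l
      have "norm (f' (x, \<xi>) (axis l 1, 0)) \<le> B"
        using b[of l x] dir_deriv_eq_derivative(2)[OF f', of "(axis l 1, 0)" "(x, \<xi>)"] by simp
      then show "norm ((h $ l) *\<^sub>R f' (x, \<xi>) (axis l 1, 0)) \<le> norm h * B"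
        using component_le_norm_cart[of h l] B by (auto intro!: mult_mono)
    qed
    finally show "norm (f' (x, \<xi>) (h, 0)) \<le> real CARD('n) * B * norm h" by (simp add: mult_ac)
  qed (use B in auto)
  show ?thesis
    by (rule differentiable_bound[of UNIV "\<lambda>x. ?f (x, \<xi>)" "\<lambda>x h. f' (x, \<xi>) (h, 0)"]) (auto intro: d o)
qed

lemma japanese_bracket_ge_1: "1 \<le> japanese_bracket \<xi>"
  by (simp add: japanese_bracket_def)

lemma norm_le_shell:
  fixes \<xi> :: "real ^ 'n" assumes "\<xi> \<in> shell j" shows "norm \<xi> \<le> 2 * real CARD('n) * 2 ^ j"
proof -
  have "norm \<xi> \<le> (\<Sum>l\<in>UNIV. \<bar>\<xi> $ l\<bar>)" by (rule norm_le_l1_cart)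
  also have "\<dots> \<le> (\<Sum>l\<in>(UNIV :: 'n set). 2 * 2 ^ j)"
    using assms by (intro sum_mono) (auto simp: shell_def intro: less_imp_le)
  finally show ?thesis by simp
qed

lemma japanese_bracket_shell:
  fixes \<xi> :: "real ^ 'n" assumes "\<xi> \<in> shell j"
  shows "2 ^ j / (2 + 2 * real CARD('n)) \<le> japanese_bracket \<xi>" "japanese_bracket \<xi> \<le> (2 + 2 * real CARD('n)) * 2 ^ j"
proof -
  have "2 ^ j / 2 \<le> japanese_bracket \<xi>"
  proof (cases "j = 0")
    case True then show ?thesis using japanese_bracket_ge_1[of \<xi>] by simp
  next
    case False
    then obtain l where "2 ^ j / 2 < \<bar>\<xi> $ l\<bar>" using assms by (auto simp: shell_def)
    also have "\<dots> \<le> norm \<xi>" by (rule component_le_norm_cart)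
    also have "\<dots> \<le> japanese_bracket \<xi>" by (simp add: japanese_bracket_def real_le_rsqrt)
    finally show ?thesis by simp
  qed
  moreover have "2 ^ j / (2 + 2 * real CARD('n)) \<le> (2 ^ j / 2 :: real)" by (intro divide_left_mono) auto
  ultimately show "2 ^ j / (2 + 2 * real CARD('n)) \<le> japanese_bracket \<xi>" by (rule order_trans[rotated])
  have "japanese_bracket \<xi> \<le> 1 + norm \<xi>"
    unfolding japanese_bracket_def by (rule real_le_lsqrt) (auto simp: power2_sum)
  also have "\<dots> \<le> 2 ^ j + 2 * real CARD('n) * 2 ^ j" using norm_le_shell[OF assms] by (intro add_mono) auto
  also have "\<dots> \<le> (2 + 2 * real CARD('n)) * 2 ^ j" by (simp add: algebra_simps)
  finally show "japanese_bracket \<xi> \<le> (2 + 2 * real CARD('n)) * 2 ^ j" .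
qed

text \<open>On the shell the bracket and \<open>2 ^ j\<close> agree up to the factor
  \<open>2 + 2 * n\<close>; the exponent here dominates the modulus of every order
  \<open>m - \<rho> * k + \<delta>\<close> with \<open>k \<le> N\<close>.\<close>

definition shell_const :: "'n::finite itself \<Rightarrow> real \<Rightarrow> nat \<Rightarrow> real" where
  "shell_const T m N = (2 + 2 * real CARD('n)) powr (\<bar>m\<bar> + N + 1)"

lemma shell_const_ge_1: "1 \<le> shell_const TYPE('n::finite) m N"
  unfolding shell_const_def by (intro ge_one_powr_ge_zero) auto

lemma bracket_powr_shell:
  fixes \<xi> :: "real ^ 'n"
  assumes "\<xi> \<in> shell j" "k \<le> N" "0 \<le> \<rho>" "\<rho> \<le> 1" "0 \<le> \<delta>" "\<delta> \<le> 1"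
  shows "japanese_bracket \<xi> powr (m - \<rho> * real k + \<delta>) \<le> shell_const TYPE('n) m N * ((2 ^ j) powr (m + \<delta>) * dscale \<rho> j ^ k)"
proof -
  have "\<rho> * real k \<le> 1 * real N" using assms by (intro mult_mono) auto
  moreover have "0 \<le> \<rho> * real k" using assms by simp
  ultimately have e: "\<bar>m - \<rho> * real k + \<delta>\<bar> \<le> \<bar>m\<bar> + real N + 1" using assms(5,6) by linarith
  have e': "m - \<rho> * real k + \<delta> = (m + \<delta>) - \<rho> * real k" by simp
  have "japanese_bracket \<xi> powr (m - \<rho> * real k + \<delta>) \<le> shell_const TYPE('n) m N * (2 ^ j) powr (m - \<rho> * real k + \<delta>)"
    unfolding shell_const_def by (rule powr_comparable[OF _ _ japanese_bracket_shell[OF assms(1)] e]) auto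
  then show ?thesis unfolding e' dscale_power by (simp add: mult_ac)
qed

text \<open>A deliberately crude bound. The unlocalized symbol needs some majorant on the whole
  space before it is multiplied by \<open>psi F j\<close>, and its size off the shell has no
  influence on the product.\<close>

lemma bracket_powr_off_shell:
  assumes "k \<le> N" "0 \<le> \<rho>" "m \<le> 0"
  shows "japanese_bracket \<xi> powr (m - \<rho> * real k) \<le> dscale \<rho> j ^ k * (1 / dscale \<rho> j ^ N)"
proof -
  have "0 \<le> \<rho> * real k" using assms by simp
  then have "japanese_bracket \<xi> powr (m - \<rho> * real k) \<le> japanese_bracket \<xi> powr 0"
    using assms(3) japanese_bracket_ge_1 by (intro powr_mono) auto
  also have "\<dots> \<le> 1" by simp
  also have "1 \<le> dscale \<rho> j ^ k * (1 / dscale \<rho> j ^ N)"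
    using power_decreasing[OF assms(1) less_imp_le[OF dscale_pos] dscale_le_1[OF assms(2)], of j] by (simp add: field_simps)
  finally show ?thesis .
qed

text \<open>The Leibniz rule multiplies majorants, and that of \<open>psi F j\<close> carries the
  indicator of the shell; this erases \<open>b'\<close>. The condition on \<open>l\<close> allows
  the derivatives of the cutoff to be measured in the coarser scale of the symbol.\<close>

lemma dbd_off_shell_mult:
  assumes g: "dbd i l N (\<lambda>\<xi>. if \<xi> \<in> shell j then b else b') g" and F: "cutoff N M F"
    and l: "1 / 2 ^ j \<le> l"
  shows "dbd i l N (\<lambda>\<xi>. 2 ^ N * 2 ^ Suc N * M * b * indicator (shell j) \<xi>) (\<lambda>\<xi>. g \<xi> * complex_of_real (psi F j \<xi>))"
proof -
  have "0 < 1 / (2 ^ j :: real)" by simp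
  then have "0 \<le> l" using l by linarith
  have "dbd i l N (\<lambda>\<xi>. 2 ^ Suc N * M * indicator (shell j) \<xi>) (\<lambda>\<xi>. complex_of_real (psi F j \<xi>))"
    by (rule dbd_mono[OF dbd_psi[OF F]]) (use l in auto)
  from dbd_mult[OF \<open>0 \<le> l\<close> g this] show ?thesis
    by (rule dbd_mono) (use \<open>0 \<le> l\<close> in \<open>auto simp: indicator_def mult_ac\<close>)
qed

text \<open>The three estimates become, after transformation, the size of the kernel, its dependence
  on the first argument (a factor \<open>(2 ^ j) powr \<delta>\<close> per unit length) and its
  modulus of continuity in the second argument (a factor \<open>2 ^ j\<close> per unit
  length).\<close>

lemma symbol_pieces:
  fixes a :: "(real ^ 'n) \<times> (real ^ 'n) \<Rightarrow> complex"
  assumes a: "a \<in> symbol_class m \<rho> \<delta>" and "m \<le> 0" "0 \<le> \<rho>" "\<rho> \<le> 1" "0 \<le> \<delta>" "\<delta> \<le> 1"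
    and F: "cutoff N M F"
  obtains C where "0 < C"
    "\<And>i j x. dbd i (dscale \<rho> j) N (\<lambda>\<xi>. C * (2 ^ j) powr m * indicator (shell j) \<xi>) (\<lambda>\<xi>. a (x, \<xi>) * complex_of_real (psi F j \<xi>))"
    "\<And>i j x x'. dbd i (dscale \<rho> j) N (\<lambda>\<xi>. C * (2 ^ j) powr m * ((2 ^ j) powr \<delta> * norm (x - x')) * indicator (shell j) \<xi>) (\<lambda>\<xi>. (a (x, \<xi>) - a (x', \<xi>)) * complex_of_real (psi F j \<xi>))"
    "\<And>i j x h. norm h \<le> CARD('n) / 2 ^ j \<Longrightarrow> dbd i (dscale \<rho> j) N (\<lambda>\<xi>. C * (2 ^ j) powr m * (2 ^ j * norm h) * indicator (shell j) \<xi>) (\<lambda>\<xi>. a (x, \<xi>) * complex_of_real (psi F j \<xi>) * (1 - cis (h \<bullet> \<xi>)))"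
proof -
  have sm: "smooth a" using a by (simp add: symbol_class_def)
  obtain C1 where C1: "0 \<le> C1" "\<And>i k x \<xi>. k \<le> N \<Longrightarrow> norm (xi_deriv i k a (x, \<xi>)) \<le> C1 * japanese_bracket \<xi> powr (m - \<rho> * real k)"
    using symbol_bounds(1)[OF a, of N] by blast
  obtain C2 where C2: "0 \<le> C2" "\<And>i k l x \<xi>. k \<le> N \<Longrightarrow> norm (dir_deriv (axis l 1, 0) (xi_deriv i k a) (x, \<xi>)) \<le> C2 * japanese_bracket \<xi> powr (m - \<rho> * real k + \<delta>)"
    using symbol_bounds(2)[OF a, of N] by blast
  let ?S = "shell_const TYPE('n) m N" and ?n = "real CARD('n)"
  have S1: "1 \<le> ?S" by (rule shell_const_ge_1)
  have M1: "1 \<le> M" using F by (simp add: cutoff_def)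
  \<comment> \<open>A common bound for the symbol and for its differences on the shell; the summand
    1 only makes it positive.\<close>
  define D where "D = C1 * ?S + ?n * C2 * ?S + 1"
  have D: "0 < D" "C1 * ?S \<le> D" "?n * C2 * ?S \<le> D"
    using C1(1) C2(1) S1 by (auto simp: D_def intro!: add_nonneg_pos add_nonneg_nonneg)
  define K where "K = 2 ^ N * 2 ^ Suc N * M"
  have K: "0 < K" using M1 by (simp add: K_def)
  \<comment> \<open>\<open>2 ^ N\<close> is the Leibniz factor of the product with
    \<open>1 - cis (h \<bullet> \<xi>)\<close>, and \<open>n ^ N + 2 * n\<close> bounds its majorant
    on the shell. The summand 1 lets \<open>C\<close> dominate \<open>D * K\<close> as well.\<close>
  define C where "C = D * K * 2 ^ N * (1 + ?n ^ N + 2 * ?n)"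
  have n1: "1 \<le> ?n" by simp
  have CD: "D * K * 1 * 1 \<le> C" unfolding C_def using D K by (intro mult_mono) auto
  have "0 < C" using CD D K by (smt (verit) mult_pos_pos)
  have diff: "((\<lambda>t. xi_deriv i k a (x, \<xi> + t *\<^sub>R axis i 1)) has_vector_derivative xi_deriv i (Suc k) a (x, \<xi>)) (at 0)" for i k x \<xi>
    using smooth_funpow_has_vector_derivative[OF sm axis_Basis(2)[of i], of k "(x, \<xi>)"] by simp
  have cont: "continuous_on UNIV (\<lambda>\<xi>. xi_deriv i k a (x, \<xi>))" for i k x
    by (rule continuous_on_compose2[OF smooth_funpow_continuous[OF sm axis_Basis(2)]]) (auto intro!: continuous_intros)
  have sle: "1 / 2 ^ j \<le> dscale \<rho> j" for j by (rule dscale_ge) fact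
  have "dbd i (dscale \<rho> j) N (\<lambda>\<xi>. if \<xi> \<in> shell j then D * (2 ^ j) powr m else D * (1 / dscale \<rho> j ^ N)) ((\<lambda>k \<xi>. xi_deriv i k a (x, \<xi>)) 0)" for i j x
  proof (rule dbd_seq[where G="\<lambda>k \<xi>. xi_deriv i k a (x, \<xi>)"])
    fix k and \<xi> :: "real ^ 'n" assume k: "k \<le> N"
    note C1(2)[OF k, of i x \<xi>]
    also have "C1 * japanese_bracket \<xi> powr (m - \<rho> * real k) \<le> dscale \<rho> j ^ k * (if \<xi> \<in> shell j then D * (2 ^ j) powr m else D * (1 / dscale \<rho> j ^ N))"
    proof (cases "\<xi> \<in> shell j")
      case True
      have "C1 * japanese_bracket \<xi> powr (m - \<rho> * real k) \<le> C1 * (?S * ((2 ^ j) powr m * dscale \<rho> j ^ k))"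
        using bracket_powr_shell[OF True k, of \<rho> 0 m] assms C1(1) by (intro mult_left_mono) auto
      also have "\<dots> = (C1 * ?S) * ((2 ^ j) powr m * dscale \<rho> j ^ k)" by simp
      also have "\<dots> \<le> D * ((2 ^ j) powr m * dscale \<rho> j ^ k)" using D by (intro mult_right_mono) (auto intro: less_imp_le)
      finally show ?thesis using True by (simp add: mult_ac)
    next
      case False
      have "C1 * 1 \<le> C1 * ?S" using C1(1) S1 by (intro mult_left_mono) auto
      then have "C1 \<le> D" using D(2) by simp
      then have "C1 * japanese_bracket \<xi> powr (m - \<rho> * real k) \<le> D * (dscale \<rho> j ^ k * (1 / dscale \<rho> j ^ N))"
        using bracket_powr_off_shell[OF k, of \<rho> m \<xi> j] assms C1(1) by (intro mult_mono) auto
      then show ?thesis using False by (simp add: mult_ac)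
    qed
    finally show "norm (xi_deriv i k a (x, \<xi>)) \<le> \<dots>" .
  qed (use diff cont in auto)
  then have d1: "dbd i (dscale \<rho> j) N (\<lambda>\<xi>. if \<xi> \<in> shell j then D * (2 ^ j) powr m else D * (1 / dscale \<rho> j ^ N)) (\<lambda>\<xi>. a (x, \<xi>))" for i j x
    by simp
  have e1: "dbd i (dscale \<rho> j) N (\<lambda>\<xi>. (D * K) * (2 ^ j) powr m * indicator (shell j) \<xi>) (\<lambda>\<xi>. a (x, \<xi>) * complex_of_real (psi F j \<xi>))" for i j x
    by (rule dbd_mono[OF dbd_off_shell_mult[OF d1 F sle]]) (auto simp: K_def mult_ac)
  have c1: "dbd i (dscale \<rho> j) N (\<lambda>\<xi>. C * (2 ^ j) powr m * indicator (shell j) \<xi>) (\<lambda>\<xi>. a (x, \<xi>) * complex_of_real (psi F j \<xi>))" for i j x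
    by (rule dbd_mono[OF e1], intro mult_right_mono) (use CD in auto)
  have "dbd i (dscale \<rho> j) N (\<lambda>\<xi>. if \<xi> \<in> shell j then D * (2 ^ j) powr m * ((2 ^ j) powr \<delta> * norm (x - x')) else 2 * D * (1 / dscale \<rho> j ^ N))
      ((\<lambda>k \<xi>. xi_deriv i k a (x, \<xi>) - xi_deriv i k a (x', \<xi>)) 0)" for i j x x'
  proof (rule dbd_seq[where G="\<lambda>k \<xi>. xi_deriv i k a (x, \<xi>) - xi_deriv i k a (x', \<xi>)"])
    fix k and \<xi> :: "real ^ 'n" assume k: "k \<le> N"
    show "norm (xi_deriv i k a (x, \<xi>) - xi_deriv i k a (x', \<xi>)) \<le>
      dscale \<rho> j ^ k * (if \<xi> \<in> shell j then D * (2 ^ j) powr m * ((2 ^ j) powr \<delta> * norm (x - x')) else 2 * D * (1 / dscale \<rho> j ^ N))"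
    proof (cases "\<xi> \<in> shell j")
      case True
      have "C2 * japanese_bracket \<xi> powr (m - \<rho> * real k + \<delta>) \<le> C2 * (?S * ((2 ^ j) powr (m + \<delta>) * dscale \<rho> j ^ k))"
        using bracket_powr_shell[OF True k, of \<rho> \<delta> m] assms C2(1) by (intro mult_left_mono) auto
      then have "norm (dir_deriv (axis l 1, 0) (xi_deriv i k a) (y, \<xi>)) \<le> C2 * (?S * ((2 ^ j) powr (m + \<delta>) * dscale \<rho> j ^ k))" for l y
        using C2(2)[OF k] order_trans by blast
      from xi_deriv_diff_le[OF sm this]
      have "norm (xi_deriv i k a (x, \<xi>) - xi_deriv i k a (x', \<xi>)) \<le> ?n * (C2 * (?S * ((2 ^ j) powr (m + \<delta>) * dscale \<rho> j ^ k))) * norm (x - x')" .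
      also have "\<dots> = (?n * C2 * ?S) * ((2 ^ j) powr (m + \<delta>) * dscale \<rho> j ^ k * norm (x - x'))" by simp
      also have "\<dots> \<le> D * ((2 ^ j) powr (m + \<delta>) * dscale \<rho> j ^ k * norm (x - x'))" using D by (intro mult_right_mono) (auto intro: less_imp_le)
      finally show ?thesis using True by (simp add: powr_add mult_ac)
    next
      case False
      have "C1 * 1 \<le> C1 * ?S" using C1(1) S1 by (intro mult_left_mono) auto
      then have "C1 \<le> D" using D(2) by simp
      then have "C1 * japanese_bracket \<xi> powr (m - \<rho> * real k) \<le> D * (dscale \<rho> j ^ k * (1 / dscale \<rho> j ^ N))"
        using bracket_powr_off_shell[OF k, of \<rho> m \<xi> j] assms C1(1) by (intro mult_mono) auto
      then have "norm (xi_deriv i k a (y, \<xi>)) \<le> D * (dscale \<rho> j ^ k * (1 / dscale \<rho> j ^ N))" for y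
        using C1(2)[OF k] order_trans by blast
      then have "norm (xi_deriv i k a (x, \<xi>) - xi_deriv i k a (x', \<xi>)) \<le> D * (dscale \<rho> j ^ k * (1 / dscale \<rho> j ^ N)) + D * (dscale \<rho> j ^ k * (1 / dscale \<rho> j ^ N))"
        by (intro norm_triangle_le_diff add_mono)
      then show ?thesis using False by (simp add: mult_ac)
    qed
  qed (use diff cont in \<open>auto intro!: continuous_intros has_vector_derivative_diff\<close>)
  then have d2: "dbd i (dscale \<rho> j) N (\<lambda>\<xi>. if \<xi> \<in> shell j then D * (2 ^ j) powr m * ((2 ^ j) powr \<delta> * norm (x - x')) else 2 * D * (1 / dscale \<rho> j ^ N))
      (\<lambda>\<xi>. a (x, \<xi>) - a (x', \<xi>))" for i j x x'
    by simp
  have "dbd i (dscale \<rho> j) N (\<lambda>\<xi>. (D * K) * ((2 ^ j) powr m * ((2 ^ j) powr \<delta> * norm (x - x'))) * indicator (shell j) \<xi>) (\<lambda>\<xi>. (a (x, \<xi>) - a (x', \<xi>)) * complex_of_real (psi F j \<xi>))" for i j x x'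
    by (rule dbd_mono[OF dbd_off_shell_mult[OF d2 F sle]]) (auto simp: K_def mult_ac)
  note e2 = this
  have c2: "dbd i (dscale \<rho> j) N (\<lambda>\<xi>. C * (2 ^ j) powr m * ((2 ^ j) powr \<delta> * norm (x - x')) * indicator (shell j) \<xi>) (\<lambda>\<xi>. (a (x, \<xi>) - a (x', \<xi>)) * complex_of_real (psi F j \<xi>))" for i j x x'
    unfolding mult.assoc[of C] by (rule dbd_mono[OF e2[unfolded mult.assoc[of "D * K"]]], intro mult_right_mono) (use CD in auto)
  have c3: "dbd i (dscale \<rho> j) N (\<lambda>\<xi>. C * (2 ^ j) powr m * (2 ^ j * norm h) * indicator (shell j) \<xi>) (\<lambda>\<xi>. a (x, \<xi>) * complex_of_real (psi F j \<xi>) * (1 - cis (h \<bullet> \<xi>)))"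
    if h: "norm h \<le> CARD('n) / 2 ^ j" for i j x h
  proof -
    have "dbd i (dscale \<rho> j) N (\<lambda>\<xi>. norm h * 2 ^ j * (real CARD('n) ^ N + norm \<xi> / 2 ^ j)) (\<lambda>\<xi>. 1 - cis (h \<bullet> \<xi>))"
      by (rule dbd_mono[OF dbd_one_minus_cis[OF h] order_refl _ sle]) auto
    note m = dbd_mult[OF less_imp_le[OF dscale_pos] e1 this]
    show ?thesis
    proof (rule dbd_mono[OF m])
      fix \<xi> :: "real ^ 'n"
      show "2 ^ N * (D * K * (2 ^ j) powr m * indicator (shell j) \<xi>) * (norm h * 2 ^ j * (real CARD('n) ^ N + norm \<xi> / 2 ^ j))
        \<le> C * (2 ^ j) powr m * (2 ^ j * norm h) * indicator (shell j) \<xi>"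
      proof (cases "\<xi> \<in> shell j")
        case True
        have "norm \<xi> / 2 ^ j \<le> 2 * ?n" using norm_le_shell[OF True] by (simp add: field_simps)
        then have "D * K * 2 ^ N * (?n ^ N + norm \<xi> / 2 ^ j) \<le> C"
          unfolding C_def using D K by (intro mult_left_mono) auto
        then have "D * K * 2 ^ N * (?n ^ N + norm \<xi> / 2 ^ j) * ((2 ^ j) powr m * (2 ^ j * norm h)) \<le> C * ((2 ^ j) powr m * (2 ^ j * norm h))"
          by (rule mult_right_mono) auto
        then show ?thesis using True by (simp add: mult_ac)
      qed simp
    qed auto
  qed
  show thesis using that[OF \<open>0 < C\<close> c1 c2 c3] by blast
qed

section \<open>Families of kernels\<close>

text \<open>A geometric sum is less than twice its last term, and the last term is below 1.\<close>

lemma sum_dyadic_low: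
  assumes "\<And>j. j < L \<Longrightarrow> 2 ^ j * r < (1::real)" "0 \<le> r"
  shows "(\<Sum>j<L. 2 ^ j * r) \<le> 2"
proof (cases L)
  case (Suc L')
  have "(\<Sum>j<L. 2 ^ j * r) = (2 ^ L - 1) * r" by (simp add: geometric_sum flip: sum_distrib_right)
  also have "\<dots> \<le> 2 ^ L * r" using assms(2) by (intro mult_right_mono) auto
  also have "\<dots> = 2 * (2 ^ L' * r)" by (simp add: Suc)
  also have "\<dots> \<le> 2 * 1" using assms(1)[of L'] Suc by (intro mult_left_mono) auto
  finally show ?thesis by simp
qed simp

lemma sum_geometric_le:
  fixes q :: real
  assumes "0 \<le> q" "q < 1"
  shows "(\<Sum>j\<in>{L..<J}. q ^ (j - L)) \<le> 1 / (1 - q)" "(\<Sum>j\<in>{L..<J}. q ^ j) \<le> 1 / (1 - q)"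
proof -
  have *: "(\<Sum>j<n. q ^ j) \<le> 1 / (1 - q)" for n
  proof -
    have "(\<Sum>j<n. q ^ j) \<le> (\<Sum>j. q ^ j)" using assms by (intro sum_le_suminf summable_geometric) auto
    then show ?thesis using assms by (simp add: suminf_geometric)
  qed
  have "(\<Sum>j\<in>{L..<J}. q ^ (j - L)) = (\<Sum>j<J - L. q ^ j)"
    by (rule sum.reindex_bij_witness[of _ "\<lambda>j. j + L" "\<lambda>j. j - L"]) auto
  then show "(\<Sum>j\<in>{L..<J}. q ^ (j - L)) \<le> 1 / (1 - q)" using * by simp
  have "(\<Sum>j\<in>{L..<J}. q ^ j) \<le> (\<Sum>j<J. q ^ j)"
    using assms by (intro sum_mono2) auto
  then show "(\<Sum>j\<in>{L..<J}. q ^ j) \<le> 1 / (1 - q)" using *[of J] by linarith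
qed

lemma peak_le_const: "0 < s \<Longrightarrow> peak N s z \<le> 1 / s ^ CARD('n)" for z :: "real ^ 'n"
proof -
  assume s: "0 < s"
  have "1 ^ N \<le> (1 + norm z / s) ^ N" using s by (intro power_mono) auto
  then have "1 / (s ^ CARD('n) * (1 + norm z / s) ^ N) \<le> 1 / (s ^ CARD('n) * 1)"
    using s by (intro divide_left_mono mult_left_mono mult_pos_pos zero_less_power) (auto intro: add_pos_nonneg)
  then show ?thesis by (simp add: peak_def)
qed

lemma sum_nn_integral_norm_le:
  fixes h :: "'j \<Rightarrow> 'a \<Rightarrow> complex"
  assumes [measurable]: "\<And>j. h j \<in> borel_measurable M" "S \<in> sets M"
    and b: "\<And>j. j \<in> I \<Longrightarrow> (\<integral>\<^sup>+x\<in>S. ennreal (norm (h j x)) \<partial>M) \<le> ennreal (c j)"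
    and c: "\<And>j. j \<in> I \<Longrightarrow> 0 \<le> c j" "(\<Sum>j\<in>I. c j) \<le> D"
  shows "(\<integral>\<^sup>+x\<in>S. ennreal (norm (\<Sum>j\<in>I. h j x)) \<partial>M) \<le> ennreal D"
proof -
  have "(\<integral>\<^sup>+x\<in>S. ennreal (norm (\<Sum>j\<in>I. h j x)) \<partial>M) \<le> (\<integral>\<^sup>+x\<in>S. (\<Sum>j\<in>I. ennreal (norm (h j x))) \<partial>M)"
    by (intro nn_integral_mono mult_right_mono) (auto intro!: ennreal_leI norm_sum)
  also have "\<dots> = (\<Sum>j\<in>I. \<integral>\<^sup>+x\<in>S. ennreal (norm (h j x)) \<partial>M)"
    by (simp add: sum_distrib_right nn_integral_sum flip: sum_ennreal)
  also have "\<dots> \<le> (\<Sum>j\<in>I. ennreal (c j))" by (intro sum_mono b)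
  also have "\<dots> \<le> ennreal D" using c by (simp add: sum_ennreal ennreal_leI)
  finally show ?thesis .
qed

text \<open>Displacements up to \<open>CARD('n) / 2 ^ j\<close> are what
  \<open>norm_le_of_mem_cube0\<close> gives for a cube of side 2^-j. On that range a peak centred at
  one of the two points suffices on the right, because 2^-j is at most the width of the
  kernel.\<close>

locale kernel_family =
  fixes k :: "nat \<Rightarrow> real ^ 'n \<Rightarrow> real ^ 'n \<Rightarrow> complex" and \<rho> A :: real
  assumes rho: "0 < \<rho>" "\<rho> \<le> 1" and A_pos: "0 < A"
    and k_measurable [measurable]: "\<And>j. case_prod (k j) \<in> borel_measurable (borel \<Otimes>\<^sub>M borel)"
    and size: "\<And>j x y. norm (k j x y) \<le> A * peak (CARD('n) + 2) (dscale \<rho> j) (x - y)"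
    and smooth_left: "\<And>j x x' y. norm (x - x') \<le> CARD('n) / 2 ^ j \<Longrightarrow>
      norm (k j x y - k j x' y) \<le> A * (2 ^ j * norm (x - x')) * peak (CARD('n) + 2) (dscale \<rho> j) (x - y)"
begin

definition T :: "nat \<Rightarrow> (real ^ 'n \<Rightarrow> complex) \<Rightarrow> real ^ 'n \<Rightarrow> complex" where
  "T j f x = (\<integral>y. k j x y * f y \<partial>lborel)"

lemma T_measurable [measurable]:
  assumes [measurable]: "f \<in> borel_measurable borel"
  shows "T j f \<in> borel_measurable borel"
  unfolding T_def[abs_def] by measurable

lemma k_measurable_right [measurable]: "k j x \<in> borel_measurable borel"
  using measurable_compose[OF _ k_measurable, of "\<lambda>y. (x, y)" borel j] by simp

lemma k_bound: "norm (k j x y) \<le> A / dscale \<rho> j ^ CARD('n)"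
proof -
  have "norm (k j x y) \<le> A * (1 / dscale \<rho> j ^ CARD('n))"
    using size[of j x y] peak_le_const[OF dscale_pos] A_pos by (meson mult_left_mono less_imp_le order_trans)
  then show ?thesis by simp
qed

lemma integrable_k_mult:
  assumes "integrable lborel f" shows "integrable lborel (\<lambda>y. k j x y * f y)"
proof (rule Bochner_Integration.integrable_bound)
  show "integrable lborel (\<lambda>y. (A / dscale \<rho> j ^ CARD('n)) * norm (f y))" using assms by simp
  have [measurable]: "f \<in> borel_measurable borel" using borel_measurable_integrable[OF assms] by simp
  show "(\<lambda>y. k j x y * f y) \<in> borel_measurable lborel" by measurable
  show "AE y in lborel. norm (k j x y * f y) \<le> norm ((A / dscale \<rho> j ^ CARD('n)) * norm (f y))"
    using mult_right_mono[OF k_bound norm_ge_zero] A_pos by (intro AE_I2) (simp add: norm_mult abs_mult)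
qed

lemma norm_T_diff_le:
  assumes "integrable lborel f"
  shows "ennreal (norm (T j f x - T j f x')) \<le> (\<integral>\<^sup>+y. ennreal (norm (k j x y - k j x' y)) * ennreal (norm (f y)) \<partial>lborel)"
proof -
  have "T j f x - T j f x' = (\<integral>y. (k j x y - k j x' y) * f y \<partial>lborel)"
    unfolding T_def by (simp add: integrable_k_mult[OF assms] left_diff_distrib)
  then show ?thesis
    using norm_integral_le_nn_integral[where h="\<lambda>y. (k j x y - k j x' y) * f y" and M=lborel]
    by (simp add: norm_mult ennreal_mult)
qed

text \<open>For \<open>2 ^ j * r < 1\<close> the cube is small enough for
  \<open>smooth_left\<close>, which gains \<open>n * 2 ^ j * r\<close> over the size bound;
  \<open>cubes_bound_peak\<close> bounds the integral against \<open>f\<close>, and the gains sum to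
  at most \<open>2 * n\<close>.\<close>

lemma low_oscillation:
  assumes f: "integrable lborel f" and cb: "cubes_bound x0 \<mu> (\<lambda>y. ennreal (norm (f y)))"
    and "0 \<le> \<mu>" "0 < r" "x0 \<in> cube p r" and low: "\<And>j. j < L \<Longrightarrow> 2 ^ j * r < 1"
  shows "(\<integral>\<^sup>+x\<in>cube p r. ennreal (norm (\<Sum>j<L. T j f x - T j f p)) \<partial>lborel)
    \<le> ennreal (8 * real CARD('n) * 12 ^ CARD('n) * A * \<mu> * r ^ CARD('n))"
proof (rule sum_nn_integral_norm_le)
  have [measurable]: "f \<in> borel_measurable borel" using borel_measurable_integrable[OF f] by simp
  let ?n = "real CARD('n)"
  define c where "c = ?n * A * (4 * 12 ^ CARD('n) * \<mu> * r ^ CARD('n))"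
  have c0: "0 \<le> c" using A_pos \<open>0 \<le> \<mu>\<close> \<open>0 < r\<close> by (simp add: c_def)
  fix j assume "j \<in> {..<L}"
  then have j: "2 ^ j * r < 1" using low by simp
  let ?\<Phi> = "peak (CARD('n) + 2) (dscale \<rho> j) :: real ^ 'n \<Rightarrow> real"
  have pt: "ennreal (norm (T j f x - T j f p)) \<le> ennreal (A * (?n * (2 ^ j * r))) * (\<integral>\<^sup>+y. ennreal (?\<Phi> (x - y)) * ennreal (norm (f y)) \<partial>lborel)"
    if x: "x \<in> cube p r" for x
  proof -
    have "x - p \<in> cube 0 r" using x unfolding mem_cube by (auto simp: algebra_simps)
    then have n: "norm (x - p) \<le> ?n * r" by (rule norm_le_of_mem_cube0)
    also have "\<dots> \<le> ?n * (1 / 2 ^ j)" using j by (intro mult_left_mono) (auto simp: field_simps)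
    finally have n2: "norm (x - p) \<le> ?n / 2 ^ j" by simp
    have "norm (k j x y - k j p y) \<le> A * (?n * (2 ^ j * r)) * ?\<Phi> (x - y)" for y
    proof -
      have "A * (2 ^ j * norm (x - p)) * ?\<Phi> (x - y) \<le> A * (2 ^ j * (?n * r)) * ?\<Phi> (x - y)"
        using n A_pos by (intro mult_right_mono mult_left_mono) auto
      then show ?thesis using smooth_left[OF n2, of y] by (simp add: mult_ac)
    qed
    then have "(\<integral>\<^sup>+y. ennreal (norm (k j x y - k j p y)) * ennreal (norm (f y)) \<partial>lborel)
       \<le> (\<integral>\<^sup>+y. ennreal (A * (?n * (2 ^ j * r)) * ?\<Phi> (x - y)) * ennreal (norm (f y)) \<partial>lborel)"
      by (intro nn_integral_mono mult_right_mono ennreal_leI) auto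
    also have "\<dots> = ennreal (A * (?n * (2 ^ j * r))) * (\<integral>\<^sup>+y. ennreal (?\<Phi> (x - y)) * ennreal (norm (f y)) \<partial>lborel)"
      using A_pos \<open>0 < r\<close> by (subst nn_integral_cmult[symmetric]) (auto simp: ennreal_mult mult.assoc)
    finally show ?thesis using norm_T_diff_le[OF f] order_trans by blast
  qed
  have "(\<integral>\<^sup>+x\<in>cube p r. ennreal (norm (T j f x - T j f p)) \<partial>lborel)
    \<le> (\<integral>\<^sup>+x. ennreal (A * (?n * (2 ^ j * r))) * ((\<integral>\<^sup>+y. ennreal (?\<Phi> (x - y)) * ennreal (norm (f y)) \<partial>lborel) * indicator (cube p r) x) \<partial>lborel)"
    using pt by (intro nn_integral_mono) (auto simp: indicator_def)
  also have "\<dots> = ennreal (A * (?n * (2 ^ j * r))) * (\<integral>\<^sup>+x\<in>cube p r. (\<integral>\<^sup>+y. ennreal (?\<Phi> (x - y)) * ennreal (norm (f y)) \<partial>lborel) \<partial>lborel)"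
    by (rule nn_integral_cmult) measurable
  also have "\<dots> \<le> ennreal (A * (?n * (2 ^ j * r))) * ennreal (4 * 12 ^ CARD('n) * \<mu> * r ^ CARD('n))"
    using assms by (intro mult_left_mono cubes_bound_peak) auto
  also have "\<dots> = ennreal (c * (2 ^ j * r))"
    using A_pos \<open>0 < r\<close> \<open>0 \<le> \<mu>\<close> by (subst ennreal_mult[symmetric]) (auto simp: c_def mult_ac)
  finally show "(\<integral>\<^sup>+x\<in>cube p r. ennreal (norm (T j f x - T j f p)) \<partial>lborel) \<le> ennreal (c * (2 ^ j * r))" .
  show "0 \<le> c * (2 ^ j * r)" using c0 \<open>0 < r\<close> by simp
next
  let ?c = "real CARD('n) * A * (4 * 12 ^ CARD('n) * \<mu> * r ^ CARD('n))"
  have c0: "0 \<le> ?c" using A_pos \<open>0 \<le> \<mu>\<close> \<open>0 < r\<close> by simp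
  have "(\<Sum>j<L. ?c * (2 ^ j * r)) = ?c * (\<Sum>j<L. 2 ^ j * r)" by (rule sum_distrib_left[symmetric])
  also have "\<dots> \<le> ?c * 2" using low \<open>0 < r\<close> c0 by (intro mult_left_mono sum_dyadic_low) auto
  finally show "(\<Sum>j<L. ?c * (2 ^ j * r)) \<le> 8 * real CARD('n) * 12 ^ CARD('n) * A * \<mu> * r ^ CARD('n)" by (simp add: mult_ac)
qed (use borel_measurable_integrable[OF f] in auto)

end

text \<open>For \<open>\<rho> < 1\<close> the local averages of the pieces decay geometrically, so that the high
  frequencies can be summed without any orthogonality between the pieces.\<close>

locale rough_family = kernel_family k \<rho> A
  for k :: "nat \<Rightarrow> real ^ 'n \<Rightarrow> real ^ 'n \<Rightarrow> complex" and \<rho> A :: real +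
  fixes \<delta> :: real
  assumes rho_less: "\<rho> < 1" and delta: "0 \<le> \<delta>" "\<delta> < 1"
    and local_average: "\<And>j d x y. 0 < d \<Longrightarrow> d \<le> dscale \<rho> j \<Longrightarrow>
      (\<integral>\<^sup>+u\<in>cube 0 d. ennreal (norm (k j (x + u) y)) \<partial>lborel)
      \<le> ennreal (A * d ^ CARD('n) * (sqrt ((1 / (d * 2 ^ j)) ^ CARD('n)) + d * (2 ^ j) powr \<delta>) * peak (CARD('n) + 2) (dscale \<rho> j) (x - y))"
begin

text \<open>The integral over the cube is averaged over translations by \<open>u\<close> in
  \<open>cube 0 d\<close>. After Fubini the average acts on the kernel alone, where
  \<open>local_average\<close> gives the gain, and only then is \<open>f\<close> integrated. Since
  \<open>d \<le> r\<close>, the translated points stay in a cube of side \<open>2 * r\<close>, which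
  turns 12 into 24.\<close>

lemma high_piece:
  assumes f: "integrable lborel f" and cb: "cubes_bound x0 \<mu> (\<lambda>y. ennreal (norm (f y)))"
    and "0 \<le> \<mu>" "0 < r" "x0 \<in> cube p r" and d: "0 < d" "d \<le> r" "d \<le> dscale \<rho> j"
  shows "(\<integral>\<^sup>+x\<in>cube p r. ennreal (norm (T j f x)) \<partial>lborel)
    \<le> ennreal (4 * 24 ^ CARD('n) * A * (sqrt ((1 / (d * 2 ^ j)) ^ CARD('n)) + d * (2 ^ j) powr \<delta>) * \<mu> * r ^ CARD('n))"
proof -
  have [measurable]: "f \<in> borel_measurable borel" using borel_measurable_integrable[OF f] by simp
  define \<eta> where "\<eta> = sqrt ((1 / (d * 2 ^ j)) ^ CARD('n)) + d * (2 ^ j) powr \<delta>"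
  have eta: "0 \<le> \<eta>" using d by (simp add: \<eta>_def)
  let ?\<Phi> = "peak (CARD('n) + 2) (dscale \<rho> j) :: real ^ 'n \<Rightarrow> real"
  define q where "q = (\<chi> i. p $ i - r)"
  have x0q: "x0 \<in> cube q (2 * r)"
    using \<open>x0 \<in> cube p r\<close> \<open>0 < r\<close> unfolding mem_cube q_def by (auto) (smt (verit))+
  define G where "G x = (\<integral>\<^sup>+y. ennreal (norm (k j x y)) * ennreal (norm (f y)) \<partial>lborel)" for x
  have [measurable]: "G \<in> borel_measurable borel" unfolding G_def by measurable
  \<comment> \<open>The volume of the set of translations is kept as a factor on the left and
    cancelled at the end.\<close>
  have "ennreal (d ^ CARD('n)) * (\<integral>\<^sup>+x\<in>cube p r. G x \<partial>lborel)
     = (\<integral>\<^sup>+u\<in>cube (0::real ^ 'n) d. (\<integral>\<^sup>+x\<in>cube p r. G x \<partial>lborel) \<partial>lborel)"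
    using d emeasure_cube[of d "0::real ^ 'n"] by (subst nn_integral_cmult_indicator) (auto simp: mult.commute)
  also have "\<dots> = (\<integral>\<^sup>+u\<in>cube (0::real ^ 'n) d. (\<integral>\<^sup>+x. G (x + u) * indicator (cube p r) (x + u) \<partial>lborel) \<partial>lborel)"
    using nn_integral_lborel_shift(1)[of "\<lambda>x. G x * indicator (cube p r) x"] by simp
  also have "\<dots> = (\<integral>\<^sup>+u. (\<integral>\<^sup>+x. G (x + u) * indicator (cube p r) (x + u) * indicator (cube 0 d) u \<partial>lborel) \<partial>lborel)"
    by (simp add: nn_integral_multc)
  also have "\<dots> \<le> (\<integral>\<^sup>+u. (\<integral>\<^sup>+x. G (x + u) * indicator (cube 0 d) u * indicator (cube q (2 * r)) x \<partial>lborel) \<partial>lborel)"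
  proof (intro nn_integral_mono)
    fix u x :: "real ^ 'n"
    have "x \<in> cube q (2 * r)" if "x + u \<in> cube p r" "u \<in> cube 0 d"
      unfolding mem_cube
    proof
      fix i
      have "p $ i \<le> x $ i + u $ i" "x $ i + u $ i \<le> p $ i + r" "0 \<le> u $ i" "u $ i \<le> d"
        using that[unfolded mem_cube] by auto
      then show "q $ i \<le> x $ i \<and> x $ i \<le> q $ i + 2 * r" using d by (simp add: q_def)
    qed
    then show "G (x + u) * indicator (cube p r) (x + u) * indicator (cube 0 d) u \<le> G (x + u) * indicator (cube 0 d) u * indicator (cube q (2 * r)) x"
      by (auto simp: indicator_def)
  qed
  also have "\<dots> = (\<integral>\<^sup>+x. (\<integral>\<^sup>+u. G (x + u) * indicator (cube 0 d) u * indicator (cube q (2 * r)) x \<partial>lborel) \<partial>lborel)"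
    by (rule lborel_pair.Fubini') measurable
  also have "\<dots> = (\<integral>\<^sup>+x\<in>cube q (2 * r). (\<integral>\<^sup>+u\<in>cube 0 d. G (x + u) \<partial>lborel) \<partial>lborel)"
    by (simp add: nn_integral_multc)
  also have "\<dots> \<le> (\<integral>\<^sup>+x. ennreal (A * d ^ CARD('n) * \<eta>) * ((\<integral>\<^sup>+y. ennreal (?\<Phi> (x - y)) * ennreal (norm (f y)) \<partial>lborel) * indicator (cube q (2 * r)) x) \<partial>lborel)"
  proof (intro nn_integral_mono)
    fix x
    have "(\<integral>\<^sup>+u\<in>cube 0 d. G (x + u) \<partial>lborel) = (\<integral>\<^sup>+u. (\<integral>\<^sup>+y. ennreal (norm (k j (x + u) y)) * indicator (cube 0 d) u * ennreal (norm (f y)) \<partial>lborel) \<partial>lborel)"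
      unfolding G_def by (intro nn_integral_cong, subst nn_integral_multc[symmetric]) (auto simp: mult_ac)
    also have "\<dots> = (\<integral>\<^sup>+y. (\<integral>\<^sup>+u. ennreal (norm (k j (x + u) y)) * indicator (cube 0 d) u * ennreal (norm (f y)) \<partial>lborel) \<partial>lborel)"
      by (rule lborel_pair.Fubini') measurable
    also have "\<dots> = (\<integral>\<^sup>+y. (\<integral>\<^sup>+u\<in>cube 0 d. ennreal (norm (k j (x + u) y)) \<partial>lborel) * ennreal (norm (f y)) \<partial>lborel)"
      by (intro nn_integral_cong nn_integral_multc) measurable
    also have "\<dots> \<le> (\<integral>\<^sup>+y. ennreal (A * d ^ CARD('n) * \<eta> * ?\<Phi> (x - y)) * ennreal (norm (f y)) \<partial>lborel)"
      unfolding \<eta>_def by (intro nn_integral_mono mult_right_mono local_average d) auto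
    also have "\<dots> = ennreal (A * d ^ CARD('n) * \<eta>) * (\<integral>\<^sup>+y. ennreal (?\<Phi> (x - y)) * ennreal (norm (f y)) \<partial>lborel)"
      using A_pos d eta by (subst nn_integral_cmult[symmetric]) (auto simp: ennreal_mult mult.assoc)
    finally show "(\<integral>\<^sup>+u\<in>cube 0 d. G (x + u) \<partial>lborel) * indicator (cube q (2 * r)) x \<le>
       ennreal (A * d ^ CARD('n) * \<eta>) * ((\<integral>\<^sup>+y. ennreal (?\<Phi> (x - y)) * ennreal (norm (f y)) \<partial>lborel) * indicator (cube q (2 * r)) x)"
      by (auto simp: indicator_def)
  qed
  also have "\<dots> = ennreal (A * d ^ CARD('n) * \<eta>) * (\<integral>\<^sup>+x\<in>cube q (2 * r). (\<integral>\<^sup>+y. ennreal (?\<Phi> (x - y)) * ennreal (norm (f y)) \<partial>lborel) \<partial>lborel)"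
    by (rule nn_integral_cmult) measurable
  also have "\<dots> \<le> ennreal (A * d ^ CARD('n) * \<eta>) * ennreal (4 * 12 ^ CARD('n) * \<mu> * (2 * r) ^ CARD('n))"
    using assms x0q by (intro mult_left_mono cubes_bound_peak) auto
  also have "\<dots> = ennreal (d ^ CARD('n)) * ennreal (4 * 24 ^ CARD('n) * A * \<eta> * \<mu> * r ^ CARD('n))"
  proof -
    have "(24::real) ^ CARD('n) = 12 ^ CARD('n) * 2 ^ CARD('n)" by (simp flip: power_mult_distrib)
    then show ?thesis
      using A_pos \<open>0 < r\<close> \<open>0 \<le> \<mu>\<close> d eta by (subst (1 2) ennreal_mult[symmetric]) (auto simp: power_mult_distrib mult_ac)
  qed
  finally have "(\<integral>\<^sup>+x\<in>cube p r. G x \<partial>lborel) \<le> ennreal (4 * 24 ^ CARD('n) * A * \<eta> * \<mu> * r ^ CARD('n))"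
    using d by (subst (asm) ennreal_mult_le_mult_iff) auto
  moreover have "(\<integral>\<^sup>+x\<in>cube p r. ennreal (norm (T j f x)) \<partial>lborel) \<le> (\<integral>\<^sup>+x\<in>cube p r. G x \<partial>lborel)"
  proof (intro nn_integral_mono mult_right_mono)
    fix x
    show "ennreal (norm (T j f x)) \<le> G x"
      using norm_integral_le_nn_integral[where h="\<lambda>y. k j x y * f y" and M=lborel] unfolding T_def G_def by (simp add: norm_mult ennreal_mult)
  qed auto
  ultimately show ?thesis unfolding \<eta>_def by (rule order_trans[rotated])
qed

text \<open>One exponent for each candidate side \<open>d\<close> in
  \<open>exists_good_side\<close>: 1/2 for the side \<open>r\<close> of the cube,
  \<open>(1 - \<rho>) / 2\<close> for the width of the kernel, and \<open>(1 - \<delta>) / 4\<close>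
  for the side with exponent halfway between \<delta> and 1.\<close>

definition rate :: real where "rate = 2 powr - (min (1 / 2) (min ((1 - \<rho>) / 2) ((1 - \<delta>) / 4)))"

lemma rate: "0 \<le> rate" "rate < 1"
proof -
  have "2 powr - (min (1 / 2) (min ((1 - \<rho>) / 2) ((1 - \<delta>) / 4))) < (2::real) powr 0"
    using rho_less delta by (intro powr_less_mono) auto
  then show "0 \<le> rate" "rate < 1" by (auto simp: rate_def)
qed

lemma two_powr_le_rate_power:
  assumes "min (1 / 2) (min ((1 - \<rho>) / 2) ((1 - \<delta>) / 4)) * real m \<le> e" shows "2 powr - e \<le> rate ^ m"
proof -
  have "rate ^ m = 2 powr (- (min (1 / 2) (min ((1 - \<rho>) / 2) ((1 - \<delta>) / 4))) * real m)"
    unfolding rate_def by (subst powr_power) (auto simp: mult.commute)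
  moreover have "(2::real) powr - e \<le> 2 powr (- (min (1 / 2) (min ((1 - \<rho>) / 2) ((1 - \<delta>) / 4))) * real m)"
    using assms by (intro powr_mono) auto
  ultimately show ?thesis by simp
qed

text \<open>The smallest of three admissible sides is taken. If it is \<open>r\<close>, the gain
  starts only at the critical index \<open>L\<close>, whence \<open>rate ^ (j - L)\<close>; the
  other two give \<open>rate ^ j\<close>. The second \<open>rate ^ j\<close> is the freezing
  error.\<close>

lemma exists_good_side:
  assumes "0 < r" "1 \<le> 2 ^ L * r" "L \<le> j"
  shows "\<exists>d. 0 < d \<and> d \<le> r \<and> d \<le> dscale \<rho> j \<and>
    sqrt ((1 / (d * 2 ^ j)) ^ CARD('n)) + d * (2 ^ j) powr \<delta> \<le> rate ^ (j - L) + 2 * rate ^ j"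
proof -
  \<comment> \<open>The midpoint of \<delta> and 1. A cube of side 2^(-j \<sigma>) is much larger
    than 2^-j and much smaller than 2^(-j \<delta>), by the same factor 2^(j (1 - \<delta>) /
    2).\<close>
  let ?\<sigma> = "(1 + \<delta>) / 2"
  define d where "d = min r (min (dscale \<rho> j) (dscale ?\<sigma> j))"
  have d: "0 < d" "d \<le> r" "d \<le> dscale \<rho> j" "d \<le> dscale ?\<sigma> j" using assms by (auto simp: d_def)
  have powr2: "(2 ^ j :: real) powr e = 2 powr (real j * e)" for e
    by (simp add: powr_powr flip: powr_realpow)
  have "d * (2 ^ j) powr \<delta> \<le> dscale ?\<sigma> j * (2 ^ j) powr \<delta>" using d by (intro mult_right_mono) auto
  also have "\<dots> = 2 powr - (real j * ((1 - \<delta>) / 2))"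
    by (simp add: dscale_def powr2 algebra_simps add_divide_distrib diff_divide_distrib flip: powr_add)
  also have "\<dots> \<le> rate ^ j"
  proof (rule two_powr_le_rate_power)
    have "min (1 / 2) (min ((1 - \<rho>) / 2) ((1 - \<delta>) / 4)) \<le> (1 - \<delta>) / 4" by (intro min.coboundedI2 order_refl)
    then have "min (1 / 2) (min ((1 - \<rho>) / 2) ((1 - \<delta>) / 4)) \<le> (1 - \<delta>) / 2" by (rule order_trans) (use delta in simp)
    then have "min (1 / 2) (min ((1 - \<rho>) / 2) ((1 - \<delta>) / 4)) * real j \<le> (1 - \<delta>) / 2 * real j" by (rule mult_right_mono) simp
    then show "min (1 / 2) (min ((1 - \<rho>) / 2) ((1 - \<delta>) / 4)) * real j \<le> real j * ((1 - \<delta>) / 2)" by (simp add: mult.commute)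
  qed
  finally have 1: "d * (2 ^ j) powr \<delta> \<le> rate ^ j" .
  have ds: "dscale \<sigma> j * 2 ^ j = 2 powr (real j * (1 - \<sigma>))" for \<sigma>
  proof -
    have "dscale \<sigma> j * 2 ^ j = 2 powr (real j * - \<sigma>) * 2 powr real j"
      unfolding dscale_def powr2 by (simp add: powr_realpow)
    also have "\<dots> = 2 powr (real j * - \<sigma> + real j)" by (rule powr_add[symmetric])
    also have "real j * - \<sigma> + real j = real j * (1 - \<sigma>)" by (simp add: algebra_simps)
    finally show ?thesis .
  qed
  have sq: "sqrt ((1 / (2 powr e)) ^ CARD('n)) \<le> rate ^ m" if e: "0 \<le> e" "min (1 / 2) (min ((1 - \<rho>) / 2) ((1 - \<delta>) / 4)) * real m \<le> e / 2" for e m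
  proof -
    have "1 \<le> (2::real) powr e" using e by (simp add: ge_one_powr_ge_zero)
    \<comment> \<open>The base is at most 1, so dimension one is the worst case and the rate can be
      chosen independent of the dimension.\<close>
    then have "(1 / (2 powr e)) ^ CARD('n) \<le> (1 / (2 powr e)) ^ 1"
      by (intro power_decreasing) (auto simp: field_simps Suc_leI)
    then have "sqrt ((1 / (2 powr e)) ^ CARD('n)) \<le> sqrt (2 powr - e)" by (simp add: powr_minus_divide)
    also have "\<dots> = 2 powr - (e / 2)" by (simp add: powr_half_sqrt[symmetric] powr_powr)
    also have "\<dots> \<le> rate ^ m" by (rule two_powr_le_rate_power) (use e in simp)
    finally show ?thesis .
  qed
  have mn: "min (1 / 2) (min ((1 - \<rho>) / 2) ((1 - \<delta>) / 4)) * real m \<le> c * real m"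
    if "c = 1/2 \<or> c = (1 - \<rho>) / 2 \<or> c = (1 - \<delta>) / 4" for c m
  proof (rule mult_right_mono)
    have "min (1 / 2) (min ((1 - \<rho>) / 2) ((1 - \<delta>) / 4)) \<le> 1 / 2" by (rule min.cobounded1)
    moreover have "min (1 / 2) (min ((1 - \<rho>) / 2) ((1 - \<delta>) / 4)) \<le> (1 - \<rho>) / 2" by (intro min.coboundedI2 min.cobounded1)
    moreover have "min (1 / 2) (min ((1 - \<rho>) / 2) ((1 - \<delta>) / 4)) \<le> (1 - \<delta>) / 4" by (intro min.coboundedI2 order_refl)
    ultimately show "min (1 / 2) (min ((1 - \<rho>) / 2) ((1 - \<delta>) / 4)) \<le> c" using that by metis
  qed simp
  have r0: "0 \<le> rate ^ m" for m using rate(1) by simp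
  have "sqrt ((1 / (d * 2 ^ j)) ^ CARD('n)) \<le> rate ^ (j - L) + rate ^ j"
  proof -
    consider "d = r" | "d = dscale \<rho> j" | "d = dscale ?\<sigma> j" unfolding d_def by linarith
    then show ?thesis
    proof cases
      case 1
      have "2 powr real (j - L) = 2 ^ (j - L)" by (simp add: powr_realpow)
      also have "\<dots> \<le> 2 ^ (j - L) * (2 ^ L * r)" using assms(2) by simp
      also have "\<dots> = r * 2 ^ j" using assms(3) by (simp flip: power_add mult.assoc)
      finally have "(1 / (d * 2 ^ j)) ^ CARD('n) \<le> (1 / 2 powr real (j - L)) ^ CARD('n)"
        using 1 assms(1) by (intro power_mono divide_left_mono) auto
      then have "sqrt ((1 / (d * 2 ^ j)) ^ CARD('n)) \<le> sqrt ((1 / 2 powr real (j - L)) ^ CARD('n))" by simp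
      also have "\<dots> \<le> rate ^ (j - L)" by (rule sq) (use mn[of "1/2" "j - L"] in auto)
      finally show ?thesis using r0[of j] by linarith
    next
      case 2
      have "d * 2 ^ j = 2 powr (real j * (1 - \<rho>))"
        by (simp only: 2 ds)
      moreover have "sqrt ((1 / 2 powr (real j * (1 - \<rho>))) ^ CARD('n)) \<le> rate ^ j"
        by (rule sq) (use rho_less mn[of "(1 - \<rho>) / 2" j] in \<open>auto simp: mult.commute\<close>)
      ultimately show ?thesis using r0[of "j - L"] by (simp add: add_increasing)
    next
      case 3
      have "d * 2 ^ j = 2 powr (real j * ((1 - \<delta>) / 2))"
      proof -
        have "1 - ?\<sigma> = (1 - \<delta>) / 2" by (simp add: field_simps)
        then show ?thesis by (simp only: 3 ds)
      qed
      moreover have "sqrt ((1 / 2 powr (real j * ((1 - \<delta>) / 2))) ^ CARD('n)) \<le> rate ^ j"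
        by (rule sq) (use delta mn[of "(1 - \<delta>) / 4" j] in \<open>auto simp: mult.commute\<close>)
      ultimately show ?thesis using r0[of "j - L"] by (simp add: add_increasing)
    qed
  qed
  with 1 d show ?thesis by (intro exI[of _ d]) auto
qed

lemma high_sum:
  assumes f: "integrable lborel f" and cb: "cubes_bound x0 \<mu> (\<lambda>y. ennreal (norm (f y)))"
    and "0 \<le> \<mu>" "0 < r" "x0 \<in> cube p r" and L: "1 \<le> 2 ^ L * r"
  shows "(\<integral>\<^sup>+x\<in>cube p r. ennreal (norm (\<Sum>j\<in>{L..<J}. T j f x)) \<partial>lborel)
    \<le> ennreal (12 * 24 ^ CARD('n) * A / (1 - rate) * \<mu> * r ^ CARD('n))"
proof (rule sum_nn_integral_norm_le)
  have [measurable]: "f \<in> borel_measurable borel" using borel_measurable_integrable[OF f] by simp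
  let ?c = "4 * 24 ^ CARD('n) * A * \<mu> * r ^ CARD('n)"
  have c0: "0 \<le> ?c" using A_pos \<open>0 \<le> \<mu>\<close> \<open>0 < r\<close> by simp
  show "(\<integral>\<^sup>+x\<in>cube p r. ennreal (norm (T j f x)) \<partial>lborel) \<le> ennreal (?c * (rate ^ (j - L) + 2 * rate ^ j))"
    if "j \<in> {L..<J}" for j
  proof -
    have "L \<le> j" using that by simp
    from exists_good_side[OF \<open>0 < r\<close> L this] obtain d where d: "0 < d" "d \<le> r" "d \<le> dscale \<rho> j"
      "sqrt ((1 / (d * 2 ^ j)) ^ CARD('n)) + d * (2 ^ j) powr \<delta> \<le> rate ^ (j - L) + 2 * rate ^ j"
      by blast
    note high_piece[OF f cb \<open>0 \<le> \<mu>\<close> \<open>0 < r\<close> \<open>x0 \<in> cube p r\<close> d(1-3)]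
    also have "ennreal (4 * 24 ^ CARD('n) * A * (sqrt ((1 / (d * 2 ^ j)) ^ CARD('n)) + d * (2 ^ j) powr \<delta>) * \<mu> * r ^ CARD('n))
       \<le> ennreal (?c * (rate ^ (j - L) + 2 * rate ^ j))"
      using mult_left_mono[OF d(4) c0] by (intro ennreal_leI) (simp add: mult_ac)
    finally show ?thesis .
  qed
  show "0 \<le> ?c * (rate ^ (j - L) + 2 * rate ^ j)" for j using c0 rate(1) by simp
  have "(\<Sum>j\<in>{L..<J}. ?c * (rate ^ (j - L) + 2 * rate ^ j)) = ?c * ((\<Sum>j\<in>{L..<J}. rate ^ (j - L)) + 2 * (\<Sum>j\<in>{L..<J}. rate ^ j))"
    unfolding sum_distrib_left[symmetric] by (simp add: sum.distrib sum_distrib_left)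
  also have "\<dots> \<le> ?c * (1 / (1 - rate) + 2 * (1 / (1 - rate)))"
    using rate c0 by (intro mult_left_mono add_mono sum_geometric_le) auto
  finally show "(\<Sum>j\<in>{L..<J}. ?c * (rate ^ (j - L) + 2 * rate ^ j)) \<le> 12 * 24 ^ CARD('n) * A / (1 - rate) * \<mu> * r ^ CARD('n)"
    by (simp add: mult_ac)
qed (use borel_measurable_integrable[OF f] in auto)

end

section \<open>Almost orthogonality\<close>

text \<open>The Cotlar--Stein lemma. A word in the expansion of \<open>(A\<^sup>* A)\<^sup>M\<close> is a list of pairs of indices;
  its norm is bounded by pairing the factors in two different ways and taking the geometric mean.\<close>

locale cotlar_stein =
  fixes V :: "'v::comm_monoid_add set" and nrm :: "'v \<Rightarrow> real" and ip :: "'v \<Rightarrow> 'v \<Rightarrow> complex"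
    and S S' :: "'j \<Rightarrow> 'v \<Rightarrow> 'v" and I :: "'j set" and \<gamma> :: "'j \<Rightarrow> 'j \<Rightarrow> real" and \<Gamma> :: real
  assumes V_0: "0 \<in> V" and V_add: "\<And>f g. f \<in> V \<Longrightarrow> g \<in> V \<Longrightarrow> f + g \<in> V"
    and nrm_nonneg: "\<And>f. 0 \<le> nrm f" and nrm_0: "nrm 0 = 0"
    and nrm_add: "\<And>f g. f \<in> V \<Longrightarrow> g \<in> V \<Longrightarrow> nrm (f + g) \<le> nrm f + nrm g"
    and ip_self: "\<And>f. f \<in> V \<Longrightarrow> norm (ip f f) = (nrm f)\<^sup>2"
    and ip_le: "\<And>f g. f \<in> V \<Longrightarrow> g \<in> V \<Longrightarrow> norm (ip f g) \<le> nrm f * nrm g"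
    and ip_add_left: "\<And>f g h. f \<in> V \<Longrightarrow> g \<in> V \<Longrightarrow> h \<in> V \<Longrightarrow> ip (f + g) h = ip f h + ip g h"
    and ip_add_right: "\<And>f g h. f \<in> V \<Longrightarrow> g \<in> V \<Longrightarrow> h \<in> V \<Longrightarrow> ip h (f + g) = ip h f + ip h g"
    and ip_0: "\<And>f. ip 0 f = 0" "\<And>f. ip f 0 = 0"
    and S_V: "\<And>j f. f \<in> V \<Longrightarrow> S j f \<in> V" "\<And>j f. f \<in> V \<Longrightarrow> S' j f \<in> V"
    and S_add: "\<And>j f g. f \<in> V \<Longrightarrow> g \<in> V \<Longrightarrow> S j (f + g) = S j f + S j g" "\<And>j f g. f \<in> V \<Longrightarrow> g \<in> V \<Longrightarrow> S' j (f + g) = S' j f + S' j g"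
    and S_0: "\<And>j. S j 0 = 0" "\<And>j. S' j 0 = 0"
    and adj: "\<And>j f g. f \<in> V \<Longrightarrow> g \<in> V \<Longrightarrow> ip (S j f) g = ip f (S' j g)"
    and I: "finite I" and \<gamma>_pos: "\<And>i j. 0 < \<gamma> i j"
    and row: "\<And>i. i \<in> I \<Longrightarrow> (\<Sum>j\<in>I. \<gamma> i j) \<le> \<Gamma>"
    and b0: "\<And>j f. j \<in> I \<Longrightarrow> f \<in> V \<Longrightarrow> nrm (S j f) \<le> \<Gamma> * nrm f" "\<And>j f. j \<in> I \<Longrightarrow> f \<in> V \<Longrightarrow> nrm (S' j f) \<le> \<Gamma> * nrm f"
    and b1: "\<And>i j f. i \<in> I \<Longrightarrow> j \<in> I \<Longrightarrow> f \<in> V \<Longrightarrow> nrm (S' i (S j f)) \<le> (\<gamma> i j)\<^sup>2 * nrm f"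
    and b2: "\<And>i j f. i \<in> I \<Longrightarrow> j \<in> I \<Longrightarrow> f \<in> V \<Longrightarrow> nrm (S i (S' j f)) \<le> (\<gamma> i j)\<^sup>2 * nrm f"
    and \<Gamma>_pos: "0 < \<Gamma>"
begin

definition Sum :: "'v \<Rightarrow> 'v" where "Sum f = (\<Sum>j\<in>I. S j f)"
definition Sum' :: "'v \<Rightarrow> 'v" where "Sum' f = (\<Sum>j\<in>I. S' j f)"
definition B :: "'v \<Rightarrow> 'v" where "B f = Sum' (Sum f)"

lemma V_sum: "finite K \<Longrightarrow> (\<And>i. i \<in> K \<Longrightarrow> f i \<in> V) \<Longrightarrow> (\<Sum>i\<in>K. f i) \<in> V"
  by (induction K rule: finite_induct) (auto intro: V_0 V_add)

lemma nrm_sum: "finite K \<Longrightarrow> (\<And>i. i \<in> K \<Longrightarrow> f i \<in> V) \<Longrightarrow> nrm (\<Sum>i\<in>K. f i) \<le> (\<Sum>i\<in>K. nrm (f i))"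
proof (induction K rule: finite_induct)
  case (insert x F)
  have "nrm (f x + sum f F) \<le> nrm (f x) + nrm (sum f F)"
    using insert by (intro nrm_add V_sum) auto
  then show ?case using insert by force
qed (simp add: nrm_0)

lemma additive_sum:
  fixes P :: "'v \<Rightarrow> 'w::comm_monoid_add"
  assumes "\<And>f g. f \<in> V \<Longrightarrow> g \<in> V \<Longrightarrow> P (f + g) = P f + P g" "P 0 = 0" "finite K" "\<And>i. i \<in> K \<Longrightarrow> f i \<in> V"
  shows "P (\<Sum>i\<in>K. f i) = (\<Sum>i\<in>K. P (f i))"
  using assms(3,4)
proof (induction K rule: finite_induct)
  case (insert x F)
  have "P (f x + sum f F) = P (f x) + P (sum f F)"
    using insert by (intro assms(1) V_sum) auto
  then show ?case using insert by simp
qed (simp add: assms)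

lemma Sum_V: "f \<in> V \<Longrightarrow> Sum f \<in> V" "f \<in> V \<Longrightarrow> Sum' f \<in> V" "f \<in> V \<Longrightarrow> B f \<in> V"
  by (auto simp: Sum_def Sum'_def B_def intro!: V_sum I S_V)

lemma Sum_add: "f \<in> V \<Longrightarrow> g \<in> V \<Longrightarrow> Sum (f + g) = Sum f + Sum g"
  "f \<in> V \<Longrightarrow> g \<in> V \<Longrightarrow> Sum' (f + g) = Sum' f + Sum' g"
  "f \<in> V \<Longrightarrow> g \<in> V \<Longrightarrow> B (f + g) = B f + B g"
proof -
  show 1: "f \<in> V \<Longrightarrow> g \<in> V \<Longrightarrow> Sum (f + g) = Sum f + Sum g" for f g
    by (simp add: Sum_def S_add sum.distrib)
  show 2: "f \<in> V \<Longrightarrow> g \<in> V \<Longrightarrow> Sum' (f + g) = Sum' f + Sum' g" for f g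
    by (simp add: Sum'_def S_add sum.distrib)
  show "f \<in> V \<Longrightarrow> g \<in> V \<Longrightarrow> B (f + g) = B f + B g"
    by (simp add: B_def 1 2 Sum_V)
qed

lemma Sum_0: "Sum 0 = 0" "Sum' 0 = 0" "B 0 = 0"
  by (simp_all add: Sum_def Sum'_def B_def S_0)

lemma adj_Sum: "f \<in> V \<Longrightarrow> g \<in> V \<Longrightarrow> ip (Sum f) g = ip f (Sum' g)"
proof -
  assume f: "f \<in> V" and g: "g \<in> V"
  have "ip (Sum f) g = (\<Sum>j\<in>I. ip (S j f) g)"
    unfolding Sum_def by (rule additive_sum[of "\<lambda>h. ip h g"]) (auto intro: ip_add_left ip_0 I S_V f g)
  also have "\<dots> = (\<Sum>j\<in>I. ip f (S' j g))" by (simp add: adj f g)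
  also have "\<dots> = ip f (Sum' g)"
    unfolding Sum'_def by (rule additive_sum[of "\<lambda>h. ip f h", symmetric]) (auto intro: ip_add_right ip_0 I S_V f g)
  finally show ?thesis .
qed

primrec word :: "('j \<times> 'j) list \<Rightarrow> 'v \<Rightarrow> 'v" where
  "word [] f = f"
| "word (p # s) f = S' (fst p) (S (snd p) (word s f))"

lemma word_V: "f \<in> V \<Longrightarrow> word s f \<in> V"
  by (induction s) (auto intro: S_V)

text \<open>The first pairing: in each letter of the word \<open>S' i\<close> is combined with the
  \<open>S j\<close> that follows it.\<close>

primrec bd1 :: "('j \<times> 'j) list \<Rightarrow> real" where
  "bd1 [] = 1"
| "bd1 (p # s) = (\<gamma> (fst p) (snd p))\<^sup>2 * bd1 s"

text \<open>The shifted pairing for a word preceded by \<open>S k\<close>: each \<open>S\<close> is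
  combined with the \<open>S'\<close> of the next letter, and the last \<open>S\<close> stays alone
  and costs \<open>\<Gamma>\<close>.\<close>

primrec bd2 :: "'j \<Rightarrow> ('j \<times> 'j) list \<Rightarrow> real" where
  "bd2 k [] = \<Gamma>"
| "bd2 k (p # s) = (\<gamma> k (fst p))\<^sup>2 * bd2 (snd p) s"

lemma bd1_pos: "0 < bd1 s" using \<gamma>_pos by (induction s) (auto simp: less_imp_neq[symmetric])
lemma bd2_pos: "0 < bd2 k s" using \<gamma>_pos \<Gamma>_pos by (induction s arbitrary: k) (auto simp: less_imp_neq[symmetric])

lemma nrm_word_le_bd1: "set s \<subseteq> I \<times> I \<Longrightarrow> f \<in> V \<Longrightarrow> nrm (word s f) \<le> bd1 s * nrm f"
proof (induction s)
  case (Cons p s)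
  have "nrm (word (p # s) f) \<le> (\<gamma> (fst p) (snd p))\<^sup>2 * nrm (word s f)"
    using Cons.prems by (auto intro!: b1 word_V)
  also have "\<dots> \<le> (\<gamma> (fst p) (snd p))\<^sup>2 * (bd1 s * nrm f)"
    using Cons by (intro mult_left_mono) auto
  finally show ?case by (simp add: mult_ac)
qed auto

lemma nrm_S_word_le_bd2: "k \<in> I \<Longrightarrow> set s \<subseteq> I \<times> I \<Longrightarrow> f \<in> V \<Longrightarrow> nrm (S k (word s f)) \<le> bd2 k s * nrm f"
proof (induction s arbitrary: k)
  case Nil
  then show ?case by (simp add: b0)
next
  case (Cons p s)
  have "nrm (S k (word (p # s) f)) \<le> (\<gamma> k (fst p))\<^sup>2 * nrm (S (snd p) (word s f))"
    using Cons.prems by (auto intro!: b2 word_V S_V)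
  also have "\<dots> \<le> (\<gamma> k (fst p))\<^sup>2 * (bd2 (snd p) s * nrm f)"
    using Cons by (intro mult_left_mono) auto
  finally show ?case by (simp add: mult_ac)
qed

text \<open>The geometric mean of the two pairings. In the shifted one the leading \<open>S'\<close>
  of the word stays alone, which costs the additional \<open>\<Gamma>\<close>. The root turns the
  squares of \<open>\<gamma>\<close> into first powers.\<close>

definition bd :: "('j \<times> 'j) list \<Rightarrow> real" where
  "bd s = sqrt (bd1 s * (\<Gamma> * bd2 (snd (hd s)) (tl s)))"

lemma nrm_word_le:
  assumes "s \<noteq> []" "set s \<subseteq> I \<times> I" "f \<in> V"
  shows "nrm (word s f) \<le> bd s * nrm f"
proof -
  obtain p t where s: "s = p # t" using assms(1) by (cases s) auto
  have 1: "nrm (word s f) \<le> bd1 s * nrm f" by (rule nrm_word_le_bd1) fact+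
  have "nrm (word s f) \<le> \<Gamma> * nrm (S (snd p) (word t f))"
    using assms by (auto simp: s intro!: b0 S_V word_V)
  also have "\<dots> \<le> \<Gamma> * (bd2 (snd p) t * nrm f)"
    using assms \<Gamma>_pos by (intro mult_left_mono nrm_S_word_le_bd2) (auto simp: s)
  finally have 2: "nrm (word s f) \<le> \<Gamma> * bd2 (snd p) t * nrm f" by (simp add: mult_ac)
  have "(nrm (word s f))\<^sup>2 \<le> (bd1 s * nrm f) * (\<Gamma> * bd2 (snd p) t * nrm f)"
    unfolding power2_eq_square using 1 2 nrm_nonneg bd1_pos[of s] by (intro mult_mono) (auto intro: mult_nonneg_nonneg less_imp_le)
  then have "nrm (word s f) \<le> sqrt ((bd1 s * nrm f) * (\<Gamma> * bd2 (snd p) t * nrm f))"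
    by (rule real_le_rsqrt)
  also have "(bd1 s * nrm f) * (\<Gamma> * bd2 (snd p) t * nrm f) = (bd1 s * (\<Gamma> * bd2 (snd (hd s)) (tl s))) * (nrm f)\<^sup>2"
    by (simp add: s power2_eq_square mult_ac)
  also have "sqrt \<dots> = bd s * nrm f" using nrm_nonneg by (simp add: bd_def real_sqrt_mult)
  finally show ?thesis .
qed

lemma bd_nonneg: "0 \<le> bd s"
  unfolding bd_def using bd1_pos bd2_pos \<Gamma>_pos by (auto intro!: mult_nonneg_nonneg less_imp_le)

text \<open>Together the two pairings use each pair of neighbouring factors once, so a new letter
  contributes its inner pair and the pair at its junction with the old word. The junction exists
  only for a nonempty word.\<close>

lemma bd_Cons: "s \<noteq> [] \<Longrightarrow> bd ((i, j) # s) = \<gamma> i j * \<gamma> j (fst (hd s)) * bd s"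
proof -
  assume "s \<noteq> []"
  then obtain p t where s: "s = p # t" by (cases s) auto
  have "bd1 ((i, j) # s) * (\<Gamma> * bd2 (snd (hd ((i, j) # s))) (tl ((i, j) # s)))
     = (\<gamma> i j * \<gamma> j (fst p))\<^sup>2 * (bd1 s * (\<Gamma> * bd2 (snd p) t))"
    by (simp add: s power_mult_distrib mult_ac)
  then show ?thesis using \<gamma>_pos[of i j] \<gamma>_pos[of j "fst p"] by (simp add: bd_def s real_sqrt_mult real_sqrt_abs)
qed

lemma \<gamma>_sum_chain:
  assumes "k \<in> I" and sym: "\<And>i j. \<gamma> i j = \<gamma> j i"
  shows "(\<Sum>i\<in>I. \<Sum>j\<in>I. \<gamma> i j * \<gamma> j k) \<le> \<Gamma>\<^sup>2"
proof -
  have "(\<Sum>i\<in>I. \<Sum>j\<in>I. \<gamma> i j * \<gamma> j k) = (\<Sum>j\<in>I. (\<Sum>i\<in>I. \<gamma> j i) * \<gamma> k j)"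
    unfolding sum_distrib_right by (subst sum.swap, intro sum.cong refl) (metis sym)
  also have "\<dots> \<le> (\<Sum>j\<in>I. \<Gamma> * \<gamma> k j)"
    using row \<gamma>_pos by (intro sum_mono mult_right_mono) (auto intro: less_imp_le)
  also have "\<dots> \<le> \<Gamma> * \<Gamma>"
    using row[OF assms(1)] \<Gamma>_pos by (simp flip: sum_distrib_left)
  finally show ?thesis by (simp add: power2_eq_square)
qed

lemma B_power_V: "f \<in> V \<Longrightarrow> (B ^^ M) f \<in> V"
  by (induction M) (auto intro: Sum_V)

lemma B_power_add: "f \<in> V \<Longrightarrow> g \<in> V \<Longrightarrow> (B ^^ M) (f + g) = (B ^^ M) f + (B ^^ M) g"
  by (induction M) (auto simp: Sum_add B_power_V)

lemma B_power_0: "(B ^^ M) 0 = 0"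
  by (induction M) (auto simp: Sum_0)

lemma nrm_B_power_expand:
  assumes "g \<in> V"
  shows "nrm ((B ^^ Suc M) g) \<le> (\<Sum>i\<in>I. \<Sum>j\<in>I. nrm ((B ^^ M) (S' i (S j g))))"
proof -
  have "(B ^^ Suc M) g = (B ^^ M) (B g)" by (simp add: funpow_Suc_right del: funpow.simps)
  also have "B g = (\<Sum>i\<in>I. \<Sum>j\<in>I. S' i (S j g))"
  proof -
    have "S' i (\<Sum>j\<in>I. S j g) = (\<Sum>j\<in>I. S' i (S j g))" for i
      by (rule additive_sum) (auto intro: S_add S_0 I S_V assms)
    then show ?thesis by (simp add: B_def Sum_def Sum'_def)
  qed
  also have "(B ^^ M) \<dots> = (\<Sum>i\<in>I. (B ^^ M) (\<Sum>j\<in>I. S' i (S j g)))"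
    by (rule additive_sum) (auto intro!: B_power_add B_power_0 I V_sum S_V assms)
  also have "\<dots> = (\<Sum>i\<in>I. \<Sum>j\<in>I. (B ^^ M) (S' i (S j g)))"
    by (intro sum.cong refl additive_sum) (auto intro!: B_power_add B_power_0 I V_sum S_V assms)
  also have "nrm \<dots> \<le> (\<Sum>i\<in>I. nrm (\<Sum>j\<in>I. (B ^^ M) (S' i (S j g))))"
    by (intro nrm_sum I V_sum B_power_V S_V assms)
  also have "\<dots> \<le> (\<Sum>i\<in>I. \<Sum>j\<in>I. nrm ((B ^^ M) (S' i (S j g))))"
    by (intro sum_mono nrm_sum I V_sum B_power_V S_V assms)
  finally show ?thesis .
qed

text \<open>Each application of \<open>B\<close> is expanded into words with one more letter at the
  front. Summing \<open>bd_Cons\<close> over that letter costs \<open>\<Gamma>\<^sup>2\<close> by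
  \<open>\<gamma>_sum_chain\<close>, regardless of the number of indices.\<close>

lemma nrm_B_power_word:
  assumes sym: "\<And>i j. \<gamma> i j = \<gamma> j i"
  shows "s \<noteq> [] \<Longrightarrow> set s \<subseteq> I \<times> I \<Longrightarrow> f \<in> V \<Longrightarrow> nrm ((B ^^ M) (word s f)) \<le> (\<Gamma>\<^sup>2) ^ M * bd s * nrm f"
proof (induction M arbitrary: s)
  case 0
  then show ?case by (simp add: nrm_word_le)
next
  case (Suc M)
  have h: "fst (hd s) \<in> I" using Suc.prems by (cases s) auto
  have "nrm ((B ^^ Suc M) (word s f)) \<le> (\<Sum>i\<in>I. \<Sum>j\<in>I. nrm ((B ^^ M) (word ((i, j) # s) f)))"
    using nrm_B_power_expand[OF word_V[OF Suc.prems(3)], of M s] by simp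
  also have "\<dots> \<le> (\<Sum>i\<in>I. \<Sum>j\<in>I. (\<Gamma>\<^sup>2) ^ M * bd ((i, j) # s) * nrm f)"
    using Suc.prems by (intro sum_mono Suc.IH) auto
  also have "\<dots> = (\<Sum>i\<in>I. \<Sum>j\<in>I. \<gamma> i j * \<gamma> j (fst (hd s))) * ((\<Gamma>\<^sup>2) ^ M * bd s * nrm f)"
    unfolding sum_distrib_right by (intro sum.cong refl) (simp add: bd_Cons Suc.prems mult_ac)
  also have "\<dots> \<le> \<Gamma>\<^sup>2 * ((\<Gamma>\<^sup>2) ^ M * bd s * nrm f)"
    using bd_nonneg nrm_nonneg by (intro mult_right_mono \<gamma>_sum_chain h sym mult_nonneg_nonneg) auto
  finally show ?case by (simp add: mult_ac)
qed

text \<open>The constant depends on \<open>f\<close> and on the index set, which is harmless: it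
  disappears when high powers are compared.\<close>

lemma nrm_B_power_le:
  assumes sym: "\<And>i j. \<gamma> i j = \<gamma> j i" and f: "f \<in> V"
  shows "\<exists>K. 0 \<le> K \<and> (\<forall>M. nrm ((B ^^ Suc M) f) \<le> K * (\<Gamma>\<^sup>2) ^ M)"
proof (intro exI conjI allI)
  let ?K = "(\<Sum>i\<in>I. \<Sum>j\<in>I. bd [(i, j)] * nrm f)"
  show "0 \<le> ?K" using bd_nonneg nrm_nonneg by (intro sum_nonneg) auto
  fix M
  have "nrm ((B ^^ Suc M) f) \<le> (\<Sum>i\<in>I. \<Sum>j\<in>I. nrm ((B ^^ M) (word [(i, j)] f)))"
    using nrm_B_power_expand[OF f] by simp
  also have "\<dots> \<le> (\<Sum>i\<in>I. \<Sum>j\<in>I. (\<Gamma>\<^sup>2) ^ M * bd [(i, j)] * nrm f)"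
    by (intro sum_mono nrm_B_power_word sym f) auto
  also have "\<dots> = ?K * (\<Gamma>\<^sup>2) ^ M" unfolding sum_distrib_right by (intro sum.cong refl) (simp add: mult_ac)
  finally show "nrm ((B ^^ Suc M) f) \<le> ?K * (\<Gamma>\<^sup>2) ^ M" .
qed

text \<open>The argument runs with one fixed vector instead of an operator norm. Repeated
  Cauchy-Schwarz bounds high powers of the quotient \<open>x\<close> by the norm of \<open>B\<close>
  to a power of two applied to \<open>f\<close>, which grows at most like the corresponding power of
  \<open>\<Gamma>\<^sup>2\<close>.\<close>

theorem nrm_Sum_le:
  assumes sym: "\<And>i j. \<gamma> i j = \<gamma> j i" and herm: "\<And>f g. f \<in> V \<Longrightarrow> g \<in> V \<Longrightarrow> ip g f = cnj (ip f g)" and f: "f \<in> V"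
  shows "nrm (Sum f) \<le> \<Gamma> * nrm f"
proof (cases "nrm f = 0")
  case True
  have "(nrm (Sum f))\<^sup>2 = norm (ip f (Sum' (Sum f)))"
    using ip_self[of "Sum f"] adj_Sum[of f "Sum f"] f Sum_V by simp
  also have "\<dots> \<le> nrm f * nrm (Sum' (Sum f))" by (intro ip_le f Sum_V)
  finally show ?thesis using True by simp
next
  case False
  then have nf: "0 < nrm f" using nrm_nonneg[of f] by simp
  have adjB: "ip (B g) h = ip g (B h)" if "g \<in> V" "h \<in> V" for g h
  proof -
    have "ip (B g) h = cnj (ip h (Sum' (Sum g)))" unfolding B_def using that by (intro herm Sum_V)
    also have "ip h (Sum' (Sum g)) = ip (Sum h) (Sum g)" using that by (intro adj_Sum[symmetric] Sum_V)
    also have "cnj (ip (Sum h) (Sum g)) = ip (Sum g) (Sum h)" using that by (intro herm[symmetric] Sum_V)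
    also have "\<dots> = ip g (B h)" unfolding B_def using that by (intro adj_Sum Sum_V)
    finally show ?thesis .
  qed
  \<comment> \<open>Self-adjointness of \<open>B\<close> moves half of the factors to the other side
    of the inner product.\<close>
  have sq: "(nrm ((B ^^ M) f))\<^sup>2 \<le> nrm ((B ^^ (2 * M)) f) * nrm f" for M
  proof -
    have move: "ip ((B ^^ m) g) h = ip g ((B ^^ m) h)" if "g \<in> V" "h \<in> V" for m g h
      using that
    proof (induction m arbitrary: h)
      case (Suc m)
      have "ip ((B ^^ Suc m) g) h = ip ((B ^^ m) g) (B h)" using Suc.prems by (simp add: adjB B_power_V)
      also have "\<dots> = ip g ((B ^^ m) (B h))" using Suc.prems by (intro Suc.IH Sum_V)
      finally show ?case by (simp add: funpow_swap1)
    qed simp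
    have "(nrm ((B ^^ M) f))\<^sup>2 = norm (ip ((B ^^ M) f) ((B ^^ M) f))" using f by (intro ip_self[symmetric] B_power_V)
    also have "\<dots> = norm (ip f ((B ^^ (2 * M)) f))"
      using f by (simp add: move B_power_V mult_2 funpow_add)
    also have "\<dots> \<le> nrm f * nrm ((B ^^ (2 * M)) f)" using f by (intro ip_le B_power_V)
    finally show ?thesis by (simp add: mult.commute)
  qed
  define x where "x = nrm (Sum f) / nrm f"
  have x0: "0 \<le> x" using nrm_nonneg nf by (simp add: x_def)
  have pow: "(x\<^sup>2) ^ (2 ^ m) * nrm f \<le> nrm ((B ^^ (2 ^ m)) f)" for m
  proof (induction m)
    case 0
    have "(nrm (Sum f))\<^sup>2 = norm (ip f (B f))"
      using ip_self[of "Sum f"] adj_Sum[of f "Sum f"] f Sum_V by (simp add: B_def)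
    also have "\<dots> \<le> nrm f * nrm (B f)" by (intro ip_le f Sum_V)
    finally show ?case using nf by (simp add: x_def power_divide power2_eq_square field_simps)
  next
    case (Suc m)
    have "((x\<^sup>2) ^ (2 ^ m) * nrm f)\<^sup>2 \<le> (nrm ((B ^^ (2 ^ m)) f))\<^sup>2"
      using Suc nf x0 by (intro power_mono) auto
    also have "\<dots> \<le> nrm ((B ^^ (2 * 2 ^ m)) f) * nrm f" by (rule sq)
    finally have "((x\<^sup>2) ^ (2 ^ m))\<^sup>2 * nrm f * nrm f \<le> nrm ((B ^^ (2 * 2 ^ m)) f) * nrm f"
      by (simp add: power2_eq_square mult_ac)
    then have "((x\<^sup>2) ^ (2 ^ m))\<^sup>2 * nrm f \<le> nrm ((B ^^ (2 * 2 ^ m)) f)" using nf by simp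
    then show ?case by (simp add: mult.commute flip: power_mult)
  qed
  obtain K where K: "0 \<le> K" "\<And>M. nrm ((B ^^ Suc M) f) \<le> K * (\<Gamma>\<^sup>2) ^ M"
    using nrm_B_power_le[OF sym f] by blast
  have "x \<le> \<Gamma>"
  proof (rule ccontr)
    assume "\<not> x \<le> \<Gamma>"
    \<comment> \<open>If the quotient exceeded \<open>\<Gamma>\<close>, the powers of this ratio
      would be unbounded, while \<open>bd\<close> bounds them along the powers of two.\<close>
    then have q: "1 < x\<^sup>2 / \<Gamma>\<^sup>2" using \<Gamma>_pos by (simp add: power_strict_mono)
    have bd: "(x\<^sup>2 / \<Gamma>\<^sup>2) ^ (2 ^ m) \<le> K / (\<Gamma>\<^sup>2 * nrm f)" for m
    proof -
      obtain M where M: "2 ^ m = Suc M" by (metis not0_implies_Suc power_not_zero zero_neq_numeral)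
      have "(x\<^sup>2) ^ (2 ^ m) * nrm f \<le> K * (\<Gamma>\<^sup>2) ^ M" using pow[of m] K(2)[of M] unfolding M by linarith
      then have "(x\<^sup>2) ^ Suc M * nrm f * \<Gamma>\<^sup>2 \<le> K * (\<Gamma>\<^sup>2) ^ M * \<Gamma>\<^sup>2" unfolding M by (rule mult_right_mono) simp
      then have "(x\<^sup>2) ^ Suc M * (nrm f * \<Gamma>\<^sup>2) \<le> K * (\<Gamma>\<^sup>2) ^ Suc M" by (simp add: mult_ac)
      then show ?thesis unfolding M using nf \<Gamma>_pos by (simp only: power_divide) (simp add: field_simps)
    qed
    obtain m where "K / (\<Gamma>\<^sup>2 * nrm f) < (x\<^sup>2 / \<Gamma>\<^sup>2) ^ m" using real_arch_pow[OF q] by blast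
    also have "\<dots> \<le> (x\<^sup>2 / \<Gamma>\<^sup>2) ^ (2 ^ m)" using q by (intro power_increasing) (auto intro: less_imp_le)
    finally show False using bd[of m] by simp
  qed
  then show ?thesis using nf by (simp add: x_def field_simps)
qed

end

section \<open>The inner product space of integrable and square integrable functions\<close>

definition L12 :: "(real ^ 'n \<Rightarrow> complex) set" where
  "L12 = {f. integrable lborel f \<and> integrable lborel (\<lambda>x. (norm (f x))\<^sup>2)}"

definition L2_norm :: "(real ^ 'n \<Rightarrow> complex) \<Rightarrow> real" where
  "L2_norm f = sqrt (\<integral>x. (norm (f x))\<^sup>2 \<partial>lborel)"

definition L2_ip :: "(real ^ 'n \<Rightarrow> complex) \<Rightarrow> (real ^ 'n \<Rightarrow> complex) \<Rightarrow> complex" where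
  "L2_ip f g = (\<integral>x. f x * cnj (g x) \<partial>lborel)"

lemma L12_measurable: "f \<in> L12 \<Longrightarrow> f \<in> borel_measurable borel"
  using borel_measurable_integrable[of lborel f] by (simp add: L12_def)

lemma L12I:
  assumes "f \<in> borel_measurable borel" "(\<integral>\<^sup>+x. ennreal (norm (f x)) \<partial>lborel) < \<infinity>" "(\<integral>\<^sup>+x. ennreal ((norm (f x))\<^sup>2) \<partial>lborel) < \<infinity>"
  shows "f \<in> L12"
  using assms by (auto simp: L12_def intro!: integrableI_bounded integrableI_nonneg)

lemma nn_integral_L2:
  assumes "f \<in> L12" shows "(\<integral>\<^sup>+x. ennreal ((norm (f x))\<^sup>2) \<partial>lborel) = ennreal ((L2_norm f)\<^sup>2)"
  using assms by (subst nn_integral_eq_integral) (auto simp: L12_def L2_norm_def)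

lemma L2_norm_nonneg: "0 \<le> L2_norm f"
  by (simp add: L2_norm_def)

lemma integrable_L2_product:
  assumes f: "f \<in> L12" and g: "g \<in> L12"
  shows "integrable lborel (\<lambda>x. f x * cnj (g x))"
proof (rule Bochner_Integration.integrable_bound)
  have [measurable]: "f \<in> borel_measurable borel" "g \<in> borel_measurable borel" by (intro L12_measurable f g)+
  show "integrable lborel (\<lambda>x. (norm (f x))\<^sup>2 + (norm (g x))\<^sup>2)" using f g by (simp add: L12_def)
  show "(\<lambda>x. f x * cnj (g x)) \<in> borel_measurable lborel" by measurable
  have "norm (f x) * norm (g x) \<le> (norm (f x))\<^sup>2 + (norm (g x))\<^sup>2" for x
  proof -
    have "2 * norm (f x) * norm (g x) \<le> (norm (f x))\<^sup>2 + (norm (g x))\<^sup>2" by (rule sum_squares_bound)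
    moreover have "0 \<le> norm (f x) * norm (g x)" by simp
    ultimately show ?thesis by linarith
  qed
  then show "AE x in lborel. norm (f x * cnj (g x)) \<le> norm ((norm (f x))\<^sup>2 + (norm (g x))\<^sup>2)"
    by (intro AE_I2) (simp add: norm_mult)
qed

lemma L2_ip_le:
  assumes f: "f \<in> L12" and g: "g \<in> L12" shows "norm (L2_ip f g) \<le> L2_norm f * L2_norm g"
proof -
  have [measurable]: "f \<in> borel_measurable borel" "g \<in> borel_measurable borel" by (intro L12_measurable f g)+
  have "ennreal (norm (L2_ip f g)) \<le> (\<integral>\<^sup>+x. ennreal (norm (f x)) * ennreal (norm (g x)) \<partial>lborel)"
    using norm_integral_le_nn_integral[where h="\<lambda>x. f x * cnj (g x)" and M=lborel]
    unfolding L2_ip_def by (simp add: norm_mult ennreal_mult)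
  also have "\<dots> \<le> ennreal (sqrt ((L2_norm f)\<^sup>2 * (L2_norm g)\<^sup>2))"
  proof (rule ennreal_le_sqrt)
    have "(\<integral>\<^sup>+x. ennreal (norm (f x)) * ennreal (norm (g x)) \<partial>lborel)\<^sup>2
       \<le> (\<integral>\<^sup>+x. (ennreal (norm (f x)))\<^sup>2 \<partial>lborel) * (\<integral>\<^sup>+x. (ennreal (norm (g x)))\<^sup>2 \<partial>lborel)"
      by (rule Cauchy_Schwarz_nn_integral) measurable
    also have "\<dots> = ennreal ((L2_norm f)\<^sup>2 * (L2_norm g)\<^sup>2)"
      by (simp add: ennreal_power nn_integral_L2 f g ennreal_mult)
    finally show "(\<integral>\<^sup>+x. ennreal (norm (f x)) * ennreal (norm (g x)) \<partial>lborel)\<^sup>2 \<le> \<dots>" .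
  qed simp
  also have "sqrt ((L2_norm f)\<^sup>2 * (L2_norm g)\<^sup>2) = L2_norm f * L2_norm g"
    by (simp add: real_sqrt_mult L2_norm_nonneg)
  finally show ?thesis using mult_nonneg_nonneg[OF L2_norm_nonneg[of f] L2_norm_nonneg[of g]] by (simp only: ennreal_le_iff)
qed

lemma L2_ip_self: "f \<in> L12 \<Longrightarrow> norm (L2_ip f f) = (L2_norm f)\<^sup>2"
proof -
  have "L2_ip f f = complex_of_real (\<integral>x. (norm (f x))\<^sup>2 \<partial>lborel)"
    unfolding L2_ip_def complex_norm_square[symmetric] by (rule integral_complex_of_real)
  then show ?thesis by (simp add: L2_norm_def)
qed

lemma L12_add: assumes f: "f \<in> L12" and g: "g \<in> L12" shows "f + g \<in> L12"
proof -
  have [measurable]: "f \<in> borel_measurable borel" "g \<in> borel_measurable borel" by (intro L12_measurable f g)+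
  have "integrable lborel (\<lambda>x. (norm (f x + g x))\<^sup>2)"
  proof (rule Bochner_Integration.integrable_bound)
    show "integrable lborel (\<lambda>x. 2 * (norm (f x))\<^sup>2 + 2 * (norm (g x))\<^sup>2)" using f g by (simp add: L12_def)
    have "(norm (f x + g x))\<^sup>2 \<le> 2 * (norm (f x))\<^sup>2 + 2 * (norm (g x))\<^sup>2" for x
    proof -
      have "(norm (f x + g x))\<^sup>2 \<le> (norm (f x) + norm (g x))\<^sup>2" by (intro power_mono norm_triangle_ineq) auto
      also have "\<dots> \<le> 2 * (norm (f x))\<^sup>2 + 2 * (norm (g x))\<^sup>2"
        using sum_squares_bound[of "norm (f x)" "norm (g x)"] by (simp add: power2_sum)
      finally show ?thesis .
    qed
    then show "AE x in lborel. norm ((norm (f x + g x))\<^sup>2) \<le> norm (2 * (norm (f x))\<^sup>2 + 2 * (norm (g x))\<^sup>2)" by (intro AE_I2) simp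
  qed measurable
  moreover have "integrable lborel (\<lambda>x. f x + g x)" using f g by (simp add: L12_def)
  ultimately show ?thesis by (simp add: L12_def plus_fun_def)
qed

lemma L12_0: "0 \<in> L12" and L2_norm_0: "L2_norm 0 = 0" and L2_ip_0: "L2_ip 0 f = 0" "L2_ip f 0 = 0"
  by (simp_all add: L12_def L2_norm_def L2_ip_def zero_fun_def)

lemma L2_ip_add:
  assumes "f \<in> L12" "g \<in> L12" "h \<in> L12"
  shows "L2_ip (f + g) h = L2_ip f h + L2_ip g h" "L2_ip h (f + g) = L2_ip h f + L2_ip h g"
  using assms by (simp_all add: L2_ip_def distrib_left distrib_right integrable_L2_product)

lemma L2_ip_cnj: "f \<in> L12 \<Longrightarrow> g \<in> L12 \<Longrightarrow> L2_ip g f = cnj (L2_ip f g)"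
  unfolding L2_ip_def by (subst Bochner_Integration.integral_cnj[symmetric]) (simp add: mult.commute)

lemma L2_norm_add:
  assumes f: "f \<in> L12" and g: "g \<in> L12" shows "L2_norm (f + g) \<le> L2_norm f + L2_norm g"
proof (cases "L2_norm (f + g) = 0")
  case True then show ?thesis using L2_norm_nonneg[of f] L2_norm_nonneg[of g] by simp
next
  case False
  then have pos: "0 < L2_norm (f + g)" using L2_norm_nonneg[of "f + g"] by simp
  have fg: "f + g \<in> L12" by (rule L12_add) fact+
  have "(L2_norm (f + g))\<^sup>2 = norm (L2_ip f (f + g) + L2_ip g (f + g))"
    using L2_ip_self[OF fg] L2_ip_add(1)[OF f g fg] by simp
  also have "\<dots> \<le> norm (L2_ip f (f + g)) + norm (L2_ip g (f + g))" by (rule norm_triangle_ineq)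
  also have "\<dots> \<le> L2_norm f * L2_norm (f + g) + L2_norm g * L2_norm (f + g)"
    by (intro add_mono L2_ip_le f g fg)
  finally have "L2_norm (f + g) * L2_norm (f + g) \<le> (L2_norm f + L2_norm g) * L2_norm (f + g)"
    by (simp add: power2_eq_square algebra_simps)
  then show ?thesis using pos by simp
qed

text \<open>The modulus of the kernel is split into two square roots, one of which is paired with
  \<open>f\<close>; Cauchy-Schwarz then needs only the row and column integrals.\<close>

lemma schur_test:
  fixes G :: "real ^ 'n \<Rightarrow> real ^ 'n \<Rightarrow> complex"
  assumes [measurable]: "case_prod G \<in> borel_measurable (borel \<Otimes>\<^sub>M borel)" "f \<in> borel_measurable borel"
    and r: "\<And>x. (\<integral>\<^sup>+y. ennreal (norm (G x y)) \<partial>lborel) \<le> ennreal b" and c: "\<And>y. (\<integral>\<^sup>+x. ennreal (norm (G x y)) \<partial>lborel) \<le> ennreal b"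
  shows "(\<integral>\<^sup>+x. ennreal ((norm (\<integral>y. G x y * f y \<partial>lborel))\<^sup>2) \<partial>lborel) \<le> (ennreal b)\<^sup>2 * (\<integral>\<^sup>+x. ennreal ((norm (f x))\<^sup>2) \<partial>lborel)"
    and "(\<integral>\<^sup>+x. ennreal (norm (\<integral>y. G x y * f y \<partial>lborel)) \<partial>lborel) \<le> ennreal b * (\<integral>\<^sup>+x. ennreal (norm (f x)) \<partial>lborel)"
proof -
  have n: "ennreal (norm (\<integral>y. G x y * f y \<partial>lborel)) \<le> (\<integral>\<^sup>+y. ennreal (norm (G x y)) * ennreal (norm (f y)) \<partial>lborel)" for x
    using norm_integral_le_nn_integral[where h="\<lambda>y. G x y * f y" and M=lborel] by (simp add: norm_mult ennreal_mult)
  have pt: "ennreal ((norm (\<integral>y. G x y * f y \<partial>lborel))\<^sup>2) \<le> ennreal b * (\<integral>\<^sup>+y. ennreal (norm (G x y)) * ennreal ((norm (f y))\<^sup>2) \<partial>lborel)" for x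
  proof -
    have "ennreal ((norm (\<integral>y. G x y * f y \<partial>lborel))\<^sup>2) = (ennreal (norm (\<integral>y. G x y * f y \<partial>lborel)))\<^sup>2" by (simp add: ennreal_power)
    also have "\<dots> \<le> (\<integral>\<^sup>+y. ennreal (norm (G x y)) * ennreal (norm (f y)) \<partial>lborel)\<^sup>2" by (intro power_mono n) simp
    also have "\<dots> = (\<integral>\<^sup>+y. ennreal (sqrt (norm (G x y))) * ennreal (sqrt (norm (G x y)) * norm (f y)) \<partial>lborel)\<^sup>2"
      by (simp flip: ennreal_mult mult.assoc)
    also have "\<dots> \<le> (\<integral>\<^sup>+y. (ennreal (sqrt (norm (G x y))))\<^sup>2 \<partial>lborel) * (\<integral>\<^sup>+y. (ennreal (sqrt (norm (G x y)) * norm (f y)))\<^sup>2 \<partial>lborel)"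
      by (rule Cauchy_Schwarz_nn_integral) measurable
    also have "\<dots> = (\<integral>\<^sup>+y. ennreal (norm (G x y)) \<partial>lborel) * (\<integral>\<^sup>+y. ennreal (norm (G x y)) * ennreal ((norm (f y))\<^sup>2) \<partial>lborel)"
      by (simp add: ennreal_power power_mult_distrib ennreal_mult)
    also have "\<dots> \<le> ennreal b * (\<integral>\<^sup>+y. ennreal (norm (G x y)) * ennreal ((norm (f y))\<^sup>2) \<partial>lborel)"
      by (intro mult_right_mono r) simp
    finally show ?thesis .
  qed
  have sw: "(\<integral>\<^sup>+x. (\<integral>\<^sup>+y. ennreal (norm (G x y)) * h y \<partial>lborel) \<partial>lborel) \<le> ennreal b * (\<integral>\<^sup>+y. h y \<partial>lborel)"
    if [measurable]: "h \<in> borel_measurable borel" for h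
  proof -
    have "(\<integral>\<^sup>+x. (\<integral>\<^sup>+y. ennreal (norm (G x y)) * h y \<partial>lborel) \<partial>lborel) = (\<integral>\<^sup>+y. (\<integral>\<^sup>+x. ennreal (norm (G x y)) * h y \<partial>lborel) \<partial>lborel)"
      by (rule lborel_pair.Fubini') measurable
    also have "\<dots> \<le> (\<integral>\<^sup>+y. ennreal b * h y \<partial>lborel)"
      using c by (intro nn_integral_mono) (simp add: nn_integral_multc mult_right_mono)
    finally show ?thesis by (simp add: nn_integral_cmult)
  qed
  have "(\<integral>\<^sup>+x. ennreal ((norm (\<integral>y. G x y * f y \<partial>lborel))\<^sup>2) \<partial>lborel)
     \<le> (\<integral>\<^sup>+x. ennreal b * (\<integral>\<^sup>+y. ennreal (norm (G x y)) * ennreal ((norm (f y))\<^sup>2) \<partial>lborel) \<partial>lborel)"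
    by (intro nn_integral_mono pt)
  also have "\<dots> \<le> ennreal b * (ennreal b * (\<integral>\<^sup>+x. ennreal ((norm (f x))\<^sup>2) \<partial>lborel))"
    by (subst nn_integral_cmult) (auto intro!: mult_left_mono sw)
  finally show "(\<integral>\<^sup>+x. ennreal ((norm (\<integral>y. G x y * f y \<partial>lborel))\<^sup>2) \<partial>lborel) \<le> (ennreal b)\<^sup>2 * (\<integral>\<^sup>+x. ennreal ((norm (f x))\<^sup>2) \<partial>lborel)"
    by (simp add: power2_eq_square mult.assoc)
  show "(\<integral>\<^sup>+x. ennreal (norm (\<integral>y. G x y * f y \<partial>lborel)) \<partial>lborel) \<le> ennreal b * (\<integral>\<^sup>+x. ennreal (norm (f x)) \<partial>lborel)"
    by (rule order_trans[OF nn_integral_mono[OF n] sw]) measurable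
qed

lemma schur_L12:
  fixes G :: "real ^ 'n \<Rightarrow> real ^ 'n \<Rightarrow> complex"
  assumes G: "case_prod G \<in> borel_measurable (borel \<Otimes>\<^sub>M borel)" and f: "f \<in> L12"
    and r: "\<And>x. (\<integral>\<^sup>+y. ennreal (norm (G x y)) \<partial>lborel) \<le> ennreal b" and c: "\<And>y. (\<integral>\<^sup>+x. ennreal (norm (G x y)) \<partial>lborel) \<le> ennreal b"
    and "0 \<le> b"
  shows "(\<lambda>x. \<integral>y. G x y * f y \<partial>lborel) \<in> L12" "L2_norm (\<lambda>x. \<integral>y. G x y * f y \<partial>lborel) \<le> b * L2_norm f"
proof -
  note [measurable] = G L12_measurable[OF f]
  note s = schur_test[OF G L12_measurable[OF f] r c]
  have "(\<integral>\<^sup>+x. ennreal (norm (f x)) \<partial>lborel) < \<infinity>" using f by (simp add: L12_def integrable_iff_bounded)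
  then have "ennreal b * (\<integral>\<^sup>+x. ennreal (norm (f x)) \<partial>lborel) < \<infinity>" by (simp add: ennreal_mult_less_top)
  moreover have "(ennreal b)\<^sup>2 * (\<integral>\<^sup>+x. ennreal ((norm (f x))\<^sup>2) \<partial>lborel) = ennreal ((b * L2_norm f)\<^sup>2)"
    using \<open>0 \<le> b\<close> by (simp add: nn_integral_L2[OF f] ennreal_power power_mult_distrib ennreal_mult)
  moreover have "(\<lambda>x. \<integral>y. G x y * f y \<partial>lborel) \<in> borel_measurable borel" by measurable
  ultimately show V: "(\<lambda>x. \<integral>y. G x y * f y \<partial>lborel) \<in> L12"
    using s by (intro L12I) (auto intro: le_less_trans)
  have "ennreal ((L2_norm (\<lambda>x. \<integral>y. G x y * f y \<partial>lborel))\<^sup>2) \<le> ennreal ((b * L2_norm f)\<^sup>2)"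
    using s(1) \<open>(ennreal b)\<^sup>2 * _ = _\<close> by (simp add: nn_integral_L2[OF V])
  then have "(L2_norm (\<lambda>x. \<integral>y. G x y * f y \<partial>lborel))\<^sup>2 \<le> (b * L2_norm f)\<^sup>2" by (simp add: ennreal_le_iff)
  then show "L2_norm (\<lambda>x. \<integral>y. G x y * f y \<partial>lborel) \<le> b * L2_norm f"
    by (rule power2_le_imp_le) (intro mult_nonneg_nonneg \<open>0 \<le> b\<close> L2_norm_nonneg)
qed

text \<open>The integrals of the kernels are only required to decay: they do not vanish, since the
  argument at which the symbol is evaluated may move with the integration variable. The rate will be
  \<open>c = 1 - \<delta>\<close>; \<open>c \<le> 1\<close> lets the gain from smoothness be
  absorbed in that from cancellation.\<close>

locale cz_family = kernel_family k 1 A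
  for k :: "nat \<Rightarrow> real ^ 'n \<Rightarrow> real ^ 'n \<Rightarrow> complex" and A :: real +
  fixes c :: real
  assumes c: "0 < c" "c \<le> 1"
    and smooth_right: "\<And>j x y y'. norm (y - y') \<le> CARD('n) / 2 ^ j \<Longrightarrow>
      norm (k j x y - k j x y') \<le> A * (2 ^ j * norm (y - y')) * peak (CARD('n) + 2) (dscale 1 j) (x - y)"
    and cancel_right: "\<And>j x. norm (\<integral>y. k j x y \<partial>lborel) \<le> A * 2 powr (- c * real j)"
    and cancel_left: "\<And>j y. norm (\<integral>x. k j x y \<partial>lborel) \<le> A * 2 powr (- c * real j)"
begin

abbreviation \<Phi> :: "nat \<Rightarrow> real ^ 'n \<Rightarrow> real" where "\<Phi> j \<equiv> peak (CARD('n) + 2) (dscale 1 j)"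
abbreviation \<Phi>' :: "nat \<Rightarrow> real ^ 'n \<Rightarrow> real" where "\<Phi>' j \<equiv> peak (CARD('n) + 1) (dscale 1 j)"

definition C0 :: real where "C0 = 4 ^ (CARD('n) + 1)"

lemma C0: "1 \<le> C0" unfolding C0_def by (rule one_le_power) simp

lemma nn_integral_\<Phi>:
  "(\<integral>\<^sup>+y. ennreal (\<Phi> j (x - y)) \<partial>lborel) \<le> ennreal C0" "(\<integral>\<^sup>+x. ennreal (\<Phi> j (x - y)) \<partial>lborel) \<le> ennreal C0"
  "(\<integral>\<^sup>+y. ennreal (\<Phi>' j (x - y)) \<partial>lborel) \<le> ennreal C0" "(\<integral>\<^sup>+x. ennreal (\<Phi>' j (x - y)) \<partial>lborel) \<le> ennreal C0"
  unfolding C0_def by (rule nn_integral_peak_diff; simp)+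

lemma measurable_flip: "case_prod (\<lambda>x y. k j y x) \<in> borel_measurable (borel \<Otimes>\<^sub>M borel)"
proof -
  have "(\<lambda>p. case_prod (k j) (snd p, fst p)) \<in> borel_measurable (borel \<Otimes>\<^sub>M borel)"
    by (rule measurable_compose[OF _ k_measurable]) measurable
  then show ?thesis by (simp add: split_def)
qed

text \<open>The hypotheses are symmetric in the two variables. Estimates for the products
  \<open>T i (T' j f)\<close> are therefore instances of those for
  \<open>T' i (T j f)\<close>.\<close>

lemma adjoint_family: "cz_family (\<lambda>j x y. cnj (k j y x)) A c"
proof
  show "case_prod (\<lambda>x y. cnj (k j y x)) \<in> borel_measurable (borel \<Otimes>\<^sub>M borel)" for j
    using measurable_compose[OF measurable_flip cnj_measurable] by (simp add: split_def)
  show "norm (cnj (k j y x)) \<le> A * \<Phi> j (x - y)" for j x y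
    using size[of j y x] by (simp add: peak_minus_commute)
  show "norm (cnj (k j y x) - cnj (k j y x')) \<le> A * (2 ^ j * norm (x - x')) * \<Phi> j (x - y)"
    if "norm (x - x') \<le> CARD('n) / 2 ^ j" for j x x' y
    using smooth_right[OF that, of y] by (simp add: peak_minus_commute flip: complex_cnj_diff)
  show "norm (cnj (k j y x) - cnj (k j y' x)) \<le> A * (2 ^ j * norm (y - y')) * \<Phi> j (x - y)"
    if "norm (y - y') \<le> CARD('n) / 2 ^ j" for j x y y'
    using smooth_left[OF that, of x] by (simp add: peak_minus_commute flip: complex_cnj_diff)
  show "norm (\<integral>y. cnj (k j y x) \<partial>lborel) \<le> A * 2 powr (- c * real j)" for j x
    using cancel_left[of j x] by simp
  show "norm (\<integral>x. cnj (k j y x) \<partial>lborel) \<le> A * 2 powr (- c * real j)" for j y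
    using cancel_right[of j y] by simp
qed (use c A_pos in auto)

lemma nn_integral_k:
  "(\<integral>\<^sup>+y. ennreal (norm (k j x y)) \<partial>lborel) \<le> ennreal (A * C0)" "(\<integral>\<^sup>+x. ennreal (norm (k j x y)) \<partial>lborel) \<le> ennreal (A * C0)"
proof -
  have "(\<integral>\<^sup>+y. ennreal (norm (k j x y)) \<partial>lborel) \<le> (\<integral>\<^sup>+y. ennreal A * ennreal (\<Phi> j (x - y)) \<partial>lborel)"
    using size A_pos by (intro nn_integral_mono) (auto simp: ennreal_mult[symmetric] intro!: ennreal_leI)
  also have "\<dots> = ennreal A * (\<integral>\<^sup>+y. ennreal (\<Phi> j (x - y)) \<partial>lborel)" by (rule nn_integral_cmult) measurable
  also have "\<dots> \<le> ennreal A * ennreal C0" by (rule mult_left_mono[OF nn_integral_\<Phi>(1)]) simp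
  finally show "(\<integral>\<^sup>+y. ennreal (norm (k j x y)) \<partial>lborel) \<le> ennreal (A * C0)" using A_pos C0 by (simp add: ennreal_mult)
  have "(\<integral>\<^sup>+x. ennreal (norm (k j x y)) \<partial>lborel) \<le> (\<integral>\<^sup>+x. ennreal A * ennreal (\<Phi> j (x - y)) \<partial>lborel)"
    using size A_pos by (intro nn_integral_mono) (auto simp: ennreal_mult[symmetric] intro!: ennreal_leI)
  also have "\<dots> = ennreal A * (\<integral>\<^sup>+x. ennreal (\<Phi> j (x - y)) \<partial>lborel)" by (rule nn_integral_cmult) measurable
  also have "\<dots> \<le> ennreal A * ennreal C0" by (rule mult_left_mono[OF nn_integral_\<Phi>(2)]) simp
  finally show "(\<integral>\<^sup>+x. ennreal (norm (k j x y)) \<partial>lborel) \<le> ennreal (A * C0)" using A_pos C0 by (simp add: ennreal_mult)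
qed

lemma k_measurable_left [measurable]: "(\<lambda>x. k j x y) \<in> borel_measurable borel"
proof -
  have "(\<lambda>x. case_prod (k j) (x, y)) \<in> borel_measurable borel"
    by (rule measurable_compose[OF _ k_measurable]) measurable
  then show ?thesis by simp
qed

lemma integrable_k: "integrable lborel (k j x)" "integrable lborel (\<lambda>x. k j x y)"
  using nn_integral_k(1)[of j x] nn_integral_k(2)[of j y] by (auto intro!: integrableI_bounded intro: le_less_trans)

text \<open>Without the restriction on the distance one of the two kernel values may be the larger one.\<close>

lemma smooth_left_all:
  "norm (k j x y - k j x' y) \<le> A * (2 ^ j * norm (x - x')) * (\<Phi> j (x - y) + \<Phi> j (x' - y))"
proof (cases "norm (x - x') \<le> CARD('n) / 2 ^ j")
  case True
  have "A * (2 ^ j * norm (x - x')) * \<Phi> j (x - y) \<le> A * (2 ^ j * norm (x - x')) * (\<Phi> j (x - y) + \<Phi> j (x' - y))"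
    using A_pos by (intro mult_left_mono) auto
  then show ?thesis using smooth_left[OF True, of y] by linarith
next
  case False
  then have "CARD('n) < 2 ^ j * norm (x - x')" by (simp add: field_simps)
  moreover have "1 \<le> real CARD('n)" by simp
  ultimately have "1 \<le> 2 ^ j * norm (x - x')" by linarith
  then have "A * 1 * (\<Phi> j (x - y) + \<Phi> j (x' - y)) \<le> A * (2 ^ j * norm (x - x')) * (\<Phi> j (x - y) + \<Phi> j (x' - y))"
    using A_pos by (intro mult_right_mono mult_left_mono) (auto intro: add_nonneg_nonneg)
  moreover have "norm (k j x y - k j x' y) \<le> A * \<Phi> j (x - y) + A * \<Phi> j (x' - y)"
    by (rule norm_triangle_le_diff) (intro add_mono size)
  ultimately show ?thesis by (simp add: algebra_simps)
qed

text \<open>The kernel of the composition of the adjoint of the \<open>i\<close>-th operator with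
  the \<open>j\<close>-th one.\<close>

definition H :: "nat \<Rightarrow> nat \<Rightarrow> real ^ 'n \<Rightarrow> real ^ 'n \<Rightarrow> complex" where
  "H i j x y = (\<integral>z. cnj (k i z x) * k j z y \<partial>lborel)"

lemma integrable_H: "integrable lborel (\<lambda>z. cnj (k i z x) * k j z y)"
proof (rule Bochner_Integration.integrable_bound)
  show "integrable lborel (\<lambda>z. (A / dscale 1 i ^ CARD('n)) * norm (k j z y))" using integrable_k(2) by simp
  show "AE z in lborel. norm (cnj (k i z x) * k j z y) \<le> norm ((A / dscale 1 i ^ CARD('n)) * norm (k j z y))"
    using mult_right_mono[OF k_bound norm_ge_zero] A_pos by (intro AE_I2) (simp add: norm_mult abs_mult)
qed measurable

lemma H_cnj: "H i j x y = cnj (H j i y x)"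
  unfolding H_def by (subst Bochner_Integration.integral_cnj[symmetric]) (simp add: mult.commute)

lemma H_measurable [measurable]: "case_prod (H i j) \<in> borel_measurable (borel \<Otimes>\<^sub>M borel)"
proof -
  have "(\<lambda>p. case_prod (k j) (snd p, snd (fst p))) \<in> borel_measurable ((borel \<Otimes>\<^sub>M borel) \<Otimes>\<^sub>M borel)"
      "(\<lambda>p. case_prod (k i) (snd p, fst (fst p))) \<in> borel_measurable ((borel \<Otimes>\<^sub>M borel) \<Otimes>\<^sub>M borel)"
    by (rule measurable_compose[OF _ k_measurable]; measurable)+
  then have [measurable]: "(\<lambda>p. k j (snd p) (snd (fst p))) \<in> borel_measurable ((borel \<Otimes>\<^sub>M borel) \<Otimes>\<^sub>M borel)"
      "(\<lambda>p. k i (snd p) (fst (fst p))) \<in> borel_measurable ((borel \<Otimes>\<^sub>M borel) \<Otimes>\<^sub>M borel)"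
    by simp_all
  show ?thesis unfolding H_def[abs_def] split_def by measurable
qed

text \<open>The value of the kernel \<open>k i\<close> at \<open>z = y\<close> is subtracted and
  added. The difference costs \<open>2 ^ i * norm (z - y)\<close>, and a power of decay of
  \<open>k j\<close> turns the distance into 2^-j; the added term is controlled by the cancellation
  of \<open>k j\<close>. The gain is useful for \<open>i \<le> j\<close>.\<close>

lemma norm_H_le:
  "ennreal (norm (H i j x y)) \<le> (\<integral>\<^sup>+z. ennreal (A * A * (2 ^ i / 2 ^ j)) * (ennreal (\<Phi>' i (z - x)) * ennreal (\<Phi>' j (z - y)) + ennreal (\<Phi>' i (y - x)) * ennreal (\<Phi>' j (z - y))) \<partial>lborel)
     + ennreal (A * A * 2 powr (- c * real j)) * ennreal (\<Phi>' i (y - x))"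
proof -
  have "H i j x y = (\<integral>z. cnj (k i z x - k i y x) * k j z y \<partial>lborel) + cnj (k i y x) * (\<integral>z. k j z y \<partial>lborel)"
    unfolding H_def using integrable_H integrable_k(2) by (simp add: left_diff_distrib)
  then have "norm (H i j x y) \<le> norm (\<integral>z. cnj (k i z x - k i y x) * k j z y \<partial>lborel) + norm (cnj (k i y x) * (\<integral>z. k j z y \<partial>lborel))"
    by (simp only: norm_triangle_ineq)
  then have "ennreal (norm (H i j x y)) \<le> ennreal (norm (\<integral>z. cnj (k i z x - k i y x) * k j z y \<partial>lborel)) + ennreal (norm (cnj (k i y x) * (\<integral>z. k j z y \<partial>lborel)))"
    by (subst ennreal_plus[symmetric], simp, simp, rule ennreal_leI)
  moreover have "ennreal (norm (\<integral>z. cnj (k i z x - k i y x) * k j z y \<partial>lborel)) \<le> (\<integral>\<^sup>+z. ennreal (A * A * (2 ^ i / 2 ^ j)) * (ennreal (\<Phi>' i (z - x)) * ennreal (\<Phi>' j (z - y)) + ennreal (\<Phi>' i (y - x)) * ennreal (\<Phi>' j (z - y))) \<partial>lborel)"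
  proof (rule order_trans[OF norm_integral_le_nn_integral], intro nn_integral_mono)
    fix z
    have p: "\<Phi> m w \<le> \<Phi>' m w" for m w by (rule peak_antimono) auto
    have "norm (z - y) * \<Phi> j (z - y) \<le> (1 / 2 ^ j) * \<Phi>' j (z - y)"
      using norm_times_peak_le[OF dscale_pos, of "z - y" "CARD('n) + 1" 1 j] by (simp add: dscale_1)
    then have "(\<Phi>' i (z - x) + \<Phi>' i (y - x)) * (norm (z - y) * \<Phi> j (z - y)) \<le> (\<Phi>' i (z - x) + \<Phi>' i (y - x)) * ((1 / 2 ^ j) * \<Phi>' j (z - y))"
      by (rule mult_left_mono) (auto intro: add_nonneg_nonneg)
    then have e: "A * A * 2 ^ i * ((\<Phi>' i (z - x) + \<Phi>' i (y - x)) * (norm (z - y) * \<Phi> j (z - y))) \<le> A * A * 2 ^ i * ((\<Phi>' i (z - x) + \<Phi>' i (y - x)) * ((1 / 2 ^ j) * \<Phi>' j (z - y)))"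
      by (rule mult_left_mono) (use A_pos in auto)
    have "norm (cnj (k i z x - k i y x) * k j z y) \<le> (A * (2 ^ i * norm (z - y)) * (\<Phi> i (z - x) + \<Phi> i (y - x))) * (A * \<Phi> j (z - y))"
      unfolding norm_mult complex_mod_cnj using A_pos
      by (intro mult_mono smooth_left_all size mult_nonneg_nonneg add_nonneg_nonneg) auto
    also have "\<dots> \<le> (A * (2 ^ i * norm (z - y)) * (\<Phi>' i (z - x) + \<Phi>' i (y - x))) * (A * \<Phi> j (z - y))"
      using A_pos by (intro mult_right_mono mult_left_mono add_mono p mult_nonneg_nonneg) auto
    also have "\<dots> = A * A * 2 ^ i * ((\<Phi>' i (z - x) + \<Phi>' i (y - x)) * (norm (z - y) * \<Phi> j (z - y)))" by (simp only: mult_ac)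
    also note e
    also have "A * A * 2 ^ i * ((\<Phi>' i (z - x) + \<Phi>' i (y - x)) * ((1 / 2 ^ j) * \<Phi>' j (z - y)))
       = A * A * (2 ^ i / 2 ^ j) * (\<Phi>' i (z - x) * \<Phi>' j (z - y) + \<Phi>' i (y - x) * \<Phi>' j (z - y))" by (simp add: algebra_simps)
    finally have "ennreal (norm (cnj (k i z x - k i y x) * k j z y)) \<le> ennreal \<dots>" by (rule ennreal_leI)
    then show "ennreal (norm (cnj (k i z x - k i y x) * k j z y)) \<le> ennreal (A * A * (2 ^ i / 2 ^ j)) * (ennreal (\<Phi>' i (z - x)) * ennreal (\<Phi>' j (z - y)) + ennreal (\<Phi>' i (y - x)) * ennreal (\<Phi>' j (z - y)))"
      using A_pos by (simp add: ennreal_mult[symmetric] ennreal_plus[symmetric] del: ennreal_plus)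
  qed
  moreover have "ennreal (norm (cnj (k i y x) * (\<integral>z. k j z y \<partial>lborel))) \<le> ennreal (A * A * 2 powr (- c * real j)) * ennreal (\<Phi>' i (y - x))"
  proof -
    have p: "\<Phi> m w \<le> \<Phi>' m w" for m w by (rule peak_antimono) auto
    have "norm (cnj (k i y x) * (\<integral>z. k j z y \<partial>lborel)) \<le> (A * \<Phi>' i (y - x)) * (A * 2 powr (- c * real j))"
      unfolding norm_mult complex_mod_cnj using A_pos
      by (intro mult_mono cancel_left order_trans[OF size] mult_left_mono p) auto
    then show ?thesis using A_pos by (simp add: ennreal_mult[symmetric] mult_ac ennreal_leI)
  qed
  ultimately show ?thesis by (meson add_mono order_trans)
qed

lemma schur_H:
  assumes "i \<le> j"
  shows "(\<integral>\<^sup>+x. ennreal (norm (H i j x y)) \<partial>lborel) \<le> ennreal (3 * (A * C0)\<^sup>2 * 2 powr (- c * (real j - real i)))"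
    and "(\<integral>\<^sup>+y. ennreal (norm (H i j x y)) \<partial>lborel) \<le> ennreal (3 * (A * C0)\<^sup>2 * 2 powr (- c * (real j - real i)))"
proof -
  let ?e = "ennreal (A * A * (2 ^ i / 2 ^ j))" and ?d = "ennreal (A * A * 2 powr (- c * real j))"
  have P: "(\<integral>\<^sup>+z. ennreal (\<Phi>' m (z - x)) \<partial>lborel) \<le> ennreal C0" "(\<integral>\<^sup>+z. ennreal (\<Phi>' m (x - z)) \<partial>lborel) \<le> ennreal C0" for m and x :: "real ^ 'n"
    by (rule nn_integral_\<Phi>)+
  \<comment> \<open>Two terms come from the difference and one from the cancellation. The latter has
    one factor \<open>C0\<close> fewer, compensated by \<open>1 \<le> C0\<close>; this gives the
    constant 3.\<close>
  have fin: "?e * (ennreal C0 * ennreal C0 + ennreal C0 * ennreal C0) + ?d * ennreal C0 \<le> ennreal (3 * (A * C0)\<^sup>2 * 2 powr (- c * (real j - real i)))"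
  proof -
    have "c * (real j - real i) \<le> 1 * (real j - real i)" using assms c by (intro mult_right_mono) auto
    then have "2 powr (- 1 * (real j - real i)) \<le> 2 powr (- c * (real j - real i))" by (intro powr_mono) auto
    moreover have "2 ^ i / 2 ^ j = 2 powr (- 1 * (real j - real i))" by (simp add: powr_diff powr_realpow)
    ultimately have 1: "2 ^ i / 2 ^ j \<le> 2 powr (- c * (real j - real i))" by simp
    have 2: "2 powr (- c * real j) \<le> 2 powr (- c * (real j - real i))" using c by (intro powr_mono) auto
    have "(A * A * (2 ^ i / 2 ^ j)) * (C0 * C0 + C0 * C0) + (A * A * 2 powr (- c * real j)) * C0
       \<le> (A * A * 2 powr (- c * (real j - real i))) * (C0 * C0 + C0 * C0) + (A * A * 2 powr (- c * (real j - real i))) * (C0 * C0)"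
    proof (intro add_mono mult_mono mult_left_mono 1 2)
      show "C0 \<le> C0 * C0" using C0 by simp
    qed (use A_pos C0 in auto)
    also have "\<dots> = 3 * (A * C0)\<^sup>2 * 2 powr (- c * (real j - real i))" by (simp add: power2_eq_square algebra_simps)
    finally show ?thesis
      using A_pos C0 by (simp add: ennreal_mult[symmetric] ennreal_plus[symmetric] ennreal_leI del: ennreal_plus)
  qed
  have "(\<integral>\<^sup>+x. ennreal (norm (H i j x y)) \<partial>lborel)
     \<le> (\<integral>\<^sup>+x. (\<integral>\<^sup>+z. ?e * (ennreal (\<Phi>' i (z - x)) * ennreal (\<Phi>' j (z - y)) + ennreal (\<Phi>' i (y - x)) * ennreal (\<Phi>' j (z - y))) \<partial>lborel) + ?d * ennreal (\<Phi>' i (y - x)) \<partial>lborel)"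
    by (intro nn_integral_mono norm_H_le)
  also have "\<dots> = (\<integral>\<^sup>+x. (\<integral>\<^sup>+z. ?e * (ennreal (\<Phi>' i (z - x)) * ennreal (\<Phi>' j (z - y)) + ennreal (\<Phi>' i (y - x)) * ennreal (\<Phi>' j (z - y))) \<partial>lborel) \<partial>lborel) + ?d * (\<integral>\<^sup>+x. ennreal (\<Phi>' i (y - x)) \<partial>lborel)"
    by (subst nn_integral_add) (auto simp: nn_integral_cmult)
  also have "(\<integral>\<^sup>+x. (\<integral>\<^sup>+z. ?e * (ennreal (\<Phi>' i (z - x)) * ennreal (\<Phi>' j (z - y)) + ennreal (\<Phi>' i (y - x)) * ennreal (\<Phi>' j (z - y))) \<partial>lborel) \<partial>lborel)
     = (\<integral>\<^sup>+z. (\<integral>\<^sup>+x. ?e * (ennreal (\<Phi>' i (z - x)) * ennreal (\<Phi>' j (z - y)) + ennreal (\<Phi>' i (y - x)) * ennreal (\<Phi>' j (z - y))) \<partial>lborel) \<partial>lborel)"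
    by (rule lborel_pair.Fubini') measurable
  also have "\<dots> = (\<integral>\<^sup>+z. ?e * ((\<integral>\<^sup>+x. ennreal (\<Phi>' i (z - x)) \<partial>lborel) * ennreal (\<Phi>' j (z - y)) + (\<integral>\<^sup>+x. ennreal (\<Phi>' i (y - x)) \<partial>lborel) * ennreal (\<Phi>' j (z - y))) \<partial>lborel)"
    by (simp add: nn_integral_cmult nn_integral_add nn_integral_multc)
  also have "\<dots> \<le> (\<integral>\<^sup>+z. ?e * (ennreal C0 * ennreal (\<Phi>' j (z - y)) + ennreal C0 * ennreal (\<Phi>' j (z - y))) \<partial>lborel)"
    by (intro nn_integral_mono mult_left_mono add_mono mult_right_mono P) auto
  also have "\<dots> = ?e * (ennreal C0 * (\<integral>\<^sup>+z. ennreal (\<Phi>' j (z - y)) \<partial>lborel) + ennreal C0 * (\<integral>\<^sup>+z. ennreal (\<Phi>' j (z - y)) \<partial>lborel))"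
    by (simp add: nn_integral_cmult nn_integral_add)
  also have "\<dots> \<le> ?e * (ennreal C0 * ennreal C0 + ennreal C0 * ennreal C0)"
    by (intro mult_left_mono add_mono P) auto
  finally have "(\<integral>\<^sup>+x. ennreal (norm (H i j x y)) \<partial>lborel) \<le> ?e * (ennreal C0 * ennreal C0 + ennreal C0 * ennreal C0) + ?d * (\<integral>\<^sup>+x. ennreal (\<Phi>' i (y - x)) \<partial>lborel)"
    by (simp add: add_right_mono)
  also have "\<dots> \<le> ?e * (ennreal C0 * ennreal C0 + ennreal C0 * ennreal C0) + ?d * ennreal C0"
    by (intro add_left_mono mult_left_mono P) auto
  finally show "(\<integral>\<^sup>+x. ennreal (norm (H i j x y)) \<partial>lborel) \<le> ennreal (3 * (A * C0)\<^sup>2 * 2 powr (- c * (real j - real i)))"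
    using fin order_trans by blast
  have "(\<integral>\<^sup>+y. ennreal (norm (H i j x y)) \<partial>lborel)
     \<le> (\<integral>\<^sup>+y. (\<integral>\<^sup>+z. ?e * (ennreal (\<Phi>' i (z - x)) * ennreal (\<Phi>' j (z - y)) + ennreal (\<Phi>' i (y - x)) * ennreal (\<Phi>' j (z - y))) \<partial>lborel) + ?d * ennreal (\<Phi>' i (y - x)) \<partial>lborel)"
    by (intro nn_integral_mono norm_H_le)
  also have "\<dots> = ?e * ((\<integral>\<^sup>+y. (\<integral>\<^sup>+z. ennreal (\<Phi>' i (z - x)) * ennreal (\<Phi>' j (z - y)) \<partial>lborel) \<partial>lborel) + (\<integral>\<^sup>+y. (\<integral>\<^sup>+z. ennreal (\<Phi>' i (y - x)) * ennreal (\<Phi>' j (z - y)) \<partial>lborel) \<partial>lborel)) + ?d * (\<integral>\<^sup>+y. ennreal (\<Phi>' i (y - x)) \<partial>lborel)"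
    by (simp add: nn_integral_cmult nn_integral_add)
  also have "(\<integral>\<^sup>+y. (\<integral>\<^sup>+z. ennreal (\<Phi>' i (z - x)) * ennreal (\<Phi>' j (z - y)) \<partial>lborel) \<partial>lborel) = (\<integral>\<^sup>+z. (\<integral>\<^sup>+y. ennreal (\<Phi>' i (z - x)) * ennreal (\<Phi>' j (z - y)) \<partial>lborel) \<partial>lborel)"
    by (rule lborel_pair.Fubini') measurable
  also have "\<dots> = (\<integral>\<^sup>+z. ennreal (\<Phi>' i (z - x)) * (\<integral>\<^sup>+y. ennreal (\<Phi>' j (z - y)) \<partial>lborel) \<partial>lborel)"
    by (simp add: nn_integral_cmult)
  also have "(\<integral>\<^sup>+y. (\<integral>\<^sup>+z. ennreal (\<Phi>' i (y - x)) * ennreal (\<Phi>' j (z - y)) \<partial>lborel) \<partial>lborel) = (\<integral>\<^sup>+y. ennreal (\<Phi>' i (y - x)) * (\<integral>\<^sup>+z. ennreal (\<Phi>' j (z - y)) \<partial>lborel) \<partial>lborel)"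
    by (simp add: nn_integral_cmult)
  also have "?e * ((\<integral>\<^sup>+z. ennreal (\<Phi>' i (z - x)) * (\<integral>\<^sup>+y. ennreal (\<Phi>' j (z - y)) \<partial>lborel) \<partial>lborel) + (\<integral>\<^sup>+y. ennreal (\<Phi>' i (y - x)) * (\<integral>\<^sup>+z. ennreal (\<Phi>' j (z - y)) \<partial>lborel) \<partial>lborel)) + ?d * (\<integral>\<^sup>+y. ennreal (\<Phi>' i (y - x)) \<partial>lborel)
     \<le> ?e * ((\<integral>\<^sup>+z. ennreal (\<Phi>' i (z - x)) * ennreal C0 \<partial>lborel) + (\<integral>\<^sup>+y. ennreal (\<Phi>' i (y - x)) * ennreal C0 \<partial>lborel)) + ?d * ennreal C0"
    by (intro add_mono mult_left_mono nn_integral_mono P) auto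
  also have "\<dots> \<le> ?e * (ennreal C0 * ennreal C0 + ennreal C0 * ennreal C0) + ?d * ennreal C0"
  proof -
    have "(\<integral>\<^sup>+z. ennreal (\<Phi>' i (z - x)) * ennreal C0 \<partial>lborel) = (\<integral>\<^sup>+z. ennreal (\<Phi>' i (z - x)) \<partial>lborel) * ennreal C0"
      by (rule nn_integral_multc) measurable
    also have "\<dots> \<le> ennreal C0 * ennreal C0" by (rule mult_right_mono[OF P(1)]) simp
    finally show ?thesis by (intro add_mono mult_left_mono) auto
  qed
  finally show "(\<integral>\<^sup>+y. ennreal (norm (H i j x y)) \<partial>lborel) \<le> ennreal (3 * (A * C0)\<^sup>2 * 2 powr (- c * (real j - real i)))"
    using fin order_trans by blast
qed

text \<open>A root of the Schur bound, as the Cotlar-Stein lemma wants squares; the 3 is rounded up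
  to 4.\<close>

definition \<gamma> :: "nat \<Rightarrow> nat \<Rightarrow> real" where
  "\<gamma> i j = 2 * A * C0 * 2 powr (- c / 2 * \<bar>real i - real j\<bar>)"

lemma \<gamma>_pos: "0 < \<gamma> i j" using A_pos C0 by (simp add: \<gamma>_def)
lemma \<gamma>_sym: "\<gamma> i j = \<gamma> j i" by (simp add: \<gamma>_def abs_minus_commute)

lemma \<gamma>_square: "(\<gamma> i j)\<^sup>2 = 4 * (A * C0)\<^sup>2 * 2 powr (- c * \<bar>real i - real j\<bar>)"
proof -
  have "(2 powr (- c / 2 * \<bar>real i - real j\<bar>))\<^sup>2 = 2 powr (- c * \<bar>real i - real j\<bar>)"
    by (simp add: power2_eq_square flip: powr_add)
  then show ?thesis by (simp add: \<gamma>_def power_mult_distrib)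
qed

lemma schur_H_all:
  "(\<integral>\<^sup>+x. ennreal (norm (H i j x y)) \<partial>lborel) \<le> ennreal ((\<gamma> i j)\<^sup>2)"
  "(\<integral>\<^sup>+y. ennreal (norm (H i j x y)) \<partial>lborel) \<le> ennreal ((\<gamma> i j)\<^sup>2)"
proof -
  have le: "3 * (A * C0)\<^sup>2 * 2 powr (- c * (real j - real i)) \<le> (\<gamma> i j)\<^sup>2" if "i \<le> j" for i j
    unfolding \<gamma>_square using that by (intro mult_mono) auto
  have nH: "norm (H i j x y) = norm (H j i y x)" for i j x y by (subst H_cnj) simp
  show "(\<integral>\<^sup>+x. ennreal (norm (H i j x y)) \<partial>lborel) \<le> ennreal ((\<gamma> i j)\<^sup>2)"
  proof (cases "i \<le> j")
    case True
    from schur_H(1)[OF this] le[OF this] show ?thesis by (meson ennreal_leI order_trans)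
  next
    case False
    then have "j \<le> i" by simp
    from schur_H(2)[OF this, of y] le[OF this] show ?thesis unfolding nH[of i j] \<gamma>_sym[of i j] by (meson ennreal_leI order_trans)
  qed
  show "(\<integral>\<^sup>+y. ennreal (norm (H i j x y)) \<partial>lborel) \<le> ennreal ((\<gamma> i j)\<^sup>2)"
  proof (cases "i \<le> j")
    case True
    from schur_H(2)[OF this] le[OF this] show ?thesis by (meson ennreal_leI order_trans)
  next
    case False
    then have "j \<le> i" by simp
    from schur_H(1)[OF this, of x] le[OF this] show ?thesis unfolding nH[of i j] \<gamma>_sym[of i j] by (meson ennreal_leI order_trans)
  qed
qed

definition T' :: "nat \<Rightarrow> (real ^ 'n \<Rightarrow> complex) \<Rightarrow> real ^ 'n \<Rightarrow> complex" where
  "T' j f x = (\<integral>y. cnj (k j y x) * f y \<partial>lborel)"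

lemma T_L12: "f \<in> L12 \<Longrightarrow> T j f \<in> L12" "f \<in> L12 \<Longrightarrow> L2_norm (T j f) \<le> A * C0 * L2_norm f"
  using schur_L12[OF k_measurable _ nn_integral_k] A_pos C0 unfolding T_def[abs_def] by auto

lemma T'_T:
  assumes f: "f \<in> L12" shows "T' i (T j f) x = (\<integral>y. H i j x y * f y \<partial>lborel)"
proof -
  note [measurable] = L12_measurable[OF f]
  have fi: "integrable lborel f" using f by (simp add: L12_def)
  have mk: "(\<lambda>p. k j (fst p) (snd p)) \<in> borel_measurable (lborel \<Otimes>\<^sub>M lborel)" using k_measurable[of j] by (simp add: split_def)
  have int: "integrable (lborel \<Otimes>\<^sub>M lborel) (\<lambda>(z, y). cnj (k i z x) * k j z y * f y)"
  proof (rule pair_integrable_bound)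
    show "integrable lborel (\<lambda>z. norm (k i z x) * (A / dscale 1 j ^ CARD('n)))" using integrable_k(2) by simp
    show "integrable lborel (\<lambda>y. norm (f y))" using fi by simp
    show "norm (case (z, y) of (z, y) \<Rightarrow> cnj (k i z x) * k j z y * f y) \<le> norm (k i z x) * (A / dscale 1 j ^ CARD('n)) * norm (f y)" for z y
      using mult_left_mono[OF k_bound[of j z y], of "norm (k i z x) * norm (f y)"] by (simp add: norm_mult mult_ac)
    show "(\<lambda>(z, y). cnj (k i z x) * k j z y * f y) \<in> borel_measurable (lborel \<Otimes>\<^sub>M lborel)"
      using mk by measurable
  qed
  have "T' i (T j f) x = (\<integral>z. (\<integral>y. cnj (k i z x) * k j z y * f y \<partial>lborel) \<partial>lborel)"
    by (simp add: T'_def T_def mult.assoc)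
  also have "\<dots> = (\<integral>y. (\<integral>z. cnj (k i z x) * k j z y * f y \<partial>lborel) \<partial>lborel)"
    using lborel_pair.Fubini_integral[OF int] by simp
  also have "\<dots> = (\<integral>y. H i j x y * f y \<partial>lborel)"
    by (simp add: H_def)
  finally show ?thesis .
qed

lemma T'_T_norm: "f \<in> L12 \<Longrightarrow> L2_norm (T' i (T j f)) \<le> (\<gamma> i j)\<^sup>2 * L2_norm f"
proof -
  assume f: "f \<in> L12"
  have "T' i (T j f) = (\<lambda>x. \<integral>y. H i j x y * f y \<partial>lborel)" by (rule ext) (rule T'_T[OF f])
  then show ?thesis using schur_L12(2)[OF H_measurable f schur_H_all(2) schur_H_all(1)] by simp
qed

lemma adj_T:
  assumes f: "f \<in> L12" and g: "g \<in> L12" shows "L2_ip (T j f) g = L2_ip f (T' j g)"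
proof -
  note [measurable] = L12_measurable[OF f] L12_measurable[OF g]
  have fi: "integrable lborel f" "integrable lborel g" using f g by (auto simp: L12_def)
  have mk: "(\<lambda>p. k j (fst p) (snd p)) \<in> borel_measurable (lborel \<Otimes>\<^sub>M lborel)" using k_measurable[of j] by (simp add: split_def)
  have int: "integrable (lborel \<Otimes>\<^sub>M lborel) (\<lambda>(x, y). k j x y * f y * cnj (g x))"
  proof (rule pair_integrable_bound)
    show "integrable lborel (\<lambda>x. norm (g x) * (A / dscale 1 j ^ CARD('n)))" using fi by simp
    show "integrable lborel (\<lambda>y. norm (f y))" using fi by simp
    show "norm (case (x, y) of (x, y) \<Rightarrow> k j x y * f y * cnj (g x)) \<le> norm (g x) * (A / dscale 1 j ^ CARD('n)) * norm (f y)" for x y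
      using mult_left_mono[OF k_bound[of j x y], of "norm (g x) * norm (f y)"] by (simp add: norm_mult mult_ac)
    show "(\<lambda>(x, y). k j x y * f y * cnj (g x)) \<in> borel_measurable (lborel \<Otimes>\<^sub>M lborel)"
      using mk by measurable
  qed
  have "L2_ip (T j f) g = (\<integral>x. (\<integral>y. k j x y * f y * cnj (g x) \<partial>lborel) \<partial>lborel)"
    by (simp add: L2_ip_def T_def)
  also have "\<dots> = (\<integral>y. (\<integral>x. k j x y * f y * cnj (g x) \<partial>lborel) \<partial>lborel)"
    using lborel_pair.Fubini_integral[OF int] by simp
  also have "\<dots> = (\<integral>y. f y * cnj (\<integral>x. cnj (k j x y) * g x \<partial>lborel) \<partial>lborel)"
  proof (intro Bochner_Integration.integral_cong refl)
    fix y
    have "cnj (\<integral>x. cnj (k j x y) * g x \<partial>lborel) = (\<integral>x. k j x y * cnj (g x) \<partial>lborel)"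
      by (subst Bochner_Integration.integral_cnj[symmetric]) simp
    then show "(\<integral>x. k j x y * f y * cnj (g x) \<partial>lborel) = f y * cnj (\<integral>x. cnj (k j x y) * g x \<partial>lborel)"
      by (simp add: mult_ac flip: integral_mult_right_zero)
  qed
  finally show ?thesis by (simp add: L2_ip_def T'_def)
qed

lemma T_add: "f \<in> L12 \<Longrightarrow> g \<in> L12 \<Longrightarrow> T j (f + g) = T j f + T j g"
  using integrable_k_mult by (auto simp: T_def L12_def distrib_left fun_eq_iff)

lemma T_0: "T j 0 = 0"
  by (auto simp: T_def fun_eq_iff)

end

context cz_family
begin

lemma adj_T_eq: "kernel_family.T (\<lambda>j x y. cnj (k j y x)) = T'"
  using kernel_family.T_def[OF cz_family.axioms(1)[OF adjoint_family]] by (auto simp: T'_def fun_eq_iff)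

lemma adj_T'_eq: "cz_family.T' (\<lambda>j x y. cnj (k j y x)) = T"
  using cz_family.T'_def[OF adjoint_family] by (auto simp: T_def fun_eq_iff)

definition q :: real where "q = 2 powr (- c / 2)"

text \<open>The geometric series with ratio \<open>q\<close>, taken on both sides of the diagonal,
  with the factor \<open>2 * A * C0\<close> of \<open>\<gamma>\<close>.\<close>

definition \<Gamma> :: real where "\<Gamma> = 4 * A * C0 / (1 - q)"

lemma q: "0 < q" "q < 1"
proof -
  have "2 powr (- c / 2) < (2::real) powr 0" using c by (intro powr_less_mono) auto
  then show "0 < q" "q < 1" by (auto simp: q_def)
qed

lemma \<gamma>_row: "finite I \<Longrightarrow> (\<Sum>j\<in>I. \<gamma> i j) \<le> \<Gamma>"
proof -
  assume I: "finite I"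
  \<comment> \<open>Subtraction of natural numbers is truncated, so the distance of the indices is
    written case by case.\<close>
  have g: "\<gamma> i j = 2 * A * C0 * q ^ (if i \<le> j then j - i else i - j)" for j
    by (auto simp: \<gamma>_def q_def powr_powr simp flip: powr_realpow)
  obtain J where J: "I \<subseteq> {..<J}" using finite_nat_bounded[OF I] by blast
  have "(\<Sum>j\<in>I. \<gamma> i j) \<le> (\<Sum>j\<in>{..<i} \<union> {i..<i + J}. \<gamma> i j)"
    using J \<gamma>_pos by (intro sum_mono2) (auto intro: less_imp_le)
  also have "\<dots> = (\<Sum>j<i. \<gamma> i j) + (\<Sum>j\<in>{i..<i + J}. \<gamma> i j)"
    by (rule sum.union_disjoint) auto
  also have "(\<Sum>j<i. \<gamma> i j) = (\<Sum>j<i. 2 * A * C0 * q ^ (i - j))" by (intro sum.cong) (auto simp: g)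
  also have "\<dots> = (\<Sum>j<i. 2 * A * C0 * q ^ (Suc j))"
    by (rule sum.reindex_bij_witness[of _ "\<lambda>j. i - Suc j" "\<lambda>j. i - Suc j"]) (auto simp: Suc_diff_Suc simp flip: power_Suc)
  also have "\<dots> \<le> (\<Sum>j<i. 2 * A * C0 * q ^ j)"
    using A_pos C0 q by (intro sum_mono mult_left_mono power_decreasing) auto
  also have "\<dots> = 2 * A * C0 * (\<Sum>j\<in>{0..<i}. q ^ j)" by (simp add: sum_distrib_left lessThan_atLeast0)
  also have "\<dots> \<le> 2 * A * C0 * (1 / (1 - q))"
    using A_pos C0 q by (intro mult_left_mono sum_geometric_le) auto
  also have "(\<Sum>j\<in>{i..<i + J}. \<gamma> i j) = 2 * A * C0 * (\<Sum>j\<in>{i..<i + J}. q ^ (j - i))"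
    unfolding sum_distrib_left by (intro sum.cong) (auto simp: g)
  also have "\<dots> \<le> 2 * A * C0 * (1 / (1 - q))"
    using A_pos C0 q by (intro mult_left_mono sum_geometric_le) auto
  finally show ?thesis by (simp add: \<Gamma>_def)
qed

lemma A_C0_le_\<Gamma>: "A * C0 \<le> \<Gamma>" "0 < \<Gamma>"
proof -
  have "A * C0 * 1 \<le> A * C0 * (4 / (1 - q))" using A_pos C0 q by (intro mult_left_mono) (auto simp: field_simps)
  then show "A * C0 \<le> \<Gamma>" by (simp add: \<Gamma>_def mult_ac)
  moreover have "0 < A * C0" using A_pos C0 by simp
  ultimately show "0 < \<Gamma>" by linarith
qed

lemma sum_fun_apply: "(\<Sum>j\<in>I. F j) x = (\<Sum>j\<in>I. F j x)" for F :: "'j \<Rightarrow> 'a \<Rightarrow> complex"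
  by (induction I rule: infinite_finite_induct) auto

text \<open>The bound is the same for all finite index sets, which later makes the estimates uniform
  in the number of pieces.\<close>

theorem L2_bound:
  assumes I: "finite I" and f: "f \<in> L12"
  shows "(\<lambda>x. \<Sum>j\<in>I. T j f x) \<in> L12" "L2_norm (\<lambda>x. \<Sum>j\<in>I. T j f x) \<le> \<Gamma> * L2_norm f"
proof -
  note adjf = adjoint_family
  interpret cotlar_stein "L12 :: (real ^ 'n \<Rightarrow> complex) set" L2_norm L2_ip T T' I \<gamma> \<Gamma>
  proof
    show "T' j f \<in> L12" if "f \<in> L12" for j f
      using cz_family.T_L12(1)[OF adjf that] by (simp add: adj_T_eq)
    show "T' j (f + g) = T' j f + T' j g" if "f \<in> L12" "g \<in> L12" for j f g
      using cz_family.T_add[OF adjf that] by (simp add: adj_T_eq)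
    show "T' j 0 = 0" for j
      using cz_family.T_0[OF adjf] by (simp add: adj_T_eq)
    show "L2_norm (T i (T' j f)) \<le> (\<gamma> i j)\<^sup>2 * L2_norm f" if "f \<in> L12" for i j f
      using cz_family.T'_T_norm[OF adjf that] by (simp add: adj_T_eq adj_T'_eq)
    show "L2_norm (T j f) \<le> \<Gamma> * L2_norm f" if "f \<in> L12" for j f
      using T_L12(2)[OF that, of j] mult_right_mono[OF A_C0_le_\<Gamma>(1) L2_norm_nonneg[of f]] by linarith
    show "L2_norm (T' j f) \<le> \<Gamma> * L2_norm f" if "f \<in> L12" for j f
      using cz_family.T_L12(2)[OF adjf that, of j] mult_right_mono[OF A_C0_le_\<Gamma>(1) L2_norm_nonneg[of f]] by (simp add: adj_T_eq)
    show "(\<Sum>j\<in>I. \<gamma> i j) \<le> \<Gamma>" for i by (rule \<gamma>_row[OF I])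
    show "L2_norm (T' i (T j f)) \<le> (\<gamma> i j)\<^sup>2 * L2_norm f" if "f \<in> L12" for i j f by (rule T'_T_norm[OF that])
    show "0 < \<Gamma>" by (rule A_C0_le_\<Gamma>(2))
  qed (fact L12_0 L12_add L2_norm_nonneg L2_norm_0 L2_norm_add L2_ip_self L2_ip_le L2_ip_add L2_ip_0 T_L12(1) T_add T_0 adj_T I \<gamma>_pos)+
  have eq: "Sum f = (\<lambda>x. \<Sum>j\<in>I. T j f x)" by (auto simp: Sum_def sum_fun_apply)
  show "(\<lambda>x. \<Sum>j\<in>I. T j f x) \<in> L12" using Sum_V(1)[OF f] by (simp add: eq)
  show "L2_norm (\<lambda>x. \<Sum>j\<in>I. T j f x) \<le> \<Gamma> * L2_norm f"
    using nrm_Sum_le[OF \<gamma>_sym L2_ip_cnj f] by (simp add: eq)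
qed

end

section \<open>Stopping times and weak type\<close>

text \<open>The half-open cell of generation \<open>k\<close> that contains \<open>x\<close>, for the grid spanned by \<open>cube p R\<close>.\<close>

definition cell :: "real ^ 'n \<Rightarrow> real \<Rightarrow> nat \<Rightarrow> real ^ 'n \<Rightarrow> (real ^ 'n) set" where
  "cell p R k x = {y. \<forall>i. \<lfloor>2 ^ k * ((y $ i - p $ i) / R)\<rfloor> = \<lfloor>2 ^ k * ((x $ i - p $ i) / R)\<rfloor>}"

lemma cell_self: "x \<in> cell p R k x"
  by (simp add: cell_def)

lemma cell_eq: "y \<in> cell p R k x \<Longrightarrow> cell p R k y = cell p R k x"
  by (auto simp: cell_def)

lemma floor_double_cong: "\<lfloor>2 * a\<rfloor> = \<lfloor>2 * b\<rfloor> \<Longrightarrow> \<lfloor>a\<rfloor> = \<lfloor>b\<rfloor>" for a b :: real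
  using floor_divide_real_eq_div[of 2 "2 * a"] floor_divide_real_eq_div[of 2 "2 * b"] by simp

lemma cell_Suc: "cell p R (Suc k) x \<subseteq> cell p R k x"
proof
  fix y assume y: "y \<in> cell p R (Suc k) x"
  have "\<lfloor>2 ^ k * ((y $ i - p $ i) / R)\<rfloor> = \<lfloor>2 ^ k * ((x $ i - p $ i) / R)\<rfloor>" for i
    by (rule floor_double_cong) (use y in \<open>simp only: cell_def mem_Collect_eq power_Suc mult.assoc\<close>)
  then show "y \<in> cell p R k x" by (simp add: cell_def)
qed

lemma cell_antimono: "k \<le> m \<Longrightarrow> cell p R m x \<subseteq> cell p R k x"
  by (induction m rule: dec_induct) (use cell_Suc in blast)+

lemma cell_bounds:
  assumes "0 < R"
  obtains lo where "\<And>y. y \<in> cell p R k x \<longleftrightarrow> (\<forall>i. lo $ i \<le> y $ i \<and> y $ i < lo $ i + R / 2 ^ k)"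
proof
  define lo where "lo = (\<chi> i. p $ i + R / 2 ^ k * real_of_int \<lfloor>2 ^ k * ((x $ i - p $ i) / R)\<rfloor>)"
  have "\<lfloor>2 ^ k * ((y $ i - p $ i) / R)\<rfloor> = \<lfloor>2 ^ k * ((x $ i - p $ i) / R)\<rfloor> \<longleftrightarrow> lo $ i \<le> y $ i \<and> y $ i < lo $ i + R / 2 ^ k" for y i
  proof -
    define m where "m = \<lfloor>2 ^ k * ((x $ i - p $ i) / R)\<rfloor>"
    define c where "c = R / 2 ^ k"
    have c: "0 < c" using assms by (simp add: c_def)
    have e: "2 ^ k * ((y $ i - p $ i) / R) = (y $ i - p $ i) / c" by (simp add: c_def)
    have "real_of_int m \<le> (y $ i - p $ i) / c \<longleftrightarrow> p $ i + c * real_of_int m \<le> y $ i"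
      using c by (simp add: pos_le_divide_eq algebra_simps)
    moreover have "(y $ i - p $ i) / c < real_of_int m + 1 \<longleftrightarrow> y $ i < p $ i + c * real_of_int m + c"
      using c by (simp add: pos_divide_less_eq algebra_simps)
    moreover have "lo $ i = p $ i + c * real_of_int m" by (simp add: lo_def m_def c_def)
    ultimately show ?thesis unfolding e m_def[symmetric] floor_eq_iff c_def[symmetric] by simp
  qed
  then show "y \<in> cell p R k x \<longleftrightarrow> (\<forall>i. lo $ i \<le> y $ i \<and> y $ i < lo $ i + R / 2 ^ k)" for y
    by (simp add: cell_def)
qed

lemma cell_measurable [measurable]: "cell p R k x \<in> sets borel"
proof -
  have "cell p R k x = (\<Inter>i. {y \<in> space borel. \<lfloor>2 ^ k * ((y $ i - p $ i) / R)\<rfloor> = \<lfloor>2 ^ k * ((x $ i - p $ i) / R)\<rfloor>})"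
    by (auto simp: cell_def)
  moreover have "{y \<in> space borel. \<lfloor>2 ^ k * ((y $ i - p $ i) / R)\<rfloor> = \<lfloor>2 ^ k * ((x $ i - p $ i) / R)\<rfloor>} \<in> sets borel" for i
    by measurable
  ultimately show ?thesis by (auto intro!: sets.countable_INT')
qed

lemma emeasure_open_cube:
  fixes p :: "real ^ 'n"
  assumes "0 \<le> s" shows "emeasure lborel (box p (\<chi> i. p $ i + s)) = ennreal (s ^ CARD('n))"
proof -
  have *: "((\<chi> i. p $ i + s) - p) \<bullet> b = s" if "b \<in> Basis" for b
    using that by (auto simp: Basis_vec_def inner_diff_left inner_axis)
  have "p \<bullet> b \<le> (\<chi> i. p $ i + s) \<bullet> b" if "b \<in> Basis" for b
    using *[OF that] assms by (simp add: inner_diff_left)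
  then show ?thesis by (simp add: *)
qed

text \<open>A half-open cell lies between an open and a closed cube of the same side.\<close>

lemma emeasure_cell:
  fixes p :: "real ^ 'n"
  assumes "0 < R" shows "emeasure lborel (cell p R k x) = ennreal ((R / 2 ^ k) ^ CARD('n))"
proof -
  obtain lo where lo: "\<And>y. y \<in> cell p R k x \<longleftrightarrow> (\<forall>i. lo $ i \<le> y $ i \<and> y $ i < lo $ i + R / 2 ^ k)"
    using cell_bounds[OF assms] by blast
  have s: "0 \<le> R / 2 ^ k" using assms by simp
  have "cell p R k x \<subseteq> cube lo (R / 2 ^ k)" unfolding subset_iff lo mem_cube by (meson less_imp_le)
  then have "emeasure lborel (cell p R k x) \<le> ennreal ((R / 2 ^ k) ^ CARD('n))"
    unfolding emeasure_cube[OF s, of lo, symmetric] by (rule emeasure_mono) simp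
  moreover have "box lo (\<chi> i. lo $ i + R / 2 ^ k) \<subseteq> cell p R k x" unfolding subset_iff lo mem_box_cart by (auto intro: less_imp_le)
  then have "ennreal ((R / 2 ^ k) ^ CARD('n)) \<le> emeasure lborel (cell p R k x)"
    unfolding emeasure_open_cube[OF s, of lo, symmetric] by (rule emeasure_mono) simp
  ultimately show ?thesis by (rule antisym)
qed

lemma cell_diameter:
  fixes p :: "real ^ 'n"
  assumes "0 < R" "y \<in> cell p R k x" shows "norm (y - x) \<le> CARD('n) * (R / 2 ^ k)"
proof -
  obtain lo where lo: "\<And>y. y \<in> cell p R k x \<longleftrightarrow> (\<forall>i. lo $ i \<le> y $ i \<and> y $ i < lo $ i + R / 2 ^ k)"
    using cell_bounds[OF assms(1)] by blast
  have "norm (y - x) \<le> (\<Sum>i\<in>UNIV. \<bar>(y - x) $ i\<bar>)" by (rule norm_le_l1_cart)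
  also have "\<dots> \<le> (\<Sum>i\<in>(UNIV :: 'n set). R / 2 ^ k)"
  proof (rule sum_mono)
    fix i
    have "lo $ i \<le> y $ i" "y $ i < lo $ i + R / 2 ^ k" "lo $ i \<le> x $ i" "x $ i < lo $ i + R / 2 ^ k"
      using assms(2) cell_self[of x p R k] unfolding lo by blast+
    then show "\<bar>(y - x) $ i\<bar> \<le> R / 2 ^ k" unfolding vector_minus_component by linarith
  qed
  finally show ?thesis by simp
qed

text \<open>The mean of the modulus of \<open>h\<close> over \<open>P\<close> lies between
  \<open>\<theta>\<close> and \<open>2 ^ n * \<theta>\<close>. The lower bound lets the mass of
  \<open>h\<close> pay for the volume of the cells, the upper one bounds the good part;
  \<open>x\<close> and \<open>s\<close> locate the cell for the estimates away from it.\<close>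

definition stopped_cell :: "(real ^ 'n \<Rightarrow> complex) \<Rightarrow> real \<Rightarrow> (real ^ 'n) set \<Rightarrow> real ^ 'n \<Rightarrow> real \<Rightarrow> bool" where
  "stopped_cell h \<theta> P x s \<longleftrightarrow> 0 < s \<and> P \<in> sets borel \<and> emeasure lborel P = ennreal (s ^ CARD('n)) \<and> (\<forall>y\<in>P. norm (y - x) \<le> real CARD('n) * s) \<and>
    ennreal (\<theta> * s ^ CARD('n)) \<le> (\<integral>\<^sup>+x\<in>P. ennreal (norm (h x)) \<partial>lborel) \<and>
    (\<integral>\<^sup>+x\<in>P. ennreal (norm (h x)) \<partial>lborel) \<le> ennreal (2 ^ CARD('n) * \<theta> * s ^ CARD('n))"

text \<open>Since the function oscillates little on the cells of some generation, the stopping time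
  only has to run through finitely many generations, and the family of selected cells is finite.\<close>

lemma calderon_zygmund_decomposition:
  fixes p :: "real ^ 'n" and h :: "real ^ 'n \<Rightarrow> complex"
  assumes "0 < R" "0 < \<theta>" and h: "integrable lborel h"
    and mass: "(\<integral>\<^sup>+x. ennreal (norm (h x)) \<partial>lborel) \<le> ennreal (\<theta> * R ^ CARD('n))"
    and osc: "\<And>x y. y \<in> cell p R G x \<Longrightarrow> norm (h x - h y) \<le> \<theta>"
  shows "\<exists>F. finite F \<and> disjoint F \<and> (\<forall>x. x \<notin> \<Union>F \<longrightarrow> norm (h x) \<le> 2 * \<theta>) \<and> (\<forall>P\<in>F. \<exists>x s. stopped_cell h \<theta> P x s)"
proof -
  have [measurable]: "h \<in> borel_measurable borel" using borel_measurable_integrable[OF h] by simp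
  define mass_on where "mass_on S = (\<integral>\<^sup>+x\<in>S. ennreal (norm (h x)) \<partial>lborel)" for S
  have mass_mono: "mass_on S \<le> mass_on S'" if "S \<subseteq> S'" for S S'
    unfolding mass_on_def using that by (intro nn_integral_mono mult_left_mono) (auto simp: indicator_def)
  let ?C = "cell p R"
  define sel where "sel k x \<longleftrightarrow> ennreal (\<theta> * (R / 2 ^ k) ^ CARD('n)) < mass_on (?C k x)" for k x
  have sel_cong: "sel k y \<longleftrightarrow> sel k x" if "y \<in> ?C k x" for k x y
    using cell_eq[OF that] by (simp add: sel_def)
  define \<tau> where "\<tau> x = (LEAST k. sel k x)" for x
  define stop where "stop x \<longleftrightarrow> (\<exists>k\<le>G. sel k x)" for x
  \<comment> \<open>The total mass is at most \<open>\<theta>\<close> times the volume of a cell of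
    generation 0. Hence every selected cell has a parent that was not selected, which gives the
    upper bound for its mean.\<close>
  have sel0: "\<not> sel 0 x" for x
  proof -
    have "mass_on (?C 0 x) \<le> (\<integral>\<^sup>+x. ennreal (norm (h x)) \<partial>lborel)"
      unfolding mass_on_def by (intro nn_integral_mono) (auto simp: indicator_def)
    then show ?thesis using mass by (simp add: sel_def not_less)
  qed
  have tau: "sel (\<tau> x) x" "\<tau> x \<le> G" "\<And>k. k < \<tau> x \<Longrightarrow> \<not> sel k x" if st: "stop x" for x
  proof -
    obtain k where k: "k \<le> G" "sel k x" using st by (auto simp: stop_def)
    show "sel (\<tau> x) x" unfolding \<tau>_def using k(2) by (rule LeastI)
    show "\<tau> x \<le> G" unfolding \<tau>_def using Least_le[of "\<lambda>k. sel k x", OF k(2)] k(1) by simp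
    show "\<not> sel k x" if "k < \<tau> x" for k using that not_less_Least unfolding \<tau>_def by blast
  qed
  define F where "F = (\<lambda>x. ?C (\<tau> x) x) ` {x. stop x}"
  \<comment> \<open>The cells of the generations up to the stopping time are shared by all points of
    the selected cell, so the stopping time is constant there and two selected cells are equal or
    disjoint.\<close>
  have same: "stop z \<and> ?C (\<tau> x) x = ?C (\<tau> z) z" if x: "stop x" and z: "z \<in> ?C (\<tau> x) x" for x z
  proof -
    have s: "sel k z \<longleftrightarrow> sel k x" if "k \<le> \<tau> x" for k
      using sel_cong cell_antimono[OF that, of p R x] z by blast
    have "\<tau> z = \<tau> x"
      unfolding \<tau>_def[of z]
    proof (rule Least_equality)
      show "sel (\<tau> x) z" using s tau(1)[OF x] by simp
      show "\<tau> x \<le> k" if "sel k z" for k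
      proof (rule ccontr)
        assume "\<not> \<tau> x \<le> k"
        then have "k < \<tau> x" by simp
        then show False using s[of k] tau(3)[OF x] that by auto
      qed
    qed
    moreover have "stop z" using s[of "\<tau> x"] tau[OF x] by (auto simp: stop_def)
    ultimately show ?thesis using cell_eq[OF z] by simp
  qed
  have disj: "disjoint F"
  proof (rule disjointI)
    fix P P' assume "P \<in> F" "P' \<in> F" "P \<noteq> P'"
    then obtain x y where "stop x" "stop y" "P = ?C (\<tau> x) x" "P' = ?C (\<tau> y) y" by (auto simp: F_def)
    then show "P \<inter> P' = {}" using same \<open>P \<noteq> P'\<close> by (metis disjoint_iff)
  qed
  have sel_prop: "\<exists>x s. R / 2 ^ G \<le> s \<and> 0 < s \<and> P \<in> sets borel \<and> emeasure lborel P = ennreal (s ^ CARD('n)) \<and> (\<forall>y\<in>P. norm (y - x) \<le> real CARD('n) * s) \<and>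
      ennreal (\<theta> * s ^ CARD('n)) \<le> mass_on P \<and> mass_on P \<le> ennreal (2 ^ CARD('n) * \<theta> * s ^ CARD('n))" if Pin: "P \<in> F" for P
  proof -
    obtain x where x: "stop x" "P = ?C (\<tau> x) x" using Pin by (auto simp: F_def)
    have "\<tau> x \<noteq> 0" using tau(1)[OF x(1)] sel0 by metis
    then obtain k where k: "\<tau> x = Suc k" by (cases "\<tau> x") auto
    let ?s = "R / 2 ^ Suc k"
    have s: "0 < ?s" using \<open>0 < R\<close> by simp
    have "2 ^ Suc k \<le> (2 ^ G :: real)" using tau(2)[OF x(1)] k by (intro power_increasing) auto
    then have "R / 2 ^ G \<le> ?s" using \<open>0 < R\<close> by (intro divide_left_mono) auto
    moreover have "mass_on P \<le> ennreal (2 ^ CARD('n) * \<theta> * ?s ^ CARD('n))"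
    proof -
      have "mass_on P \<le> mass_on (?C k x)" unfolding x(2) k by (intro mass_mono cell_Suc)
      also have "\<dots> \<le> ennreal (\<theta> * (R / 2 ^ k) ^ CARD('n))" using tau(3)[OF x(1), of k] k by (simp add: sel_def not_less)
      also have "R / 2 ^ k = 2 * ?s" by simp
      finally show ?thesis by (simp only: power_mult_distrib mult_ac)
    qed
    moreover have "ennreal (\<theta> * ?s ^ CARD('n)) \<le> mass_on P" using tau(1)[OF x(1)] by (simp only: sel_def x(2) k less_imp_le)
    moreover have "emeasure lborel P = ennreal (?s ^ CARD('n))" unfolding x(2) k by (rule emeasure_cell) fact
    moreover have "\<forall>y\<in>P. norm (y - x) \<le> CARD('n) * ?s" unfolding x(2) k using cell_diameter[OF \<open>0 < R\<close>] by blast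
    moreover have "P \<in> sets borel" unfolding x(2) by measurable
    ultimately show ?thesis using s by blast
  qed
  \<comment> \<open>Each selected cell carries at least the mass
    \<open>\<theta> * (R / 2 ^ G) ^ n\<close>, and the cells are disjoint, so the total mass limits
    their number.\<close>
  have fin: "finite F"
  proof -
    let ?m = "\<theta> * (R / 2 ^ G) ^ CARD('n)"
    have m: "0 < ?m" using \<open>0 < R\<close> \<open>0 < \<theta>\<close> by simp
    have "card F' \<le> nat \<lceil>(\<theta> * R ^ CARD('n)) / ?m\<rceil>" if F': "F' \<subseteq> F" "finite F'" for F'
    proof -
      have "ennreal (real (card F') * ?m) = (\<Sum>P\<in>F'. ennreal ?m)"
        using m by (simp add: ennreal_mult ennreal_of_nat_eq_real_of_nat)
      also have "\<dots> \<le> (\<Sum>P\<in>F'. mass_on P)"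
      proof (rule sum_mono)
        fix P assume "P \<in> F'"
        then obtain s where s: "R / 2 ^ G \<le> s" "ennreal (\<theta> * s ^ CARD('n)) \<le> mass_on P" using sel_prop F' by blast
        have "?m \<le> \<theta> * s ^ CARD('n)" using s(1) \<open>0 < R\<close> \<open>0 < \<theta>\<close> by (intro mult_left_mono power_mono) auto
        then show "ennreal ?m \<le> mass_on P" using s(2) by (meson ennreal_leI order_trans)
      qed
      also have "\<dots> = (\<integral>\<^sup>+x. (\<Sum>P\<in>F'. ennreal (norm (h x)) * indicator P x) \<partial>lborel)"
        unfolding mass_on_def
      proof (rule nn_integral_sum[symmetric])
        fix P assume "P \<in> F'"
        then have [measurable]: "P \<in> sets borel" using sel_prop F' by blast
        show "(\<lambda>x. ennreal (norm (h x)) * indicator P x) \<in> borel_measurable lborel" by measurable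
      qed
      also have "\<dots> \<le> (\<integral>\<^sup>+x. ennreal (norm (h x)) \<partial>lborel)"
      proof (rule nn_integral_mono)
        fix x
        have "disjoint F'" using disj F'(1) by (auto simp: disjoint_def)
        then have "(\<Sum>P\<in>F'. indicator P x :: ennreal) = indicator (\<Union>F') x"
          using F'(2) by (subst indicator_UN_disjoint[of F' "\<lambda>P. P", symmetric, simplified]) (auto simp: disjoint_family_on_def disjoint_def)
        then show "(\<Sum>P\<in>F'. ennreal (norm (h x)) * indicator P x) \<le> ennreal (norm (h x))"
          by (simp add: sum_distrib_left[symmetric] indicator_def)
      qed
      also note mass
      finally have "real (card F') * ?m \<le> \<theta> * R ^ CARD('n)"
        using \<open>0 < R\<close> \<open>0 < \<theta>\<close> by (simp only: ennreal_le_iff mult_nonneg_nonneg zero_le_power less_imp_le)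
      then have "real (card F') \<le> (\<theta> * R ^ CARD('n)) / ?m" using m by (simp only: pos_le_divide_eq)
      then show ?thesis by linarith
    qed
    then show ?thesis using finite_if_finite_subsets_card_bdd[of F] by blast
  qed
  \<comment> \<open>This takes the place of Lebesgue's differentiation theorem: at a point that
    never stops, the mean over its cell of generation \<open>G\<close> is at most
    \<open>\<theta>\<close>, and the function differs from its value there by at most
    \<open>\<theta>\<close>.\<close>
  have small: "norm (h x) \<le> 2 * \<theta>" if "x \<notin> \<Union>F" for x
  proof (rule ccontr)
    assume big: "\<not> norm (h x) \<le> 2 * \<theta>"
    have "\<not> stop x" using that cell_self[of x p R "\<tau> x"] by (auto simp: F_def)
    then have "\<not> sel G x" by (auto simp: stop_def)
    then have m: "mass_on (?C G x) \<le> ennreal (\<theta> * (R / 2 ^ G) ^ CARD('n))" by (simp add: sel_def not_less)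
    have "ennreal ((norm (h x) - \<theta>) * (R / 2 ^ G) ^ CARD('n)) = (\<integral>\<^sup>+y\<in>?C G x. ennreal (norm (h x) - \<theta>) \<partial>lborel)"
      using big \<open>0 < R\<close> \<open>0 < \<theta>\<close> by (simp add: nn_integral_cmult_indicator emeasure_cell ennreal_mult)
    also have "\<dots> \<le> mass_on (?C G x)"
      unfolding mass_on_def
    proof (rule nn_integral_mono)
      fix y
      have "norm (h x) - \<theta> \<le> norm (h y)" if "y \<in> ?C G x"
        using osc[OF that] norm_triangle_ineq2[of "h x" "h y"] by linarith
      then show "ennreal (norm (h x) - \<theta>) * indicator (?C G x) y \<le> ennreal (norm (h y)) * indicator (?C G x) y"
        by (auto simp: indicator_def intro: ennreal_leI)
    qed
    also note m
    finally have "(norm (h x) - \<theta>) * (R / 2 ^ G) ^ CARD('n) \<le> \<theta> * (R / 2 ^ G) ^ CARD('n)"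
      using \<open>0 < R\<close> \<open>0 < \<theta>\<close> by (simp only: ennreal_le_iff mult_nonneg_nonneg zero_le_power less_imp_le divide_nonneg_nonneg zero_le_numeral)
    then have "norm (h x) - \<theta> \<le> \<theta>" using \<open>0 < R\<close> by simp
    then show False using big by simp
  qed
  have "\<exists>x s. stopped_cell h \<theta> P x s" if "P \<in> F" for P
    using sel_prop[OF that, unfolded mass_on_def] unfolding stopped_cell_def by blast
  with fin disj small show ?thesis by blast
qed

section \<open>The weak type estimate and Kolmogorov's inequality\<close>

lemma sum_min_dyadic:
  fixes s :: real
  assumes "0 < s" "finite I" and D: "\<And>j. 0 \<le> D j"
    and low: "\<And>j. 2 ^ j * s < 1 \<Longrightarrow> D j \<le> K * (2 ^ j * s)" and high: "\<And>j. 1 \<le> 2 ^ j * s \<Longrightarrow> D j \<le> K * (1 / (2 ^ j * s))"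
    and "0 \<le> K"
  shows "(\<Sum>j\<in>I. D j) \<le> 4 * K"
proof -
  obtain L0 where "1 / s < 2 ^ L0" using real_arch_pow[of 2 "1 / s"] by auto
  then have ex: "\<exists>L. 1 \<le> 2 ^ L * s" using \<open>0 < s\<close> by (intro exI[of _ L0]) (simp add: field_simps)
  define L where "L = (LEAST L. 1 \<le> 2 ^ L * s)"
  have L: "1 \<le> 2 ^ L * s" unfolding L_def using ex by (rule LeastI_ex)
  have less: "2 ^ j * s < 1" if "j < L" for j
    using not_less_Least[of j "\<lambda>L. 1 \<le> 2 ^ L * s"] that unfolding L_def by (simp add: not_le)
  obtain J where J: "I \<subseteq> {..<J}" using finite_nat_bounded[OF \<open>finite I\<close>] by blast
  have "(\<Sum>j\<in>I. D j) \<le> (\<Sum>j\<in>{..<L} \<union> {L..<L + J}. D j)"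
    using J D by (intro sum_mono2) auto
  also have "\<dots> = (\<Sum>j<L. D j) + (\<Sum>j\<in>{L..<L + J}. D j)" by (rule sum.union_disjoint) auto
  also have "(\<Sum>j<L. D j) \<le> (\<Sum>j<L. K * (2 ^ j * s))" by (intro sum_mono low less) simp
  also have "\<dots> = K * (\<Sum>j<L. 2 ^ j * s)" by (simp add: sum_distrib_left)
  also have "\<dots> \<le> K * 2" using \<open>0 < s\<close> \<open>0 \<le> K\<close> less by (intro mult_left_mono sum_dyadic_low) auto
  also have "(\<Sum>j\<in>{L..<L + J}. D j) \<le> (\<Sum>j\<in>{L..<L + J}. K * (1 / 2) ^ (j - L))"
  proof (rule sum_mono)
    fix j assume j: "j \<in> {L..<L + J}"
    have "2 ^ (j - L) * 1 \<le> 2 ^ (j - L) * (2 ^ L * s)" using L by (intro mult_left_mono) auto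
    also have "\<dots> = 2 ^ j * s" using j by (simp flip: power_add mult.assoc)
    finally have js: "2 ^ (j - L) \<le> 2 ^ j * s" by simp
    moreover have "(1::real) \<le> 2 ^ (j - L)" by simp
    ultimately have "1 \<le> 2 ^ j * s" by linarith
    then have "D j \<le> K * (1 / (2 ^ j * s))" by (rule high)
    also have "\<dots> \<le> K * (1 / 2 ^ (j - L))" using js \<open>0 < s\<close> \<open>0 \<le> K\<close> by (intro mult_left_mono divide_left_mono) auto
    finally show "D j \<le> K * (1 / 2) ^ (j - L)" by (simp add: power_divide)
  qed
  also have "\<dots> = K * (\<Sum>j\<in>{L..<L + J}. (1 / 2) ^ (j - L))" by (simp add: sum_distrib_left)
  also have "\<dots> \<le> K * (1 / (1 - 1 / 2))" using \<open>0 \<le> K\<close> by (intro mult_left_mono sum_geometric_le) auto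
  finally show ?thesis by simp
qed

lemma markov:
  fixes f :: "'a::euclidean_space \<Rightarrow> real"
  assumes [measurable]: "f \<in> borel_measurable borel" and "0 < t" "0 \<le> c" and b: "(\<integral>\<^sup>+x. ennreal (f x) \<partial>lborel) \<le> ennreal c"
  shows "emeasure lborel {x. t < f x} \<le> ennreal (c / t)"
proof -
  have "ennreal t * emeasure lborel {x. t < f x} = (\<integral>\<^sup>+x. ennreal t * indicator {x. t < f x} x \<partial>lborel)"
    by (rule nn_integral_cmult_indicator[symmetric]) measurable
  also have "\<dots> \<le> (\<integral>\<^sup>+x. ennreal (f x) \<partial>lborel)"
    by (rule nn_integral_mono) (auto simp: indicator_def intro: ennreal_leI)
  also have "\<dots> \<le> ennreal c" by fact
  also have "ennreal c = ennreal t * ennreal (c / t)" using \<open>0 < t\<close> \<open>0 \<le> c\<close> by (simp flip: ennreal_mult)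
  finally show ?thesis using \<open>0 < t\<close> by (subst (asm) ennreal_mult_le_mult_iff) auto
qed

lemma disjoint_sum_indicator_le:
  assumes "finite F" "disjoint F" shows "(\<Sum>P\<in>F. indicator P x :: ennreal) \<le> 1"
proof (cases "\<exists>P0\<in>F. x \<in> P0")
  case True
  then obtain P0 where P0: "P0 \<in> F" "x \<in> P0" by blast
  then have "x \<notin> P" if "P \<in> F - {P0}" for P using that assms(2) by (auto simp: disjoint_def)
  then have "(\<Sum>P\<in>F. indicator P x :: ennreal) = indicator P0 x"
    using assms(1) P0 by (subst sum.remove[of F P0]) auto
  then show ?thesis by (simp add: indicator_def)
qed auto

text \<open>Dyadic layers: where the function lies between \<open>2 ^ m * \<mu>\<close> and twice
  that, its power is at most \<open>(2 ^ Suc m * \<mu>) powr \<epsilon>\<close>. Against the weak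
  bound this leaves a geometric series with ratio \<open>2 powr (\<epsilon> - 1)\<close>, which is
  below 1 because of \<open>\<epsilon> < 1\<close>.\<close>

lemma kolmogorov:
  fixes f :: "'a::euclidean_space \<Rightarrow> real"
  assumes [measurable]: "f \<in> borel_measurable borel" "S \<in> sets borel" and f0: "\<And>x. 0 \<le> f x"
    and "0 < \<mu>" "0 < \<epsilon>" "\<epsilon> < 1" "0 \<le> K"
    and weak: "\<And>m::nat. emeasure lborel {x. 2 ^ m * \<mu> < f x} \<le> ennreal (K / 2 ^ m)"
  shows "(\<integral>\<^sup>+x\<in>S. ennreal (f x powr \<epsilon>) \<partial>lborel) \<le> ennreal (\<mu> powr \<epsilon>) * emeasure lborel S + ennreal (\<mu> powr \<epsilon> * K * (2 powr \<epsilon> / (1 - 2 powr (\<epsilon> - 1))))"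
proof -
  let ?q = "2 powr (\<epsilon> - 1) :: real"
  have "?q < 2 powr 0" using \<open>\<epsilon> < 1\<close> by (intro powr_less_mono) auto
  then have q: "0 < ?q" "?q < 1" by auto
  let ?w = "\<lambda>m::nat. (2 ^ Suc m * \<mu>) powr \<epsilon>"
  have w: "?w m * (K / 2 ^ m) = \<mu> powr \<epsilon> * K * 2 powr \<epsilon> * ?q ^ m" for m
  proof -
    have "?w m = 2 powr \<epsilon> * (2 powr \<epsilon>) ^ m * \<mu> powr \<epsilon>"
      using \<open>0 < \<mu>\<close> by (simp add: powr_mult powr_power powr_powr mult_ac flip: powr_realpow)
    moreover have "?q ^ m = (2 powr \<epsilon>) ^ m / 2 ^ m" by (simp add: powr_diff power_divide)
    ultimately show ?thesis by simp
  qed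
  have pt: "ennreal (f x powr \<epsilon>) \<le> ennreal (\<mu> powr \<epsilon>) + (\<Sum>m. ennreal (?w m) * indicator {x. 2 ^ m * \<mu> < f x} x)" for x
  proof (cases "f x \<le> \<mu>")
    case True
    then have "f x powr \<epsilon> \<le> \<mu> powr \<epsilon>" using f0 \<open>0 < \<epsilon>\<close> by (intro powr_mono2) auto
    then show ?thesis by (intro add_increasing2) (auto intro: ennreal_leI)
  next
    case False
    obtain M0 where "f x / \<mu> < 2 ^ M0" using real_arch_pow[of 2 "f x / \<mu>"] by auto
    then have ex: "\<exists>M. f x \<le> 2 ^ M * \<mu>" using \<open>0 < \<mu>\<close> by (intro exI[of _ M0]) (simp add: field_simps)
    define M where "M = (LEAST M. f x \<le> 2 ^ M * \<mu>)"
    have M: "f x \<le> 2 ^ M * \<mu>" unfolding M_def using ex by (rule LeastI_ex)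
    then have "M \<noteq> 0" using False by (cases M) auto
    then obtain m where m: "M = Suc m" by (cases M) auto
    have less: "2 ^ m * \<mu> < f x" using not_less_Least[of m "\<lambda>M. f x \<le> 2 ^ M * \<mu>"] m unfolding M_def by (simp add: not_le)
    have "f x powr \<epsilon> \<le> ?w m" using M m f0 \<open>0 < \<epsilon>\<close> by (intro powr_mono2) auto
    then have "ennreal (f x powr \<epsilon>) \<le> ennreal (?w m) * indicator {x. 2 ^ m * \<mu> < f x} x" using less by (simp add: ennreal_leI)
    also have "\<dots> \<le> (\<Sum>m. ennreal (?w m) * indicator {x. 2 ^ m * \<mu> < f x} x)" by (rule ennreal_term_le_suminf)
    finally show ?thesis by (rule add_increasing[rotated]) simp
  qed
  have "(\<integral>\<^sup>+x\<in>S. ennreal (f x powr \<epsilon>) \<partial>lborel) \<le> (\<integral>\<^sup>+x. ennreal (\<mu> powr \<epsilon>) * indicator S x + (\<Sum>m. ennreal (?w m) * indicator {x. 2 ^ m * \<mu> < f x} x) \<partial>lborel)"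
    using pt by (intro nn_integral_mono) (auto simp: indicator_def)
  also have "\<dots> = ennreal (\<mu> powr \<epsilon>) * emeasure lborel S + (\<Sum>m. ennreal (?w m) * emeasure lborel {x. 2 ^ m * \<mu> < f x})"
    by (subst nn_integral_add) (auto simp: nn_integral_cmult_indicator nn_integral_suminf)
  also have "(\<Sum>m. ennreal (?w m) * emeasure lborel {x. 2 ^ m * \<mu> < f x}) \<le> (\<Sum>m. ennreal (\<mu> powr \<epsilon> * K * 2 powr \<epsilon> * ?q ^ m))"
  proof (intro suminf_le summableI)
    fix m
    have "ennreal (?w m) * emeasure lborel {x. 2 ^ m * \<mu> < f x} \<le> ennreal (?w m) * ennreal (K / 2 ^ m)" by (intro mult_left_mono weak) simp
    also have "\<dots> = ennreal (?w m * (K / 2 ^ m))" using \<open>0 \<le> K\<close> by (subst ennreal_mult) auto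
    finally show "ennreal (?w m) * emeasure lborel {x. 2 ^ m * \<mu> < f x} \<le> ennreal (\<mu> powr \<epsilon> * K * 2 powr \<epsilon> * ?q ^ m)" unfolding w .
  qed
  also have "\<dots> = ennreal (\<mu> powr \<epsilon> * K * (2 powr \<epsilon> / (1 - ?q)))"
  proof -
    have "(\<lambda>m. \<mu> powr \<epsilon> * K * 2 powr \<epsilon> * ?q ^ m) sums (\<mu> powr \<epsilon> * K * 2 powr \<epsilon> * (1 / (1 - ?q)))"
      using q by (intro sums_mult geometric_sums) auto
    then show ?thesis using \<open>0 \<le> K\<close> by (subst suminf_ennreal2) (auto simp: sums_iff mult_ac)
  qed
  finally show ?thesis by (simp add: add_left_mono)
qed

context cz_family
begin

text \<open>For \<open>2 ^ j * s < 1\<close> smoothness in the second variable gains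
  \<open>2 ^ j * s\<close>; for larger \<open>j\<close> both kernels are small at distance at least
  \<open>s\<close> from their centres and a power of decay gains the inverse. The radius
  \<open>2 * n * s\<close> keeps this distance from \<open>y\<close> as well as from
  \<open>y0\<close>.\<close>

lemma hoermander:
  assumes "0 < s" "norm (y - y0) \<le> real CARD('n) * s" "finite I"
  shows "(\<Sum>j\<in>I. (\<integral>\<^sup>+x. ennreal (norm (k j x y - k j x y0)) * indicator {x. 2 * real CARD('n) * s < norm (x - y0)} x \<partial>lborel)) \<le> ennreal (8 * real CARD('n) * A * C0)"
proof -
  let ?n = "real CARD('n)" and ?E = "{x. 2 * real CARD('n) * s < norm (x - y0)}"
  have n1: "1 \<le> ?n" by simp
  define D where "D j = (if 2 ^ j * s < 1 then 2 ^ j * s else 1 / (2 ^ j * s))" for j :: nat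
  have D0: "0 \<le> D j" for j using \<open>0 < s\<close> by (simp add: D_def)
  have far: "s \<le> norm (x - y)" "s \<le> norm (x - y0)" if "x \<in> ?E" for x
  proof -
    have "?n * s + ?n * s < norm (x - y0)" using that by (simp add: algebra_simps)
    moreover have "norm (x - y0) \<le> norm (x - y) + norm (y - y0)" using norm_triangle_ineq[of "x - y" "y - y0"] by simp
    moreover have "1 * s \<le> ?n * s" using n1 \<open>0 < s\<close> by (intro mult_right_mono) auto
    ultimately show "s \<le> norm (x - y)" "s \<le> norm (x - y0)" using assms(2) \<open>0 < s\<close> by linarith+
  qed
  have "(\<integral>\<^sup>+x. ennreal (norm (k j x y - k j x y0)) * indicator ?E x \<partial>lborel) \<le> ennreal (2 * ?n * A * C0 * D j)" for j
  proof (cases "2 ^ j * s < 1")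
    case True
    have "norm (y - y0) \<le> ?n * s" by fact
    also have "\<dots> \<le> ?n * (1 / 2 ^ j)" using True by (intro mult_left_mono) (auto simp: field_simps)
    finally have d: "norm (y - y0) \<le> ?n / 2 ^ j" by simp
    have "(\<integral>\<^sup>+x. ennreal (norm (k j x y - k j x y0)) * indicator ?E x \<partial>lborel) \<le> (\<integral>\<^sup>+x. ennreal (A * (2 ^ j * (?n * s))) * ennreal (\<Phi> j (x - y)) \<partial>lborel)"
    proof (rule nn_integral_mono)
      fix x
      have "norm (k j x y - k j x y0) \<le> A * (2 ^ j * norm (y - y0)) * \<Phi> j (x - y)" by (rule smooth_right[OF d])
      also have "\<dots> \<le> A * (2 ^ j * (?n * s)) * \<Phi> j (x - y)" using assms(2) A_pos by (intro mult_right_mono mult_left_mono) auto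
      finally have "ennreal (norm (k j x y - k j x y0)) \<le> ennreal (A * (2 ^ j * (?n * s))) * ennreal (\<Phi> j (x - y))"
        using A_pos \<open>0 < s\<close> by (subst ennreal_mult[symmetric]) (auto intro: ennreal_leI)
      then show "ennreal (norm (k j x y - k j x y0)) * indicator ?E x \<le> ennreal (A * (2 ^ j * (?n * s))) * ennreal (\<Phi> j (x - y))"
        by (auto simp: indicator_def)
    qed
    also have "\<dots> = ennreal (A * (2 ^ j * (?n * s))) * (\<integral>\<^sup>+x. ennreal (\<Phi> j (x - y)) \<partial>lborel)" by (rule nn_integral_cmult) measurable
    also have "\<dots> \<le> ennreal (A * (2 ^ j * (?n * s))) * ennreal C0" by (rule mult_left_mono[OF nn_integral_\<Phi>(2)]) simp
    also have "\<dots> = ennreal (?n * A * C0 * D j)" using True A_pos C0 \<open>0 < s\<close> by (subst ennreal_mult[symmetric]) (auto simp: D_def mult_ac)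
    also have "\<dots> \<le> ennreal (2 * ?n * A * C0 * D j)"
      using A_pos C0 D0[of j] by (intro ennreal_leI mult_right_mono) auto
    finally show ?thesis .
  next
    case False
    have pk: "\<Phi> j w \<le> D j * \<Phi>' j w" if "s \<le> norm w" for w
      using peak_far_le[OF dscale_pos \<open>0 < s\<close> that, of "CARD('n) + 1" 1 j] False by (simp add: D_def dscale_1)
    have "(\<integral>\<^sup>+x. ennreal (norm (k j x y - k j x y0)) * indicator ?E x \<partial>lborel) \<le> (\<integral>\<^sup>+x. ennreal (A * D j) * (ennreal (\<Phi>' j (x - y)) + ennreal (\<Phi>' j (x - y0))) \<partial>lborel)"
    proof (rule nn_integral_mono)
      fix x
      show "ennreal (norm (k j x y - k j x y0)) * indicator ?E x \<le> ennreal (A * D j) * (ennreal (\<Phi>' j (x - y)) + ennreal (\<Phi>' j (x - y0)))"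
      proof (cases "x \<in> ?E")
        case True
        have "norm (k j x y - k j x y0) \<le> A * \<Phi> j (x - y) + A * \<Phi> j (x - y0)"
          by (rule norm_triangle_le_diff) (intro add_mono size)
        also have "\<dots> \<le> A * (D j * \<Phi>' j (x - y)) + A * (D j * \<Phi>' j (x - y0))"
          using A_pos by (intro add_mono mult_left_mono pk far[OF True]) auto
        also have "\<dots> = A * D j * (\<Phi>' j (x - y) + \<Phi>' j (x - y0))" by (simp add: algebra_simps)
        finally have "ennreal (norm (k j x y - k j x y0)) \<le> ennreal \<dots>" by (rule ennreal_leI)
        also have "\<dots> = ennreal (A * D j) * (ennreal (\<Phi>' j (x - y)) + ennreal (\<Phi>' j (x - y0)))"
          using A_pos D0[of j] by (subst ennreal_mult) (auto simp: ennreal_plus)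
        finally show ?thesis using True by simp
      qed simp
    qed
    also have "\<dots> = ennreal (A * D j) * ((\<integral>\<^sup>+x. ennreal (\<Phi>' j (x - y)) \<partial>lborel) + (\<integral>\<^sup>+x. ennreal (\<Phi>' j (x - y0)) \<partial>lborel))"
      by (subst nn_integral_cmult, measurable, subst nn_integral_add) auto
    also have "\<dots> \<le> ennreal (A * D j) * (ennreal C0 + ennreal C0)"
      by (intro mult_left_mono add_mono nn_integral_\<Phi>) simp
    also have "\<dots> = ennreal (2 * A * C0 * D j)" using A_pos C0 D0[of j]
      by (simp add: ennreal_mult[symmetric] ennreal_plus[symmetric] mult_ac del: ennreal_plus)
    also have "\<dots> \<le> ennreal (2 * ?n * A * C0 * D j)"
    proof (intro ennreal_leI mult_right_mono)
      show "2 \<le> 2 * ?n" using n1 by simp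
    qed (use C0 D0 A_pos in auto)
    finally show ?thesis .
  qed
  then have "(\<Sum>j\<in>I. (\<integral>\<^sup>+x. ennreal (norm (k j x y - k j x y0)) * indicator ?E x \<partial>lborel)) \<le> (\<Sum>j\<in>I. ennreal (2 * ?n * A * C0 * D j))"
    by (intro sum_mono)
  also have "\<dots> = ennreal (\<Sum>j\<in>I. 2 * ?n * A * C0 * D j)" using A_pos C0 D0 by (subst sum_ennreal) auto
  also have "(\<Sum>j\<in>I. 2 * ?n * A * C0 * D j) \<le> 4 * (2 * ?n * A * C0)"
    by (rule sum_min_dyadic[OF \<open>0 < s\<close> \<open>finite I\<close>]) (use A_pos C0 D0 in \<open>auto simp: D_def\<close>)
  finally show ?thesis by (simp add: mult_ac ennreal_leI)
qed

text \<open>As the integral of \<open>b\<close> vanishes, the kernel at the reference point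
  \<open>y0\<close> can be subtracted for every \<open>x\<close>; then the preceding sum applies
  under the integral in \<open>y\<close>.\<close>

lemma mean_zero_piece:
  assumes b: "integrable lborel b" and b0: "(\<integral>y. b y \<partial>lborel) = 0" and supp: "\<And>y. b y \<noteq> 0 \<Longrightarrow> norm (y - y0) \<le> real CARD('n) * s"
    and "0 < s" "finite I"
  shows "(\<integral>\<^sup>+x. ennreal (norm (\<Sum>j\<in>I. T j b x)) * indicator {x. 2 * real CARD('n) * s < norm (x - y0)} x \<partial>lborel)
    \<le> ennreal (8 * real CARD('n) * A * C0) * (\<integral>\<^sup>+y. ennreal (norm (b y)) \<partial>lborel)"
proof -
  have [measurable]: "b \<in> borel_measurable borel" using borel_measurable_integrable[OF b] by simp
  let ?E = "{x. 2 * real CARD('n) * s < norm (x - y0)}"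
  have meas_diff [measurable]: "(\<lambda>(x, y). k j x y - k j x y0) \<in> borel_measurable (borel \<Otimes>\<^sub>M borel)" for j
  proof -
    have "(\<lambda>p. case_prod (k j) (fst p, y0)) \<in> borel_measurable (borel \<Otimes>\<^sub>M borel)"
      by (rule measurable_compose[OF _ k_measurable]) measurable
    then have [measurable]: "(\<lambda>p. k j (fst p) y0) \<in> borel_measurable (borel \<Otimes>\<^sub>M borel)" by simp
    have [measurable]: "(\<lambda>p. k j (fst p) (snd p)) \<in> borel_measurable (borel \<Otimes>\<^sub>M borel)" using k_measurable[of j] by (simp add: split_def)
    show ?thesis unfolding split_def by measurable
  qed
  have Tb: "T j b x = (\<integral>y. (k j x y - k j x y0) * b y \<partial>lborel)" for j x
    using integrable_k_mult[OF b, of j x] b by (simp add: T_def left_diff_distrib b0)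
  have pt: "ennreal (norm (T j b x)) \<le> (\<integral>\<^sup>+y. ennreal (norm (k j x y - k j x y0)) * ennreal (norm (b y)) \<partial>lborel)" for j x
    using norm_integral_le_nn_integral[where h="\<lambda>y. (k j x y - k j x y0) * b y" and M=lborel] unfolding Tb by (simp add: norm_mult ennreal_mult)
  have "(\<integral>\<^sup>+x. ennreal (norm (\<Sum>j\<in>I. T j b x)) * indicator ?E x \<partial>lborel)
      \<le> (\<integral>\<^sup>+x. (\<Sum>j\<in>I. (\<integral>\<^sup>+y. ennreal (norm (k j x y - k j x y0)) * ennreal (norm (b y)) * indicator ?E x \<partial>lborel)) \<partial>lborel)"
  proof (rule nn_integral_mono)
    fix x
    have "ennreal (norm (\<Sum>j\<in>I. T j b x)) \<le> (\<Sum>j\<in>I. ennreal (norm (T j b x)))"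
      using norm_sum[of "\<lambda>j. T j b x" I] by (subst sum_ennreal) (auto intro: ennreal_leI)
    also have "\<dots> \<le> (\<Sum>j\<in>I. (\<integral>\<^sup>+y. ennreal (norm (k j x y - k j x y0)) * ennreal (norm (b y)) \<partial>lborel))"
      by (intro sum_mono pt)
    finally show "ennreal (norm (\<Sum>j\<in>I. T j b x)) * indicator ?E x
      \<le> (\<Sum>j\<in>I. (\<integral>\<^sup>+y. ennreal (norm (k j x y - k j x y0)) * ennreal (norm (b y)) * indicator ?E x \<partial>lborel))"
      by (auto simp: indicator_def)
  qed
  also have "\<dots> = (\<Sum>j\<in>I. (\<integral>\<^sup>+x. (\<integral>\<^sup>+y. ennreal (norm (k j x y - k j x y0)) * ennreal (norm (b y)) * indicator ?E x \<partial>lborel) \<partial>lborel))"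
    by (rule nn_integral_sum) measurable
  also have "\<dots> = (\<Sum>j\<in>I. (\<integral>\<^sup>+y. (\<integral>\<^sup>+x. ennreal (norm (k j x y - k j x y0)) * ennreal (norm (b y)) * indicator ?E x \<partial>lborel) \<partial>lborel))"
    by (intro sum.cong refl lborel_pair.Fubini') measurable
  also have "\<dots> = (\<integral>\<^sup>+y. (\<Sum>j\<in>I. (\<integral>\<^sup>+x. ennreal (norm (k j x y - k j x y0)) * ennreal (norm (b y)) * indicator ?E x \<partial>lborel)) \<partial>lborel)"
    by (rule nn_integral_sum[symmetric]) measurable
  also have "\<dots> \<le> (\<integral>\<^sup>+y. ennreal (8 * real CARD('n) * A * C0) * ennreal (norm (b y)) \<partial>lborel)"
  proof (rule nn_integral_mono)
    fix y
    have "(\<integral>\<^sup>+x. ennreal (norm (k j x y - k j x y0)) * ennreal (norm (b y)) * indicator ?E x \<partial>lborel)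
       = (\<integral>\<^sup>+x. (ennreal (norm (k j x y - k j x y0)) * indicator ?E x) * ennreal (norm (b y)) \<partial>lborel)" for j
      by (simp add: mult_ac)
    also have "\<dots> j = (\<integral>\<^sup>+x. ennreal (norm (k j x y - k j x y0)) * indicator ?E x \<partial>lborel) * ennreal (norm (b y))" for j
      by (rule nn_integral_multc) measurable
    finally have e: "(\<Sum>j\<in>I. (\<integral>\<^sup>+x. ennreal (norm (k j x y - k j x y0)) * ennreal (norm (b y)) * indicator ?E x \<partial>lborel))
      = (\<Sum>j\<in>I. (\<integral>\<^sup>+x. ennreal (norm (k j x y - k j x y0)) * indicator ?E x \<partial>lborel)) * ennreal (norm (b y))"
      by (simp add: sum_distrib_right)
    show "(\<Sum>j\<in>I. (\<integral>\<^sup>+x. ennreal (norm (k j x y - k j x y0)) * ennreal (norm (b y)) * indicator ?E x \<partial>lborel))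
      \<le> ennreal (8 * real CARD('n) * A * C0) * ennreal (norm (b y))"
    proof (cases "b y = 0")
      case False
      show ?thesis unfolding e by (intro mult_right_mono hoermander \<open>0 < s\<close> \<open>finite I\<close> supp False) simp
    qed simp
  qed
  also have "\<dots> = ennreal (8 * real CARD('n) * A * C0) * (\<integral>\<^sup>+y. ennreal (norm (b y)) \<partial>lborel)"
    by (rule nn_integral_cmult) measurable
  finally show ?thesis .
qed

text \<open>The three summands belong to the good part (by the L2 bound), to the neighbourhoods of
  the selected cells (by their volume) and to the bad parts outside these neighbourhoods.\<close>

definition W :: real where
  "W = 24 * 2 ^ CARD('n) * \<Gamma>\<^sup>2 + (4 * real CARD('n)) ^ CARD('n) + 32 * real CARD('n) * A * C0"

text \<open>Calderon-Zygmund decomposition at height \<open>\<theta>\<close>. The root scale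
  \<open>R\<close> is fixed by the mass at the lowest level \<open>\<mu>\<close>, so
  \<open>\<mu> \<le> \<theta>\<close> is what prevents stopping in generation 0.\<close>

lemma weak_type:
  assumes "0 < R" "0 < \<mu>" "\<mu> \<le> \<theta>" and h: "integrable lborel h" and I: "finite I"
    and mass: "(\<integral>\<^sup>+x. ennreal (norm (h x)) \<partial>lborel) \<le> ennreal (\<mu> * R ^ CARD('n))"
    and osc: "\<And>x y. y \<in> cell p R G x \<Longrightarrow> norm (h x - h y) \<le> \<theta>"
  shows "emeasure lborel {x. \<theta> < norm (\<Sum>j\<in>I. T j h x)} \<le> ennreal (W * (\<mu> * R ^ CARD('n)) / \<theta>)"
proof -
  have [measurable]: "h \<in> borel_measurable borel" using borel_measurable_integrable[OF h] by simp
  let ?n = "real CARD('n)"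
  define m where "m = \<mu> * R ^ CARD('n)"
  have m0: "0 \<le> m" using assms by (simp add: m_def)
  have th: "0 < \<theta>" using assms by simp
  have mass': "(\<integral>\<^sup>+x. ennreal (norm (h x)) \<partial>lborel) \<le> ennreal (\<theta> * R ^ CARD('n))"
    using mass assms by (elim order_trans) (auto intro!: ennreal_leI mult_right_mono)
  have "\<exists>F. finite F \<and> disjoint F \<and> (\<forall>x. x \<notin> \<Union>F \<longrightarrow> norm (h x) \<le> 2 * \<theta>) \<and> (\<forall>P\<in>F. \<exists>x s. stopped_cell h \<theta> P x s)"
    by (rule calderon_zygmund_decomposition[where p=p and G=G, OF \<open>0 < R\<close> th h mass']) (rule osc)
  then obtain F where dec: "finite F \<and> disjoint F \<and> (\<forall>x. x \<notin> \<Union>F \<longrightarrow> norm (h x) \<le> 2 * \<theta>) \<and> (\<forall>P\<in>F. \<exists>x s. stopped_cell h \<theta> P x s)"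
    by (rule exE) (rule that)
  from dec have F: "finite F" "disjoint F" by simp_all
  from dec have small: "\<forall>x. x \<notin> \<Union>F \<longrightarrow> norm (h x) \<le> 2 * \<theta>" by (elim conjE)
  from dec have pr: "\<forall>P\<in>F. \<exists>x s. stopped_cell h \<theta> P x s" by (elim conjE)
  obtain cx sd where "\<forall>P\<in>F. stopped_cell h \<theta> P (cx P) (sd P)"
    using pr unfolding bchoice_iff by blast
  then have cs: "\<And>P. P \<in> F \<Longrightarrow> 0 < sd P" "\<And>P. P \<in> F \<Longrightarrow> P \<in> sets borel"
    "\<And>P. P \<in> F \<Longrightarrow> emeasure lborel P = ennreal (sd P ^ CARD('n))" "\<And>P y. P \<in> F \<Longrightarrow> y \<in> P \<Longrightarrow> norm (y - cx P) \<le> ?n * sd P"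
    "\<And>P. P \<in> F \<Longrightarrow> ennreal (\<theta> * sd P ^ CARD('n)) \<le> (\<integral>\<^sup>+x\<in>P. ennreal (norm (h x)) \<partial>lborel)"
    "\<And>P. P \<in> F \<Longrightarrow> (\<integral>\<^sup>+x\<in>P. ennreal (norm (h x)) \<partial>lborel) \<le> ennreal (2 ^ CARD('n) * \<theta> * sd P ^ CARD('n))"
    unfolding stopped_cell_def by blast+
  define mP where "mP P = (\<integral>\<^sup>+x\<in>P. ennreal (norm (h x)) \<partial>lborel)" for P
  \<comment> \<open>The means over the selected cells. The good part \<open>g\<close> takes these
    values on the cells, and each \<open>b P\<close> has integral 0 and at most twice the mass of
    \<open>h\<close> on its cell.\<close>
  define a where "a P = (\<integral>y. indicator P y *\<^sub>R h y \<partial>lborel) / of_real (sd P ^ CARD('n))" for P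
  define b where "b P y = indicator P y *\<^sub>R (h y - a P)" for P y
  have sum_mP: "(\<Sum>P\<in>F. mP P) \<le> ennreal m"
  proof -
    have "(\<Sum>P\<in>F. mP P) = (\<integral>\<^sup>+x. (\<Sum>P\<in>F. ennreal (norm (h x)) * indicator P x) \<partial>lborel)"
      unfolding mP_def
    proof (rule nn_integral_sum[symmetric])
      fix P assume "P \<in> F"
      then have [measurable]: "P \<in> sets borel" by (rule cs)
      show "(\<lambda>x. ennreal (norm (h x)) * indicator P x) \<in> borel_measurable lborel" by measurable
    qed
    also have "\<dots> \<le> (\<integral>\<^sup>+x. ennreal (norm (h x)) \<partial>lborel)"
    proof (rule nn_integral_mono)
      fix x
      have "ennreal (norm (h x)) * (\<Sum>P\<in>F. indicator P x) \<le> ennreal (norm (h x)) * 1"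
        by (intro mult_left_mono disjoint_sum_indicator_le F) simp
      then show "(\<Sum>P\<in>F. ennreal (norm (h x)) * indicator P x) \<le> ennreal (norm (h x))" by (simp add: sum_distrib_left)
    qed
    finally show ?thesis using mass by (simp add: m_def)
  qed
  have bP: "integrable lborel (b P)" "(\<integral>y. b P y \<partial>lborel) = 0" "(\<integral>\<^sup>+y. ennreal (norm (b P y)) \<partial>lborel) \<le> 2 * mP P"
    "norm (a P) \<le> 2 ^ CARD('n) * \<theta>" if P: "P \<in> F" for P
  proof -
    note [measurable] = cs(2)[OF P]
    have s: "0 < sd P ^ CARD('n)" using cs(1)[OF P] by simp
    have ih: "integrable lborel (\<lambda>y. indicator P y *\<^sub>R h y)" using h by (rule integrable_mult_indicator[rotated]) (use cs(2)[OF P] in simp)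
    have fin: "emeasure lborel P < \<infinity>" using cs(3)[OF P] by simp
    have ia: "integrable lborel (\<lambda>y. indicator P y *\<^sub>R a P)" using fin cs(2)[OF P] by (intro integrable_indicator integrable_scaleR_left) auto
    have mP': "measure lborel P = sd P ^ CARD('n)" using cs(3)[OF P] s by (simp add: measure_def)
    show "integrable lborel (b P)" unfolding b_def[abs_def] scaleR_diff_right using ih ia by (rule Bochner_Integration.integrable_diff)
    have Ia: "(\<integral>y. indicator P y *\<^sub>R a P \<partial>lborel) = of_real (sd P ^ CARD('n)) * a P"
      using mP' by (simp add: scaleR_conv_of_real)
    show "(\<integral>y. b P y \<partial>lborel) = 0"
      unfolding b_def[abs_def] scaleR_diff_right using ih ia cs(1)[OF P] Ia by (simp add: a_def)
    have "ennreal (norm (\<integral>y. indicator P y *\<^sub>R h y \<partial>lborel)) \<le> (\<integral>\<^sup>+y. ennreal (norm (indicator P y *\<^sub>R h y)) \<partial>lborel)"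
      by (rule norm_integral_le_nn_integral)
    also have "\<dots> = mP P" unfolding mP_def by (intro nn_integral_cong) (auto simp: indicator_def)
    finally have nI: "ennreal (norm (a P) * sd P ^ CARD('n)) \<le> mP P" using cs(1)[OF P] by (simp add: a_def norm_divide norm_power)
    have "ennreal (norm (a P) * sd P ^ CARD('n)) \<le> ennreal (2 ^ CARD('n) * \<theta> * sd P ^ CARD('n))"
      using nI cs(6)[OF P] unfolding mP_def by (rule order_trans)
    then have "norm (a P) * sd P ^ CARD('n) \<le> 2 ^ CARD('n) * \<theta> * sd P ^ CARD('n)"
      using s th by (subst (asm) ennreal_le_iff) auto
    then show "norm (a P) \<le> 2 ^ CARD('n) * \<theta>" using s by (simp only: mult_le_cancel_right_pos)
    have "(\<integral>\<^sup>+y. ennreal (norm (b P y)) \<partial>lborel) \<le> (\<integral>\<^sup>+y. ennreal (norm (h y)) * indicator P y + ennreal (norm (a P)) * indicator P y \<partial>lborel)"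
    proof (rule nn_integral_mono)
      fix y
      show "ennreal (norm (b P y)) \<le> ennreal (norm (h y)) * indicator P y + ennreal (norm (a P)) * indicator P y"
        using norm_triangle_ineq4[of "h y" "a P"] by (auto simp: b_def indicator_def ennreal_plus[symmetric] simp del: ennreal_plus intro: ennreal_leI)
    qed
    also have "\<dots> = mP P + ennreal (norm (a P)) * emeasure lborel P"
      unfolding mP_def by (subst nn_integral_add) (auto simp: nn_integral_cmult_indicator)
    also have "\<dots> \<le> mP P + mP P" using nI s by (intro add_left_mono) (simp add: cs(3)[OF P] ennreal_mult)
    finally show "(\<integral>\<^sup>+y. ennreal (norm (b P y)) \<partial>lborel) \<le> 2 * mP P" by (simp add: mult_2)
  qed
  have b_supp: "norm (y - cx P) \<le> ?n * sd P" if "P \<in> F" "b P y \<noteq> 0" for P y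
    using that cs(4)[OF that(1)] by (auto simp: b_def indicator_def split: if_splits)
  define g where "g x = h x - (\<Sum>P\<in>F. b P x)" for x
  have gi: "integrable lborel g" unfolding g_def[abs_def] using h bP(1) by auto
  have [measurable]: "g \<in> borel_measurable borel" using borel_measurable_integrable[OF gi] by simp
  have g_le: "norm (g x) \<le> 2 * 2 ^ CARD('n) * \<theta>" for x
  proof (cases "x \<in> \<Union>F")
    case True
    then obtain P0 where P0: "P0 \<in> F" "x \<in> P0" by blast
    have "b P x = 0" if "P \<in> F - {P0}" for P
    proof -
      have "P \<inter> P0 = {}" using that F(2) P0(1) unfolding disjoint_def by blast
      then have "x \<notin> P" using P0(2) by blast
      then show ?thesis by (simp add: b_def)
    qed
    then have "(\<Sum>P\<in>F. b P x) = b P0 x" using F(1) P0 by (subst sum.remove[of F P0]) auto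
    then have "g x = a P0" using P0 by (simp add: g_def b_def)
    then have "norm (g x) \<le> 2 ^ CARD('n) * \<theta>" using bP(4)[OF P0(1)] by simp
    moreover have "2 ^ CARD('n) * \<theta> \<le> 2 * 2 ^ CARD('n) * \<theta>" using th by simp
    ultimately show ?thesis by linarith
  next
    case False
    then have "g x = h x" by (auto simp: g_def b_def intro!: sum.neutral)
    moreover have "1 * (2 * \<theta>) \<le> 2 ^ CARD('n) * (2 * \<theta>)" using th by (intro mult_right_mono) auto
    ultimately show ?thesis using small False by (auto simp: mult_ac)
  qed
  have g1: "(\<integral>\<^sup>+x. ennreal (norm (g x)) \<partial>lborel) \<le> ennreal (3 * m)"
  proof -
    have "(\<integral>\<^sup>+x. ennreal (norm (g x)) \<partial>lborel) \<le> (\<integral>\<^sup>+x. ennreal (norm (h x)) + (\<Sum>P\<in>F. ennreal (norm (b P x))) \<partial>lborel)"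
    proof (rule nn_integral_mono)
      fix x
      have "norm (g x) \<le> norm (h x) + (\<Sum>P\<in>F. norm (b P x))"
        unfolding g_def by (rule order_trans[OF norm_triangle_ineq4]) (intro add_left_mono norm_sum)
      then have "ennreal (norm (g x)) \<le> ennreal (norm (h x) + (\<Sum>P\<in>F. norm (b P x)))" by (rule ennreal_leI)
      then show "ennreal (norm (g x)) \<le> ennreal (norm (h x)) + (\<Sum>P\<in>F. ennreal (norm (b P x)))"
        by (simp add: ennreal_plus sum_nonneg sum_ennreal)
    qed
    also have "\<dots> = (\<integral>\<^sup>+x. ennreal (norm (h x)) \<partial>lborel) + (\<Sum>P\<in>F. (\<integral>\<^sup>+x. ennreal (norm (b P x)) \<partial>lborel))"
    proof -
      have mb: "(\<lambda>x. ennreal (norm (b P x))) \<in> borel_measurable lborel" if "P \<in> F" for P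
        using borel_measurable_integrable[OF bP(1)[OF that]] by measurable
      have "(\<lambda>x. \<Sum>P\<in>F. ennreal (norm (b P x))) \<in> borel_measurable lborel" by (intro borel_measurable_sum mb)
      moreover have "(\<lambda>x. ennreal (norm (h x))) \<in> borel_measurable lborel" by measurable
      moreover have "(\<integral>\<^sup>+x. (\<Sum>P\<in>F. ennreal (norm (b P x))) \<partial>lborel) = (\<Sum>P\<in>F. (\<integral>\<^sup>+x. ennreal (norm (b P x)) \<partial>lborel))"
        by (rule nn_integral_sum) (rule mb)
      ultimately show ?thesis by (simp only: nn_integral_add)
    qed
    also have "\<dots> \<le> ennreal m + (\<Sum>P\<in>F. 2 * mP P)"
      using mass by (intro add_mono sum_mono bP(3)) (auto simp: m_def)
    also have "\<dots> = ennreal m + 2 * (\<Sum>P\<in>F. mP P)" by (simp only: sum_distrib_left)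
    also have "\<dots> \<le> ennreal m + 2 * ennreal m" by (intro add_left_mono mult_left_mono sum_mP) simp
    also have "\<dots> = ennreal (3 * m)"
    proof -
      have "2 * ennreal m = ennreal (2 * m)" using m0 by (simp add: ennreal_mult)
      then show ?thesis using m0 by (simp add: ennreal_plus[symmetric] del: ennreal_plus)
    qed
    finally show ?thesis .
  qed
  \<comment> \<open>Since \<open>g\<close> is bounded by a multiple of \<open>\<theta>\<close>, its
    L2 norm is controlled by this bound times its L1 norm.\<close>
  have g2: "(\<integral>\<^sup>+x. ennreal ((norm (g x))\<^sup>2) \<partial>lborel) \<le> ennreal (6 * 2 ^ CARD('n) * \<theta> * m)"
  proof -
    have "(\<integral>\<^sup>+x. ennreal ((norm (g x))\<^sup>2) \<partial>lborel) \<le> (\<integral>\<^sup>+x. ennreal (2 * 2 ^ CARD('n) * \<theta>) * ennreal (norm (g x)) \<partial>lborel)"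
      using th mult_right_mono[OF g_le norm_ge_zero] by (intro nn_integral_mono) (simp add: power2_eq_square ennreal_mult[symmetric] ennreal_leI)
    also have "\<dots> = ennreal (2 * 2 ^ CARD('n) * \<theta>) * (\<integral>\<^sup>+x. ennreal (norm (g x)) \<partial>lborel)" by (rule nn_integral_cmult) measurable
    also have "\<dots> \<le> ennreal (2 * 2 ^ CARD('n) * \<theta>) * ennreal (3 * m)" by (rule mult_left_mono[OF g1]) simp
    also have "\<dots> = ennreal (6 * 2 ^ CARD('n) * \<theta> * m)" using th m0 by (subst ennreal_mult[symmetric]) (auto simp: mult_ac)
    finally show ?thesis .
  qed
  have gL: "g \<in> L12" using g1 g2 by (intro L12I) (auto intro: le_less_trans)
  have T_dec: "(\<Sum>j\<in>I. T j h x) = (\<Sum>j\<in>I. T j g x) + (\<Sum>P\<in>F. \<Sum>j\<in>I. T j (b P) x)" for x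
  proof -
    have "T j h x = T j g x + (\<Sum>P\<in>F. T j (b P) x)" for j
    proof -
      have "T j h x = (\<integral>y. k j x y * g y + (\<Sum>P\<in>F. k j x y * b P y) \<partial>lborel)"
        unfolding T_def by (intro Bochner_Integration.integral_cong refl) (simp add: g_def algebra_simps sum_distrib_left)
      also have "\<dots> = (\<integral>y. k j x y * g y \<partial>lborel) + (\<integral>y. (\<Sum>P\<in>F. k j x y * b P y) \<partial>lborel)"
        using integrable_k_mult[OF gi] integrable_k_mult[OF bP(1)] by (intro Bochner_Integration.integral_add) auto
      also have "(\<integral>y. (\<Sum>P\<in>F. k j x y * b P y) \<partial>lborel) = (\<Sum>P\<in>F. (\<integral>y. k j x y * b P y \<partial>lborel))"
        using integrable_k_mult[OF bP(1)] by (intro Bochner_Integration.integral_sum) auto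
      finally show ?thesis by (simp add: T_def)
    qed
    then show ?thesis by (simp add: sum.distrib) (rule sum.swap)
  qed
  define Tg where "Tg x = (\<Sum>j\<in>I. T j g x)" for x
  define Tb where "Tb P x = (\<Sum>j\<in>I. T j (b P) x)" for P x
  have [measurable]: "Tg \<in> borel_measurable borel" unfolding Tg_def[abs_def] by measurable
  have Tb_meas: "Tb P \<in> borel_measurable borel" if "P \<in> F" for P
  proof -
    have [measurable]: "b P \<in> borel_measurable borel" using borel_measurable_integrable[OF bP(1)[OF that]] by simp
    show ?thesis unfolding Tb_def[abs_def] by measurable
  qed
  define D where "D P = {x. 2 * ?n * sd P < norm (x - cx P)}" for P
  have [measurable]: "D P \<in> sets borel" for P unfolding D_def by measurable
  define u where "u x = (\<Sum>P\<in>F. norm (Tb P x) * indicator (D P) x)" for x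
  have [measurable]: "u \<in> borel_measurable borel"
    unfolding u_def[abs_def]
  proof (rule borel_measurable_sum)
    fix P assume "P \<in> F"
    then have [measurable]: "Tb P \<in> borel_measurable borel" by (rule Tb_meas)
    show "(\<lambda>x. norm (Tb P x) * indicator (D P) x) \<in> borel_measurable borel" by measurable
  qed
  \<comment> \<open>Stated with squares so that Markov's inequality applies to the squared norm;
    halving the level gives the factor 4 that turns 6 into 24.\<close>
  have e1: "emeasure lborel {x. (\<theta> / 2)\<^sup>2 < (norm (Tg x))\<^sup>2} \<le> ennreal (24 * 2 ^ CARD('n) * \<Gamma>\<^sup>2 * m / \<theta>)"
  proof -
    have L2: "L2_norm Tg \<le> \<Gamma> * L2_norm g" "Tg \<in> L12" using L2_bound[OF I gL] by (auto simp: Tg_def[abs_def])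
    have "(\<integral>\<^sup>+x. ennreal ((norm (Tg x))\<^sup>2) \<partial>lborel) = ennreal ((L2_norm Tg)\<^sup>2)" by (rule nn_integral_L2[OF L2(2)])
    also have "\<dots> \<le> ennreal ((\<Gamma> * L2_norm g)\<^sup>2)" using L2(1) L2_norm_nonneg by (intro ennreal_leI power_mono)
    also have "\<dots> = ennreal (\<Gamma>\<^sup>2) * ennreal ((L2_norm g)\<^sup>2)" by (simp add: power_mult_distrib ennreal_mult)
    also have "\<dots> = ennreal (\<Gamma>\<^sup>2) * (\<integral>\<^sup>+x. ennreal ((norm (g x))\<^sup>2) \<partial>lborel)" by (simp add: nn_integral_L2[OF gL])
    also have "\<dots> \<le> ennreal (\<Gamma>\<^sup>2) * ennreal (6 * 2 ^ CARD('n) * \<theta> * m)" by (rule mult_left_mono[OF g2]) simp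
    also have "\<dots> = ennreal (\<Gamma>\<^sup>2 * (6 * 2 ^ CARD('n) * \<theta> * m))" using th m0 by (subst ennreal_mult) auto
    finally have "emeasure lborel {x. (\<theta> / 2)\<^sup>2 < (norm (Tg x))\<^sup>2} \<le> ennreal (\<Gamma>\<^sup>2 * (6 * 2 ^ CARD('n) * \<theta> * m) / (\<theta> / 2)\<^sup>2)"
      using th m0 by (intro markov) auto
    also have "\<Gamma>\<^sup>2 * (6 * 2 ^ CARD('n) * \<theta> * m) / (\<theta> / 2)\<^sup>2 = 24 * 2 ^ CARD('n) * \<Gamma>\<^sup>2 * m / \<theta>"
      using th by (simp add: power2_eq_square field_simps)
    finally show ?thesis .
  qed
  \<comment> \<open>The neighbourhood of a cell is a ball of radius \<open>2 * n * sd P\<close>; its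
    volume is compared with that of the cell and then with the mass of \<open>h\<close> on the
    cell.\<close>
  have e2: "emeasure lborel (\<Union>P\<in>F. - D P) \<le> ennreal ((4 * ?n) ^ CARD('n) * m / \<theta>)"
  proof -
    have "emeasure lborel (\<Union>P\<in>F. - D P) \<le> (\<Sum>P\<in>F. emeasure lborel (- D P))"
      by (rule emeasure_subadditive_finite) (use F in auto)
    also have "\<dots> \<le> (\<Sum>P\<in>F. ennreal ((4 * ?n) ^ CARD('n) / \<theta>) * mP P)"
    proof (rule sum_mono)
      fix P assume P: "P \<in> F"
      have "- D P = {x. norm (cx P - x) \<le> 2 * ?n * sd P}" by (auto simp: D_def norm_minus_commute)
      then have "emeasure lborel (- D P) \<le> ennreal ((2 * (2 * ?n * sd P)) ^ CARD('n))"
        using emeasure_ball_le[of "2 * ?n * sd P" "cx P"] cs(1)[OF P] by simp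
      also have "(2 * (2 * ?n * sd P)) ^ CARD('n) = (4 * ?n) ^ CARD('n) / \<theta> * (\<theta> * sd P ^ CARD('n))"
      proof -
        have "2 * (2 * ?n * sd P) = (4 * ?n) * sd P" by simp
        then have "(2 * (2 * ?n * sd P)) ^ CARD('n) = ((4 * ?n) * sd P) ^ CARD('n)" by (simp only:)
        also have "\<dots> = (4 * ?n) ^ CARD('n) * sd P ^ CARD('n)" by (rule power_mult_distrib)
        finally show ?thesis using th by (simp only: times_divide_eq_left nonzero_mult_div_cancel_left mult.assoc) (simp add: mult_ac)
      qed
      also have "ennreal \<dots> = ennreal ((4 * ?n) ^ CARD('n) / \<theta>) * ennreal (\<theta> * sd P ^ CARD('n))"
        using th cs(1)[OF P] by (subst ennreal_mult) auto
      also have "\<dots> \<le> ennreal ((4 * ?n) ^ CARD('n) / \<theta>) * mP P"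
        unfolding mP_def by (rule mult_left_mono[OF cs(5)[OF P]]) simp
      finally show "emeasure lborel (- D P) \<le> ennreal ((4 * ?n) ^ CARD('n) / \<theta>) * mP P" .
    qed
    also have "\<dots> = ennreal ((4 * ?n) ^ CARD('n) / \<theta>) * (\<Sum>P\<in>F. mP P)" by (simp only: sum_distrib_left)
    also have "\<dots> \<le> ennreal ((4 * ?n) ^ CARD('n) / \<theta>) * ennreal m" by (rule mult_left_mono[OF sum_mP]) simp
    also have "\<dots> = ennreal ((4 * ?n) ^ CARD('n) * m / \<theta>)" using th m0 by (subst ennreal_mult[symmetric]) auto
    finally show ?thesis .
  qed
  have e3: "emeasure lborel {x. \<theta> / 2 < u x} \<le> ennreal (32 * ?n * A * C0 * m / \<theta>)"
  proof -
    let ?c = "8 * ?n * A * C0"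
    have c0: "0 \<le> ?c" using A_pos C0 by simp
    have "(\<integral>\<^sup>+x. ennreal (u x) \<partial>lborel) = (\<integral>\<^sup>+x. (\<Sum>P\<in>F. ennreal (norm (Tb P x)) * indicator (D P) x) \<partial>lborel)"
    proof (rule nn_integral_cong)
      fix x
      have "ennreal (u x) = (\<Sum>P\<in>F. ennreal (norm (Tb P x) * indicator (D P) x))"
        unfolding u_def by (rule sum_ennreal[symmetric]) simp
      also have "\<dots> = (\<Sum>P\<in>F. ennreal (norm (Tb P x)) * indicator (D P) x)"
        by (intro sum.cong refl) (simp add: indicator_def)
      finally show "ennreal (u x) = (\<Sum>P\<in>F. ennreal (norm (Tb P x)) * indicator (D P) x)" .
    qed
    also have "\<dots> = (\<Sum>P\<in>F. (\<integral>\<^sup>+x. ennreal (norm (Tb P x)) * indicator (D P) x \<partial>lborel))"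
    proof (rule nn_integral_sum)
      fix P assume "P \<in> F"
      then have [measurable]: "Tb P \<in> borel_measurable borel" by (rule Tb_meas)
      show "(\<lambda>x. ennreal (norm (Tb P x)) * indicator (D P) x) \<in> borel_measurable lborel" by measurable
    qed
    also have "\<dots> \<le> (\<Sum>P\<in>F. ennreal ?c * (2 * mP P))"
    proof (rule sum_mono)
      fix P assume P: "P \<in> F"
      have "(\<integral>\<^sup>+x. ennreal (norm (Tb P x)) * indicator (D P) x \<partial>lborel) \<le> ennreal ?c * (\<integral>\<^sup>+y. ennreal (norm (b P y)) \<partial>lborel)"
        unfolding Tb_def D_def by (rule mean_zero_piece[OF bP(1,2)[OF P] b_supp[OF P] cs(1)[OF P] I])
      also have "\<dots> \<le> ennreal ?c * (2 * mP P)" by (rule mult_left_mono[OF bP(3)[OF P]]) simp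
      finally show "(\<integral>\<^sup>+x. ennreal (norm (Tb P x)) * indicator (D P) x \<partial>lborel) \<le> ennreal ?c * (2 * mP P)" .
    qed
    also have "\<dots> = ennreal ?c * (2 * (\<Sum>P\<in>F. mP P))" by (simp only: sum_distrib_left)
    also have "\<dots> \<le> ennreal ?c * (2 * ennreal m)" by (intro mult_left_mono sum_mP) simp_all
    also have "\<dots> = ennreal (16 * ?n * A * C0 * m)"
    proof -
      have "2 * ennreal m = ennreal (2 * m)" using m0 by (simp add: ennreal_mult)
      then show ?thesis using m0 c0 by (simp add: ennreal_mult[symmetric] mult_ac)
    qed
    finally have "emeasure lborel {x. \<theta> / 2 < u x} \<le> ennreal (16 * ?n * A * C0 * m / (\<theta> / 2))"
      using th m0 A_pos C0 by (intro markov) auto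
    then show ?thesis by (simp add: mult_ac)
  qed
  \<comment> \<open>Outside the neighbourhoods \<open>u\<close> is the full sum of the moduli of the
    bad parts, so a value above \<open>\<theta>\<close> forces one of the two parts above
    \<open>\<theta> / 2\<close>.\<close>
  have sub: "{x. \<theta> < norm (\<Sum>j\<in>I. T j h x)} \<subseteq> {x. (\<theta> / 2)\<^sup>2 < (norm (Tg x))\<^sup>2} \<union> ((\<Union>P\<in>F. - D P) \<union> {x. \<theta> / 2 < u x})"
  proof
    fix x assume "x \<in> {x. \<theta> < norm (\<Sum>j\<in>I. T j h x)}"
    then have x: "\<theta> < norm (Tg x + (\<Sum>P\<in>F. Tb P x))" by (simp add: T_dec Tg_def Tb_def)
    show "x \<in> {x. (\<theta> / 2)\<^sup>2 < (norm (Tg x))\<^sup>2} \<union> ((\<Union>P\<in>F. - D P) \<union> {x. \<theta> / 2 < u x})"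
    proof (rule ccontr)
      assume n: "\<not> ?thesis"
      have "\<not> \<theta> / 2 < norm (Tg x)"
      proof
        assume "\<theta> / 2 < norm (Tg x)"
        then have "(\<theta> / 2)\<^sup>2 < (norm (Tg x))\<^sup>2" using th by (intro power_strict_mono) auto
        then show False using n by simp
      qed
      moreover have "u x = (\<Sum>P\<in>F. norm (Tb P x))" unfolding u_def using n by (intro sum.cong) auto
      then have "norm (\<Sum>P\<in>F. Tb P x) \<le> u x" using norm_sum[of "\<lambda>P. Tb P x" F] by simp
      moreover have "\<not> \<theta> / 2 < u x" using n by simp
      ultimately show False using x norm_triangle_ineq[of "Tg x" "\<Sum>P\<in>F. Tb P x"] by linarith
    qed
  qed
  have [measurable]: "(\<Union>P\<in>F. - D P) \<in> sets borel" using F(1) by (intro sets.finite_UN) auto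
  have "emeasure lborel {x. \<theta> < norm (\<Sum>j\<in>I. T j h x)}
    \<le> emeasure lborel ({x. (\<theta> / 2)\<^sup>2 < (norm (Tg x))\<^sup>2} \<union> ((\<Union>P\<in>F. - D P) \<union> {x. \<theta> / 2 < u x}))"
    by (rule emeasure_mono[OF sub]) measurable
  also have "\<dots> \<le> emeasure lborel {x. (\<theta> / 2)\<^sup>2 < (norm (Tg x))\<^sup>2} + emeasure lborel ((\<Union>P\<in>F. - D P) \<union> {x. \<theta> / 2 < u x})"
    by (rule emeasure_subadditive) measurable
  also have "\<dots> \<le> emeasure lborel {x. (\<theta> / 2)\<^sup>2 < (norm (Tg x))\<^sup>2} + (emeasure lborel (\<Union>P\<in>F. - D P) + emeasure lborel {x. \<theta> / 2 < u x})"
    by (intro add_left_mono emeasure_subadditive) measurable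
  also have "\<dots> \<le> ennreal (24 * 2 ^ CARD('n) * \<Gamma>\<^sup>2 * m / \<theta>) + (ennreal ((4 * ?n) ^ CARD('n) * m / \<theta>) + ennreal (32 * ?n * A * C0 * m / \<theta>))"
    by (intro add_mono e1 e2 e3)
  also have "\<dots> = ennreal (24 * 2 ^ CARD('n) * \<Gamma>\<^sup>2 * m / \<theta> + ((4 * ?n) ^ CARD('n) * m / \<theta> + 32 * ?n * A * C0 * m / \<theta>))"
  proof -
    have "0 \<le> 24 * 2 ^ CARD('n) * \<Gamma>\<^sup>2 * m / \<theta>" "0 \<le> (4 * ?n) ^ CARD('n) * m / \<theta>" "0 \<le> 32 * ?n * A * C0 * m / \<theta>"
      using th m0 A_pos C0 by auto
    then show ?thesis by (simp only: ennreal_plus add_nonneg_nonneg)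
  qed
  also have "24 * 2 ^ CARD('n) * \<Gamma>\<^sup>2 * m / \<theta> + ((4 * ?n) ^ CARD('n) * m / \<theta> + 32 * ?n * A * C0 * m / \<theta>) = W * m / \<theta>"
    using th by (simp add: W_def field_simps)
  finally show ?thesis unfolding m_def .
qed

end

section \<open>Local estimates\<close>

text \<open>Each share \<open>t / (a + b)\<close> is at most 1 and hence at most its own power
  \<epsilon>; the two shares add up to 1.\<close>

lemma powr_add_le:
  fixes a b :: real
  assumes "0 \<le> a" "0 \<le> b" "0 < \<epsilon>" "\<epsilon> \<le> 1" shows "(a + b) powr \<epsilon> \<le> a powr \<epsilon> + b powr \<epsilon>"
proof (cases "a + b = 0")
  case True then show ?thesis using assms by simp
next
  case False
  then have s: "0 < a + b" using assms by linarith
  have *: "t / (a + b) * (a + b) powr \<epsilon> \<le> t powr \<epsilon>" if "0 \<le> t" "t \<le> a + b" for t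
  proof (cases "t = 0")
    case False
    have "(t / (a + b)) powr 1 \<le> (t / (a + b)) powr \<epsilon>" using that s assms False by (intro powr_mono') auto
    then have "t / (a + b) \<le> t powr \<epsilon> / (a + b) powr \<epsilon>" using that s False by (simp add: powr_divide)
    then show ?thesis using s by (simp add: pos_le_divide_eq)
  qed simp
  have "a / (a + b) + b / (a + b) = 1" using s by (simp flip: add_divide_distrib)
  then have "(a + b) powr \<epsilon> = (a / (a + b) + b / (a + b)) * (a + b) powr \<epsilon>" by simp
  also have "\<dots> = a / (a + b) * (a + b) powr \<epsilon> + b / (a + b) * (a + b) powr \<epsilon>" by (rule distrib_right)
  also have "\<dots> \<le> a powr \<epsilon> + b powr \<epsilon>" using assms by (intro add_mono *) auto
  finally show ?thesis .
qed

text \<open>Pointwise, \<open>(f x / \<mu>) powr \<epsilon> \<le> 1 + f x / \<mu>\<close>. A bound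
  for the mean thus passes to the mean of the power with the right homogeneity in
  \<open>\<mu>\<close>.\<close>

lemma nn_integral_powr_le:
  fixes f :: "'a::euclidean_space \<Rightarrow> real"
  assumes [measurable]: "f \<in> borel_measurable borel" "S \<in> sets borel" and f0: "\<And>x. 0 \<le> f x" and "0 < \<mu>" "0 < \<epsilon>" "\<epsilon> \<le> 1" "0 \<le> C" "0 \<le> v"
    and v: "emeasure lborel S = ennreal v" and b: "(\<integral>\<^sup>+x\<in>S. ennreal (f x) \<partial>lborel) \<le> ennreal (C * \<mu> * v)"
  shows "(\<integral>\<^sup>+x\<in>S. ennreal (f x powr \<epsilon>) \<partial>lborel) \<le> ennreal ((1 + C) * \<mu> powr \<epsilon> * v)"
proof -
  have pt: "f x powr \<epsilon> \<le> \<mu> powr \<epsilon> + \<mu> powr \<epsilon> / \<mu> * f x" for x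
  proof -
    have "(f x / \<mu>) powr \<epsilon> \<le> 1 + f x / \<mu>"
    proof (cases "f x / \<mu> \<le> 1")
      case True
      then have "(f x / \<mu>) powr \<epsilon> \<le> 1" using f0[of x] assms by (intro powr_le1) auto
      moreover have "0 \<le> f x / \<mu>" using f0[of x] assms by simp
      ultimately show ?thesis by linarith
    next
      case False
      then have "(f x / \<mu>) powr \<epsilon> \<le> (f x / \<mu>) powr 1" using assms by (intro powr_mono) auto
      then show ?thesis using False by simp
    qed
    then have "f x powr \<epsilon> / \<mu> powr \<epsilon> \<le> 1 + f x / \<mu>" using f0[of x] \<open>0 < \<mu>\<close> by (simp add: powr_divide)
    then have "f x powr \<epsilon> \<le> (1 + f x / \<mu>) * \<mu> powr \<epsilon>" using \<open>0 < \<mu>\<close> by (simp add: pos_divide_le_eq)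
    then show ?thesis by (simp add: algebra_simps)
  qed
  have "(\<integral>\<^sup>+x\<in>S. ennreal (f x powr \<epsilon>) \<partial>lborel) \<le> (\<integral>\<^sup>+x. ennreal (\<mu> powr \<epsilon>) * indicator S x + ennreal (\<mu> powr \<epsilon> / \<mu>) * (ennreal (f x) * indicator S x) \<partial>lborel)"
  proof (rule nn_integral_mono)
    fix x
    have "ennreal (f x powr \<epsilon>) \<le> ennreal (\<mu> powr \<epsilon> + \<mu> powr \<epsilon> / \<mu> * f x)" by (rule ennreal_leI[OF pt])
    also have "\<dots> = ennreal (\<mu> powr \<epsilon>) + ennreal (\<mu> powr \<epsilon> / \<mu> * f x)" using f0[of x] \<open>0 < \<mu>\<close> by (intro ennreal_plus) auto
    also have "ennreal (\<mu> powr \<epsilon> / \<mu> * f x) = ennreal (\<mu> powr \<epsilon> / \<mu>) * ennreal (f x)" using f0[of x] \<open>0 < \<mu>\<close> by (intro ennreal_mult) auto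
    finally show "ennreal (f x powr \<epsilon>) * indicator S x \<le> ennreal (\<mu> powr \<epsilon>) * indicator S x + ennreal (\<mu> powr \<epsilon> / \<mu>) * (ennreal (f x) * indicator S x)"
      by (simp add: indicator_def)
  qed
  also have "\<dots> = (\<integral>\<^sup>+x. ennreal (\<mu> powr \<epsilon>) * indicator S x \<partial>lborel) + (\<integral>\<^sup>+x. ennreal (\<mu> powr \<epsilon> / \<mu>) * (ennreal (f x) * indicator S x) \<partial>lborel)"
    by (rule nn_integral_add) measurable
  also have "(\<integral>\<^sup>+x. ennreal (\<mu> powr \<epsilon>) * indicator S x \<partial>lborel) = ennreal (\<mu> powr \<epsilon>) * ennreal v"
    using v by (subst nn_integral_cmult_indicator) auto
  also have "(\<integral>\<^sup>+x. ennreal (\<mu> powr \<epsilon> / \<mu>) * (ennreal (f x) * indicator S x) \<partial>lborel) = ennreal (\<mu> powr \<epsilon> / \<mu>) * (\<integral>\<^sup>+x\<in>S. ennreal (f x) \<partial>lborel)"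
    by (rule nn_integral_cmult) measurable
  also have "ennreal (\<mu> powr \<epsilon>) * ennreal v + \<dots> \<le> ennreal (\<mu> powr \<epsilon>) * ennreal v + ennreal (\<mu> powr \<epsilon> / \<mu>) * ennreal (C * \<mu> * v)"
    by (intro add_left_mono mult_left_mono b) simp
  also have "\<dots> = ennreal (\<mu> powr \<epsilon> * v) + ennreal (\<mu> powr \<epsilon> / \<mu> * (C * \<mu> * v))"
    using assms(4-8) by (intro arg_cong2[where f="(+)"] ennreal_mult[symmetric]) auto
  also have "\<dots> = ennreal (\<mu> powr \<epsilon> * v + \<mu> powr \<epsilon> / \<mu> * (C * \<mu> * v))"
    using assms(4-8) by (intro ennreal_plus[symmetric]) auto
  also have "\<mu> powr \<epsilon> * v + \<mu> powr \<epsilon> / \<mu> * (C * \<mu> * v) = (1 + C) * \<mu> powr \<epsilon> * v" using \<open>0 < \<mu>\<close> by (simp add: algebra_simps)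
  finally show ?thesis .
qed

text \<open>The index at which the wavelength 2^-j drops below the side of the cube; for
  \<open>r \<ge> 1\<close> it is 0 and there are no low frequencies.\<close>

lemma exists_critical_index:
  fixes r :: real assumes "0 < r"
  obtains L where "1 \<le> 2 ^ L * r" "\<And>j. j < L \<Longrightarrow> 2 ^ j * r < 1"
proof -
  obtain L0 where "1 / r < 2 ^ L0" using real_arch_pow[of 2 "1 / r"] by auto
  then have ex: "\<exists>L. 1 \<le> 2 ^ L * r" using assms by (intro exI[of _ L0]) (simp add: field_simps)
  show ?thesis
  proof (rule that)
    show "1 \<le> 2 ^ (LEAST L. 1 \<le> 2 ^ L * r) * r" using ex by (rule LeastI_ex)
    show "2 ^ j * r < 1" if "j < (LEAST L. 1 \<le> 2 ^ L * r)" for j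
      using not_less_Least[OF that] by (simp add: not_le)
  qed
qed

text \<open>The number \<open>z\<close> does not depend on \<open>J\<close>, so that the estimate passes to the limit.\<close>

definition local_estimate :: "(nat \<Rightarrow> (real ^ 'n \<Rightarrow> complex) \<Rightarrow> real ^ 'n \<Rightarrow> complex) \<Rightarrow> real \<Rightarrow> real \<Rightarrow> bool" where
  "local_estimate T \<epsilon> C \<longleftrightarrow> (\<forall>f x0 \<mu> p r. integrable lborel f \<longrightarrow> continuous_on UNIV f \<longrightarrow> 0 < \<mu> \<longrightarrow>
     cubes_bound x0 \<mu> (\<lambda>y. ennreal (norm (f y))) \<longrightarrow> 0 < r \<longrightarrow> x0 \<in> cube p r \<longrightarrow>
     (\<exists>z L. \<forall>J\<ge>L. (\<integral>\<^sup>+x\<in>cube p r. ennreal (norm ((\<Sum>j<J. T j f x) - z) powr \<epsilon>) \<partial>lborel) \<le> ennreal (C * \<mu> powr \<epsilon> * r ^ CARD('n))))"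

lemma split_sum_at:
  fixes F :: "nat \<Rightarrow> complex"
  assumes "L \<le> J"
  shows "(\<Sum>j<J. F j) - (\<Sum>j<L. G j) = (\<Sum>j<L. F j - G j) + (\<Sum>j\<in>{L..<J}. F j)"
proof -
  have "(\<Sum>j<J. F j) = (\<Sum>j<L. F j) + (\<Sum>j\<in>{L..<J}. F j)"
    using sum.atLeastLessThan_concat[of 0 L J F] assms by (simp add: lessThan_atLeast0)
  then show ?thesis by (simp add: sum_subtractf)
qed

text \<open>The subtracted constant is the sum of the low pieces at the corner \<open>p\<close>. For
  \<open>J \<ge> L\<close> the remainder consists of the oscillation of the low pieces and of the
  high pieces, both small in the mean.\<close>

lemma (in rough_family) rough_local_estimate:
  assumes "0 < \<epsilon>" "\<epsilon> < 1"
  shows "\<exists>C\<ge>0. local_estimate T \<epsilon> C"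
proof -
  define c where "c = 8 * real CARD('n) * 12 ^ CARD('n) * A + 12 * 24 ^ CARD('n) * A / (1 - rate)"
  have c0: "0 \<le> 8 * real CARD('n) * 12 ^ CARD('n) * A" "0 \<le> 12 * 24 ^ CARD('n) * A / (1 - rate)" using A_pos rate by auto
  have "local_estimate T \<epsilon> (1 + c)"
    unfolding local_estimate_def
  proof (intro allI impI)
    fix f :: "real ^ 'n \<Rightarrow> complex" and x0 p :: "real ^ 'n" and \<mu> r :: real
    assume f: "integrable lborel f" and "0 < \<mu>" and cb: "cubes_bound x0 \<mu> (\<lambda>y. ennreal (norm (f y)))" and "0 < r" and x0: "x0 \<in> cube p r"
    have [measurable]: "f \<in> borel_measurable borel" using borel_measurable_integrable[OF f] by simp
    obtain L where L: "1 \<le> 2 ^ L * r" "\<And>j. j < L \<Longrightarrow> 2 ^ j * r < 1" using exists_critical_index[OF \<open>0 < r\<close>] by blast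
    have "(\<integral>\<^sup>+x\<in>cube p r. ennreal (norm ((\<Sum>j<J. T j f x) - (\<Sum>j<L. T j f p)) powr \<epsilon>) \<partial>lborel) \<le> ennreal ((1 + c) * \<mu> powr \<epsilon> * r ^ CARD('n))" if J: "L \<le> J" for J
    proof (rule nn_integral_powr_le)
      show "emeasure lborel (cube p r) = ennreal (r ^ CARD('n))" using \<open>0 < r\<close> by (intro emeasure_cube) simp
      have "(\<integral>\<^sup>+x\<in>cube p r. ennreal (norm ((\<Sum>j<J. T j f x) - (\<Sum>j<L. T j f p))) \<partial>lborel)
        \<le> (\<integral>\<^sup>+x. ennreal (norm (\<Sum>j<L. T j f x - T j f p)) * indicator (cube p r) x + ennreal (norm (\<Sum>j\<in>{L..<J}. T j f x)) * indicator (cube p r) x \<partial>lborel)"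
      proof (rule nn_integral_mono)
        fix x
        have "ennreal (norm ((\<Sum>j<J. T j f x) - (\<Sum>j<L. T j f p))) \<le> ennreal (norm (\<Sum>j<L. T j f x - T j f p) + norm (\<Sum>j\<in>{L..<J}. T j f x))"
          unfolding split_sum_at[OF J] by (intro ennreal_leI norm_triangle_ineq)
        then show "ennreal (norm ((\<Sum>j<J. T j f x) - (\<Sum>j<L. T j f p))) * indicator (cube p r) x \<le>
          ennreal (norm (\<Sum>j<L. T j f x - T j f p)) * indicator (cube p r) x + ennreal (norm (\<Sum>j\<in>{L..<J}. T j f x)) * indicator (cube p r) x"
          by (simp add: indicator_def ennreal_plus)
      qed
      also have "\<dots> = (\<integral>\<^sup>+x\<in>cube p r. ennreal (norm (\<Sum>j<L. T j f x - T j f p)) \<partial>lborel) + (\<integral>\<^sup>+x\<in>cube p r. ennreal (norm (\<Sum>j\<in>{L..<J}. T j f x)) \<partial>lborel)"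
        by (rule nn_integral_add) measurable
      also have "\<dots> \<le> ennreal (8 * real CARD('n) * 12 ^ CARD('n) * A * \<mu> * r ^ CARD('n)) + ennreal (12 * 24 ^ CARD('n) * A / (1 - rate) * \<mu> * r ^ CARD('n))"
        using \<open>0 < \<mu>\<close> by (intro add_mono low_oscillation[OF f cb _ \<open>0 < r\<close> x0 L(2)] high_sum[OF f cb _ \<open>0 < r\<close> x0 L(1)]) auto
      also have "\<dots> = ennreal (c * \<mu> * r ^ CARD('n))"
      proof -
        have "0 \<le> 8 * real CARD('n) * 12 ^ CARD('n) * A * \<mu> * r ^ CARD('n)" "0 \<le> 12 * 24 ^ CARD('n) * A / (1 - rate) * \<mu> * r ^ CARD('n)"
          using \<open>0 < \<mu>\<close> \<open>0 < r\<close> by (intro mult_nonneg_nonneg[OF mult_nonneg_nonneg[OF c0(1)]] mult_nonneg_nonneg[OF mult_nonneg_nonneg[OF c0(2)]]; simp)+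
        then show ?thesis unfolding c_def by (subst ennreal_plus[symmetric]) (simp_all add: algebra_simps)
      qed
      finally show "(\<integral>\<^sup>+x\<in>cube p r. ennreal (norm ((\<Sum>j<J. T j f x) - (\<Sum>j<L. T j f p))) \<partial>lborel) \<le> ennreal (c * \<mu> * r ^ CARD('n))" .
    qed (use assms \<open>0 < \<mu>\<close> \<open>0 < r\<close> c0 in \<open>auto simp: c_def\<close>)
    then show "\<exists>z L. \<forall>J\<ge>L. (\<integral>\<^sup>+x\<in>cube p r. ennreal (norm ((\<Sum>j<J. T j f x) - z) powr \<epsilon>) \<partial>lborel) \<le> ennreal ((1 + c) * \<mu> powr \<epsilon> * r ^ CARD('n))"
      by blast
  qed
  then show ?thesis using c0 by (intro exI[of _ "1 + c"]) (auto simp: c_def)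
qed

context cz_family
begin

text \<open>At distance at least \<open>r\<close> a power of decay gains
  \<open>1 / (2 ^ j * r)\<close>, which is summable beyond the critical index. No cancellation is
  involved.\<close>

lemma far_sum:
  assumes f: "integrable lborel f" and cb: "cubes_bound x0 \<mu> (\<lambda>y. ennreal (norm (f y)))"
    and "0 \<le> \<mu>" "0 < r" "x0 \<in> cube p r" and L: "1 \<le> 2 ^ L * r"
    and f2: "integrable lborel f2" "\<And>y. norm (f2 y) \<le> norm (f y)" and far: "\<And>x y. x \<in> cube p r \<Longrightarrow> f2 y \<noteq> 0 \<Longrightarrow> r \<le> norm (x - y)"
  shows "(\<integral>\<^sup>+x\<in>cube p r. ennreal (norm (\<Sum>j\<in>{L..<J}. T j f2 x)) \<partial>lborel) \<le> ennreal (8 * 12 ^ CARD('n) * A * \<mu> * r ^ CARD('n))"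
proof (rule sum_nn_integral_norm_le)
  have [measurable]: "f \<in> borel_measurable borel" "f2 \<in> borel_measurable borel" using borel_measurable_integrable[OF f] borel_measurable_integrable[OF f2(1)] by simp_all
  let ?c = "4 * 12 ^ CARD('n) * A * \<mu> * r ^ CARD('n)"
  have c0: "0 \<le> ?c" using A_pos \<open>0 \<le> \<mu>\<close> \<open>0 < r\<close> by simp
  show "(\<integral>\<^sup>+x\<in>cube p r. ennreal (norm (T j f2 x)) \<partial>lborel) \<le> ennreal (?c * (1 / 2) ^ (j - L))" if j: "j \<in> {L..<J}" for j
  proof -
    have "2 ^ (j - L) * 1 \<le> 2 ^ (j - L) * (2 ^ L * r)" using L by (intro mult_left_mono) auto
    also have "\<dots> = 2 ^ j * r" using j by (simp flip: power_add mult.assoc)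
    finally have js: "1 / (2 ^ j * r) \<le> (1 / 2) ^ (j - L)" using \<open>0 < r\<close> by (simp add: power_divide frac_le)
    have pt: "ennreal (norm (T j f2 x)) \<le> ennreal (A * (1 / 2) ^ (j - L)) * (\<integral>\<^sup>+y. ennreal (\<Phi>' j (x - y)) * ennreal (norm (f y)) \<partial>lborel)" if x: "x \<in> cube p r" for x
    proof -
      have "ennreal (norm (T j f2 x)) \<le> (\<integral>\<^sup>+y. ennreal (norm (k j x y * f2 y)) \<partial>lborel)" unfolding T_def by (rule norm_integral_le_nn_integral)
      also have "\<dots> \<le> (\<integral>\<^sup>+y. ennreal (A * (1 / 2) ^ (j - L)) * (ennreal (\<Phi>' j (x - y)) * ennreal (norm (f y))) \<partial>lborel)"
      proof (rule nn_integral_mono)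
        fix y
        have "norm (k j x y * f2 y) \<le> A * (1 / 2) ^ (j - L) * (\<Phi>' j (x - y) * norm (f y))"
        proof (cases "f2 y = 0")
          case False
          have "\<Phi> j (x - y) \<le> 1 / (2 ^ j * r) * \<Phi>' j (x - y)"
            using peak_far_le[OF dscale_pos \<open>0 < r\<close> far[OF x False], of "CARD('n) + 1" 1 j] by (simp add: dscale_1)
          also have "\<dots> \<le> (1 / 2) ^ (j - L) * \<Phi>' j (x - y)" by (rule mult_right_mono[OF js]) simp
          finally have "A * \<Phi> j (x - y) \<le> A * ((1 / 2) ^ (j - L) * \<Phi>' j (x - y))" using A_pos by (intro mult_left_mono) auto
          then have "norm (k j x y) \<le> A * ((1 / 2) ^ (j - L) * \<Phi>' j (x - y))" using size[of j x y] by linarith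
          then have "norm (k j x y) * norm (f2 y) \<le> A * ((1 / 2) ^ (j - L) * \<Phi>' j (x - y)) * norm (f y)"
            using A_pos by (intro mult_mono f2(2)) auto
          then show ?thesis by (simp add: norm_mult mult_ac)
        qed (use A_pos in auto)
        then have "ennreal (norm (k j x y * f2 y)) \<le> ennreal (A * (1 / 2) ^ (j - L) * (\<Phi>' j (x - y) * norm (f y)))" by (rule ennreal_leI)
        then show "ennreal (norm (k j x y * f2 y)) \<le> ennreal (A * (1 / 2) ^ (j - L)) * (ennreal (\<Phi>' j (x - y)) * ennreal (norm (f y)))"
          using A_pos by (simp only: ennreal_mult peak_nonneg dscale_pos norm_ge_zero mult_nonneg_nonneg less_imp_le zero_le_power divide_nonneg_nonneg zero_le_one zero_le_numeral)
      qed
      also have "\<dots> = ennreal (A * (1 / 2) ^ (j - L)) * (\<integral>\<^sup>+y. ennreal (\<Phi>' j (x - y)) * ennreal (norm (f y)) \<partial>lborel)"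
        by (rule nn_integral_cmult) measurable
      finally show ?thesis .
    qed
    have "(\<integral>\<^sup>+x\<in>cube p r. ennreal (norm (T j f2 x)) \<partial>lborel)
      \<le> (\<integral>\<^sup>+x. ennreal (A * (1 / 2) ^ (j - L)) * ((\<integral>\<^sup>+y. ennreal (\<Phi>' j (x - y)) * ennreal (norm (f y)) \<partial>lborel) * indicator (cube p r) x) \<partial>lborel)"
      using pt by (intro nn_integral_mono) (auto simp: indicator_def)
    also have "\<dots> = ennreal (A * (1 / 2) ^ (j - L)) * (\<integral>\<^sup>+x\<in>cube p r. (\<integral>\<^sup>+y. ennreal (\<Phi>' j (x - y)) * ennreal (norm (f y)) \<partial>lborel) \<partial>lborel)"
      by (rule nn_integral_cmult) measurable
    also have "\<dots> \<le> ennreal (A * (1 / 2) ^ (j - L)) * ennreal (4 * 12 ^ CARD('n) * \<mu> * r ^ CARD('n))"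
      using assms by (intro mult_left_mono cubes_bound_peak) auto
    also have "\<dots> = ennreal (?c * (1 / 2) ^ (j - L))" using A_pos \<open>0 \<le> \<mu>\<close> \<open>0 < r\<close> by (subst ennreal_mult[symmetric]) (auto simp: mult_ac)
    finally show ?thesis .
  qed
  show "0 \<le> ?c * (1 / 2) ^ (j - L)" for j by (rule mult_nonneg_nonneg[OF c0]) simp
  have "(\<Sum>j\<in>{L..<J}. ?c * (1 / 2) ^ (j - L)) = ?c * (\<Sum>j\<in>{L..<J}. (1 / 2) ^ (j - L))" by (rule sum_distrib_left[symmetric])
  also have "\<dots> \<le> ?c * (1 / (1 - 1 / 2))" using c0 by (intro mult_left_mono sum_geometric_le) auto
  finally show "(\<Sum>j\<in>{L..<J}. ?c * (1 / 2) ^ (j - L)) \<le> 8 * 12 ^ CARD('n) * A * \<mu> * r ^ CARD('n)" by simp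
qed (use borel_measurable_integrable[OF f2(1)] in auto)

text \<open>Weak type bounds at the levels \<open>2 ^ m * \<mu>\<close> feed Kolmogorov's
  inequality. The function is cut off to a cell of generation 0 of the same grid that is used for
  stopping, so the jump at the boundary of the cell creates no oscillation within finer
  cells.\<close>

lemma near_sum:
  fixes f :: "real ^ 'n \<Rightarrow> complex" and q :: "real ^ 'n" and R \<mu> :: real
  assumes f: "integrable lborel f" and cf: "continuous_on UNIV f" and mass: "(\<integral>\<^sup>+y\<in>cube q R. ennreal (norm (f y)) \<partial>lborel) \<le> ennreal (\<mu> * R ^ CARD('n))"
    and "0 < \<mu>" "0 < R" "0 < \<epsilon>" "\<epsilon> < 1" "finite I" and S: "S \<in> sets borel"
  shows "(\<integral>\<^sup>+x\<in>S. ennreal (norm (\<Sum>j\<in>I. T j (\<lambda>y. indicator (cell q R 0 q) y *\<^sub>R f y) x) powr \<epsilon>) \<partial>lborel)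
    \<le> ennreal (\<mu> powr \<epsilon>) * emeasure lborel S + ennreal (\<mu> powr \<epsilon> * (W * R ^ CARD('n)) * (2 powr \<epsilon> / (1 - 2 powr (\<epsilon> - 1))))"
proof (rule kolmogorov)
  let ?f1 = "\<lambda>y. indicator (cell q R 0 q) y *\<^sub>R f y"
  have i1: "integrable lborel ?f1" using f by (rule integrable_mult_indicator[rotated]) simp
  have [measurable]: "?f1 \<in> borel_measurable borel" using borel_measurable_integrable[OF i1] by simp
  show "(\<lambda>x. norm (\<Sum>j\<in>I. T j ?f1 x)) \<in> borel_measurable borel" by measurable
  have "cell q R 0 q \<subseteq> cube q R"
  proof
    fix y assume y: "y \<in> cell q R 0 q"
    have "\<lfloor>(y $ i - q $ i) / R\<rfloor> = 0" for i using y by (simp add: cell_def)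
    then have "0 \<le> (y $ i - q $ i) / R \<and> (y $ i - q $ i) / R < 1" for i by (simp add: floor_eq_iff)
    then show "y \<in> cube q R" unfolding mem_cube using \<open>0 < R\<close> by (simp add: field_simps less_imp_le)
  qed
  then have "(\<integral>\<^sup>+y. ennreal (norm (?f1 y)) \<partial>lborel) \<le> (\<integral>\<^sup>+y\<in>cube q R. ennreal (norm (f y)) \<partial>lborel)"
    by (intro nn_integral_mono) (auto simp: indicator_def)
  then have m1: "(\<integral>\<^sup>+y. ennreal (norm (?f1 y)) \<partial>lborel) \<le> ennreal (\<mu> * R ^ CARD('n))" using mass by (rule order_trans)
  show "emeasure lborel {x. 2 ^ m * \<mu> < norm (\<Sum>j\<in>I. T j ?f1 x)} \<le> ennreal (W * R ^ CARD('n) / 2 ^ m)" for m :: nat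
  proof -
    let ?t = "2 ^ m * \<mu>"
    have t: "\<mu> \<le> ?t" "0 < ?t" using \<open>0 < \<mu>\<close> by auto
    \<comment> \<open>The generation \<open>G\<close> found here depends on the level, but the weak
      type bound does not depend on \<open>G\<close>.\<close>
    have "uniformly_continuous_on (cube q R) f"
      by (intro compact_uniformly_continuous continuous_on_subset[OF cf]) auto
    then obtain d where d: "0 < d" "\<And>x y. x \<in> cube q R \<Longrightarrow> y \<in> cube q R \<Longrightarrow> dist y x < d \<Longrightarrow> dist (f y) (f x) < ?t"
      using t unfolding uniformly_continuous_on_def by metis
    obtain G where "real CARD('n) * R / d < 2 ^ G" using real_arch_pow[of 2 "real CARD('n) * R / d"] by auto
    then have G: "real CARD('n) * (R / 2 ^ G) < d" using \<open>0 < d\<close> by (simp add: field_simps)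
    have osc: "norm (?f1 x - ?f1 y) \<le> ?t" if y: "y \<in> cell q R G x" for x y
    proof -
      have c0: "cell q R 0 y = cell q R 0 x" using cell_antimono[of 0 G q R x] y cell_eq by blast
      have iff: "y \<in> cell q R 0 q \<longleftrightarrow> x \<in> cell q R 0 q"
        using c0 cell_self[of x q R 0] cell_self[of y q R 0] cell_eq[of x q R 0 q] cell_eq[of y q R 0 q] by auto
      show ?thesis
      proof (cases "x \<in> cell q R 0 q")
        case True
        then have "x \<in> cube q R" "y \<in> cube q R" using iff \<open>cell q R 0 q \<subseteq> cube q R\<close> by auto
        moreover have "dist y x < d" using cell_diameter[OF \<open>0 < R\<close> y] G by (simp add: dist_norm)
        ultimately have "dist (f y) (f x) < ?t" by (rule d(2))
        then show ?thesis using True iff by (simp add: dist_norm norm_minus_commute)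
      qed (use iff t in simp)
    qed
    have "emeasure lborel {x. ?t < norm (\<Sum>j\<in>I. T j ?f1 x)} \<le> ennreal (W * (\<mu> * R ^ CARD('n)) / ?t)"
      by (rule weak_type[OF \<open>0 < R\<close> \<open>0 < \<mu>\<close> t(1) i1 \<open>finite I\<close> m1 osc])
    also have "W * (\<mu> * R ^ CARD('n)) / ?t = W * R ^ CARD('n) / 2 ^ m" using \<open>0 < \<mu>\<close> by simp
    finally show ?thesis .
  qed
  show "0 \<le> W * R ^ CARD('n)" using A_pos C0 \<open>0 < R\<close> by (simp add: W_def)
qed (use assms in auto)

text \<open>Only the high pieces acting on the part of \<open>f\<close> near the cube need the weak
  type bound. The low pieces act on all of \<open>f\<close>, and the high pieces on the far part are
  small in the mean; these two are grouped together.\<close>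

lemma cz_local_estimate:
  assumes e: "0 < \<epsilon>" "\<epsilon> < 1"
  shows "\<exists>C\<ge>0. local_estimate T \<epsilon> C"
proof -
  let ?n = "real CARD('n)"
  define c1 where "c1 = 8 * ?n * 12 ^ CARD('n) * A + 8 * 12 ^ CARD('n) * A"
  define c2 where "c2 = W * 3 ^ CARD('n) * (2 powr \<epsilon> / (1 - 2 powr (\<epsilon> - 1)))"
  have "2 powr (\<epsilon> - 1) < (2::real) powr 0" using e by (intro powr_less_mono) auto
  then have q: "0 < 1 - 2 powr (\<epsilon> - 1)" by simp
  have W0: "0 \<le> W" using A_pos C0 by (simp add: W_def)
  have c0: "0 \<le> c1" "0 \<le> c2" using A_pos W0 q by (auto simp: c1_def c2_def)
  have "local_estimate T \<epsilon> ((1 + c1) + (1 + c2))"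
    unfolding local_estimate_def
  proof (intro allI impI)
    fix f :: "real ^ 'n \<Rightarrow> complex" and x0 p :: "real ^ 'n" and \<mu> r :: real
    assume f: "integrable lborel f" and cf: "continuous_on UNIV f" and "0 < \<mu>" and cb: "cubes_bound x0 \<mu> (\<lambda>y. ennreal (norm (f y)))" and "0 < r" and x0: "x0 \<in> cube p r"
    have [measurable]: "f \<in> borel_measurable borel" using borel_measurable_integrable[OF f] by simp
    obtain L where L: "1 \<le> 2 ^ L * r" "\<And>j. j < L \<Longrightarrow> 2 ^ j * r < 1" using exists_critical_index[OF \<open>0 < r\<close>] by blast
    \<comment> \<open>The corner of the cube with the same centre and three times the side: points
      outside it have distance at least \<open>r\<close> from \<open>cube p r\<close>.\<close>
    define q where "q = (\<chi> i. p $ i - r)"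
    define Q where "Q = cell q (3 * r) 0 q"
    define f1 where "f1 y = indicator Q y *\<^sub>R f y" for y
    define f2 where "f2 y = indicator (- Q) y *\<^sub>R f y" for y
    have [measurable]: "Q \<in> sets borel" by (simp add: Q_def)
    have i1: "integrable lborel f1" unfolding f1_def[abs_def] using f by (rule integrable_mult_indicator[rotated]) simp
    have i2: "integrable lborel f2" unfolding f2_def[abs_def] using f by (rule integrable_mult_indicator[rotated]) simp
    have [measurable]: "f1 \<in> borel_measurable borel" "f2 \<in> borel_measurable borel" using borel_measurable_integrable[OF i1] borel_measurable_integrable[OF i2] by simp_all
    have T12: "T j f x = T j f1 x + T j f2 x" for j x
    proof -
      have "k j x y * f y = k j x y * f1 y + k j x y * f2 y" for y by (simp add: f1_def f2_def indicator_def)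
      then show ?thesis unfolding T_def using integrable_k_mult[OF i1, of j x] integrable_k_mult[OF i2, of j x] by simp
    qed
    have far: "r \<le> norm (x - y)" if x: "x \<in> cube p r" and y: "f2 y \<noteq> 0" for x y
    proof -
      have "y \<notin> Q" using y by (auto simp: f2_def)
      then obtain i where i: "\<lfloor>(y $ i - q $ i) / (3 * r)\<rfloor> \<noteq> 0" by (auto simp: Q_def cell_def)
      have "\<not> (0 \<le> (y $ i - q $ i) / (3 * r) \<and> (y $ i - q $ i) / (3 * r) < 1)" using i by (simp add: floor_eq_iff)
      then have "y $ i < p $ i - r \<or> p $ i + 2 * r \<le> y $ i" using \<open>0 < r\<close> by (auto simp: q_def field_simps not_le not_less)
      moreover have "p $ i \<le> x $ i" "x $ i \<le> p $ i + r" using x unfolding mem_cube by auto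
      ultimately have "r \<le> \<bar>(x - y) $ i\<bar>" unfolding vector_minus_component by linarith
      then show ?thesis using component_le_norm_cart[of "x - y" i] by linarith
    qed
    have "x0 \<in> cube q (3 * r)"
      unfolding mem_cube
    proof
      fix i
      have "p $ i \<le> x0 $ i" "x0 $ i \<le> p $ i + r" using x0 unfolding mem_cube by auto
      then show "q $ i \<le> x0 $ i \<and> x0 $ i \<le> q $ i + 3 * r" using \<open>0 < r\<close> by (simp add: q_def)
    qed
    then have mass: "(\<integral>\<^sup>+y\<in>cube q (3 * r). ennreal (norm (f y)) \<partial>lborel) \<le> ennreal (\<mu> * (3 * r) ^ CARD('n))"
      using \<open>0 < r\<close> by (intro cubes_boundD[OF cb]) auto
    have vol: "emeasure lborel (cube p r) = ennreal (r ^ CARD('n))" using \<open>0 < r\<close> by (intro emeasure_cube) simp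
    have "(\<integral>\<^sup>+x\<in>cube p r. ennreal (norm ((\<Sum>j<J. T j f x) - (\<Sum>j<L. T j f p)) powr \<epsilon>) \<partial>lborel) \<le> ennreal (((1 + c1) + (1 + c2)) * \<mu> powr \<epsilon> * r ^ CARD('n))" if J: "L \<le> J" for J
    proof -
      let ?lo = "\<lambda>x. (\<Sum>j<L. T j f x - T j f p) + (\<Sum>j\<in>{L..<J}. T j f2 x)" and ?hi = "\<lambda>x. \<Sum>j\<in>{L..<J}. T j f1 x"
      have dec: "(\<Sum>j<J. T j f x) - (\<Sum>j<L. T j f p) = ?lo x + ?hi x" for x
        unfolding split_sum_at[OF J] by (simp add: T12 sum.distrib)
      have lo: "(\<integral>\<^sup>+x\<in>cube p r. ennreal (norm (?lo x) powr \<epsilon>) \<partial>lborel) \<le> ennreal ((1 + c1) * \<mu> powr \<epsilon> * r ^ CARD('n))"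
      proof (rule nn_integral_powr_le)
        have "(\<integral>\<^sup>+x\<in>cube p r. ennreal (norm (?lo x)) \<partial>lborel)
          \<le> (\<integral>\<^sup>+x. ennreal (norm (\<Sum>j<L. T j f x - T j f p)) * indicator (cube p r) x + ennreal (norm (\<Sum>j\<in>{L..<J}. T j f2 x)) * indicator (cube p r) x \<partial>lborel)"
        proof (rule nn_integral_mono)
          fix x
          have "ennreal (norm (?lo x)) \<le> ennreal (norm (\<Sum>j<L. T j f x - T j f p) + norm (\<Sum>j\<in>{L..<J}. T j f2 x))"
            by (intro ennreal_leI norm_triangle_ineq)
          then show "ennreal (norm (?lo x)) * indicator (cube p r) x \<le>
            ennreal (norm (\<Sum>j<L. T j f x - T j f p)) * indicator (cube p r) x + ennreal (norm (\<Sum>j\<in>{L..<J}. T j f2 x)) * indicator (cube p r) x"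
            by (simp add: indicator_def ennreal_plus)
        qed
        also have "\<dots> = (\<integral>\<^sup>+x\<in>cube p r. ennreal (norm (\<Sum>j<L. T j f x - T j f p)) \<partial>lborel) + (\<integral>\<^sup>+x\<in>cube p r. ennreal (norm (\<Sum>j\<in>{L..<J}. T j f2 x)) \<partial>lborel)"
          by (rule nn_integral_add) measurable
        also have "\<dots> \<le> ennreal (8 * ?n * 12 ^ CARD('n) * A * \<mu> * r ^ CARD('n)) + ennreal (8 * 12 ^ CARD('n) * A * \<mu> * r ^ CARD('n))"
        proof (intro add_mono low_oscillation[OF f cb _ \<open>0 < r\<close> x0 L(2)] far_sum[OF f cb _ \<open>0 < r\<close> x0 L(1) i2 _ far])
          show "norm (f2 y) \<le> norm (f y)" for y by (simp add: f2_def indicator_def)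
        qed (use \<open>0 < \<mu>\<close> in auto)
        also have "\<dots> = ennreal (c1 * \<mu> * r ^ CARD('n))"
        proof -
          have "0 \<le> 8 * ?n * 12 ^ CARD('n) * A * \<mu> * r ^ CARD('n)" "0 \<le> 8 * 12 ^ CARD('n) * A * \<mu> * r ^ CARD('n)"
            using A_pos \<open>0 < \<mu>\<close> \<open>0 < r\<close> by auto
          then show ?thesis unfolding c1_def by (subst ennreal_plus[symmetric]) (simp_all add: algebra_simps)
        qed
        finally show "(\<integral>\<^sup>+x\<in>cube p r. ennreal (norm (?lo x)) \<partial>lborel) \<le> ennreal (c1 * \<mu> * r ^ CARD('n))" .
      qed (use e \<open>0 < \<mu>\<close> \<open>0 < r\<close> c0 vol in auto)
      have hi: "(\<integral>\<^sup>+x\<in>cube p r. ennreal (norm (?hi x) powr \<epsilon>) \<partial>lborel) \<le> ennreal ((1 + c2) * \<mu> powr \<epsilon> * r ^ CARD('n))"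
      proof -
        have "(\<integral>\<^sup>+x\<in>cube p r. ennreal (norm (?hi x) powr \<epsilon>) \<partial>lborel) \<le> ennreal (\<mu> powr \<epsilon>) * emeasure lborel (cube p r) + ennreal (\<mu> powr \<epsilon> * (W * (3 * r) ^ CARD('n)) * (2 powr \<epsilon> / (1 - 2 powr (\<epsilon> - 1))))"
          unfolding f1_def[abs_def] Q_def by (rule near_sum[OF f cf mass \<open>0 < \<mu>\<close> _ e]) (use \<open>0 < r\<close> in auto)
        also have "\<dots> = ennreal (\<mu> powr \<epsilon> * r ^ CARD('n)) + ennreal (c2 * (\<mu> powr \<epsilon> * r ^ CARD('n)))"
          unfolding vol c2_def using \<open>0 < r\<close> by (simp add: ennreal_mult power_mult_distrib mult_ac)
        also have "\<dots> = ennreal ((1 + c2) * \<mu> powr \<epsilon> * r ^ CARD('n))"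
          using c0 \<open>0 < r\<close> by (subst ennreal_plus[symmetric]) (auto simp: algebra_simps)
        finally show ?thesis .
      qed
      have "(\<integral>\<^sup>+x\<in>cube p r. ennreal (norm ((\<Sum>j<J. T j f x) - (\<Sum>j<L. T j f p)) powr \<epsilon>) \<partial>lborel)
        \<le> (\<integral>\<^sup>+x. ennreal (norm (?lo x) powr \<epsilon>) * indicator (cube p r) x + ennreal (norm (?hi x) powr \<epsilon>) * indicator (cube p r) x \<partial>lborel)"
      proof (rule nn_integral_mono)
        fix x
        have "norm (?lo x + ?hi x) powr \<epsilon> \<le> (norm (?lo x) + norm (?hi x)) powr \<epsilon>" using e by (intro powr_mono2 norm_triangle_ineq) auto
        also have "\<dots> \<le> norm (?lo x) powr \<epsilon> + norm (?hi x) powr \<epsilon>" using e by (intro powr_add_le) auto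
        finally have "ennreal (norm (?lo x + ?hi x) powr \<epsilon>) \<le> ennreal (norm (?lo x) powr \<epsilon> + norm (?hi x) powr \<epsilon>)" by (rule ennreal_leI)
        then show "ennreal (norm ((\<Sum>j<J. T j f x) - (\<Sum>j<L. T j f p)) powr \<epsilon>) * indicator (cube p r) x \<le>
          ennreal (norm (?lo x) powr \<epsilon>) * indicator (cube p r) x + ennreal (norm (?hi x) powr \<epsilon>) * indicator (cube p r) x"
          unfolding dec by (simp add: indicator_def ennreal_plus)
      qed
      also have "\<dots> = (\<integral>\<^sup>+x\<in>cube p r. ennreal (norm (?lo x) powr \<epsilon>) \<partial>lborel) + (\<integral>\<^sup>+x\<in>cube p r. ennreal (norm (?hi x) powr \<epsilon>) \<partial>lborel)"
        by (rule nn_integral_add) measurable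
      also have "\<dots> \<le> ennreal ((1 + c1) * \<mu> powr \<epsilon> * r ^ CARD('n)) + ennreal ((1 + c2) * \<mu> powr \<epsilon> * r ^ CARD('n))"
        by (intro add_mono lo hi)
      also have "\<dots> = ennreal (((1 + c1) + (1 + c2)) * \<mu> powr \<epsilon> * r ^ CARD('n))"
        using c0 \<open>0 < r\<close> by (subst ennreal_plus[symmetric]) (auto simp: algebra_simps)
      finally show ?thesis .
    qed
    then show "\<exists>z L. \<forall>J\<ge>L. (\<integral>\<^sup>+x\<in>cube p r. ennreal (norm ((\<Sum>j<J. T j f x) - z) powr \<epsilon>) \<partial>lborel) \<le> ennreal (((1 + c1) + (1 + c2)) * \<mu> powr \<epsilon> * r ^ CARD('n))"
      by blast
  qed
  then show ?thesis using c0 by (intro exI[of _ "(1 + c1) + (1 + c2)"]) auto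
qed

end

section \<open>The kernels of a symbol\<close>

lemma integral_lborel_reflect:
  fixes f :: "'a::euclidean_space \<Rightarrow> 'b::{banach,second_countable_topology}"
  assumes [measurable]: "f \<in> borel_measurable borel"
  shows "(\<integral>y. f (x - y) \<partial>lborel) = (\<integral>y. f y \<partial>lborel)"
proof -
  have "(\<integral>y. f y \<partial>lborel) = (\<integral>y. f y \<partial>density (distr lborel borel (\<lambda>y. x + (- 1) *\<^sub>R y)) (\<lambda>_. ennreal (\<bar>- 1\<bar> ^ DIM('a))))"
    by (rule arg_cong[where f="\<lambda>M. integral\<^sup>L M f"], rule lborel_affine) simp
  also have "\<dots> = (\<integral>y. f (x + (- 1) *\<^sub>R y) \<partial>lborel)"
    by (subst integral_density) (auto simp: integral_distr)
  finally show ?thesis by simp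
qed

lemma ennreal_mult_leD:
  assumes "ennreal c * X \<le> ennreal b" "0 < c" "0 \<le> b" shows "X \<le> ennreal (b / c)"
proof (cases X)
  case (real r)
  then have "c * r \<le> b" using assms by (simp flip: ennreal_mult)
  then show ?thesis using real assms by (simp add: field_simps ennreal_leI)
next
  case top
  then show ?thesis using assms by (simp add: ennreal_mult_top top_unique)
qed

lemma shell_measurable [measurable]: "(shell j :: (real ^ 'n) set) \<in> sets borel"
proof -
  have "(shell j :: (real ^ 'n) set) = (\<Inter>l. {\<xi>. \<bar>\<xi> $ l\<bar> < 2 * 2 ^ j}) \<inter> (if j = 0 then UNIV else (\<Union>l. {\<xi>::real ^ 'n. 2 ^ j / 2 < \<bar>\<xi> $ l\<bar>}))"
    by (auto simp: shell_def)
  moreover have "open ((\<Inter>l. {\<xi>. \<bar>\<xi> $ l\<bar> < 2 * 2 ^ j}) \<inter> (if j = 0 then UNIV else (\<Union>l. {\<xi>::real ^ 'n. 2 ^ j / 2 < \<bar>\<xi> $ l\<bar>})))"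
    by (auto intro!: open_Int open_INT open_UN open_Collect_less continuous_intros)
  ultimately show ?thesis by (simp only: borel_open)
qed

lemma emeasure_shell: "emeasure lborel (shell j :: (real ^ 'n) set) \<le> ennreal ((4 * 2 ^ j) ^ CARD('n))"
proof -
  have "shell j \<subseteq> cube (\<chi> i. - 2 * 2 ^ j :: real ^ 'n) (4 * 2 ^ j)"
    unfolding mem_cube subset_eq by (auto simp: shell_def abs_less_iff intro: less_imp_le dest!: spec)
  then have "emeasure lborel (shell j :: (real ^ 'n) set) \<le> emeasure lborel (cube (\<chi> i. - 2 * 2 ^ j :: real ^ 'n) (4 * 2 ^ j))"
    by (rule emeasure_mono) simp
  also have "\<dots> = ennreal ((4 * 2 ^ j) ^ CARD('n))" by (rule emeasure_cube) simp
  finally show ?thesis .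
qed

lemma integral_shell:
  fixes b :: real assumes "0 \<le> b"
  shows "integrable lborel (\<lambda>\<xi>::real ^ 'n. b * indicator (shell j) \<xi>)"
    and "(\<integral>\<xi>. b * indicator (shell j) (\<xi>::real ^ 'n) \<partial>lborel) \<le> b * (4 * 2 ^ j) ^ CARD('n)"
proof -
  have fin: "emeasure lborel (shell j :: (real ^ 'n) set) < \<infinity>" by (rule le_less_trans[OF emeasure_shell]) simp
  then show "integrable lborel (\<lambda>\<xi>::real ^ 'n. b * indicator (shell j) \<xi>)" by simp
  have "measure lborel (shell j :: (real ^ 'n) set) \<le> (4 * 2 ^ j) ^ CARD('n)"
    unfolding measure_def by (rule enn2real_leI[OF _ emeasure_shell]) simp
  then show "(\<integral>\<xi>. b * indicator (shell j) (\<xi>::real ^ 'n) \<partial>lborel) \<le> b * (4 * 2 ^ j) ^ CARD('n)"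
    using assms by (simp add: mult_left_mono)
qed

text \<open>Here the order \<open>- n * (1 - \<rho>)\<close> matters: size of the symbol times
  volume of the shell equals the height of a normalized peak of width
  \<open>dscale \<rho> j\<close>.\<close>

lemma dscale_card:
  "(2 ^ j) powr (- real CARD('n::finite) * (1 - \<rho>)) * (2 ^ j) ^ CARD('n) = 1 / dscale \<rho> j ^ CARD('n)"
proof -
  have "dscale \<rho> j ^ CARD('n) = (2 ^ j) powr (- \<rho> * real CARD('n))" unfolding dscale_def by (subst powr_power) (auto simp: mult.commute)
  then have "1 / dscale \<rho> j ^ CARD('n) = (2 ^ j) powr (\<rho> * real CARD('n))" by (simp add: powr_minus_divide)
  also have "\<rho> * real CARD('n) = - real CARD('n) * (1 - \<rho>) + real CARD('n)" by (simp add: algebra_simps)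
  also have "(2 ^ j) powr \<dots> = (2 ^ j) powr (- real CARD('n) * (1 - \<rho>)) * (2 ^ j) ^ CARD('n)"
    unfolding powr_add by (subst powr_realpow[of "2 ^ j" "CARD('n)"]) auto
  finally show ?thesis by simp
qed

lemma ift_diff:
  assumes "integrable lborel g" "integrable lborel h" shows "ift (\<lambda>\<xi>. g \<xi> - h \<xi>) z = ift g z - ift h z"
  unfolding ift_def right_diff_distrib using assms by (intro Bochner_Integration.integral_diff integrable_cis_mult)

lemma ift_shift_diff:
  assumes "integrable lborel g" shows "ift (\<lambda>\<xi>. g \<xi> * (1 - cis (h \<bullet> \<xi>))) z = ift g z - ift g (z + h)"
proof -
  have "ift (\<lambda>\<xi>. g \<xi> * (1 - cis (h \<bullet> \<xi>))) z = (\<integral>\<xi>. cis (z \<bullet> \<xi>) * g \<xi> - cis ((z + h) \<bullet> \<xi>) * g \<xi> \<partial>lborel)"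
    unfolding ift_def by (intro Bochner_Integration.integral_cong) (auto simp: inner_add_left algebra_simps simp flip: cis_mult)
  then show ?thesis unfolding ift_def using assms by (subst (asm) Bochner_Integration.integral_diff) (auto intro: integrable_cis_mult)
qed

text \<open>A displacement of at most \<open>n\<close> widths changes \<open>1 + norm z / s\<close>
  by a factor of at most \<open>1 + n\<close>.\<close>

lemma peak_shift_le:
  fixes z u :: "real ^ 'n" and s :: real
  assumes "0 < s" "norm u \<le> real CARD('n) * s"
  shows "peak N s (z + u) \<le> (1 + real CARD('n)) ^ N * peak N s z"
proof -
  have "norm u / s \<le> real CARD('n)" using assms by (simp add: pos_divide_le_eq)
  moreover have "norm z / s \<le> norm (z + u) / s + norm u / s"
    using norm_triangle_ineq4[of "z + u" u] \<open>0 < s\<close> by (simp add: divide_right_mono flip: add_divide_distrib)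
  moreover have "0 \<le> real CARD('n) * (norm (z + u) / s)" using \<open>0 < s\<close> by simp
  ultimately have "1 + norm z / s \<le> (1 + real CARD('n)) * (1 + norm (z + u) / s)" unfolding distrib_left distrib_right by linarith
  then have "(1 + norm z / s) ^ N \<le> ((1 + real CARD('n)) * (1 + norm (z + u) / s)) ^ N" using \<open>0 < s\<close> by (intro power_mono) auto
  then have "(1 + norm z / s) ^ N \<le> (1 + real CARD('n)) ^ N * (1 + norm (z + u) / s) ^ N" by (simp only: power_mult_distrib)
  moreover have "0 < (1 + norm z / s) ^ N" "0 < (1 + norm (z + u) / s) ^ N" "0 < s ^ CARD('n)" using \<open>0 < s\<close> by (auto intro!: zero_less_power add_pos_nonneg)
  moreover have "1 / (S * B) \<le> c * (1 / (S * A))" if "A \<le> c * B" "0 < A" "0 < B" "0 < S" for A B S c :: real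
    using that by (simp add: field_simps)
  ultimately show ?thesis unfolding peak_def by blast
qed

text \<open>The output of \<open>symbol_pieces\<close> for the critical order and
  \<open>n + 2\<close> derivatives, detached from the symbol class.\<close>

locale dyadic_symbol =
  fixes a :: "(real ^ 'n) \<times> (real ^ 'n) \<Rightarrow> complex" and \<rho> \<delta> :: real and F M C
  assumes rho: "0 < \<rho>" "\<rho> \<le> 1" and delta: "0 \<le> \<delta>" "\<delta> < 1" and C_pos: "0 < C"
    and a_continuous: "continuous_on UNIV a" and F: "cutoff (CARD('n) + 2) M F"
    and piece: "\<And>i j x. dbd i (dscale \<rho> j) (CARD('n) + 2) (\<lambda>\<xi>. C * (2 ^ j) powr (- real CARD('n) * (1 - \<rho>)) * indicator (shell j) \<xi>) (\<lambda>\<xi>. a (x, \<xi>) * complex_of_real (psi F j \<xi>))"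
    and piece_diff: "\<And>i j x x'. dbd i (dscale \<rho> j) (CARD('n) + 2) (\<lambda>\<xi>. C * (2 ^ j) powr (- real CARD('n) * (1 - \<rho>)) * ((2 ^ j) powr \<delta> * norm (x - x')) * indicator (shell j) \<xi>) (\<lambda>\<xi>. (a (x, \<xi>) - a (x', \<xi>)) * complex_of_real (psi F j \<xi>))"
    and piece_cis: "\<And>i j x h. norm h \<le> CARD('n) / 2 ^ j \<Longrightarrow> dbd i (dscale \<rho> j) (CARD('n) + 2) (\<lambda>\<xi>. C * (2 ^ j) powr (- real CARD('n) * (1 - \<rho>)) * (2 ^ j * norm h) * indicator (shell j) \<xi>) (\<lambda>\<xi>. a (x, \<xi>) * complex_of_real (psi F j \<xi>) * (1 - cis (h \<bullet> \<xi>)))"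
begin

abbreviation P :: "nat \<Rightarrow> real ^ 'n \<Rightarrow> real" where "P j \<equiv> peak (CARD('n) + 2) (dscale \<rho> j)"

definition g :: "nat \<Rightarrow> real ^ 'n \<Rightarrow> real ^ 'n \<Rightarrow> complex" where
  "g j x \<xi> = a (x, \<xi>) * complex_of_real (psi F j \<xi>)"

definition K :: "nat \<Rightarrow> real ^ 'n \<Rightarrow> real ^ 'n \<Rightarrow> complex" where
  "K j x z = complex_of_real (1 / (2 * pi) ^ CARD('n)) * ift (g j x) z"

definition A0 :: real where
  "A0 = (ift_const TYPE('n) (CARD('n) + 2) * 4 ^ CARD('n) + local_const TYPE('n) (CARD('n) + 2) * 2 ^ CARD('n)) * C"

text \<open>One constant for all kernel estimates: the 2 adds two differences,
  \<open>4 ^ (n + 1)\<close> is the mass of a peak, and the power of \<open>1 + n\<close> comes from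
  shifting a peak within a cube and from the diameter of the cube.\<close>

definition A1 :: real where "A1 = 2 * 4 ^ (CARD('n) + 1) * (1 + real CARD('n)) ^ (CARD('n) + 3) * A0"

lemma const_pos: "0 < ift_const TYPE('n) (CARD('n) + 2)" "0 < local_const TYPE('n) (CARD('n) + 2)"
  by (auto simp: ift_const_def local_const_def intro!: mult_pos_pos add_pos_nonneg)

lemma A0_pos: "0 < A0"
  unfolding A0_def using const_pos C_pos by (intro mult_pos_pos add_pos_pos) auto

lemma A1_ge: "A0 * c \<le> A1" if "c \<le> 2 * 4 ^ (CARD('n) + 1) * (1 + real CARD('n)) ^ (CARD('n) + 3)"
  unfolding A1_def using mult_left_mono[OF that, of A0] A0_pos by (simp add: mult_ac)

lemma A1_pos: "0 < A1" unfolding A1_def using A0_pos by (simp add: add_pos_nonneg)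

text \<open>The factor \<open>t\<close> stands for the gain in each of the three estimates of the
  pieces: 1, \<open>(2 ^ j) powr \<delta> * norm (x - x')\<close> and
  \<open>2 ^ j * norm h\<close>.\<close>

lemma ift_peak:
  assumes d: "\<And>i. dbd i (dscale \<rho> j) (CARD('n) + 2) (\<lambda>\<xi>. C * (2 ^ j) powr (- real CARD('n) * (1 - \<rho>)) * t * indicator (shell j) \<xi>) h" and "0 \<le> t"
  shows "integrable lborel h" "norm (ift h z) \<le> A0 * t * P j z"
proof -
  let ?b = "C * (2 ^ j) powr (- real CARD('n) * (1 - \<rho>)) * t" and ?X = "(1 + norm z / dscale \<rho> j) ^ (CARD('n) + 2)" and ?c = "ift_const TYPE('n) (CARD('n) + 2)"
  have b0: "0 \<le> ?b" using C_pos \<open>0 \<le> t\<close> by simp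
  note I = integral_shell[OF b0, of j]
  show "integrable lborel h" using dbd_continuous[OF d] dbd_norm_le[OF d] I(1) by (rule integrable_dominated_continuous)
  have X: "0 < ?X" by (intro zero_less_power add_pos_nonneg) auto
  have "?X * norm (ift h z) \<le> ?c * (\<integral>\<xi>. ?b * indicator (shell j) (\<xi>::real ^ 'n) \<partial>lborel)"
    by (rule norm_ift_decay[OF d I(1) dscale_pos])
  also have "\<dots> \<le> ?c * (?b * (4 * 2 ^ j) ^ CARD('n))" using const_pos by (intro mult_left_mono I(2)) auto
  also have "\<dots> = ?c * 4 ^ CARD('n) * C * t * ((2 ^ j) powr (- real CARD('n) * (1 - \<rho>)) * (2 ^ j) ^ CARD('n))"
    unfolding power_mult_distrib by (simp only: mult_ac)
  also have "\<dots> = (?c * 4 ^ CARD('n) * C) * (t * (1 / dscale \<rho> j ^ CARD('n)))" unfolding dscale_card by (simp only: mult_ac)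
  also have "\<dots> \<le> A0 * (t * (1 / dscale \<rho> j ^ CARD('n)))"
    using const_pos C_pos \<open>0 \<le> t\<close> by (intro mult_right_mono) (auto simp: A0_def algebra_simps)
  finally have "norm (ift h z) \<le> A0 * (t * (1 / dscale \<rho> j ^ CARD('n))) / ?X" using X by (simp only: pos_le_divide_eq mult.commute)
  also have "\<dots> = A0 * t * P j z" unfolding peak_def
    by (simp only: times_divide_eq_right times_divide_eq_left divide_divide_eq_left mult_1_right mult_1 mult.assoc)
  finally show "norm (ift h z) \<le> A0 * t * P j z" .
qed

text \<open>The L2 norm of the majorant involves only the square root of the volume of the shell.
  Relative to the pointwise bound times the volume of the cube this gains the root of
  \<open>(1 / (l * 2 ^ j)) ^ n\<close>.\<close>

lemma ift_average:
  assumes d: "\<And>i. dbd i (dscale \<rho> j) (CARD('n) + 2) (\<lambda>\<xi>. C * (2 ^ j) powr (- real CARD('n) * (1 - \<rho>)) * indicator (shell j) \<xi>) h"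
    and l: "0 < l" "l \<le> dscale \<rho> j"
  shows "(\<integral>\<^sup>+u\<in>cube 0 l. ennreal (norm (ift h (z + u))) \<partial>lborel) \<le> ennreal (A0 * (l ^ CARD('n) * sqrt ((1 / (l * 2 ^ j)) ^ CARD('n)) * P j z))"
proof -
  let ?w = "(2 ^ j) powr (- real CARD('n) * (1 - \<rho>))"
  let ?b = "C * ?w" and ?X = "(1 + norm z / dscale \<rho> j) ^ (CARD('n) + 2)" and ?c = "local_const TYPE('n) (CARD('n) + 2)"
  have b0: "0 \<le> ?b" using C_pos by simp
  note I = integral_shell[OF b0, of j]
  have "(\<lambda>\<xi>::real ^ 'n. (?b * indicator (shell j) \<xi>)\<^sup>2) = (\<lambda>\<xi>. ?b\<^sup>2 * indicator (shell j) \<xi>)"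
    by (auto simp: indicator_def power_mult_distrib)
  note I2 = integral_shell[where 'n='n and b="?b\<^sup>2" and j=j, OF zero_le_power2, folded this]
  have four: "(4::real) ^ m = (2 ^ m)\<^sup>2" for m by (simp add: power2_eq_square flip: power_mult_distrib)
  \<comment> \<open>Writes a product as its square times its inverse, so that the root shows the
    pointwise bound multiplied by the gain.\<close>
  have eq: "L * (b\<^sup>2 * (e\<^sup>2 * J)) = (b * e * (L * J))\<^sup>2 * (1 / (L * J))" if "0 < L" "0 < J" for L J b e :: real
    using that by (simp add: power2_eq_square)
  have X: "0 < ?X" by (intro zero_less_power add_pos_nonneg) auto
  have "sqrt (l ^ CARD('n) * (\<integral>(\<xi>::real ^ 'n). (?b * indicator (shell j) \<xi>)\<^sup>2 \<partial>lborel)) \<le> sqrt (l ^ CARD('n) * (?b\<^sup>2 * (4 * 2 ^ j) ^ CARD('n)))"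
    using l by (intro real_sqrt_le_mono mult_left_mono I2(2)) auto
  also have "\<dots> = sqrt ((?b * 2 ^ CARD('n) * (l ^ CARD('n) * (2 ^ j) ^ CARD('n)))\<^sup>2 * (1 / (l * 2 ^ j)) ^ CARD('n))"
    using l eq[of "l ^ CARD('n)" "(2 ^ j) ^ CARD('n)" ?b "2 ^ CARD('n)"]
    by (simp only: power_mult_distrib[of l] power_mult_distrib[of 4] four power_one_over zero_less_power zero_less_numeral)
  also have "\<dots> = ?b * 2 ^ CARD('n) * (l ^ CARD('n) * (2 ^ j) ^ CARD('n)) * sqrt ((1 / (l * 2 ^ j)) ^ CARD('n))"
    using b0 l by (subst real_sqrt_mult) auto
  also have "\<dots> = 2 ^ CARD('n) * C * l ^ CARD('n) * sqrt ((1 / (l * 2 ^ j)) ^ CARD('n)) * (?w * (2 ^ j) ^ CARD('n))" by (simp only: mult_ac)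
  finally have s: "sqrt (l ^ CARD('n) * (\<integral>(\<xi>::real ^ 'n). (?b * indicator (shell j) \<xi>)\<^sup>2 \<partial>lborel))
    \<le> 2 ^ CARD('n) * C * l ^ CARD('n) * sqrt ((1 / (l * 2 ^ j)) ^ CARD('n)) * (1 / dscale \<rho> j ^ CARD('n))" unfolding dscale_card .
  have "ennreal ?X * (\<integral>\<^sup>+u\<in>cube 0 l. ennreal (norm (ift h (z + u))) \<partial>lborel)
    \<le> ennreal (?c * sqrt (l ^ CARD('n) * (\<integral>(\<xi>::real ^ 'n). (?b * indicator (shell j) \<xi>)\<^sup>2 \<partial>lborel)))"
    by (rule ift_local_average[OF d I(1) I2(1) l])
  also have "\<dots> \<le> ennreal (?c * (2 ^ CARD('n) * C * l ^ CARD('n) * sqrt ((1 / (l * 2 ^ j)) ^ CARD('n)) * (1 / dscale \<rho> j ^ CARD('n))))"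
    using const_pos by (intro ennreal_leI mult_left_mono s) auto
  also have "?c * (2 ^ CARD('n) * C * l ^ CARD('n) * sqrt ((1 / (l * 2 ^ j)) ^ CARD('n)) * (1 / dscale \<rho> j ^ CARD('n)))
    = (?c * 2 ^ CARD('n) * C) * (l ^ CARD('n) * sqrt ((1 / (l * 2 ^ j)) ^ CARD('n)) * (1 / dscale \<rho> j ^ CARD('n)))" by (simp only: mult_ac)
  also have "ennreal \<dots> \<le> ennreal (A0 * (l ^ CARD('n) * sqrt ((1 / (l * 2 ^ j)) ^ CARD('n)) * (1 / dscale \<rho> j ^ CARD('n))))"
    using const_pos C_pos l by (intro ennreal_leI mult_right_mono) (auto simp: A0_def algebra_simps)
  finally have "(\<integral>\<^sup>+u\<in>cube 0 l. ennreal (norm (ift h (z + u))) \<partial>lborel)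
      \<le> ennreal (A0 * (l ^ CARD('n) * sqrt ((1 / (l * 2 ^ j)) ^ CARD('n)) * (1 / dscale \<rho> j ^ CARD('n))) / ?X)"
    by (rule ennreal_mult_leD[OF _ X]) (use A0_pos l in auto)
  then show ?thesis by (simp add: peak_def mult.assoc)
qed

lemma two_pi: "norm (complex_of_real (1 / (2 * pi) ^ CARD('n))) \<le> 1"
proof -
  have X: "1 \<le> (2 * pi) ^ CARD('n)" using pi_ge_two by (intro one_le_power) linarith
  have "\<bar>1 / x\<bar> \<le> 1" if "1 \<le> x" for x :: real using that by simp
  from this[OF X] show ?thesis by (simp only: norm_of_real)
qed

lemma integrable_g: "integrable lborel (g j x)"
  unfolding g_def[abs_def] using ift_peak(1)[of j 1] piece by simp

lemma norm_const_mult_le: "norm w \<le> b \<Longrightarrow> norm (complex_of_real (1 / (2 * pi) ^ CARD('n)) * w) \<le> b"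
  using order_trans[OF mult_right_mono[OF two_pi norm_ge_zero[of w]], of b] by (simp only: norm_mult mult_1_left)

lemma K_size: "norm (K j x z) \<le> A0 * P j z"
  unfolding K_def g_def[abs_def] using ift_peak(2)[of j 1] piece by (intro norm_const_mult_le) simp

lemma K_freeze: "norm (K j x z - K j x' z) \<le> A0 * ((2 ^ j) powr \<delta> * norm (x - x')) * P j z"
proof -
  have "ift (\<lambda>\<xi>. (a (x, \<xi>) - a (x', \<xi>)) * complex_of_real (psi F j \<xi>)) z = ift (g j x) z - ift (g j x') z"
    using ift_diff[OF integrable_g integrable_g, of j x j x' z] by (simp add: g_def left_diff_distrib)
  then show ?thesis
    unfolding K_def right_diff_distrib[symmetric] using ift_peak(2)[OF piece_diff, of j x x' z] by (intro norm_const_mult_le) simp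
qed

lemma K_shift: "norm h \<le> CARD('n) / 2 ^ j \<Longrightarrow> norm (K j x z - K j x (z + h)) \<le> A0 * (2 ^ j * norm h) * P j z"
proof -
  assume h: "norm h \<le> CARD('n) / 2 ^ j"
  have "ift (\<lambda>\<xi>. a (x, \<xi>) * complex_of_real (psi F j \<xi>) * (1 - cis (h \<bullet> \<xi>))) z = ift (g j x) z - ift (g j x) (z + h)"
    using ift_shift_diff[OF integrable_g, of j x h z] by (simp add: g_def)
  then show ?thesis
    unfolding K_def right_diff_distrib[symmetric] using ift_peak(2)[OF piece_cis[OF h], of x z] by (intro norm_const_mult_le) simp
qed

text \<open>Both arguments may move at once. This covers the smoothness in either variable of both
  \<open>K j x (x - y)\<close> and \<open>K j y (x - y)\<close>; the change of the first argument
  costs \<open>(2 ^ j) powr \<delta>\<close>, no more than that of the second.\<close>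

lemma K_diff:
  assumes h: "norm h \<le> CARD('n) / 2 ^ j" and x: "norm (x - x') \<le> norm h"
  shows "norm (K j x z - K j x' (z + h)) \<le> A1 * (2 ^ j * norm h) * P j z"
proof -
  have "norm (K j x z - K j x' (z + h)) \<le> norm (K j x z - K j x' z) + norm (K j x' z - K j x' (z + h))" using norm_triangle_ineq[of "K j x z - K j x' z" "K j x' z - K j x' (z + h)"] by simp
  also have "\<dots> \<le> A0 * ((2 ^ j) powr \<delta> * norm (x - x')) * P j z + A0 * (2 ^ j * norm h) * P j z"
    by (intro add_mono K_freeze K_shift h)
  also have "A0 * ((2 ^ j) powr \<delta> * norm (x - x')) * P j z \<le> A0 * (2 ^ j * norm h) * P j z"
  proof -
    have "(2 ^ j) powr \<delta> \<le> (2 ^ j :: real) powr 1" using delta by (intro powr_mono) auto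
    then have "(2 ^ j) powr \<delta> * norm (x - x') \<le> 2 ^ j * norm h" using x by (intro mult_mono) auto
    then show ?thesis using A0_pos by (intro mult_right_mono mult_left_mono) auto
  qed
  finally have "norm (K j x z - K j x' (z + h)) \<le> (A0 * 2) * ((2 ^ j * norm h) * P j z)" by (simp add: algebra_simps)
  also have "\<dots> \<le> A1 * ((2 ^ j * norm h) * P j z)"
  proof (intro mult_right_mono A1_ge)
    have "2 * 1 * 1 \<le> 2 * 4 ^ (CARD('n) + 1) * (1 + real CARD('n)) ^ (CARD('n) + 3)" by (intro mult_mono one_le_power) auto
    then show "2 \<le> 2 * 4 ^ (CARD('n) + 1) * (1 + real CARD('n)) ^ (CARD('n) + 3)" by simp
  qed auto
  finally show ?thesis by (simp add: mult.assoc)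
qed

lemma psi_measurable [measurable]: "psi F j \<in> borel_measurable (borel :: (real ^ 'n) measure)"
proof -
  have "continuous_on UNIV (\<lambda>\<xi>::real ^ 'n. complex_of_real (psi F j \<xi>))" by (rule dbd_continuous[OF dbd_psi[OF F]])
  from borel_measurable_continuous_onI[OF continuous_on_Re[OF this]] show ?thesis by simp
qed

lemma a_measurable [measurable]: "a \<in> borel_measurable (borel \<Otimes>\<^sub>M borel)"
  using a_continuous by (simp add: borel_prod borel_measurable_continuous_onI)

lemma K_measurable: "(\<lambda>p. K j (fst p) (snd p)) \<in> borel_measurable (borel \<Otimes>\<^sub>M borel)"
  unfolding K_def ift_def g_def by measurable

lemma K_measurable_compose [measurable (raw)]:
  assumes [measurable]: "u \<in> borel_measurable N" "v \<in> borel_measurable N"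
  shows "(\<lambda>x. K j (u x) (v x)) \<in> borel_measurable N"
  using measurable_compose[OF _ K_measurable, of "\<lambda>x. (u x, v x)" N j] by simp

lemma A0_le_A1: "A0 \<le> A1"
proof -
  have "1 * 1 * 1 \<le> 2 * 4 ^ (CARD('n) + 1) * (1 + real CARD('n)) ^ (CARD('n) + 3)" by (intro mult_mono one_le_power) auto
  then show ?thesis using A1_ge[of 1] by simp
qed

lemma K_size': "norm (K j x z) \<le> A1 * P j z"
  using K_size[of j x z] A0_le_A1 mult_right_mono[OF A0_le_A1, of "P j z"] by simp

lemma family: "kernel_family (\<lambda>j x y. K j x (x - y)) \<rho> A1"
proof
  fix j and x x' y :: "real ^ 'n" assume h: "norm (x - x') \<le> CARD('n) / 2 ^ j"
  show "norm (K j x (x - y) - K j x' (x' - y)) \<le> A1 * (2 ^ j * norm (x - x')) * P j (x - y)"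
    using K_diff[of "x' - x" j x x' "x - y"] h by (simp add: norm_minus_commute)
qed (use rho A1_pos K_size' in \<open>auto simp: split_def\<close>)

lemma family_adj: "kernel_family (\<lambda>j x y. K j y (x - y)) \<rho> A1"
proof
  fix j and x x' y :: "real ^ 'n" assume h: "norm (x - x') \<le> CARD('n) / 2 ^ j"
  show "norm (K j y (x - y) - K j y (x' - y)) \<le> A1 * (2 ^ j * norm (x - x')) * P j (x - y)"
    using K_diff[of "x' - x" j y y "x - y"] h by (simp add: norm_minus_commute)
qed (use rho A1_pos K_size' in \<open>auto simp: split_def\<close>)

lemma K_average:
  assumes l: "0 < l" "l \<le> dscale \<rho> j"
  shows "(\<integral>\<^sup>+u\<in>cube 0 l. ennreal (norm (K j x (z + u))) \<partial>lborel) \<le> ennreal (A0 * (l ^ CARD('n) * sqrt ((1 / (l * 2 ^ j)) ^ CARD('n)) * P j z))"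
proof -
  have "(\<integral>\<^sup>+u\<in>cube 0 l. ennreal (norm (K j x (z + u))) \<partial>lborel) \<le> (\<integral>\<^sup>+u\<in>cube 0 l. ennreal (norm (ift (g j x) (z + u))) \<partial>lborel)"
    unfolding K_def by (intro nn_integral_mono mult_right_mono ennreal_leI norm_const_mult_le) auto
  also have "\<dots> \<le> ennreal (A0 * (l ^ CARD('n) * sqrt ((1 / (l * 2 ^ j)) ^ CARD('n)) * P j z))"
    by (rule ift_average[OF _ l]) (use piece in \<open>simp add: g_def[abs_def]\<close>)
  finally show ?thesis .
qed

text \<open>The error of replacing the moving first argument \<open>x + u\<close> by
  \<open>x\<close>. The translation of the peak by \<open>u\<close> is harmless, because the cube is
  not larger than the width of the kernel.\<close>

lemma freeze_average:
  assumes l: "0 < l" "l \<le> dscale \<rho> j"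
  shows "(\<integral>\<^sup>+u\<in>cube 0 l. ennreal (norm (K j (x + u) (z + u) - K j x (z + u))) \<partial>lborel)
    \<le> ennreal (A0 * (1 + real CARD('n)) ^ (CARD('n) + 3) * (l ^ CARD('n) * (l * (2 ^ j) powr \<delta>) * P j z))"
proof -
  let ?n = "real CARD('n)"
  let ?c = "A0 * ((2 ^ j) powr \<delta> * (?n * l)) * ((1 + ?n) ^ (CARD('n) + 2) * P j z)"
  have "(\<integral>\<^sup>+u\<in>cube 0 l. ennreal (norm (K j (x + u) (z + u) - K j x (z + u))) \<partial>lborel) \<le> (\<integral>\<^sup>+u. ennreal ?c * indicator (cube (0::real ^ 'n) l) u \<partial>lborel)"
  proof (rule nn_integral_mono)
    fix u :: "real ^ 'n"
    have "norm (K j (x + u) (z + u) - K j x (z + u)) \<le> ?c" if u: "u \<in> cube 0 l"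
    proof -
      have nu: "norm u \<le> ?n * l" by (rule norm_le_of_mem_cube0[OF u])
      also have "\<dots> \<le> ?n * dscale \<rho> j" using l by (intro mult_left_mono) auto
      finally have pk: "P j (z + u) \<le> (1 + ?n) ^ (CARD('n) + 2) * P j z" by (intro peak_shift_le) auto
      have "norm (K j (x + u) (z + u) - K j x (z + u)) \<le> A0 * ((2 ^ j) powr \<delta> * norm u) * P j (z + u)"
        using K_freeze[of j "x + u" "z + u" x] by simp
      also have "\<dots> \<le> ?c" using A0_pos nu pk l by (intro mult_mono[of _ _ "P j (z + u)"] mult_left_mono) auto
      finally show ?thesis .
    qed
    then show "ennreal (norm (K j (x + u) (z + u) - K j x (z + u))) * indicator (cube 0 l) u \<le> ennreal ?c * indicator (cube 0 l) u"
      by (auto simp: indicator_def intro: ennreal_leI)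
  qed
  also have "\<dots> = ennreal ?c * ennreal (l ^ CARD('n))" using l emeasure_cube[of l "0::real ^ 'n"] by (simp add: nn_integral_cmult_indicator)
  also have "\<dots> = ennreal (?c * l ^ CARD('n))" using A0_pos l by (intro ennreal_mult[symmetric]) auto
  also have "?c * l ^ CARD('n) = ?n * (A0 * (1 + ?n) ^ (CARD('n) + 2) * (l ^ CARD('n) * (l * (2 ^ j) powr \<delta>) * P j z))" by (simp only: mult_ac)
  also have "ennreal \<dots> \<le> ennreal ((1 + ?n) * (A0 * (1 + ?n) ^ (CARD('n) + 2) * (l ^ CARD('n) * (l * (2 ^ j) powr \<delta>) * P j z)))"
    using A0_pos l by (intro ennreal_leI mult_right_mono) auto
  also have "(1 + ?n) * (A0 * (1 + ?n) ^ (CARD('n) + 2) * (l ^ CARD('n) * (l * (2 ^ j) powr \<delta>) * P j z))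
      = A0 * (1 + ?n) ^ Suc (CARD('n) + 2) * (l ^ CARD('n) * (l * (2 ^ j) powr \<delta>) * P j z)" by (simp only: power_Suc mult_ac)
  also have "Suc (CARD('n) + 2) = CARD('n) + 3" by simp
  finally show ?thesis .
qed

lemma rough:
  assumes "\<rho> < 1"
  shows "rough_family (\<lambda>j x y. K j x (x - y)) \<rho> A1 \<delta>" "rough_family (\<lambda>j x y. K j y (x - y)) \<rho> A1 \<delta>"
proof -
  have bd: "ennreal (A0 * (l ^ CARD('n) * sqrt ((1 / (l * 2 ^ j)) ^ CARD('n)) * P j z)) + ennreal (A0 * (1 + real CARD('n)) ^ (CARD('n) + 3) * (l ^ CARD('n) * (l * (2 ^ j) powr \<delta>) * P j z))
      \<le> ennreal (A1 * l ^ CARD('n) * (sqrt ((1 / (l * 2 ^ j)) ^ CARD('n)) + l * (2 ^ j) powr \<delta>) * P j z)" if l: "0 < l" for l :: real and j z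
  proof -
    have "1 * 1 * (1 + real CARD('n)) ^ (CARD('n) + 3) \<le> 2 * 4 ^ (CARD('n) + 1) * (1 + real CARD('n)) ^ (CARD('n) + 3)" by (intro mult_mono one_le_power) auto
    then have A: "A0 * (1 + real CARD('n)) ^ (CARD('n) + 3) \<le> A1" by (intro A1_ge) simp
    have "A0 * (l ^ CARD('n) * sqrt ((1 / (l * 2 ^ j)) ^ CARD('n)) * P j z) + A0 * (1 + real CARD('n)) ^ (CARD('n) + 3) * (l ^ CARD('n) * (l * (2 ^ j) powr \<delta>) * P j z)
      \<le> A1 * (l ^ CARD('n) * sqrt ((1 / (l * 2 ^ j)) ^ CARD('n)) * P j z) + A1 * (l ^ CARD('n) * (l * (2 ^ j) powr \<delta>) * P j z)"
      using l by (intro add_mono mult_right_mono A A0_le_A1) auto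
    also have "\<dots> = A1 * l ^ CARD('n) * (sqrt ((1 / (l * 2 ^ j)) ^ CARD('n)) + l * (2 ^ j) powr \<delta>) * P j z" by (simp only: distrib_left distrib_right mult_ac)
    finally have "ennreal (A0 * (l ^ CARD('n) * sqrt ((1 / (l * 2 ^ j)) ^ CARD('n)) * P j z) + A0 * (1 + real CARD('n)) ^ (CARD('n) + 3) * (l ^ CARD('n) * (l * (2 ^ j) powr \<delta>) * P j z))
      \<le> ennreal (A1 * l ^ CARD('n) * (sqrt ((1 / (l * 2 ^ j)) ^ CARD('n)) + l * (2 ^ j) powr \<delta>) * P j z)" by (rule ennreal_leI)
    moreover have "0 \<le> A0 * (l ^ CARD('n) * sqrt ((1 / (l * 2 ^ j)) ^ CARD('n)) * P j z)" "0 \<le> A0 * (1 + real CARD('n)) ^ (CARD('n) + 3) * (l ^ CARD('n) * (l * (2 ^ j) powr \<delta>) * P j z)"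
      using A0_pos l by auto
    ultimately show ?thesis by (simp only: ennreal_plus)
  qed
  interpret T: kernel_family "\<lambda>j x y. K j x (x - y)" \<rho> A1 by (rule family)
  interpret S: kernel_family "\<lambda>j x y. K j y (x - y)" \<rho> A1 by (rule family_adj)
  show "rough_family (\<lambda>j x y. K j x (x - y)) \<rho> A1 \<delta>"
  proof
    fix j and l :: real and x y :: "real ^ 'n" assume l: "0 < l" "l \<le> dscale \<rho> j"
    have "(\<integral>\<^sup>+u\<in>cube 0 l. ennreal (norm (K j (x + u) (x + u - y))) \<partial>lborel)
      \<le> (\<integral>\<^sup>+u. ennreal (norm (K j x ((x - y) + u))) * indicator (cube 0 l) u + ennreal (norm (K j (x + u) ((x - y) + u) - K j x ((x - y) + u))) * indicator (cube 0 l) u \<partial>lborel)"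
    proof (rule nn_integral_mono)
      fix u
      have e: "x + u - y = (x - y) + u" by simp
      have "ennreal (norm (K j (x + u) ((x - y) + u))) \<le> ennreal (norm (K j x ((x - y) + u)) + norm (K j (x + u) ((x - y) + u) - K j x ((x - y) + u)))"
        by (intro ennreal_leI norm_triangle_sub)
      then show "ennreal (norm (K j (x + u) (x + u - y))) * indicator (cube 0 l) u
        \<le> ennreal (norm (K j x ((x - y) + u))) * indicator (cube 0 l) u + ennreal (norm (K j (x + u) ((x - y) + u) - K j x ((x - y) + u))) * indicator (cube 0 l) u"
        unfolding e by (simp add: indicator_def ennreal_plus)
    qed
    also have "\<dots> = (\<integral>\<^sup>+u\<in>cube 0 l. ennreal (norm (K j x ((x - y) + u))) \<partial>lborel) + (\<integral>\<^sup>+u\<in>cube 0 l. ennreal (norm (K j (x + u) ((x - y) + u) - K j x ((x - y) + u))) \<partial>lborel)"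
      by (rule nn_integral_add) measurable
    also have "\<dots> \<le> ennreal (A0 * (l ^ CARD('n) * sqrt ((1 / (l * 2 ^ j)) ^ CARD('n)) * P j (x - y))) + ennreal (A0 * (1 + real CARD('n)) ^ (CARD('n) + 3) * (l ^ CARD('n) * (l * (2 ^ j) powr \<delta>) * P j (x - y)))"
      by (intro add_mono K_average freeze_average l)
    also note bd[OF l(1)]
    finally show "(\<integral>\<^sup>+u\<in>cube 0 l. ennreal (norm (K j (x + u) (x + u - y))) \<partial>lborel)
      \<le> ennreal (A1 * l ^ CARD('n) * (sqrt ((1 / (l * 2 ^ j)) ^ CARD('n)) + l * (2 ^ j) powr \<delta>) * P j (x - y))" .
  qed (use assms delta in auto)
  show "rough_family (\<lambda>j x y. K j y (x - y)) \<rho> A1 \<delta>"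
  proof
    fix j and l :: real and x y :: "real ^ 'n" assume l: "0 < l" "l \<le> dscale \<rho> j"
    have "(\<integral>\<^sup>+u\<in>cube 0 l. ennreal (norm (K j y (x + u - y))) \<partial>lborel) = (\<integral>\<^sup>+u\<in>cube 0 l. ennreal (norm (K j y ((x - y) + u))) \<partial>lborel)"
      by (simp add: algebra_simps)
    also have "\<dots> \<le> ennreal (A0 * (l ^ CARD('n) * sqrt ((1 / (l * 2 ^ j)) ^ CARD('n)) * P j (x - y)))" by (intro K_average l)
    \<comment> \<open>For the adjoint kernel the first argument \<open>y\<close> stays fixed while
      \<open>u\<close> varies, so there is no freezing error; the term is added to reuse
      \<open>bd\<close>.\<close>
    also have "\<dots> \<le> \<dots> + ennreal (A0 * (1 + real CARD('n)) ^ (CARD('n) + 3) * (l ^ CARD('n) * (l * (2 ^ j) powr \<delta>) * P j (x - y)))" by simp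
    also note bd[OF l(1)]
    finally show "(\<integral>\<^sup>+u\<in>cube 0 l. ennreal (norm (K j y (x + u - y))) \<partial>lborel)
      \<le> ennreal (A1 * l ^ CARD('n) * (sqrt ((1 / (l * 2 ^ j)) ^ CARD('n)) + l * (2 ^ j) powr \<delta>) * P j (x - y))" .
  qed (use assms delta in auto)
qed

lemma nn_integral_P: "(\<integral>\<^sup>+y. ennreal (A0 * P j (x - y)) \<partial>lborel) \<le> ennreal (A0 * 4 ^ (CARD('n) + 1))" "(\<integral>\<^sup>+y. ennreal (A0 * P j (y - x)) \<partial>lborel) \<le> ennreal (A0 * 4 ^ (CARD('n) + 1))"
proof -
  have "(\<integral>\<^sup>+y. ennreal (A0 * P j (x - y)) \<partial>lborel) = (\<integral>\<^sup>+y. ennreal A0 * ennreal (P j (x - y)) \<partial>lborel)"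
    using A0_pos by (intro nn_integral_cong ennreal_mult) auto
  also have "\<dots> = ennreal A0 * (\<integral>\<^sup>+y. ennreal (P j (x - y)) \<partial>lborel)" by (rule nn_integral_cmult) measurable
  also have "\<dots> \<le> ennreal A0 * ennreal (4 ^ (CARD('n) + 1))" by (intro mult_left_mono nn_integral_peak_diff) auto
  also have "\<dots> = ennreal (A0 * 4 ^ (CARD('n) + 1))" using A0_pos by (intro ennreal_mult[symmetric]) auto
  finally show "(\<integral>\<^sup>+y. ennreal (A0 * P j (x - y)) \<partial>lborel) \<le> ennreal (A0 * 4 ^ (CARD('n) + 1))" .
  then show "(\<integral>\<^sup>+y. ennreal (A0 * P j (y - x)) \<partial>lborel) \<le> ennreal (A0 * 4 ^ (CARD('n) + 1))" by (simp only: peak_minus_commute[of _ _ _ x])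
qed

lemma K_measurable_right [measurable]: "K j x \<in> borel_measurable borel"
  using measurable_compose[OF _ K_measurable, of "\<lambda>z. (x, z)" borel j] by simp

lemma integrable_K: "integrable lborel (K j x)"
proof (rule integrableI_bounded)
  show "K j x \<in> borel_measurable lborel" by measurable
  have "(\<integral>\<^sup>+z. ennreal (norm (K j x z)) \<partial>lborel) \<le> (\<integral>\<^sup>+z. ennreal (A0 * P j (z - 0)) \<partial>lborel)"
    unfolding diff_zero by (intro nn_integral_mono ennreal_leI K_size)
  also have "\<dots> < \<infinity>" by (rule le_less_trans[OF nn_integral_P(2)]) simp
  finally show "(\<integral>\<^sup>+z. ennreal (norm (K j x z)) \<partial>lborel) < \<infinity>" .
qed

text \<open>For positive \<open>j\<close> the shell avoids the origin, so the localized symbol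
  vanishes there and inversion at the origin applies.\<close>

lemma integral_K:
  assumes "0 < j" shows "(\<integral>z. K j x z \<partial>lborel) = 0"
proof -
  have ig: "integrable lborel (ift (g j x))"
  proof -
    have "integrable lborel (\<lambda>z. complex_of_real ((2 * pi) ^ CARD('n)) * K j x z)" by (intro integrable_mult_right integrable_K)
    then show ?thesis by (simp add: K_def)
  qed
  have d: "dbd i (dscale \<rho> j) (CARD('n) + 2) (\<lambda>\<xi>. C * (2 ^ j) powr (- real CARD('n) * (1 - \<rho>)) * indicator (shell j) \<xi>) (g j x)" for i
    using piece by (simp add: g_def[abs_def])
  have "(\<integral>z. ift (g j x) z \<partial>lborel) = 0"
  proof (rule integral_ift_eq_0[OF dbd_continuous[OF d] integrable_g _ _ ig])
    show "norm (g j x \<xi>) \<le> C * (2 ^ j) powr (- real CARD('n) * (1 - \<rho>))" for \<xi>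
    proof -
      have "C * (2 ^ j) powr (- real CARD('n) * (1 - \<rho>)) * indicator (shell j) \<xi> \<le> C * (2 ^ j) powr (- real CARD('n) * (1 - \<rho>)) * 1"
        using C_pos by (intro mult_left_mono) (auto simp: indicator_def)
      then show ?thesis using dbd_norm_le[OF d, of \<xi>] by simp
    qed
    have "(0::real ^ 'n) \<notin> shell j" using assms by (simp add: shell_def not_less)
    then show "g j x 0 = 0" using dbd_norm_le[OF d, of 0] by simp
  qed
  then show ?thesis by (simp add: K_def[abs_def])
qed

lemma integral_low:
  fixes f :: "real ^ 'n \<Rightarrow> complex" and v :: "real ^ 'n \<Rightarrow> real ^ 'n"
  assumes "\<And>x. norm (f x) \<le> A0 * P 0 (v x)" "(\<integral>\<^sup>+x. ennreal (A0 * P 0 (v x)) \<partial>lborel) \<le> ennreal (A0 * 4 ^ (CARD('n) + 1))"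
  shows "norm (\<integral>x. f x \<partial>lborel) \<le> A1"
proof -
  have "ennreal (norm (\<integral>x. f x \<partial>lborel)) \<le> (\<integral>\<^sup>+x. ennreal (norm (f x)) \<partial>lborel)" by (rule norm_integral_le_nn_integral)
  also have "\<dots> \<le> (\<integral>\<^sup>+x. ennreal (A0 * P 0 (v x)) \<partial>lborel)" by (intro nn_integral_mono ennreal_leI assms)
  also note assms(2)
  finally have "norm (\<integral>x. f x \<partial>lborel) \<le> A0 * 4 ^ (CARD('n) + 1)" using A0_pos by (subst (asm) ennreal_le_iff) auto
  also have "\<dots> \<le> A1"
  proof (rule A1_ge)
    have "1 * 4 ^ (CARD('n) + 1) * 1 \<le> 2 * 4 ^ (CARD('n) + 1) * (1 + real CARD('n)) ^ (CARD('n) + 3)" by (intro mult_mono one_le_power) auto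
    then show "4 ^ (CARD('n) + 1) \<le> 2 * 4 ^ (CARD('n) + 1) * (1 + real CARD('n)) ^ (CARD('n) + 3)" by (simp only: mult_1_left mult_1_right)
  qed
  finally show ?thesis .
qed

text \<open>The first argument is frozen at \<open>p\<close>, where the integral vanishes. The
  freezing error carries a factor \<open>norm (v x)\<close>, which a power of decay turns into the
  width 2^-j; together with \<open>(2 ^ j) powr \<delta>\<close> this is the claimed rate.\<close>

lemma drift:
  fixes u v :: "real ^ 'n \<Rightarrow> real ^ 'n"
  assumes "\<rho> = 1" "0 < j" and i: "integrable lborel (\<lambda>x. K j p (v x))" and z: "(\<integral>x. K j p (v x) \<partial>lborel) = 0"
    and e: "\<And>x. norm (u x - p) = norm (v x)" and [measurable]: "v \<in> borel_measurable borel"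
    and pk: "(\<integral>\<^sup>+x. ennreal (peak (CARD('n) + 1) (dscale \<rho> j) (v x)) \<partial>lborel) \<le> ennreal (4 ^ (CARD('n) + 1))"
  shows "norm (\<integral>x. K j (u x) (v x) \<partial>lborel) \<le> A1 * 2 powr (- (1 - \<delta>) * real j)"
proof (cases "integrable lborel (\<lambda>x. K j (u x) (v x))")
  case True
  let ?c = "A0 * 2 powr (- (1 - \<delta>) * real j)"
  have w: "(2 ^ j) powr \<delta> * dscale \<rho> j = 2 powr (- (1 - \<delta>) * real j)"
  proof -
    have "(2 ^ j) powr \<delta> * dscale \<rho> j = (2 ^ j) powr (\<delta> + - 1)" unfolding dscale_def \<open>\<rho> = 1\<close> by (simp only: powr_add)
    also have "\<dots> = (2 powr real j) powr (\<delta> + - 1)" by (simp add: powr_realpow)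
    also have "\<dots> = 2 powr (real j * (\<delta> + - 1))" by (rule powr_powr)
    also have "real j * (\<delta> + - 1) = - (1 - \<delta>) * real j" by (simp add: algebra_simps)
    finally show ?thesis .
  qed
  have pt: "norm (K j (u x) (v x) - K j p (v x)) \<le> ?c * peak (CARD('n) + 1) (dscale \<rho> j) (v x)" for x
  proof -
    have "norm (K j (u x) (v x) - K j p (v x)) \<le> A0 * ((2 ^ j) powr \<delta> * norm (v x)) * P j (v x)" using K_freeze[of j "u x" "v x" p] e by simp
    also have "\<dots> = A0 * (2 ^ j) powr \<delta> * (norm (v x) * peak (Suc (CARD('n) + 1)) (dscale \<rho> j) (v x))" by (simp add: mult_ac)
    also have "\<dots> \<le> A0 * (2 ^ j) powr \<delta> * (dscale \<rho> j * peak (CARD('n) + 1) (dscale \<rho> j) (v x))"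
      using A0_pos by (intro mult_left_mono norm_times_peak_le) auto
    also have "\<dots> = ?c * peak (CARD('n) + 1) (dscale \<rho> j) (v x)" unfolding w[symmetric] by (simp only: mult_ac)
    finally show ?thesis .
  qed
  have c0: "0 \<le> ?c" using A0_pos by simp
  have "(\<integral>x. K j (u x) (v x) \<partial>lborel) = (\<integral>x. K j (u x) (v x) - K j p (v x) \<partial>lborel)" using Bochner_Integration.integral_diff[OF True i] z by simp
  then have "ennreal (norm (\<integral>x. K j (u x) (v x) \<partial>lborel)) \<le> (\<integral>\<^sup>+x. ennreal (norm (K j (u x) (v x) - K j p (v x))) \<partial>lborel)"
    by (simp only: norm_integral_le_nn_integral)
  also have "\<dots> \<le> (\<integral>\<^sup>+x. ennreal ?c * ennreal (peak (CARD('n) + 1) (dscale \<rho> j) (v x)) \<partial>lborel)"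
  proof (rule nn_integral_mono)
    fix x
    have "ennreal (norm (K j (u x) (v x) - K j p (v x))) \<le> ennreal (?c * peak (CARD('n) + 1) (dscale \<rho> j) (v x))" by (rule ennreal_leI[OF pt])
    also have "\<dots> = ennreal ?c * ennreal (peak (CARD('n) + 1) (dscale \<rho> j) (v x))" using c0 by (intro ennreal_mult) auto
    finally show "ennreal (norm (K j (u x) (v x) - K j p (v x))) \<le> \<dots>" .
  qed
  also have "\<dots> = ennreal ?c * (\<integral>\<^sup>+x. ennreal (peak (CARD('n) + 1) (dscale \<rho> j) (v x)) \<partial>lborel)" by (rule nn_integral_cmult) measurable
  also have "\<dots> \<le> ennreal ?c * ennreal (4 ^ (CARD('n) + 1))" by (intro mult_left_mono pk) simp
  also have "\<dots> = ennreal (?c * 4 ^ (CARD('n) + 1))" using c0 by (intro ennreal_mult[symmetric]) auto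
  finally have "norm (\<integral>x. K j (u x) (v x) \<partial>lborel) \<le> ?c * 4 ^ (CARD('n) + 1)" using c0 by (subst (asm) ennreal_le_iff) auto
  also have "\<dots> = (A0 * 4 ^ (CARD('n) + 1)) * 2 powr (- (1 - \<delta>) * real j)" by (simp only: mult_ac)
  also have "\<dots> \<le> A1 * 2 powr (- (1 - \<delta>) * real j)"
  proof (intro mult_right_mono A1_ge)
    have "1 * 4 ^ (CARD('n) + 1) * 1 \<le> 2 * 4 ^ (CARD('n) + 1) * (1 + real CARD('n)) ^ (CARD('n) + 3)" by (intro mult_mono one_le_power) auto
    then show "4 ^ (CARD('n) + 1) \<le> 2 * 4 ^ (CARD('n) + 1) * (1 + real CARD('n)) ^ (CARD('n) + 3)" by (simp only: mult_1_left mult_1_right)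
  qed simp
  finally show ?thesis .
\<comment> \<open>In the remaining case the integral is 0 by convention.\<close>
qed (use A1_pos in \<open>simp add: not_integrable_integral_eq\<close>)

text \<open>For each of the two kernels one of the marginal integrals keeps the first argument of
  \<open>K\<close> fixed and vanishes for positive \<open>j\<close>; in the other one it moves with
  the integration variable and \<open>drift\<close> applies. The piece \<open>j = 0\<close> has no
  cancellation and is bounded by its mass.\<close>

lemma cz:
  assumes "\<rho> = 1"
  shows "cz_family (\<lambda>j x y. K j x (x - y)) A1 (1 - \<delta>)" "cz_family (\<lambda>j x y. K j y (x - y)) A1 (1 - \<delta>)"
proof -
  have zl: "(\<integral>x. K j p (x - y) \<partial>lborel) = (\<integral>z. K j p z \<partial>lborel)" for j p y using integral_lborel_shift[OF K_measurable_right, of j p "- y"] by simp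
  have zr: "(\<integral>y. K j p (x - y) \<partial>lborel) = (\<integral>z. K j p z \<partial>lborel)" for j p x by (rule integral_lborel_reflect) measurable
  have il: "integrable lborel (\<lambda>x. K j p (x - y))" for j p y using integrable_lborel_shift[OF integrable_K, of j p "- y"] by simp
  have ir: "integrable lborel (\<lambda>y. K j p (x - y))" for j p x
  proof (rule integrableI_bounded)
    have "(\<integral>\<^sup>+y. ennreal (norm (K j p (x - y))) \<partial>lborel) \<le> (\<integral>\<^sup>+y. ennreal (A0 * P j (x - y)) \<partial>lborel)" by (intro nn_integral_mono ennreal_leI K_size)
    also have "\<dots> < \<infinity>" by (rule le_less_trans[OF nn_integral_P(1)]) simp
    finally show "(\<integral>\<^sup>+y. ennreal (norm (K j p (x - y))) \<partial>lborel) < \<infinity>" .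
  qed measurable
  have A1w: "0 \<le> A1 * 2 powr (- (1 - \<delta>) * real j)" for j using A1_pos by simp
  have bounds: "norm (\<integral>y. K j x (x - y) \<partial>lborel) \<le> A1 * 2 powr (- (1 - \<delta>) * real j)"
    "norm (\<integral>x. K j x (x - y) \<partial>lborel) \<le> A1 * 2 powr (- (1 - \<delta>) * real j)"
    "norm (\<integral>y. K j y (x - y) \<partial>lborel) \<le> A1 * 2 powr (- (1 - \<delta>) * real j)"
    "norm (\<integral>x. K j y (x - y) \<partial>lborel) \<le> A1 * 2 powr (- (1 - \<delta>) * real j)" for j x y
  \<comment> \<open>The case distinction splits only the first of the four bounds; the other three
    follow as the goals 3 to 5.\<close>
  proof (cases "j = 0", goal_cases)
    case 1 then show ?case using integral_low[OF K_size nn_integral_P(1)] by simp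
  next
    case 2 then show ?case using A1w[of j] by (simp add: zr integral_K)
  next
    case 3
    show ?case
    proof (cases "j = 0")
      case True then show ?thesis using integral_low[OF K_size nn_integral_P(2)] by simp
    next
      case False
      show ?thesis using False by (intro drift[where p=y, OF assms _ il _ _ _ nn_integral_peak_diff(2)]) (auto simp: zl integral_K)
    qed
  next
    case 4
    show ?case
    proof (cases "j = 0")
      case True then show ?thesis using integral_low[OF K_size nn_integral_P(1)] by simp
    next
      case False
      show ?thesis using False by (intro drift[where p=x, OF assms _ ir _ _ _ nn_integral_peak_diff(1)]) (auto simp: zr integral_K norm_minus_commute)
    qed
  next
    case 5
    show ?case
    proof (cases "j = 0")
      case True then show ?thesis using integral_low[OF K_size nn_integral_P(2)] by simp
    next
      case False then show ?thesis using A1w[of j] by (simp add: zl integral_K)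
    qed
  qed
  have f: "kernel_family (\<lambda>j x y. K j x (x - y)) 1 A1" "kernel_family (\<lambda>j x y. K j y (x - y)) 1 A1"
    using family family_adj assms by simp_all
  have d: "norm (K j q (x - y) - K j q' (x - y')) \<le> A1 * (2 ^ j * norm (y - y')) * peak (CARD('n) + 2) (dscale 1 j) (x - y)"
    if "norm (y - y') \<le> CARD('n) / 2 ^ j" "norm (q - q') \<le> norm (y - y')" for j q q' x y y'
    using K_diff[OF that, of "x - y"] assms by simp
  show "cz_family (\<lambda>j x y. K j x (x - y)) A1 (1 - \<delta>)"
    by (intro cz_family.intro[OF f(1)] cz_family_axioms.intro bounds d) (use delta in auto)
  show "cz_family (\<lambda>j x y. K j y (x - y)) A1 (1 - \<delta>)"
    by (intro cz_family.intro[OF f(2)] cz_family_axioms.intro bounds d) (use delta in auto)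
qed

lemma local_estimates:
  assumes "0 < \<epsilon>" "\<epsilon> < 1"
  shows "\<exists>C\<ge>0. local_estimate (\<lambda>j f x. \<integral>y. K j x (x - y) * f y \<partial>lborel) \<epsilon> C"
    and "\<exists>C\<ge>0. local_estimate (\<lambda>j f x. \<integral>y. K j y (x - y) * f y \<partial>lborel) \<epsilon> C"
proof -
  have T: "kernel_family.T (\<lambda>j x y. K j x (x - y)) = (\<lambda>j f x. \<integral>y. K j x (x - y) * f y \<partial>lborel)"
    "kernel_family.T (\<lambda>j x y. K j y (x - y)) = (\<lambda>j f x. \<integral>y. K j y (x - y) * f y \<partial>lborel)"
    by (simp_all add: fun_eq_iff kernel_family.T_def[OF family] kernel_family.T_def[OF family_adj])
  show "\<exists>C\<ge>0. local_estimate (\<lambda>j f x. \<integral>y. K j x (x - y) * f y \<partial>lborel) \<epsilon> C"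
    using rough_family.rough_local_estimate[OF rough(1) assms] cz_family.cz_local_estimate[OF cz(1) assms] rho unfolding T by force
  show "\<exists>C\<ge>0. local_estimate (\<lambda>j f x. \<integral>y. K j y (x - y) * f y \<partial>lborel) \<epsilon> C"
    using rough_family.rough_local_estimate[OF rough(2) assms] cz_family.cz_local_estimate[OF cz(2) assms] rho unfolding T by force
qed

end

section \<open>Summation of the pieces\<close>

lemma abs_powr_diff_le:
  fixes a b :: real
  assumes "0 \<le> a" "0 \<le> b" "0 < \<epsilon>" "\<epsilon> \<le> 1" shows "\<bar>a powr \<epsilon> - b powr \<epsilon>\<bar> \<le> \<bar>a - b\<bar> powr \<epsilon>"
proof -
  have *: "a powr \<epsilon> \<le> b powr \<epsilon> + \<bar>a - b\<bar> powr \<epsilon>" if "0 \<le> a" "0 \<le> b" for a b :: real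
  proof -
    have "a powr \<epsilon> \<le> (b + \<bar>a - b\<bar>) powr \<epsilon>" using that assms by (intro powr_mono2) auto
    also have "\<dots> \<le> b powr \<epsilon> + \<bar>a - b\<bar> powr \<epsilon>" using that assms by (intro powr_add_le) auto
    finally show ?thesis .
  qed
  from *[of a b] *[of b a] assms show ?thesis by (simp add: abs_minus_commute abs_le_iff)
qed

lemma cubes_bound_maximal:
  fixes x :: "real ^ 'n" and \<mu> :: real
  assumes "maximal f x \<le> ennreal \<mu>" "0 \<le> \<mu>"
  shows "cubes_bound x \<mu> (\<lambda>y. ennreal (norm (f y)))"
  unfolding cubes_bound_def
proof (intro allI impI)
  fix p :: "real ^ 'n" and s :: real assume s: "0 < s" "x \<in> cube p s"
  let ?I = "\<integral>\<^sup>+y\<in>cube p s. ennreal (norm (f y)) \<partial>lborel" and ?v = "ennreal (s ^ CARD('n))"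
  have v: "emeasure lborel (cube p s) = ?v" using s by (intro emeasure_cube) simp
  have "cube p s \<in> {Q \<in> cubes. x \<in> Q}" using s by (auto simp: cubes_def)
  then have "average (cube p s) (\<lambda>y. ennreal (norm (f y))) \<le> maximal f x" unfolding maximal_def by (rule SUP_upper)
  then have "?I / ?v \<le> ennreal \<mu>" using assms(1) by (simp add: average_def v)
  then have "?I / ?v * ?v \<le> ennreal \<mu> * ?v" by (intro mult_right_mono) auto
  moreover have "?I / ?v * ?v = ?I" unfolding ennreal_divide_times using s by (subst ennreal_divide_self) auto
  ultimately show "?I \<le> ennreal (\<mu> * s ^ CARD('n))" using s assms(2) by (simp add: ennreal_mult)
qed

text \<open>In the infimum over constants \<open>norm z powr \<epsilon>\<close> is chosen, and
  differences of powers are bounded by the power of the difference. Fatou's lemma in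
  \<open>J\<close> replaces the partial sums by \<open>U\<close>, and taking the power
  \<open>1 / \<epsilon>\<close> restores homogeneity of degree one in \<open>\<mu>\<close>.\<close>

lemma sharp_maximal_pow_le:
  fixes T :: "nat \<Rightarrow> (real ^ 'n \<Rightarrow> complex) \<Rightarrow> real ^ 'n \<Rightarrow> complex"
  assumes T: "local_estimate T \<epsilon> C" "0 \<le> C" and e: "0 < \<epsilon>" "\<epsilon> < 1" and f: "integrable lborel f" "continuous_on UNIV f"
    and Tm [measurable]: "\<And>j. T j f \<in> borel_measurable borel" and lim: "\<And>x. (\<lambda>J. \<Sum>j<J. T j f x) \<longlonglongrightarrow> U x"
  shows "sharp_maximal_pow \<epsilon> U x \<le> ennreal ((C + 1) powr (1 / \<epsilon>)) * maximal f x"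
proof (cases "maximal f x")
  case top
  then show ?thesis using \<open>0 \<le> C\<close> by (simp add: ennreal_mult_top)
next
  case (real m)
  \<comment> \<open>\<open>C + 1\<close> instead of \<open>C\<close> keeps the factor positive: in
    \<open>ennreal\<close> the product of 0 and infinity is 0, and \<open>d\<close> is divided by
    \<open>?C\<close> below.\<close>
  let ?C = "(C + 1) powr (1 / \<epsilon>)"
  have C: "0 < ?C" using \<open>0 \<le> C\<close> by simp
  have key: "sharp_maximal_pow \<epsilon> U x \<le> ennreal (?C * \<mu>)" if mu: "m \<le> \<mu>" "0 < \<mu>" for \<mu>
  proof -
    have cb: "cubes_bound x \<mu> (\<lambda>y. ennreal (norm (f y)))" using real mu by (intro cubes_bound_maximal) (auto intro: ennreal_leI)
    have "sharp_maximal (\<lambda>y. complex_of_real (norm (U y) powr \<epsilon>)) x \<le> ennreal (C * \<mu> powr \<epsilon>)"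
      unfolding sharp_maximal_def
    proof (rule SUP_least)
      fix Q assume "Q \<in> {Q \<in> cubes. x \<in> Q}"
      then obtain p r where Q: "Q = cube p r" "0 < r" "x \<in> cube p r" by (auto simp: cubes_def)
      obtain z L where L: "\<And>J. L \<le> J \<Longrightarrow> (\<integral>\<^sup>+x\<in>cube p r. ennreal (norm ((\<Sum>j<J. T j f x) - z) powr \<epsilon>) \<partial>lborel) \<le> ennreal (C * \<mu> powr \<epsilon> * r ^ CARD('n))"
        using T(1)[unfolded local_estimate_def, rule_format, OF f mu(2) cb Q(2,3)] by blast
      have v: "emeasure lborel (cube p r) = ennreal (r ^ CARD('n))" using Q by (intro emeasure_cube) simp
      have "(\<integral>\<^sup>+y\<in>cube p r. ennreal (norm (complex_of_real (norm (U y) powr \<epsilon>) - complex_of_real (norm z powr \<epsilon>))) \<partial>lborel)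
        \<le> (\<integral>\<^sup>+y. liminf (\<lambda>J. ennreal (norm ((\<Sum>j<J. T j f y) - z) powr \<epsilon>) * indicator (cube p r) y) \<partial>lborel)"
      proof (rule nn_integral_mono)
        fix y
        have "(\<lambda>J. norm ((\<Sum>j<J. T j f y) - z) powr \<epsilon>) \<longlonglongrightarrow> norm (U y - z) powr \<epsilon>"
          using e by (intro tendsto_powr' tendsto_intros lim) auto
        then have "(\<lambda>J. ennreal (norm ((\<Sum>j<J. T j f y) - z) powr \<epsilon>) * indicator (cube p r) y) \<longlonglongrightarrow> ennreal (norm (U y - z) powr \<epsilon>) * indicator (cube p r) y"
          by (cases "y \<in> cube p r") (auto intro: tendsto_ennrealI)
        then have "liminf (\<lambda>J. ennreal (norm ((\<Sum>j<J. T j f y) - z) powr \<epsilon>) * indicator (cube p r) y) = ennreal (norm (U y - z) powr \<epsilon>) * indicator (cube p r) y"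
          by (intro lim_imp_Liminf) auto
        moreover have "norm (complex_of_real (norm (U y) powr \<epsilon>) - complex_of_real (norm z powr \<epsilon>)) \<le> norm (U y - z) powr \<epsilon>"
        proof -
          have "norm (complex_of_real (norm (U y) powr \<epsilon>) - complex_of_real (norm z powr \<epsilon>)) = \<bar>norm (U y) powr \<epsilon> - norm z powr \<epsilon>\<bar>"
            by (simp only: norm_of_real flip: of_real_diff)
          also have "\<dots> \<le> \<bar>norm (U y) - norm z\<bar> powr \<epsilon>" using e by (intro abs_powr_diff_le) auto
          also have "\<dots> \<le> norm (U y - z) powr \<epsilon>" using e norm_triangle_ineq3 by (intro powr_mono2) auto
          finally show ?thesis .
        qed
        ultimately show "ennreal (norm (complex_of_real (norm (U y) powr \<epsilon>) - complex_of_real (norm z powr \<epsilon>))) * indicator (cube p r) y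
          \<le> liminf (\<lambda>J. ennreal (norm ((\<Sum>j<J. T j f y) - z) powr \<epsilon>) * indicator (cube p r) y)"
          by (simp add: mult_right_mono ennreal_leI)
      qed
      also have "\<dots> \<le> liminf (\<lambda>J. \<integral>\<^sup>+y\<in>cube p r. ennreal (norm ((\<Sum>j<J. T j f y) - z) powr \<epsilon>) \<partial>lborel)"
        by (rule nn_integral_liminf) measurable
      also have "\<dots> \<le> ennreal (C * \<mu> powr \<epsilon> * r ^ CARD('n))"
        by (rule Liminf_le) (auto intro!: eventually_sequentiallyI[of L] L)
      also have "\<dots> = ennreal (r ^ CARD('n)) * ennreal (C * \<mu> powr \<epsilon>)" using Q \<open>0 \<le> C\<close> by (subst ennreal_mult[symmetric]) (auto simp: mult_ac)
      finally have "average Q (\<lambda>y. norm (complex_of_real (norm (U y) powr \<epsilon>) - complex_of_real (norm z powr \<epsilon>))) \<le> ennreal (C * \<mu> powr \<epsilon>)"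
        unfolding average_def Q(1) v using Q(2) by (intro divide_le_posI_ennreal) auto
      then show "(INF c. average Q (\<lambda>y. norm (complex_of_real (norm (U y) powr \<epsilon>) - c))) \<le> ennreal (C * \<mu> powr \<epsilon>)"
        by (rule INF_lower2[OF UNIV_I])
    qed
    then obtain t where t: "sharp_maximal (\<lambda>y. complex_of_real (norm (U y) powr \<epsilon>)) x = ennreal t" "0 \<le> t" "t \<le> C * \<mu> powr \<epsilon>"
      using \<open>0 \<le> C\<close> by (cases "sharp_maximal (\<lambda>y. complex_of_real (norm (U y) powr \<epsilon>)) x") (auto simp: top_unique ennreal_le_iff)
    have "sharp_maximal_pow \<epsilon> U x = ennreal (t powr (1 / \<epsilon>))" using t(2) by (simp add: sharp_maximal_pow_def ennreal_powr_def t(1))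
    also have "t powr (1 / \<epsilon>) \<le> ((C + 1) * \<mu> powr \<epsilon>) powr (1 / \<epsilon>)"
    proof (rule powr_mono2)
      have "C * \<mu> powr \<epsilon> \<le> (C + 1) * \<mu> powr \<epsilon>" by (intro mult_right_mono) auto
      then show "t \<le> (C + 1) * \<mu> powr \<epsilon>" using t(3) by linarith
    qed (use e t in auto)
    also have "\<dots> = ?C * \<mu>" using mu e \<open>0 \<le> C\<close> by (simp add: powr_mult powr_powr)
    finally show ?thesis by (simp add: ennreal_leI)
  qed
  \<comment> \<open>The local estimate wants a positive \<open>\<mu>\<close>, while the maximal
    function may be 0; it is approached from above.\<close>
  have "sharp_maximal_pow \<epsilon> U x \<le> ennreal (?C * m)"
  proof (rule ennreal_le_epsilon)
    fix d :: real assume d: "0 < d"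
    have "sharp_maximal_pow \<epsilon> U x \<le> ennreal (?C * (m + d / ?C))"
    proof (rule key)
      have "0 < d / ?C" using d C by (rule divide_pos_pos)
      then show "m \<le> m + d / ?C" "0 < m + d / ?C" using real by linarith+
    qed
    also have "?C * (m + d / ?C) = ?C * m + d" using C unfolding distrib_left by simp
    also have "ennreal \<dots> = ennreal (?C * m) + ennreal d" using real d C by (intro ennreal_plus) auto
    finally show "sharp_maximal_pow \<epsilon> U x \<le> ennreal (?C * m) + ennreal d" .
  qed
  then show ?thesis using real C by (simp add: ennreal_mult)
qed

lemma chi_tendsto:
  assumes "cutoff N M F" shows "(\<lambda>J. chi F J \<xi>) \<longlonglongrightarrow> 1"
proof -
  obtain J0 where J0: "norm \<xi> < 2 ^ J0" using real_arch_pow[of 2 "norm \<xi>"] by auto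
  have "chi F J \<xi> = 1" if "J0 \<le> J" for J
  proof -
    have "\<bar>\<xi> $ l / 2 ^ J\<bar> \<le> 1" for l
    proof -
      have "(2::real) ^ J0 \<le> 2 ^ J" using that by (intro power_increasing) auto
      then have "\<bar>\<xi> $ l\<bar> \<le> 2 ^ J" using component_le_norm_cart[of \<xi> l] J0 by linarith
      then show ?thesis by simp
    qed
    then show ?thesis using assms by (simp add: chi_def cutoff_def)
  qed
  then show ?thesis by (intro tendsto_eventually eventually_sequentiallyI)
qed

lemma abs_chi_le: "cutoff N M F \<Longrightarrow> \<bar>chi F J \<xi>\<bar> \<le> 1"
  unfolding chi_def abs_prod by (intro prod_le_1) (auto simp: cutoff_def)

context dyadic_symbol
begin

text \<open>The map \<open>q\<close> selects where the symbol is evaluated: the constant map to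
  \<open>x\<close> gives the integrand of \<open>pdo\<close>, the identity that of
  \<open>pdo_adj\<close>. Both limits are thus treated at once.\<close>

definition G :: "(real ^ 'n \<Rightarrow> real ^ 'n) \<Rightarrow> (real ^ 'n \<Rightarrow> complex) \<Rightarrow> real ^ 'n \<Rightarrow> real ^ 'n \<Rightarrow> complex" where
  "G q f x \<xi> = (\<integral>y. cis ((x - y) \<bullet> \<xi>) * a (q y, \<xi>) * f y \<partial>lborel)"

lemma G_measurable [measurable]:
  assumes [measurable]: "f \<in> borel_measurable borel" "q \<in> borel_measurable borel"
  shows "G q f x \<in> borel_measurable borel"
  unfolding G_def[abs_def] by measurable

text \<open>After localization to a shell the double integral converges absolutely, so the order of
  integration may be exchanged; this identifies the pieces of the operator with the kernels
  \<open>K\<close>.\<close>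

lemma piece_integral:
  assumes f: "integrable lborel f" and [measurable]: "q \<in> borel_measurable borel"
  shows "integrable lborel (\<lambda>\<xi>. complex_of_real (psi F j \<xi>) * G q f x \<xi>)"
    and "(\<integral>y. K j (q y) (x - y) * f y \<partial>lborel) = complex_of_real (1 / (2 * pi) ^ CARD('n)) * (\<integral>\<xi>. complex_of_real (psi F j \<xi>) * G q f x \<xi> \<partial>lborel)"
proof -
  have [measurable]: "f \<in> borel_measurable borel" using borel_measurable_integrable[OF f] by simp
  define B where "B \<xi> = C * (2 ^ j) powr (- real CARD('n) * (1 - \<rho>)) * indicator (shell j) \<xi>" for \<xi> :: "real ^ 'n"
  have B: "integrable lborel B" unfolding B_def[abs_def] using C_pos by (intro integral_shell) simp
  define h where "h \<xi> y = complex_of_real (psi F j \<xi>) * (cis ((x - y) \<bullet> \<xi>) * a (q y, \<xi>) * f y)" for \<xi> y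
  have i: "integrable (lborel \<Otimes>\<^sub>M lborel) (case_prod h)"
  proof (rule pair_integrable_bound[OF B integrable_norm[OF f]])
    show "case_prod h \<in> borel_measurable (lborel \<Otimes>\<^sub>M lborel)" unfolding h_def by measurable
    show "norm (case_prod h (\<xi>, y)) \<le> B \<xi> * norm (f y)" for \<xi> y
    proof -
      have "norm (a (q y, \<xi>) * complex_of_real (psi F j \<xi>)) \<le> B \<xi>" unfolding B_def by (rule dbd_norm_le[OF piece])
      then have "norm (a (q y, \<xi>) * complex_of_real (psi F j \<xi>)) * norm (f y) \<le> B \<xi> * norm (f y)" by (intro mult_right_mono) auto
      then show ?thesis by (simp add: h_def norm_mult mult_ac)
    qed
  qed
  have hG: "(\<integral>y. h \<xi> y \<partial>lborel) = complex_of_real (psi F j \<xi>) * G q f x \<xi>" for \<xi> unfolding h_def G_def by simp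
  from lborel_pair.integrable_fst[OF i] show "integrable lborel (\<lambda>\<xi>. complex_of_real (psi F j \<xi>) * G q f x \<xi>)" by (simp add: hG)
  have "(\<integral>y. K j (q y) (x - y) * f y \<partial>lborel) = (\<integral>y. complex_of_real (1 / (2 * pi) ^ CARD('n)) * (\<integral>\<xi>. h \<xi> y \<partial>lborel) \<partial>lborel)"
  proof (rule Bochner_Integration.integral_cong[OF refl])
    fix y
    have "(\<integral>\<xi>. h \<xi> y \<partial>lborel) = (\<integral>\<xi>. cis ((x - y) \<bullet> \<xi>) * g j (q y) \<xi> * f y \<partial>lborel)"
      by (intro Bochner_Integration.integral_cong refl) (simp add: h_def g_def mult_ac)
    then show "K j (q y) (x - y) * f y = complex_of_real (1 / (2 * pi) ^ CARD('n)) * (\<integral>\<xi>. h \<xi> y \<partial>lborel)" by (simp add: K_def ift_def)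
  qed
  also have "\<dots> = complex_of_real (1 / (2 * pi) ^ CARD('n)) * (\<integral>y. (\<integral>\<xi>. h \<xi> y \<partial>lborel) \<partial>lborel)" by (rule integral_mult_right_zero)
  also have "(\<integral>y. (\<integral>\<xi>. h \<xi> y \<partial>lborel) \<partial>lborel) = (\<integral>\<xi>. (\<integral>y. h \<xi> y \<partial>lborel) \<partial>lborel)" by (rule lborel_pair.Fubini_integral[OF i])
  finally show "(\<integral>y. K j (q y) (x - y) * f y \<partial>lborel) = complex_of_real (1 / (2 * pi) ^ CARD('n)) * (\<integral>\<xi>. complex_of_real (psi F j \<xi>) * G q f x \<xi> \<partial>lborel)"
    by (simp only: hG)
qed

text \<open>The partial sums of the cutoffs telescope to \<open>chi F J\<close>, which is bounded by
  1 and tends to 1, so the integrable \<open>G q f x\<close> dominates.\<close>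

lemma partial_sums_tendsto:
  assumes f: "integrable lborel f" and [measurable]: "q \<in> borel_measurable borel" and i: "integrable lborel (G q f x)"
  shows "(\<lambda>J. \<Sum>j<J. \<integral>y. K j (q y) (x - y) * f y \<partial>lborel) \<longlonglongrightarrow> 1 / (2 * pi) ^ CARD('n) * (\<integral>\<xi>. G q f x \<xi> \<partial>lborel)"
proof -
  let ?c = "complex_of_real (1 / (2 * pi) ^ CARD('n))"
  have [measurable]: "f \<in> borel_measurable borel" using borel_measurable_integrable[OF f] by simp
  have s: "(\<Sum>j<Suc J. \<integral>y. K j (q y) (x - y) * f y \<partial>lborel) = ?c * (\<integral>\<xi>. complex_of_real (chi F J \<xi>) * G q f x \<xi> \<partial>lborel)" for J
  proof -
    have "(\<Sum>j<Suc J. \<integral>y. K j (q y) (x - y) * f y \<partial>lborel) = ?c * (\<Sum>j<Suc J. \<integral>\<xi>. complex_of_real (psi F j \<xi>) * G q f x \<xi> \<partial>lborel)"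
      unfolding piece_integral(2)[OF f assms(2)] sum_distrib_left ..
    also have "(\<Sum>j<Suc J. \<integral>\<xi>. complex_of_real (psi F j \<xi>) * G q f x \<xi> \<partial>lborel) = (\<integral>\<xi>. (\<Sum>j<Suc J. complex_of_real (psi F j \<xi>) * G q f x \<xi>) \<partial>lborel)"
      by (intro Bochner_Integration.integral_sum[symmetric] piece_integral(1)[OF f assms(2)])
    also have "\<dots> = (\<integral>\<xi>. complex_of_real (chi F J \<xi>) * G q f x \<xi> \<partial>lborel)"
      by (intro Bochner_Integration.integral_cong refl) (simp only: sum_psi[symmetric] of_real_sum sum_distrib_right)
    finally show ?thesis .
  qed
  have m [measurable]: "(\<lambda>\<xi>. chi F J \<xi>) \<in> borel_measurable (borel :: (real ^ 'n) measure)" for J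
    unfolding sum_psi[symmetric] by measurable
  have "(\<lambda>J. \<integral>\<xi>. complex_of_real (chi F J \<xi>) * G q f x \<xi> \<partial>lborel) \<longlonglongrightarrow> (\<integral>\<xi>. G q f x \<xi> \<partial>lborel)"
  proof (rule integral_dominated_convergence[OF _ _ integrable_norm[OF i]])
    show "AE \<xi> in lborel. (\<lambda>J. complex_of_real (chi F J \<xi>) * G q f x \<xi>) \<longlonglongrightarrow> G q f x \<xi>"
    proof (rule AE_I2)
      fix \<xi>
      have "(\<lambda>J. complex_of_real (chi F J \<xi>) * G q f x \<xi>) \<longlonglongrightarrow> complex_of_real 1 * G q f x \<xi>" by (intro tendsto_intros chi_tendsto[OF F])
      then show "(\<lambda>J. complex_of_real (chi F J \<xi>) * G q f x \<xi>) \<longlonglongrightarrow> G q f x \<xi>" by simp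
    qed
    show "AE \<xi> in lborel. norm (complex_of_real (chi F J \<xi>) * G q f x \<xi>) \<le> norm (G q f x \<xi>)" for J
    proof (rule AE_I2)
      fix \<xi> show "norm (complex_of_real (chi F J \<xi>) * G q f x \<xi>) \<le> norm (G q f x \<xi>)"
        using mult_right_mono[OF abs_chi_le[OF F], of "norm (G q f x \<xi>)" J \<xi>] by (simp add: norm_mult)
    qed
  qed measurable
  then have "(\<lambda>J. ?c * (\<integral>\<xi>. complex_of_real (chi F J \<xi>) * G q f x \<xi> \<partial>lborel)) \<longlonglongrightarrow> ?c * (\<integral>\<xi>. G q f x \<xi> \<partial>lborel)" by (intro tendsto_intros)
  then have "(\<lambda>J. \<Sum>j<Suc J. \<integral>y. K j (q y) (x - y) * f y \<partial>lborel) \<longlonglongrightarrow> ?c * (\<integral>\<xi>. G q f x \<xi> \<partial>lborel)" by (simp only: s)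
  then have "(\<lambda>J. \<Sum>j<J. \<integral>y. K j (q y) (x - y) * f y \<partial>lborel) \<longlonglongrightarrow> ?c * (\<integral>\<xi>. G q f x \<xi> \<partial>lborel)" by (rule LIMSEQ_imp_Suc)
  then show ?thesis by simp
qed

lemma G_const: "G (\<lambda>_. p) f x \<xi> = cis (x \<bullet> \<xi>) * a (p, \<xi>) * fourier f \<xi>"
proof -
  have e: "cis ((x - y) \<bullet> \<xi>) = cis (x \<bullet> \<xi>) * cis (- (y \<bullet> \<xi>))" for y by (simp add: inner_diff_left cis_mult)
  have "G (\<lambda>_. p) f x \<xi> = (\<integral>y. cis (x \<bullet> \<xi>) * a (p, \<xi>) * (cis (- (y \<bullet> \<xi>)) * f y) \<partial>lborel)"
    unfolding G_def e by (intro Bochner_Integration.integral_cong refl) (simp only: mult_ac)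
  then show ?thesis by (simp add: fourier_def)
qed

text \<open>The modulus of \<open>G q f x \<xi>\<close> does not depend on \<open>x\<close>;
  integrability at one point is therefore integrability at every point.\<close>

lemma G_translate: "G q f x \<xi> = cis (x \<bullet> \<xi>) * G q f 0 \<xi>"
proof -
  have e: "cis ((x - y) \<bullet> \<xi>) = cis (x \<bullet> \<xi>) * cis ((0 - y) \<bullet> \<xi>)" for y by (simp add: inner_diff_left cis_mult)
  have "G q f x \<xi> = (\<integral>y. cis (x \<bullet> \<xi>) * (cis ((0 - y) \<bullet> \<xi>) * a (q y, \<xi>) * f y) \<partial>lborel)"
    unfolding G_def e by (intro Bochner_Integration.integral_cong refl) (simp only: mult_ac)
  then show ?thesis by (simp add: G_def)
qed

end

section \<open>Schwartz functions, and conclusion\<close>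

lemma integrable_peak_1: "integrable lborel (peak (CARD('n) + 1) 1 :: real ^ 'n \<Rightarrow> real)"
proof (rule integrableI_nonneg)
  show "(\<integral>\<^sup>+x. ennreal (peak (CARD('n) + 1) 1 (x :: real ^ 'n)) \<partial>lborel) < \<infinity>"
    by (rule le_less_trans[OF nn_integral_peak]) auto
qed auto

text \<open>Only the monomials 1 and \<open>(x $ l) ^ (n + 1)\<close> are used: some component of
  \<open>x\<close> is comparable to \<open>norm x\<close>.\<close>

lemma schwartz_deriv_bound:
  fixes f :: "real ^ 'n \<Rightarrow> complex"
  assumes f: "f \<in> schwartz"
  shows "\<exists>C\<ge>0. \<forall>i k x. k \<le> N \<longrightarrow> norm ((dir_deriv (axis i 1) ^^ k) f x) \<le> C * peak (CARD('n) + 1) 1 x"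
proof -
  let ?N = "CARD('n) + 1" and ?n = "real CARD('n)"
  define D where "D i k = (dir_deriv (axis i 1) ^^ k) f" for i :: 'n and k
  have single: "\<exists>C. \<forall>x. norm (D i k x) \<le> C * peak ?N 1 x" for i k
  proof -
    have b: "\<exists>C. \<forall>x. \<bar>\<Prod>l\<in>UNIV. (x $ l) ^ \<alpha> l\<bar> * norm (D i k x) \<le> C" for \<alpha>
    proof -
      have "\<exists>C. \<forall>x. norm ((\<Prod>l\<in>UNIV. (x $ l) ^ \<alpha> l) *\<^sub>R multi_deriv (\<lambda>i. axis i 1) (\<lambda>j. if j = i then k else 0) f x) \<le> C"
        using f by (simp add: schwartz_def)
      then show ?thesis unfolding multi_deriv_single D_def by simp
    qed
    obtain C1 where C1: "\<And>x. norm (D i k x) \<le> C1" using b[of "\<lambda>_. 0"] by auto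
    have "\<exists>C. \<forall>x. \<bar>x $ l\<bar> ^ ?N * norm (D i k x) \<le> C" for l
    proof -
      have "(\<Prod>j\<in>UNIV. (x $ j) ^ (if j = l then ?N else 0)) = (x $ l) ^ ?N" for x :: "real ^ 'n"
        by (subst prod.remove[of UNIV l]) auto
      then show ?thesis using b[of "\<lambda>j. if j = l then ?N else 0"] by (simp only: power_abs)
    qed
    then obtain C2 where C2: "\<And>l x. \<bar>x $ l\<bar> ^ ?N * norm (D i k x) \<le> C2 l" by metis
    define S where "S = (\<Sum>l\<in>UNIV. \<bar>C2 l\<bar>)"
    have S: "\<bar>x $ l\<bar> ^ ?N * norm (D i k x) \<le> S" for l x
    proof -
      have "\<bar>C2 l\<bar> \<le> S" unfolding S_def by (rule member_le_sum) auto
      then show ?thesis using C2[of x l] by linarith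
    qed
    have "norm (D i k x) \<le> 2 ^ ?N * (C1 + ?n ^ ?N * S) * peak ?N 1 x" for x
    proof -
      obtain l where l: "norm x \<le> ?n * \<bar>x $ l\<bar>" using exists_large_component by blast
      have "norm x ^ ?N * norm (D i k x) \<le> (?n * \<bar>x $ l\<bar>) ^ ?N * norm (D i k x)" using l by (intro mult_right_mono power_mono) auto
      also have "\<dots> = ?n ^ ?N * (\<bar>x $ l\<bar> ^ ?N * norm (D i k x))" by (simp only: power_mult_distrib mult.assoc)
      also have "\<dots> \<le> ?n ^ ?N * S" by (intro mult_left_mono S) simp
      finally have 1: "norm (D i k x) + norm x ^ ?N * norm (D i k x) \<le> C1 + ?n ^ ?N * S" using C1[of x] by linarith
      have "(1 + norm x) ^ ?N * norm (D i k x) \<le> 2 ^ ?N * (1 + norm x ^ ?N) * norm (D i k x)" by (intro mult_right_mono one_plus_power_le) auto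
      also have "\<dots> = 2 ^ ?N * (norm (D i k x) + norm x ^ ?N * norm (D i k x))" by (simp only: distrib_left distrib_right mult.assoc mult_1_left mult_1_right)
      also have "\<dots> \<le> 2 ^ ?N * (C1 + ?n ^ ?N * S)" by (intro mult_left_mono 1) simp
      finally have "(1 + norm x) ^ ?N * norm (D i k x) \<le> 2 ^ ?N * (C1 + ?n ^ ?N * S)" .
      moreover have "0 < (1 + norm x) ^ ?N" by (intro zero_less_power add_pos_nonneg) auto
      ultimately have "norm (D i k x) \<le> 2 ^ ?N * (C1 + ?n ^ ?N * S) / (1 + norm x) ^ ?N" by (simp only: pos_le_divide_eq mult.commute)
      then show ?thesis by (simp add: peak_def)
    qed
    then show ?thesis by blast
  qed
  have "\<exists>C\<ge>0. \<forall>s\<in>UNIV \<times> {..N}. \<forall>x. norm (D (fst s) (snd s) x) \<le> C * peak ?N 1 x"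
    by (rule finite_uniform_bound[OF _ single]) auto
  then show ?thesis by (auto simp: D_def)
qed

text \<open>The transform is \<open>ift\<close> at the reflected point, and \<open>n + 1\<close>
  integrations by parts with scale 1 bound it by an integrable peak.\<close>

lemma schwartz_integrable:
  fixes f :: "real ^ 'n \<Rightarrow> complex"
  assumes f: "f \<in> schwartz"
  shows "integrable lborel f" "continuous_on UNIV f" "integrable lborel (fourier f)"
proof -
  let ?N = "CARD('n) + 1"
  obtain C where C: "0 \<le> C" "\<And>i k x. k \<le> ?N \<Longrightarrow> norm ((dir_deriv (axis i 1) ^^ k) f x) \<le> C * peak ?N 1 x"
    using schwartz_deriv_bound[OF f, of ?N] by blast
  have sm: "smooth f" using f by (simp add: schwartz_def)
  have ax: "axis i 1 \<in> (Basis :: (real ^ 'n) set)" for i by (auto simp: Basis_vec_def)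
  define B where "B x = C * peak ?N 1 x" for x :: "real ^ 'n"
  have B: "integrable lborel B" unfolding B_def[abs_def] by (intro integrable_mult_right integrable_peak_1)
  have "dbd i 1 ?N B ((\<lambda>k. (dir_deriv (axis i 1) ^^ k) f) 0)" for i
    by (rule dbd_seq[where G="\<lambda>k. (dir_deriv (axis i 1) ^^ k) f"])
      (use C(2) in \<open>auto simp: B_def intro: smooth_funpow_continuous[OF sm ax] smooth_funpow_has_vector_derivative[OF sm ax, simplified]\<close>)
  then have d: "dbd i 1 ?N B f" for i by simp
  show c: "continuous_on UNIV f" by (rule dbd_continuous[OF d])
  show i: "integrable lborel f" by (rule integrable_dominated_continuous[OF c dbd_norm_le[OF d] B])
  have [measurable]: "f \<in> borel_measurable borel" using borel_measurable_integrable[OF i] by simp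
  define c where "c = ift_const TYPE('n) ?N * (\<integral>x. B x \<partial>lborel)"
  have "norm (fourier f \<xi>) \<le> c * peak ?N 1 \<xi>" for \<xi>
  proof -
    have "fourier f \<xi> = ift f (- \<xi>)" by (simp add: fourier_def ift_def inner_commute)
    moreover have "(1 + norm (- \<xi>) / 1) ^ ?N * norm (ift f (- \<xi>)) \<le> c" unfolding c_def by (rule norm_ift_decay[OF d B]) simp
    ultimately have "(1 + norm \<xi>) ^ ?N * norm (fourier f \<xi>) \<le> c" by (simp only: norm_minus_cancel div_by_1)
    moreover have "0 < (1 + norm \<xi>) ^ ?N" by (intro zero_less_power add_pos_nonneg) auto
    ultimately have "norm (fourier f \<xi>) \<le> c / (1 + norm \<xi>) ^ ?N" by (simp only: pos_le_divide_eq mult.commute)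
    then show ?thesis by (simp add: peak_def)
  qed
  then show "integrable lborel (fourier f)"
  proof (intro Bochner_Integration.integrable_bound[OF integrable_mult_right[OF integrable_peak_1[where 'n='n], of c]] AE_I2)
    show "fourier f \<in> borel_measurable lborel" unfolding fourier_def[abs_def] by measurable
  qed (auto intro: order_trans[OF _ abs_ge_self])
qed

theorem theorem1p6:
  fixes \<rho> \<delta> \<epsilon> :: real and a :: "(real ^ 'n) \<times> (real ^ 'n) \<Rightarrow> complex"
  assumes "0 < \<rho>" "\<rho> \<le> 1"
    and "0 \<le> \<delta>" "\<delta> < 1"
    and "0 < \<epsilon>" "\<epsilon> < 1"
    and "a \<in> symbol_class (- real CARD('n) * (1 - \<rho>)) \<rho> \<delta>"
  shows "\<exists>C::real. \<forall>f\<in>schwartz. \<forall>x.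
    sharp_maximal_pow \<epsilon> (pdo a f) x \<le> ennreal C * maximal f x \<and>
    sharp_maximal_pow \<epsilon> (pdo_adj a f) x \<le> ennreal C * maximal f x"
proof -
  have sm: "smooth a" using assms(7) by (simp add: symbol_class_def)
  have m0: "- real CARD('n) * (1 - \<rho>) \<le> 0" using assms by (simp add: mult_nonneg_nonneg)
  obtain F M where F: "cutoff (CARD('n) + 2) M F" using exists_cutoff by blast
  obtain C0 where C0: "dyadic_symbol a \<rho> \<delta> F M C0"
  proof (rule symbol_pieces[OF assms(7) m0 _ assms(2,3) _ F])
    fix C :: real
    assume *: "0 < C"
      "\<And>i j x. dbd i (dscale \<rho> j) (CARD('n) + 2) (\<lambda>\<xi>. C * (2 ^ j) powr (- real CARD('n) * (1 - \<rho>)) * indicator (shell j) \<xi>) (\<lambda>\<xi>. a (x, \<xi>) * complex_of_real (psi F j \<xi>))"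
      "\<And>i j x x'. dbd i (dscale \<rho> j) (CARD('n) + 2) (\<lambda>\<xi>. C * (2 ^ j) powr (- real CARD('n) * (1 - \<rho>)) * ((2 ^ j) powr \<delta> * norm (x - x')) * indicator (shell j) \<xi>) (\<lambda>\<xi>. (a (x, \<xi>) - a (x', \<xi>)) * complex_of_real (psi F j \<xi>))"
      "\<And>i j x h. norm h \<le> CARD('n) / 2 ^ j \<Longrightarrow> dbd i (dscale \<rho> j) (CARD('n) + 2) (\<lambda>\<xi>. C * (2 ^ j) powr (- real CARD('n) * (1 - \<rho>)) * (2 ^ j * norm h) * indicator (shell j) \<xi>) (\<lambda>\<xi>. a (x, \<xi>) * complex_of_real (psi F j \<xi>) * (1 - cis (h \<bullet> \<xi>)))"
    have "continuous_on UNIV a" using smooth_funpow_continuous[OF sm axis_Basis(1), where k=0] by simp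
    then have "dyadic_symbol a \<rho> \<delta> F M C" using assms(1-4) F * by unfold_locales
    then show thesis by (rule that)
  qed (use assms in auto)
  interpret dyadic_symbol a \<rho> \<delta> F M C0 by (rule C0)
  obtain C1 C2 where C: "0 \<le> C1" "local_estimate (\<lambda>j f x. \<integral>y. K j x (x - y) * f y \<partial>lborel) \<epsilon> C1"
    "0 \<le> C2" "local_estimate (\<lambda>j f x. \<integral>y. K j y (x - y) * f y \<partial>lborel) \<epsilon> C2"
    using local_estimates[OF assms(5,6)] by blast
  \<comment> \<open>The order is not positive, so the symbol is bounded, and the frequency integral
    of \<open>pdo\<close> is dominated by the integrable transform of \<open>f\<close>.\<close>
  obtain Ca where Ca: "\<And>x \<xi>. norm (a (x, \<xi>)) \<le> Ca"
  proof -
    obtain c where c: "0 \<le> c" "\<And>x \<xi>. norm (a (x, \<xi>)) \<le> c * japanese_bracket \<xi> powr (- real CARD('n) * (1 - \<rho>))"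
      using symbol_bounds(1)[OF assms(7), of 0] by auto
    have "norm (a (x, \<xi>)) \<le> c" for x \<xi>
    proof -
      have "japanese_bracket \<xi> powr (- real CARD('n) * (1 - \<rho>)) \<le> japanese_bracket \<xi> powr 0"
        using m0 by (intro powr_mono japanese_bracket_ge_1)
      then have "japanese_bracket \<xi> powr (- real CARD('n) * (1 - \<rho>)) \<le> 1" using japanese_bracket_ge_1[of \<xi>] by simp
      then have "c * japanese_bracket \<xi> powr (- real CARD('n) * (1 - \<rho>)) \<le> c * 1" using c(1) by (rule mult_left_mono)
      then show ?thesis using c(2)[of x \<xi>] by linarith
    qed
    then show thesis by (rule that)
  qed
  define c where "c = max ((C1 + 1) powr (1 / \<epsilon>)) ((C2 + 1) powr (1 / \<epsilon>))"
  show ?thesis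
  proof (intro exI[of _ c] ballI allI conjI)
    fix f :: "real ^ 'n \<Rightarrow> complex" and x assume f: "f \<in> schwartz"
    note fi = schwartz_integrable[OF f]
    have [measurable]: "f \<in> borel_measurable borel" "fourier f \<in> borel_measurable borel"
      using borel_measurable_integrable[OF fi(1)] borel_measurable_integrable[OF fi(3)] by simp_all
    have "sharp_maximal_pow \<epsilon> (pdo a f) x \<le> ennreal ((C1 + 1) powr (1 / \<epsilon>)) * maximal f x"
    proof (rule sharp_maximal_pow_le[OF C(2,1) assms(5,6) fi(1,2)])
      show "(\<lambda>x. \<integral>y. K j x (x - y) * f y \<partial>lborel) \<in> borel_measurable borel" for j by measurable
      show "(\<lambda>J. \<Sum>j<J. \<integral>y. K j z (z - y) * f y \<partial>lborel) \<longlonglongrightarrow> pdo a f z" for z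
      proof -
        have "integrable lborel (\<lambda>\<xi>. cis (z \<bullet> \<xi>) * a (z, \<xi>) * fourier f \<xi>)"
        proof (rule Bochner_Integration.integrable_bound[OF integrable_mult_right[OF fi(3), of "complex_of_real Ca"]])
          show "AE \<xi> in lborel. norm (cis (z \<bullet> \<xi>) * a (z, \<xi>) * fourier f \<xi>) \<le> norm (complex_of_real Ca * fourier f \<xi>)"
          proof (rule AE_I2)
            fix \<xi>
            have "norm (a (z, \<xi>)) * norm (fourier f \<xi>) \<le> \<bar>Ca\<bar> * norm (fourier f \<xi>)"
              using order_trans[OF Ca abs_ge_self] by (intro mult_right_mono) auto
            then show "norm (cis (z \<bullet> \<xi>) * a (z, \<xi>) * fourier f \<xi>) \<le> norm (complex_of_real Ca * fourier f \<xi>)" by (simp add: norm_mult)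
          qed
        qed measurable
        then have "integrable lborel (G (\<lambda>_. z) f z)" by (simp only: G_const[abs_def])
        from partial_sums_tendsto[OF fi(1) _ this] show ?thesis by (simp add: pdo_def G_const)
      qed
    qed
    also have "\<dots> \<le> ennreal c * maximal f x" by (intro mult_right_mono ennreal_leI) (auto simp: c_def)
    finally show "sharp_maximal_pow \<epsilon> (pdo a f) x \<le> ennreal c * maximal f x" .
    have adj: "pdo_adj a f z = 1 / (2 * pi) ^ CARD('n) * (\<integral>\<xi>. G (\<lambda>y. y) f z \<xi> \<partial>lborel)" for z by (simp add: pdo_adj_def G_def)
    have "sharp_maximal_pow \<epsilon> (pdo_adj a f) x \<le> ennreal ((C2 + 1) powr (1 / \<epsilon>)) * maximal f x"
    proof (cases "integrable lborel (G (\<lambda>y. y) f 0)")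
      case True
      show ?thesis
      proof (rule sharp_maximal_pow_le[OF C(4,3) assms(5,6) fi(1,2)])
        show "(\<lambda>x. \<integral>y. K j y (x - y) * f y \<partial>lborel) \<in> borel_measurable borel" for j by measurable
        show "(\<lambda>J. \<Sum>j<J. \<integral>y. K j y (z - y) * f y \<partial>lborel) \<longlonglongrightarrow> pdo_adj a f z" for z
        proof -
          have "G (\<lambda>y. y) f z = (\<lambda>\<xi>. cis (z \<bullet> \<xi>) * G (\<lambda>y. y) f 0 \<xi>)" by (rule ext) (rule G_translate)
          then have "integrable lborel (G (\<lambda>y. y) f z)" using integrable_cis_mult[OF True] by simp
          from partial_sums_tendsto[OF fi(1) _ this] show ?thesis unfolding adj by simp
        qed
      qed
    next
      case False
      \<comment> \<open>The Bochner integral then is \<open>0\<close> by convention, at every point.\<close>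
      have "pdo_adj a f z = 0" for z
      proof -
        have "\<not> integrable lborel (G (\<lambda>y. y) f z)"
        proof
          assume "integrable lborel (G (\<lambda>y. y) f z)"
          from integrable_cis_mult[OF this, of "- z"] have "integrable lborel (\<lambda>\<xi>. G (\<lambda>y. y) f 0 \<xi>)"
            unfolding G_translate[of _ _ z] by (simp add: cis_mult flip: mult.assoc)
          with False show False by simp
        qed
        then show ?thesis unfolding adj by (simp add: not_integrable_integral_eq)
      qed
      \<comment> \<open>The zero operators form a family with the zero function as limit, for which
        the same lemma applies.\<close>
      then have lim: "(\<lambda>J. \<Sum>j<J. (\<lambda>_ _ _. 0) j f z) \<longlonglongrightarrow> pdo_adj a f z" for z by simp
      have "local_estimate (\<lambda>_ _ _. 0 :: complex) \<epsilon> C2" unfolding local_estimate_def by (auto intro!: exI[of _ 0])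
      from sharp_maximal_pow_le[OF this C(3) assms(5,6) fi(1,2) _ lim] show ?thesis by simp
    qed
    also have "\<dots> \<le> ennreal c * maximal f x" by (intro mult_right_mono ennreal_leI) (auto simp: c_def)
    finally show "sharp_maximal_pow \<epsilon> (pdo_adj a f) x \<le> ennreal c * maximal f x" .
  qed
qed

end
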